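(* Let $R$ be a principal ideal domain, and let $(\Sigma,w)$ be an $R$-balanced fan of dimension $d\ge2$, with $H_q^{BM}(\Sigma,F_p^R)=0$ for $q\ne d$, for all $p$. If $(\mathrm{Star}_\gamma,w)$ satisfies tropical Poincaré duality over $R$ for each $\gamma\in\Sigma$ with $\mathrm{Star}_\gamma\ne\Sigma$, then $(\Sigma,w)$ satisfies tropical Poincaré duality over $R$.
   Context: **Fans.** Let $N\cong\mathbb{Z}^n$ be a lattice, $N_{\mathbb{R}}=N\otimes\mathbb{R}$. A rational polyhedral cone is a strictly convex cone generated by finitely many vectors of $N$; for a cone $\sigma$, $L_{\mathbb{Z}}(\sigma)=N\cap\mathrm{span}(\sigma)$ and $\dim\sigma=\mathrm{rank}\,L_{\mathbb{Z}}(\sigma)$. A (rational polyhedral) fan $\Sigma$ is a finite nonempty collection of such cones, closed under taking faces, any two meeting in a common face; fans are assumed pure dimensional (all maximal cones have the same dimension $d=\dim\Sigma$). Cones are also called faces. $\Sigma^i$ is the set of $i$-dimensional cones, $\tau\preceq\sigma$ means $\tau$ is a face of $\sigma$, and $v=\{0\}\in\Sigma$ is the vertex, the only compact cone. Fix an orientation of each cone; for $\tau\prec\sigma$ with $\dim\tau=\dim\sigma-1$ let $\mathcal{O}(\tau,\sigma)=\pm1$ be the relative orientation sign. **Stars.** For $\gamma\in\Sigma$, $\mathrm{Star}_\gamma$ is the rational polyhedral fan with underlying set $\bigcup_{\kappa\succeq\gamma}\widetilde\kappa$, where $\widetilde\kappa=\{t(x-y):t\ge0,\,x\in\kappa,\,y\in\gamma\}$,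 subdivided into rational polyhedral cones with a shared vertex. A weight function $w$ on $\Sigma$ induces one on $\mathrm{Star}_\gamma$, also denoted $w$: a maximal cone contained in $\widetilde\alpha$ ($\alpha\in\Sigma^d$, $\alpha\succeq\gamma$) gets weight $w(\alpha)$. If $(\Sigma,w)$ is $R$-balanced (below), so is $(\mathrm{Star}_\gamma,w)$. **Tropical (co)homology.** $F_p^{\mathbb{Z}}(\sigma)=\sum_{\gamma\succeq\sigma}\bigwedge^pL_{\mathbb{Z}}(\gamma)\subseteq\bigwedge^pN$ (with $F_0^{\mathbb{Z}}(\sigma)=\mathbb{Z}$), $F_p^R(\sigma)=F_p^{\mathbb{Z}}(\sigma)\otimes_{\mathbb{Z}}R$, and for $\tau\preceq\sigma$ the map $\iota_{\sigma,\tau}:F_p^R(\sigma)\to F_p^R(\tau)$ is induced by inclusion. $F^p_R(\sigma)=\mathrm{Hom}_R(F_p^R(\sigma),R)$ with $\rho_{\tau,\sigma}:F_R^p(\tau)\to F_R^p(\sigma)$ dual to $\iota_{\sigma,\tau}$. $C_q^{BM}(\Sigma,F_p^R)=\bigoplus_{\sigma\in\Sigma^q}F_p^R(\sigma)$, with boundary having components $\mathcal{O}(\tau,\sigma)\iota_{\sigma,\tau}$; its homology is the tropical Borel–Moore homology $H_q^{BM}(\Sigma,F_p^R)$. $C^q(\Sigma,F_R^p)=\bigoplus F_R^p(\sigma)$ over compact $\sigma\in\Sigma^q$, with coboundary having components $\mathcal{O}(\tau,\sigma)\rho_{\tau,\sigma}$; its cohomology is the tropical cohomology $H^q(\Sigma,F_R^p)$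 (so $C^0=F_R^p(v)$ and $C^q=0$ for $q>0$). **Balancing.** For $\alpha\in\Sigma^d$, $\Lambda_\alpha\in F_d^R(\alpha)=\bigwedge^dL_{\mathbb{Z}}(\alpha)\otimes R\cong R$ is the image of the generator of $\bigwedge^dL_{\mathbb{Z}}(\alpha)$ compatible with the orientation of $\alpha$. An $R$-weight function is $w:\Sigma^d\to R$ with no $w(\alpha)$ a zero-divisor. $(\Sigma,w)$ is $R$-balanced if the fundamental chain $\mathrm{Ch}(\Sigma,w)=(w(\alpha)\Lambda_\alpha)_\alpha\in C_d^{BM}(\Sigma,F_d^R)$ is a cycle; its class is the fundamental class $[\Sigma,w]\in H_d^{BM}(\Sigma,F_d^R)$. **Cap product and duality.** For $y=y_1\wedge\dots\wedge y_m$ in $\bigwedge^mM$ ($M$ free of finite rank) and $x=x_1\wedge\dots\wedge x_p\in\bigwedge^pM^*$, $p\le m$, the contraction is $x\lrcorner y=(-1)^{p(p-1)/2}\sum_a\mathrm{sign}(a)\left(\prod_{i=1}^px_i(y_{a(i)})\right)y_{a(p+1)}\wedge\dots\wedge y_{a(m)}\in\bigwedge^{m-p}M$, summing over permutations $a\in S_m$ increasing on $1,\dots,p$ and on $p+1,\dots,m$. The cap product $\frown[\Sigma,w]:H^q(\Sigma,F_R^p)\to H_{d-q}^{BM}(\Sigma,F_{d-p}^R)$ is induced by $(u_\gamma)_{\gamma\in\Sigma^q}\mapsto\left(\sum_{\alpha\in\Sigma^d,\ \gamma,\tau\preceq\alpha}w(\alpha)\,\iota_{\alpha,\tau}(\rho_{\gamma,\alpha}(u_\gamma)\lrcorner\Lambda_\alpha)\right)_{\tau\in\Sigma^{d-q}}$;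 for $q=0$ it is $u\mapsto(\rho_{v,\alpha}(u)\lrcorner w(\alpha)\Lambda_\alpha)_{\alpha\in\Sigma^d}$. An $R$-balanced $(\Sigma,w)$ satisfies tropical Poincaré duality (TPD) over $R$ if $\frown[\Sigma,w]:H^q(\Sigma,F_R^p)\to H_{d-q}^{BM}(\Sigma,F_{d-p}^R)$ is an isomorphism for all $p,q\in\{0,\dots,d\}$.
   Formalization: The contraction's coefficient is taken as the determinant det(x_i(y_{a(j)})), since the printed product over shuffles is not alternating in the x_i; the condition Star_γ ≠ Σ is read as γ not being the vertex, since comparing supports makes the claim false (the plane with weight 2 over Z). *)

theory Defs
  imports
    "HOL-Analysis.Analysis"
    "HOL-Combinatorics.Permutations"
    "HOL-Library.Function_Algebras"
    "HOL-Algebra.Ring_Divisibility"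
    "HOL-Algebra.Module"
begin

section \<open>Modules over a commutative ring\<close>

text \<open>Modules are records of the type used by the locale \<^locale>\<open>Module.module\<close>. This record type
  extends that of rings; the ring multiplication and unit play no role and are left unspecified.\<close>

definition quot_mod :: "('r, 'a) module \<Rightarrow> 'a set \<Rightarrow> ('r, 'a set) module" where
  "quot_mod M H =
    \<lparr>carrier = a_rcosets\<^bsub>M\<^esub> H, mult = undefined, one = undefined,
     zero = H, add = (\<lambda>X Y. X <+>\<^bsub>M\<^esub> Y),
     smult = (\<lambda>r X. \<Union>x\<in>X. H +>\<^bsub>M\<^esub> (r \<odot>\<^bsub>M\<^esub> x))\<rparr>"

text \<open>The map into the quotient of \<open>N\<close> by \<open>K\<close>, defined on cosets, that is induced by \<open>h\<close>. All elements
  of a coset contribute the same coset of \<open>K\<close> whenever \<open>h\<close> descends to the quotients.\<close>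

definition quot_map :: "('r, 'b) module \<Rightarrow> 'b set \<Rightarrow> ('a \<Rightarrow> 'b) \<Rightarrow> 'a set \<Rightarrow> 'b set" where
  "quot_map N K h X = (\<Union>x\<in>X. K +>\<^bsub>N\<^esub> h x)"

text \<open>Direct sum over a finite index set.\<close>

definition dsum_mod :: "'i set \<Rightarrow> ('i \<Rightarrow> ('r, 'a) module) \<Rightarrow> ('r, 'i \<Rightarrow> 'a) module" where
  "dsum_mod I M =
    \<lparr>carrier = (\<Pi>\<^sub>E i\<in>I. carrier (M i)), mult = undefined, one = undefined,
     zero = (\<lambda>i\<in>I. \<zero>\<^bsub>M i\<^esub>), add = (\<lambda>f g. \<lambda>i\<in>I. f i \<oplus>\<^bsub>M i\<^esub> g i),
     smult = (\<lambda>r f. \<lambda>i\<in>I. r \<odot>\<^bsub>M i\<^esub> f i)\<rparr>"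

definition dual_mod :: "('r, 'm) ring_scheme \<Rightarrow> ('r, 'a) module \<Rightarrow> ('r, 'a \<Rightarrow> 'r) module" where
  "dual_mod R M =
    \<lparr>carrier = {u \<in> carrier M \<rightarrow>\<^sub>E carrier R.
        (\<forall>x\<in>carrier M. \<forall>y\<in>carrier M. u (x \<oplus>\<^bsub>M\<^esub> y) = u x \<oplus>\<^bsub>R\<^esub> u y) \<and>
        (\<forall>r\<in>carrier R. \<forall>x\<in>carrier M. u (r \<odot>\<^bsub>M\<^esub> x) = r \<otimes>\<^bsub>R\<^esub> u x)},
     mult = undefined, one = undefined,
     zero = (\<lambda>x\<in>carrier M. \<zero>\<^bsub>R\<^esub>), add = (\<lambda>u v. \<lambda>x\<in>carrier M. u x \<oplus>\<^bsub>R\<^esub> v x),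
     smult = (\<lambda>r u. \<lambda>x\<in>carrier M. r \<otimes>\<^bsub>R\<^esub> u x)\<rparr>"

definition mod_iso ::
  "('r, 'm) ring_scheme \<Rightarrow> ('r, 'a) module \<Rightarrow> ('r, 'b) module \<Rightarrow> ('a \<Rightarrow> 'b) \<Rightarrow> bool" where
  "mod_iso R M N h \<longleftrightarrow> bij_betw h (carrier M) (carrier N) \<and>
    (\<forall>x\<in>carrier M. \<forall>y\<in>carrier M. h (x \<oplus>\<^bsub>M\<^esub> y) = h x \<oplus>\<^bsub>N\<^esub> h y) \<and>
    (\<forall>r\<in>carrier R. \<forall>x\<in>carrier M. h (r \<odot>\<^bsub>M\<^esub> x) = r \<odot>\<^bsub>N\<^esub> h x)"

subsection \<open>Extension of scalars of an abelian group\<close>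

text \<open>For a subgroup \<open>G\<close> of an abelian group, \<open>G \<otimes> R\<close> (tensor product over the integers) is the free
  \<open>R\<close>-module on the set \<open>G\<close> modulo the submodule generated by the elements \<open>[a + b] - ([a] + [b])\<close>.
  It has to be formed from \<open>G\<close> itself: for subgroups \<open>G \<subseteq> G'\<close> the induced map
  \<open>G \<otimes> R \<rightarrow> G' \<otimes> R\<close> need not be injective.\<close>

definition free_mod :: "('r, 'm) ring_scheme \<Rightarrow> 'a set \<Rightarrow> ('r, 'a \<Rightarrow> 'r) module" where
  "free_mod R G =
    \<lparr>carrier = {f. (\<forall>a. f a \<in> carrier R) \<and> (\<forall>a. a \<notin> G \<longrightarrow> f a = \<zero>\<^bsub>R\<^esub>) \<and> finite {a. f a \<noteq> \<zero>\<^bsub>R\<^esub>}},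
     mult = undefined, one = undefined,
     zero = (\<lambda>a. \<zero>\<^bsub>R\<^esub>), add = (\<lambda>f g a. f a \<oplus>\<^bsub>R\<^esub> g a), smult = (\<lambda>r f a. r \<otimes>\<^bsub>R\<^esub> f a)\<rparr>"

definition free_single :: "('r, 'm) ring_scheme \<Rightarrow> 'a \<Rightarrow> 'r \<Rightarrow> 'a \<Rightarrow> 'r" where
  "free_single R a r = (\<lambda>b. if b = a then r else \<zero>\<^bsub>R\<^esub>)"

definition tensor_rel :: "('r, 'm) ring_scheme \<Rightarrow> 'a::ab_group_add set \<Rightarrow> ('a \<Rightarrow> 'r) set" where
  "tensor_rel R G =
    \<Inter>{H. submodule H R (free_mod R G) \<and>
        (\<forall>a\<in>G. \<forall>b\<in>G. free_single R (a + b) \<one>\<^bsub>R\<^esub>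
            \<ominus>\<^bsub>free_mod R G\<^esub> (free_single R a \<one>\<^bsub>R\<^esub> \<oplus>\<^bsub>free_mod R G\<^esub> free_single R b \<one>\<^bsub>R\<^esub>) \<in> H)}"

definition tensor_mod ::
  "('r, 'm) ring_scheme \<Rightarrow> 'a::ab_group_add set \<Rightarrow> ('r, ('a \<Rightarrow> 'r) set) module" where
  "tensor_mod R G = quot_mod (free_mod R G) (tensor_rel R G)"

text \<open>The element \<open>a \<otimes> 1\<close>.\<close>

definition tensor_one :: "('r, 'm) ring_scheme \<Rightarrow> 'a::ab_group_add set \<Rightarrow> 'a \<Rightarrow> ('a \<Rightarrow> 'r) set" where
  "tensor_one R G a = tensor_rel R G +>\<^bsub>free_mod R G\<^esub> free_single R a \<one>\<^bsub>R\<^esub>"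

text \<open>The map \<open>G \<otimes> R \<rightarrow> G' \<otimes> R\<close> induced by an inclusion \<open>G \<subseteq> G'\<close>. Elements of the free module on \<open>G\<close>,
  being extended by zero, literally are elements of the free module on \<open>G'\<close>. The map depends on \<open>G\<close>
  only through its domain.\<close>

definition tensor_incl ::
  "('r, 'm) ring_scheme \<Rightarrow> 'a::ab_group_add set \<Rightarrow> ('a \<Rightarrow> 'r) set \<Rightarrow> ('a \<Rightarrow> 'r) set" where
  "tensor_incl R G' = quot_map (free_mod R G') (tensor_rel R G') (\<lambda>f. f)"


section \<open>Lattice and exterior powers\<close>

text \<open>The lattice \<open>N\<close> is the type \<open>int ^ 'n\<close>, embedded in \<open>real ^ 'n\<close>.\<close>

definition real_vec :: "int ^ 'n \<Rightarrow> real ^ 'n" where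
  "real_vec z = (\<chi> i. real_of_int (z $ i))"

definition lat :: "(real ^ 'n) set \<Rightarrow> (int ^ 'n) set" where
  "lat \<sigma> = {z. real_vec z \<in> span \<sigma>}"

text \<open>The subgroup generated by a set.\<close>

definition zspan :: "'a::ab_group_add set \<Rightarrow> 'a set" where
  "zspan S = (\<lambda>H. 0 \<in> H \<and> (\<forall>x\<in>H. \<forall>y\<in>H. x - y \<in> H)) hull S"

text \<open>An element of the \<open>m\<close>-th exterior power of \<open>N\<close> is represented by its Pluecker coordinates: a
  function on lists \<open>[j\<^sub>1, \<dots>, j\<^sub>m]\<close> of coordinate indices, whose value on \<open>y\<^sub>1 \<and> \<dots> \<and> y\<^sub>m\<close> is the minor
  with entries \<open>y\<^sub>a $ j\<^sub>b\<close>. These functions vanish on lists of length other than \<open>m\<close> and alternate in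
  the list, so they are determined by the minors with increasing index sequences and
  this is an isomorphic copy of the exterior power.\<close>

definition wedge :: "(int ^ 'n) list \<Rightarrow> 'n list \<Rightarrow> int" where
  "wedge ys js =
    (if length js = length ys
     then \<Sum>\<pi> | \<pi> permutes {..<length ys}. sign \<pi> * (\<Prod>k<length ys. (ys ! \<pi> k) $ (js ! k))
     else 0)"

definition ext_power :: "nat \<Rightarrow> (int ^ 'n) set \<Rightarrow> ('n list \<Rightarrow> int) set" where
  "ext_power p L = zspan {wedge ys | ys. length ys = p \<and> set ys \<subseteq> L}"


section \<open>Fans\<close>

definition rational_cone :: "(real ^ 'n) set \<Rightarrow> bool" where
  "rational_cone \<sigma> \<longleftrightarrow>
    (\<exists>G. finite G \<and> \<sigma> = convex_cone hull (real_vec ` G)) \<and> (\<forall>x. x \<in> \<sigma> \<and> - x \<in> \<sigma> \<longrightarrow> x = 0)"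

definition fan_dim :: "(real ^ 'n) set set \<Rightarrow> nat" where
  "fan_dim \<Sigma> = Max (dim ` \<Sigma>)"

text \<open>The empty set, which the library counts as a face of every convex set, is not a face of a cone.\<close>

definition rational_fan :: "(real ^ 'n) set set \<Rightarrow> bool" where
  "rational_fan \<Sigma> \<longleftrightarrow> finite \<Sigma> \<and> \<Sigma> \<noteq> {} \<and> (\<forall>\<sigma>\<in>\<Sigma>. rational_cone \<sigma>) \<and>
    (\<forall>\<sigma>\<in>\<Sigma>. \<forall>\<tau>. \<tau> face_of \<sigma> \<and> \<tau> \<noteq> {} \<longrightarrow> \<tau> \<in> \<Sigma>) \<and>
    (\<forall>\<sigma>\<in>\<Sigma>. \<forall>\<tau>\<in>\<Sigma>. \<sigma> \<inter> \<tau> face_of \<sigma> \<and> \<sigma> \<inter> \<tau> face_of \<tau>) \<and>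
    (\<forall>\<sigma>\<in>\<Sigma>. (\<forall>\<kappa>\<in>\<Sigma>. \<sigma> face_of \<kappa> \<longrightarrow> \<kappa> = \<sigma>) \<longrightarrow> dim \<sigma> = fan_dim \<Sigma>)"

text \<open>Degrees are integers, so that there are no cones in degree \<open>-1\<close>.\<close>

definition cones :: "(real ^ 'n) set set \<Rightarrow> int \<Rightarrow> (real ^ 'n) set set" where
  "cones \<Sigma> q = {\<sigma> \<in> \<Sigma>. int (dim \<sigma>) = q}"

definition max_cones :: "(real ^ 'n) set set \<Rightarrow> (real ^ 'n) set set" where
  "max_cones \<Sigma> = cones \<Sigma> (int (fan_dim \<Sigma>))"

subsection \<open>Orientations\<close>

text \<open>An orientation of \<open>\<sigma>\<close> is given by an ordered basis of the lattice \<open>lat \<sigma>\<close>: as the rank of this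
  lattice is \<open>dim \<sigma>\<close>, a generating list of that length is a basis. The vertex gets the positive
  orientation.\<close>

definition orientation :: "(real ^ 'n) set set \<Rightarrow> ((real ^ 'n) set \<Rightarrow> (int ^ 'n) list) \<Rightarrow> bool" where
  "orientation \<Sigma> ori \<longleftrightarrow> (\<forall>\<sigma>\<in>\<Sigma>. length (ori \<sigma>) = dim \<sigma> \<and> zspan (set (ori \<sigma>)) = lat \<sigma>)"

text \<open>The sign is positive if an outward pointing vector, followed by the basis of the facet \<open>\<tau>\<close>, is
  a positively oriented basis of the span of \<open>\<sigma>\<close>; the vector \<open>u\<close> below points inward.\<close>

definition rel_sign ::
  "((real ^ 'n) set \<Rightarrow> (int ^ 'n) list) \<Rightarrow> (real ^ 'n) set \<Rightarrow> (real ^ 'n) set \<Rightarrow> int" where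
  "rel_sign ori \<tau> \<sigma> =
    (if \<exists>u c. real_vec u \<in> \<sigma> - \<tau> \<and> c > 0 \<and> (\<forall>js. wedge (- u # ori \<tau>) js = c * wedge (ori \<sigma>) js)
     then 1 else - 1)"


section \<open>Tropical homology and cohomology\<close>

definition FZ :: "(real ^ 'n) set set \<Rightarrow> nat \<Rightarrow> (real ^ 'n) set \<Rightarrow> ('n list \<Rightarrow> int) set" where
  "FZ \<Sigma> p \<sigma> = zspan (\<Union>\<gamma>\<in>{\<gamma> \<in> \<Sigma>. \<sigma> face_of \<gamma>}. ext_power p (lat \<gamma>))"

type_synonym ('r, 'n) mvec = "(('n list \<Rightarrow> int) \<Rightarrow> 'r) set"

definition F_low ::
  "('r, 'm) ring_scheme \<Rightarrow> (real ^ 'n) set set \<Rightarrow> nat \<Rightarrow> (real ^ 'n) set \<Rightarrow> ('r, ('r, 'n) mvec) module" where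
  "F_low R \<Sigma> p \<sigma> = tensor_mod R (FZ \<Sigma> p \<sigma>)"

definition F_up ::
  "('r, 'm) ring_scheme \<Rightarrow> (real ^ 'n) set set \<Rightarrow> nat \<Rightarrow> (real ^ 'n) set
    \<Rightarrow> ('r, ('r, 'n) mvec \<Rightarrow> 'r) module" where
  "F_up R \<Sigma> p \<sigma> = dual_mod R (F_low R \<Sigma> p \<sigma>)"

text \<open>\<open>iota R \<Sigma> p \<tau>\<close> is \<open>\<iota>\<^sub>\<sigma>\<^sub>,\<^sub>\<tau>\<close>, for every \<open>\<sigma>\<close> having \<open>\<tau>\<close> as a face; \<open>rho R \<Sigma> p \<tau> \<sigma>\<close> is \<open>\<rho>\<^sub>\<tau>\<^sub>,\<^sub>\<sigma>\<close>.\<close>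

definition iota ::
  "('r, 'm) ring_scheme \<Rightarrow> (real ^ 'n) set set \<Rightarrow> nat \<Rightarrow> (real ^ 'n) set
    \<Rightarrow> ('r, 'n) mvec \<Rightarrow> ('r, 'n) mvec" where
  "iota R \<Sigma> p \<tau> = tensor_incl R (FZ \<Sigma> p \<tau>)"

definition rho ::
  "('r, 'm) ring_scheme \<Rightarrow> (real ^ 'n) set set \<Rightarrow> nat \<Rightarrow> (real ^ 'n) set \<Rightarrow> (real ^ 'n) set
    \<Rightarrow> (('r, 'n) mvec \<Rightarrow> 'r) \<Rightarrow> ('r, 'n) mvec \<Rightarrow> 'r" where
  "rho R \<Sigma> p \<tau> \<sigma> u = (\<lambda>x\<in>carrier (F_low R \<Sigma> p \<sigma>). u (iota R \<Sigma> p \<tau> x))"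

subsection \<open>Borel-Moore homology\<close>

definition BM_chains ::
  "('r, 'm) ring_scheme \<Rightarrow> (real ^ 'n) set set \<Rightarrow> nat \<Rightarrow> int
    \<Rightarrow> ('r, (real ^ 'n) set \<Rightarrow> ('r, 'n) mvec) module" where
  "BM_chains R \<Sigma> p q = dsum_mod (cones \<Sigma> q) (F_low R \<Sigma> p)"

definition BM_boundary ::
  "('r, 'm) ring_scheme \<Rightarrow> (real ^ 'n) set set \<Rightarrow> ((real ^ 'n) set \<Rightarrow> (int ^ 'n) list) \<Rightarrow> nat \<Rightarrow> int
    \<Rightarrow> ((real ^ 'n) set \<Rightarrow> ('r, 'n) mvec) \<Rightarrow> (real ^ 'n) set \<Rightarrow> ('r, 'n) mvec" where
  "BM_boundary R \<Sigma> ori p q c =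
    (\<lambda>\<tau>\<in>cones \<Sigma> (q - 1).
      \<Oplus>\<^bsub>F_low R \<Sigma> p \<tau>\<^esub>\<sigma>\<in>{\<sigma> \<in> cones \<Sigma> q. \<tau> face_of \<sigma>}.
        [rel_sign ori \<tau> \<sigma>] \<cdot>\<^bsub>F_low R \<Sigma> p \<tau>\<^esub> iota R \<Sigma> p \<tau> (c \<sigma>))"

definition BM_cycles ::
  "('r, 'm) ring_scheme \<Rightarrow> (real ^ 'n) set set \<Rightarrow> ((real ^ 'n) set \<Rightarrow> (int ^ 'n) list) \<Rightarrow> nat \<Rightarrow> int
    \<Rightarrow> ((real ^ 'n) set \<Rightarrow> ('r, 'n) mvec) set" where
  "BM_cycles R \<Sigma> ori p q =
    a_kernel (BM_chains R \<Sigma> p q) (BM_chains R \<Sigma> p (q - 1)) (BM_boundary R \<Sigma> ori p q)"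

definition BM_boundaries ::
  "('r, 'm) ring_scheme \<Rightarrow> (real ^ 'n) set set \<Rightarrow> ((real ^ 'n) set \<Rightarrow> (int ^ 'n) list) \<Rightarrow> nat \<Rightarrow> int
    \<Rightarrow> ((real ^ 'n) set \<Rightarrow> ('r, 'n) mvec) set" where
  "BM_boundaries R \<Sigma> ori p q =
    BM_boundary R \<Sigma> ori p (q + 1) ` carrier (BM_chains R \<Sigma> p (q + 1))"

definition BM_homology ::
  "('r, 'm) ring_scheme \<Rightarrow> (real ^ 'n) set set \<Rightarrow> ((real ^ 'n) set \<Rightarrow> (int ^ 'n) list) \<Rightarrow> nat \<Rightarrow> int
    \<Rightarrow> ('r, ((real ^ 'n) set \<Rightarrow> ('r, 'n) mvec) set) module" where
  "BM_homology R \<Sigma> ori p q =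
    quot_mod (BM_chains R \<Sigma> p q \<lparr>carrier := BM_cycles R \<Sigma> ori p q\<rparr>) (BM_boundaries R \<Sigma> ori p q)"

subsection \<open>Cohomology\<close>

definition compact_cones :: "(real ^ 'n) set set \<Rightarrow> int \<Rightarrow> (real ^ 'n) set set" where
  "compact_cones \<Sigma> q = {\<sigma> \<in> cones \<Sigma> q. compact \<sigma>}"

definition cochains ::
  "('r, 'm) ring_scheme \<Rightarrow> (real ^ 'n) set set \<Rightarrow> nat \<Rightarrow> int
    \<Rightarrow> ('r, (real ^ 'n) set \<Rightarrow> ('r, 'n) mvec \<Rightarrow> 'r) module" where
  "cochains R \<Sigma> p q = dsum_mod (compact_cones \<Sigma> q) (F_up R \<Sigma> p)"

definition coboundary ::
  "('r, 'm) ring_scheme \<Rightarrow> (real ^ 'n) set set \<Rightarrow> ((real ^ 'n) set \<Rightarrow> (int ^ 'n) list) \<Rightarrow> nat \<Rightarrow> int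
    \<Rightarrow> ((real ^ 'n) set \<Rightarrow> ('r, 'n) mvec \<Rightarrow> 'r) \<Rightarrow> (real ^ 'n) set \<Rightarrow> ('r, 'n) mvec \<Rightarrow> 'r" where
  "coboundary R \<Sigma> ori p q u =
    (\<lambda>\<sigma>\<in>compact_cones \<Sigma> (q + 1).
      \<Oplus>\<^bsub>F_up R \<Sigma> p \<sigma>\<^esub>\<tau>\<in>{\<tau> \<in> compact_cones \<Sigma> q. \<tau> face_of \<sigma>}.
        [rel_sign ori \<tau> \<sigma>] \<cdot>\<^bsub>F_up R \<Sigma> p \<sigma>\<^esub> rho R \<Sigma> p \<tau> \<sigma> (u \<tau>))"

definition cocycles ::
  "('r, 'm) ring_scheme \<Rightarrow> (real ^ 'n) set set \<Rightarrow> ((real ^ 'n) set \<Rightarrow> (int ^ 'n) list) \<Rightarrow> nat \<Rightarrow> int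
    \<Rightarrow> ((real ^ 'n) set \<Rightarrow> ('r, 'n) mvec \<Rightarrow> 'r) set" where
  "cocycles R \<Sigma> ori p q =
    a_kernel (cochains R \<Sigma> p q) (cochains R \<Sigma> p (q + 1)) (coboundary R \<Sigma> ori p q)"

definition coboundaries ::
  "('r, 'm) ring_scheme \<Rightarrow> (real ^ 'n) set set \<Rightarrow> ((real ^ 'n) set \<Rightarrow> (int ^ 'n) list) \<Rightarrow> nat \<Rightarrow> int
    \<Rightarrow> ((real ^ 'n) set \<Rightarrow> ('r, 'n) mvec \<Rightarrow> 'r) set" where
  "coboundaries R \<Sigma> ori p q =
    coboundary R \<Sigma> ori p (q - 1) ` carrier (cochains R \<Sigma> p (q - 1))"

definition cohomology ::
  "('r, 'm) ring_scheme \<Rightarrow> (real ^ 'n) set set \<Rightarrow> ((real ^ 'n) set \<Rightarrow> (int ^ 'n) list) \<Rightarrow> nat \<Rightarrow> int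
    \<Rightarrow> ('r, ((real ^ 'n) set \<Rightarrow> ('r, 'n) mvec \<Rightarrow> 'r) set) module" where
  "cohomology R \<Sigma> ori p q =
    quot_mod (cochains R \<Sigma> p q \<lparr>carrier := cocycles R \<Sigma> ori p q\<rparr>) (coboundaries R \<Sigma> ori p q)"


section \<open>Balancing, cap product and duality\<close>

text \<open>In particular zero is not allowed as a weight.\<close>

definition weight_function ::
  "('r, 'm) ring_scheme \<Rightarrow> (real ^ 'n) set set \<Rightarrow> ((real ^ 'n) set \<Rightarrow> 'r) \<Rightarrow> bool" where
  "weight_function R \<Sigma> w \<longleftrightarrow>
    (\<forall>\<alpha>\<in>max_cones \<Sigma>. w \<alpha> \<in> carrier R \<and> (\<forall>b\<in>carrier R. w \<alpha> \<otimes>\<^bsub>R\<^esub> b = \<zero>\<^bsub>R\<^esub> \<longrightarrow> b = \<zero>\<^bsub>R\<^esub>))"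

text \<open>\<open>\<Lambda>\<^sub>\<alpha>\<close> is the image of the wedge product of the oriented lattice basis of \<open>\<alpha>\<close>.\<close>

definition Lambda ::
  "('r, 'm) ring_scheme \<Rightarrow> (real ^ 'n) set set \<Rightarrow> ((real ^ 'n) set \<Rightarrow> (int ^ 'n) list)
    \<Rightarrow> (real ^ 'n) set \<Rightarrow> ('r, 'n) mvec" where
  "Lambda R \<Sigma> ori \<alpha> = tensor_one R (FZ \<Sigma> (fan_dim \<Sigma>) \<alpha>) (wedge (ori \<alpha>))"

definition fundamental_chain ::
  "('r, 'm) ring_scheme \<Rightarrow> (real ^ 'n) set set \<Rightarrow> ((real ^ 'n) set \<Rightarrow> (int ^ 'n) list)
    \<Rightarrow> ((real ^ 'n) set \<Rightarrow> 'r) \<Rightarrow> (real ^ 'n) set \<Rightarrow> ('r, 'n) mvec" where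
  "fundamental_chain R \<Sigma> ori w =
    (\<lambda>\<alpha>\<in>max_cones \<Sigma>. w \<alpha> \<odot>\<^bsub>F_low R \<Sigma> (fan_dim \<Sigma>) \<alpha>\<^esub> Lambda R \<Sigma> ori \<alpha>)"

definition balanced ::
  "('r, 'm) ring_scheme \<Rightarrow> (real ^ 'n) set set \<Rightarrow> ((real ^ 'n) set \<Rightarrow> (int ^ 'n) list)
    \<Rightarrow> ((real ^ 'n) set \<Rightarrow> 'r) \<Rightarrow> bool" where
  "balanced R \<Sigma> ori w \<longleftrightarrow>
    fundamental_chain R \<Sigma> ori w \<in> BM_cycles R \<Sigma> ori (fan_dim \<Sigma>) (int (fan_dim \<Sigma>))"

definition shuffles_perm :: "nat \<Rightarrow> nat \<Rightarrow> (nat \<Rightarrow> nat) set" where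
  "shuffles_perm p m =
    {a. a permutes {..<m} \<and> strict_mono_on {..<p} a \<and> strict_mono_on {p..<m} a}"

text \<open>The contraction of \<open>y\<^sub>1 \<and> \<dots> \<and> y\<^sub>m\<close> by \<open>u\<close>, where \<open>u\<close> is a functional on the \<open>p\<close>-th exterior power
  \<open>F_low R \<Sigma> p \<alpha>\<close> for a maximal cone \<open>\<alpha>\<close>. With the usual identification of \<open>x\<^sub>1 \<and> \<dots> \<and> x\<^sub>p\<close> with the
  functional \<open>y\<^sub>1 \<and> \<dots> \<and> y\<^sub>p \<mapsto> det (x\<^sub>i (y\<^sub>j))\<close>, the coefficient of the summand of a shuffle \<open>a\<close>
  is the value of the functional on \<open>y\<^sub>a\<^sub>(\<^sub>1\<^sub>) \<and> \<dots> \<and> y\<^sub>a\<^sub>(\<^sub>p\<^sub>)\<close>.\<close>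

definition contraction ::
  "('r, 'm) ring_scheme \<Rightarrow> (real ^ 'n) set set \<Rightarrow> nat \<Rightarrow> (real ^ 'n) set
    \<Rightarrow> (('r, 'n) mvec \<Rightarrow> 'r) \<Rightarrow> (int ^ 'n) list \<Rightarrow> ('r, 'n) mvec" where
  "contraction R \<Sigma> p \<alpha> u ys =
    (let m = length ys; M = F_low R \<Sigma> (m - p) \<alpha> in
      \<Oplus>\<^bsub>M\<^esub>a\<in>shuffles_perm p m.
        [((- 1) ^ (p * (p - 1) div 2) * sign a)] \<cdot>\<^bsub>M\<^esub>
          (u (tensor_one R (FZ \<Sigma> p \<alpha>) (wedge (map (\<lambda>i. ys ! a i) [0..<p])))
            \<odot>\<^bsub>M\<^esub> tensor_one R (FZ \<Sigma> (m - p) \<alpha>) (wedge (map (\<lambda>i. ys ! a i) [p..<m]))))"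

definition cap_chain ::
  "('r, 'm) ring_scheme \<Rightarrow> (real ^ 'n) set set \<Rightarrow> ((real ^ 'n) set \<Rightarrow> (int ^ 'n) list)
    \<Rightarrow> ((real ^ 'n) set \<Rightarrow> 'r) \<Rightarrow> nat \<Rightarrow> int
    \<Rightarrow> ((real ^ 'n) set \<Rightarrow> ('r, 'n) mvec \<Rightarrow> 'r) \<Rightarrow> (real ^ 'n) set \<Rightarrow> ('r, 'n) mvec" where
  "cap_chain R \<Sigma> ori w p q u =
    (\<lambda>\<tau>\<in>cones \<Sigma> (int (fan_dim \<Sigma>) - q).
      let M = F_low R \<Sigma> (fan_dim \<Sigma> - p) \<tau> in
      \<Oplus>\<^bsub>M\<^esub>\<gamma>\<in>compact_cones \<Sigma> q.
        \<Oplus>\<^bsub>M\<^esub>\<alpha>\<in>{\<alpha> \<in> max_cones \<Sigma>. \<gamma> face_of \<alpha> \<and> \<tau> face_of \<alpha>}.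
          w \<alpha> \<odot>\<^bsub>M\<^esub> iota R \<Sigma> (fan_dim \<Sigma> - p) \<tau>
            (contraction R \<Sigma> p \<alpha> (rho R \<Sigma> p \<gamma> \<alpha> (u \<gamma>)) (ori \<alpha>)))"

text \<open>The map on homology induced by \<^const>\<open>cap_chain\<close>.\<close>

definition cap_product ::
  "('r, 'm) ring_scheme \<Rightarrow> (real ^ 'n) set set \<Rightarrow> ((real ^ 'n) set \<Rightarrow> (int ^ 'n) list)
    \<Rightarrow> ((real ^ 'n) set \<Rightarrow> 'r) \<Rightarrow> nat \<Rightarrow> int
    \<Rightarrow> ((real ^ 'n) set \<Rightarrow> ('r, 'n) mvec \<Rightarrow> 'r) set \<Rightarrow> ((real ^ 'n) set \<Rightarrow> ('r, 'n) mvec) set" where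
  "cap_product R \<Sigma> ori w p q =
    quot_map (BM_chains R \<Sigma> (fan_dim \<Sigma> - p) (int (fan_dim \<Sigma>) - q))
      (BM_boundaries R \<Sigma> ori (fan_dim \<Sigma> - p) (int (fan_dim \<Sigma>) - q)) (cap_chain R \<Sigma> ori w p q)"

definition tropical_PD ::
  "('r, 'm) ring_scheme \<Rightarrow> (real ^ 'n) set set \<Rightarrow> ((real ^ 'n) set \<Rightarrow> (int ^ 'n) list)
    \<Rightarrow> ((real ^ 'n) set \<Rightarrow> 'r) \<Rightarrow> bool" where
  "tropical_PD R \<Sigma> ori w \<longleftrightarrow>
    (\<forall>p\<in>{0..fan_dim \<Sigma>}. \<forall>q\<in>{0..int (fan_dim \<Sigma>)}.
      mod_iso R (cohomology R \<Sigma> ori p q)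
        (BM_homology R \<Sigma> ori (fan_dim \<Sigma> - p) (int (fan_dim \<Sigma>) - q))
        (cap_product R \<Sigma> ori w p q))"


section \<open>Stars\<close>

definition star_cone :: "(real ^ 'n) set \<Rightarrow> (real ^ 'n) set \<Rightarrow> (real ^ 'n) set" where
  "star_cone \<gamma> \<kappa> = {t *\<^sub>R (x - y) | t x y. 0 \<le> t \<and> x \<in> \<kappa> \<and> y \<in> \<gamma>}"

text \<open>The star as a complex of (in general not strictly convex) polyhedral cones, before it is
  subdivided. It is equal to \<open>\<Sigma>\<close> for the vertex \<open>\<gamma> = {0}\<close>, and for no other \<open>\<gamma>\<close>, because it
  then contains the linear space \<open>star_cone \<gamma> \<gamma> = span \<gamma> \<noteq> {0}\<close>, which is not a cone of a fan.
  Equality of complexes is to be distinguished from equality of supports: for a complete fan in the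
  plane with constant weight 2 every star has the same support as the fan, but over the integers
  none of them satisfies duality.\<close>

definition star_complex :: "(real ^ 'n) set set \<Rightarrow> (real ^ 'n) set \<Rightarrow> (real ^ 'n) set set" where
  "star_complex \<Sigma> \<gamma> = star_cone \<gamma> ` {\<kappa> \<in> \<Sigma>. \<gamma> face_of \<kappa>}"

text \<open>\<open>S\<close> is a rational fan subdividing the star.\<close>

definition star_fan :: "(real ^ 'n) set set \<Rightarrow> (real ^ 'n) set \<Rightarrow> (real ^ 'n) set set \<Rightarrow> bool" where
  "star_fan \<Sigma> \<gamma> S \<longleftrightarrow> rational_fan S \<and> \<Union>S = \<Union>(star_complex \<Sigma> \<gamma>) \<and>
    (\<forall>\<sigma>\<in>S. \<exists>\<kappa>\<in>star_complex \<Sigma> \<gamma>. \<sigma> \<subseteq> \<kappa>)"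

definition star_weight ::
  "(real ^ 'n) set set \<Rightarrow> ((real ^ 'n) set \<Rightarrow> 'r) \<Rightarrow> (real ^ 'n) set \<Rightarrow> (real ^ 'n) set \<Rightarrow> 'r" where
  "star_weight \<Sigma> w \<gamma> \<beta> = w (THE \<alpha>. \<alpha> \<in> max_cones \<Sigma> \<and> \<gamma> face_of \<alpha> \<and> \<beta> \<subseteq> star_cone \<gamma> \<alpha>)"

end

theory Submission
  imports Defs
begin

text \<open>Write \<open>d\<close> for the dimension of the fan. The vertex is the only compact cone, so the cohomology
  of a fan is concentrated in degree 0. For \<open>q > 0\<close> duality therefore says that the homology in
  degree \<open>d - q \<noteq> d\<close> vanishes (\<open>duality_in_positive_degree\<close>).

  For \<open>q = 0\<close> there are no boundaries in the top degree, and duality says that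
  \<open>u \<mapsto> (cap p {0} \<alpha> u)\<^sub>\<alpha>\<close> is a bijection from \<open>F_up R \<Sigma> p {0}\<close> onto the cycles of degree \<open>d\<close>
  (\<open>duality_in_degree_0\<close>). Being a cycle is a condition at each cone of codimension one. So for every
  cone \<open>\<gamma>\<close> there is a local version of the statement, \<open>local_duality p \<gamma>\<close>, which only sees the cones
  around \<open>\<gamma>\<close>: the functionals on \<open>F_low R \<Sigma> p \<gamma>\<close> correspond to the families on the maximal cones
  around \<open>\<gamma>\<close> that satisfy the cycle condition at the cones of codimension one around \<open>\<gamma>\<close>.

  Duality of the star of \<open>\<gamma>\<close> is local duality at \<open>\<gamma>\<close> (\<open>star_duality_local\<close>). The star comes with an
  arbitrary subdivision and arbitrary orientations. A family on the maximal cones around \<open>\<gamma>\<close> is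
  lifted to the cells of the star, each cell taking the value of the maximal cone whose star cone
  contains it, up to the sign comparing the orientations. A wall between two cells of the same
  star cone imposes no condition, as its two neighbours contribute opposite values; a wall in
  the star cone of a cone of codimension one has the neighbours of that cone, and the same condition
  (\<open>star_family_cycle_iff\<close>). All signs are read off from linear functionals vanishing on the wall.

  It remains to pass from the cones \<open>\<gamma> \<noteq> {0}\<close> to the vertex (\<open>local_duality_vertex\<close>). As \<open>d \<ge> 2\<close>, the
  homology vanishes in degrees 0 and 1. In degree 0 this says that \<open>F_low R \<Sigma> p {0}\<close> is the sum of the
  images of \<open>F_low R \<Sigma> p \<rho>\<close> for the rays \<open>\<rho>\<close>; so a functional at the vertex is determined by its
  restrictions to the rays, which gives injectivity. In degree 1 it says that all relations between
  elements of these images come from the cones of dimension two; so functionals on the rays that agree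
  on the cones of dimension two glue to one at the vertex (\<open>glue_ray_functionals\<close>). A cycle of degree
  \<open>d\<close> restricts to a local cycle around every ray and thus gives a functional on every ray; by
  injectivity of local duality on a cone of dimension two the functionals of its two rays agree there. The
  glued functional has the given cycle as its cap product, since every maximal cone has a ray.
  Conversely a cap product is a cycle, since every cone of codimension one has a ray, again by
  \<open>d \<ge> 2\<close>.\<close>

section \<open>Linear maps, quotients and extension of scalars\<close>

definition linear_map ::
  "('r, 'm) ring_scheme \<Rightarrow> ('r, 'a) module \<Rightarrow> ('r, 'b) module \<Rightarrow> ('a \<Rightarrow> 'b) \<Rightarrow> bool" where
  "linear_map R M N h \<longleftrightarrow> h \<in> carrier M \<rightarrow> carrier N \<and>
    (\<forall>x\<in>carrier M. \<forall>y\<in>carrier M. h (x \<oplus>\<^bsub>M\<^esub> y) = h x \<oplus>\<^bsub>N\<^esub> h y) \<and>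
    (\<forall>r\<in>carrier R. \<forall>x\<in>carrier M. h (r \<odot>\<^bsub>M\<^esub> x) = r \<odot>\<^bsub>N\<^esub> h x)"

lemma linear_mapD:
  assumes "linear_map R M N h"
  shows "x \<in> carrier M \<Longrightarrow> h x \<in> carrier N"
    and "x \<in> carrier M \<Longrightarrow> y \<in> carrier M \<Longrightarrow> h (x \<oplus>\<^bsub>M\<^esub> y) = h x \<oplus>\<^bsub>N\<^esub> h y"
    and "r \<in> carrier R \<Longrightarrow> x \<in> carrier M \<Longrightarrow> h (r \<odot>\<^bsub>M\<^esub> x) = r \<odot>\<^bsub>N\<^esub> h x"
  using assms by (auto simp: linear_map_def)

lemma linear_map_group_hom:
  assumes "module R M" "module R N" "linear_map R M N h"
  shows "group_hom (add_monoid M) (add_monoid N) h"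
proof -
  interpret M: module R M by fact
  interpret N: module R N by fact
  show ?thesis
    by (intro group_hom.intro group_hom_axioms.intro M.add.is_group N.add.is_group)
       (use assms(3) in \<open>auto simp: linear_map_def hom_def\<close>)
qed

lemma linear_map_zero:
  assumes "module R M" "module R N" "linear_map R M N h"
  shows "h \<zero>\<^bsub>M\<^esub> = \<zero>\<^bsub>N\<^esub>"
  using group_hom.hom_one[OF linear_map_group_hom[OF assms]] by simp

lemma linear_map_add_pow:
  assumes "module R M" "module R N" "linear_map R M N h" "x \<in> carrier M"
  shows "h ([(k::int)] \<cdot>\<^bsub>M\<^esub> x) = [k] \<cdot>\<^bsub>N\<^esub> h x"
  using group_hom.hom_int_pow[OF linear_map_group_hom[OF assms(1-3)], of x k] assms(4)
  by (simp add: add_pow_def)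

lemma linear_map_finsum:
  assumes M: "module R M" and N: "module R N" and h: "linear_map R M N h"
    and f: "f \<in> I \<rightarrow> carrier M"
  shows "h (\<Oplus>\<^bsub>M\<^esub>i\<in>I. f i) = (\<Oplus>\<^bsub>N\<^esub>i\<in>I. h (f i))"
proof -
  interpret M: module R M by fact
  interpret N: module R N by fact
  show ?thesis using f
  proof (induction I rule: infinite_finite_induct)
    case (infinite I)
    then show ?case by (simp add: M.M.finsum_infinite N.M.finsum_infinite linear_map_zero[OF M N h])
  next
    case empty
    then show ?case by (simp add: linear_map_zero[OF M N h])
  next
    case (insert i I)
    then have *: "f i \<in> carrier M" "f \<in> I \<rightarrow> carrier M" by auto
    then have "(\<lambda>i. h (f i)) \<in> I \<rightarrow> carrier N" using h by (auto simp: linear_map_def)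
    with * insert h show ?case
      by (simp add: M.M.finsum_insert N.M.finsum_insert linear_mapD[OF h] M.M.finsum_closed)
  qed
qed

lemma (in abelian_group) add_pow_sign [simp]:
  assumes "x \<in> carrier G"
  shows "[(1::int)] \<cdot> x = x" "[(- 1::int)] \<cdot> x = \<ominus> x"
  using assms by (simp_all add: add_pow_def a_inv_def int_pow_def2 nat_pow_def)

text \<open>A map that respects \<open>H\<close>-cosets up to \<open>K\<close>-cosets may be evaluated on any representative.\<close>

lemma quot_map_coset:
  assumes N: "abelian_group N" and K: "additive_subgroup K N"
    and hx: "h x \<in> carrier N" and H0: "\<zero>\<^bsub>M\<^esub> \<in> H" "\<zero>\<^bsub>M\<^esub> \<oplus>\<^bsub>M\<^esub> x = x"
    and diff: "\<And>a. a \<in> H \<Longrightarrow> h (a \<oplus>\<^bsub>M\<^esub> x) \<in> K +>\<^bsub>N\<^esub> h x"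
  shows "quot_map N K h (H +>\<^bsub>M\<^esub> x) = K +>\<^bsub>N\<^esub> h x"
proof -
  interpret N: abelian_group N by fact
  have "K +>\<^bsub>N\<^esub> h y = K +>\<^bsub>N\<^esub> h x" if y: "y \<in> H +>\<^bsub>M\<^esub> x" for y
  proof -
    from y obtain a where "a \<in> H" "y = a \<oplus>\<^bsub>M\<^esub> x" by (auto simp: a_r_coset_def')
    with diff have "h y \<in> K +>\<^bsub>N\<^esub> h x" by simp
    then show ?thesis
      using N.a_repr_independence[of "h y" K "h x"] hx K
      by (simp add: additive_subgroup_def)
  qed
  moreover have "x \<in> H +>\<^bsub>M\<^esub> x" using H0 by (force simp: a_r_coset_def')
  ultimately show ?thesis unfolding quot_map_def by blast
qed

lemma quot_mod_simps:
  "carrier (quot_mod M H) = a_rcosets\<^bsub>M\<^esub> H" "\<zero>\<^bsub>quot_mod M H\<^esub> = H"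
  "X \<oplus>\<^bsub>quot_mod M H\<^esub> Y = X <+>\<^bsub>M\<^esub> Y"
  "r \<odot>\<^bsub>quot_mod M H\<^esub> X = quot_map M H (\<lambda>x. r \<odot>\<^bsub>M\<^esub> x) X"
  by (simp_all add: quot_mod_def quot_map_def)

locale quotient_module = module R M + submodule H R M
  for R :: "('r, 'm) ring_scheme" (structure) and M :: "('r, 'a) module" (structure) and H
begin

lemma additive: "additive_subgroup H M"
  by (simp add: additive_subgroup_def subgroup_axioms)

lemma abelian_sub: "abelian_subgroup H M"
  using abelian_subgroupI3[OF additive] abelian_group_axioms by blast

lemma carrier_quot: "carrier (quot_mod M H) = {H +>\<^bsub>M\<^esub> x | x. x \<in> carrier M}"
  by (auto simp: quot_mod_simps A_RCOSETS_def')

lemma add_quot: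
  "x \<in> carrier M \<Longrightarrow> y \<in> carrier M \<Longrightarrow>
    (H +>\<^bsub>M\<^esub> x) \<oplus>\<^bsub>quot_mod M H\<^esub> (H +>\<^bsub>M\<^esub> y) = H +>\<^bsub>M\<^esub> (x \<oplus>\<^bsub>M\<^esub> y)"
  by (simp add: quot_mod_simps abelian_subgroup.a_rcos_sum[OF abelian_sub])

lemma mem_H: "a \<in> H \<Longrightarrow> a \<in> carrier M"
  using additive_subgroup.a_Hcarr[OF additive] by blast

lemma smult_quot:
  assumes "r \<in> carrier R" "x \<in> carrier M"
  shows "r \<odot>\<^bsub>quot_mod M H\<^esub> (H +>\<^bsub>M\<^esub> x) = H +>\<^bsub>M\<^esub> (r \<odot>\<^bsub>M\<^esub> x)"
  unfolding quot_mod_simps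
proof (rule quot_map_coset[OF abelian_group_axioms additive])
  show "\<zero>\<^bsub>M\<^esub> \<in> H" using additive_subgroup.zero_closed[OF additive] .
  fix a assume a: "a \<in> H"
  then show "r \<odot>\<^bsub>M\<^esub> (a \<oplus>\<^bsub>M\<^esub> x) \<in> H +>\<^bsub>M\<^esub> r \<odot>\<^bsub>M\<^esub> x"
    using assms by (auto simp: smult_r_distr mem_H a_r_coset_def')
qed (use assms in auto)

lemma zero_quot: "\<zero>\<^bsub>quot_mod M H\<^esub> = H +>\<^bsub>M\<^esub> \<zero>\<^bsub>M\<^esub>"
proof -
  have "H \<subseteq> carrier M" using mem_H by blast
  then show ?thesis by (simp add: quot_mod_simps)
qed

text \<open>Addition and scalar action on cosets are defined through all their elements; as \<open>H\<close> is a
  submodule, the result is the coset of any single one.\<close>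

lemma quot_module: "module R (quot_mod M H)"
proof -
  let ?Q = "quot_mod M H"
  let ?c = "\<lambda>x. H +>\<^bsub>M\<^esub> x"
  have mem: "?c x \<in> carrier ?Q" if "x \<in> carrier M" for x
    using that by (auto simp: carrier_quot)
  have rep: "\<exists>x\<in>carrier M. X = ?c x" if "X \<in> carrier ?Q" for X
    using that by (auto simp: carrier_quot)
  note smult = module.smult_closed[OF module_axioms]
  show ?thesis
  proof (rule moduleI)
    show "cring R" by (rule is_cring)
    show "abelian_group ?Q"
    proof (rule abelian_groupI)
      show "\<zero>\<^bsub>?Q\<^esub> \<in> carrier ?Q" by (simp add: zero_quot mem)
      fix X assume "X \<in> carrier ?Q"
      then obtain x where x: "x \<in> carrier M" "X = ?c x" using rep by blast
      show "\<exists>Y\<in>carrier ?Q. Y \<oplus>\<^bsub>?Q\<^esub> X = \<zero>\<^bsub>?Q\<^esub>"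
        by (rule bexI[of _ "?c (\<ominus>\<^bsub>M\<^esub> x)"]) (use x in \<open>simp_all add: mem zero_quot add_quot M.l_neg\<close>)
      show "\<zero>\<^bsub>?Q\<^esub> \<oplus>\<^bsub>?Q\<^esub> X = X"
        using x by (simp add: zero_quot add_quot)
      fix Y assume "Y \<in> carrier ?Q"
      then obtain y where y: "y \<in> carrier M" "Y = ?c y" using rep by blast
      show "X \<oplus>\<^bsub>?Q\<^esub> Y \<in> carrier ?Q" using x y by (simp add: add_quot mem)
      show "X \<oplus>\<^bsub>?Q\<^esub> Y = Y \<oplus>\<^bsub>?Q\<^esub> X" using x y by (simp add: add_quot M.a_comm)
      fix Z assume "Z \<in> carrier ?Q"
      then obtain z where z: "z \<in> carrier M" "Z = ?c z" using rep by blast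
      show "X \<oplus>\<^bsub>?Q\<^esub> Y \<oplus>\<^bsub>?Q\<^esub> Z = X \<oplus>\<^bsub>?Q\<^esub> (Y \<oplus>\<^bsub>?Q\<^esub> Z)"
        using x y z by (simp add: add_quot M.a_assoc)
    qed
    fix X assume "X \<in> carrier ?Q"
    then obtain x where x: "x \<in> carrier M" "X = ?c x" using rep by blast
    show "\<one> \<odot>\<^bsub>?Q\<^esub> X = X" using x by (simp add: smult_quot)
    fix r assume r: "r \<in> carrier R"
    show "r \<odot>\<^bsub>?Q\<^esub> X \<in> carrier ?Q" using x r by (simp add: smult_quot mem smult)
    {
      fix s assume s: "s \<in> carrier R"
      show "(r \<oplus> s) \<odot>\<^bsub>?Q\<^esub> X = r \<odot>\<^bsub>?Q\<^esub> X \<oplus>\<^bsub>?Q\<^esub> s \<odot>\<^bsub>?Q\<^esub> X"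
        using x r s by (simp add: smult_quot add_quot smult_l_distr smult)
      show "r \<otimes> s \<odot>\<^bsub>?Q\<^esub> X = r \<odot>\<^bsub>?Q\<^esub> (s \<odot>\<^bsub>?Q\<^esub> X)"
        using x r s by (simp add: smult_quot smult_assoc1 smult)
    }
    fix Y assume "Y \<in> carrier ?Q"
    then obtain y where y: "y \<in> carrier M" "Y = ?c y" using rep by blast
    show "r \<odot>\<^bsub>?Q\<^esub> (X \<oplus>\<^bsub>?Q\<^esub> Y) = r \<odot>\<^bsub>?Q\<^esub> X \<oplus>\<^bsub>?Q\<^esub> r \<odot>\<^bsub>?Q\<^esub> Y"
      using x y r by (simp add: smult_quot add_quot smult_r_distr smult)
  qed
qed

end

lemma quotient_moduleI: "module R M \<Longrightarrow> submodule H R M \<Longrightarrow> quotient_module R M H"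
  by (simp add: quotient_module_def)

lemma free_mod_simps:
  "f \<in> carrier (free_mod R G) \<longleftrightarrow>
    (\<forall>a. f a \<in> carrier R) \<and> (\<forall>a. a \<notin> G \<longrightarrow> f a = \<zero>\<^bsub>R\<^esub>) \<and> finite {a. f a \<noteq> \<zero>\<^bsub>R\<^esub>}"
  "\<zero>\<^bsub>free_mod R G\<^esub> = (\<lambda>a. \<zero>\<^bsub>R\<^esub>)"
  "f \<oplus>\<^bsub>free_mod R G\<^esub> g = (\<lambda>a. f a \<oplus>\<^bsub>R\<^esub> g a)"
  "r \<odot>\<^bsub>free_mod R G\<^esub> f = (\<lambda>a. r \<otimes>\<^bsub>R\<^esub> f a)"
  by (simp_all add: free_mod_def)

lemma free_mod_minus_closed:
  assumes "cring R" "f \<in> carrier (free_mod R G)"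
  shows "(\<lambda>a. \<ominus>\<^bsub>R\<^esub> f a) \<in> carrier (free_mod R G)"
proof -
  interpret R: cring R by fact
  have "{a. \<ominus>\<^bsub>R\<^esub> f a \<noteq> \<zero>\<^bsub>R\<^esub>} \<subseteq> {a. f a \<noteq> \<zero>\<^bsub>R\<^esub>}" by auto
  then show ?thesis using assms(2) by (auto simp: free_mod_simps intro: finite_subset)
qed

lemma free_mod_module:
  assumes "cring R"
  shows "module R (free_mod R G)"
proof -
  interpret R: cring R by fact
  have add: "(\<lambda>a. f a \<oplus>\<^bsub>R\<^esub> g a) \<in> carrier (free_mod R G)"
    if "f \<in> carrier (free_mod R G)" "g \<in> carrier (free_mod R G)" for f g
  proof -
    have "{a. f a \<oplus>\<^bsub>R\<^esub> g a \<noteq> \<zero>\<^bsub>R\<^esub>} \<subseteq> {a. f a \<noteq> \<zero>\<^bsub>R\<^esub>} \<union> {a. g a \<noteq> \<zero>\<^bsub>R\<^esub>}"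
      by auto
    then show ?thesis using that by (auto simp: free_mod_simps intro: finite_subset)
  qed
  show ?thesis
  proof (rule moduleI)
    show "abelian_group (free_mod R G)"
    proof (rule abelian_groupI)
      fix f assume f: "f \<in> carrier (free_mod R G)"
      show "\<exists>g\<in>carrier (free_mod R G). g \<oplus>\<^bsub>free_mod R G\<^esub> f = \<zero>\<^bsub>free_mod R G\<^esub>"
        by (rule bexI[OF _ free_mod_minus_closed[OF assms f]])
           (use f in \<open>auto simp: free_mod_simps R.l_neg\<close>)
    qed (auto simp: free_mod_simps(2,3) add, auto simp: free_mod_simps R.a_ac)
    fix r f assume r: "r \<in> carrier R" and f: "f \<in> carrier (free_mod R G)"
    have "{a. r \<otimes>\<^bsub>R\<^esub> f a \<noteq> \<zero>\<^bsub>R\<^esub>} \<subseteq> {a. f a \<noteq> \<zero>\<^bsub>R\<^esub>}" using r by auto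
    then show "r \<odot>\<^bsub>free_mod R G\<^esub> f \<in> carrier (free_mod R G)"
      using r f by (auto simp: free_mod_simps intro: finite_subset)
  qed (use assms in \<open>auto simp: free_mod_simps R.l_distr R.r_distr R.m_assoc\<close>)
qed

lemma free_mod_a_inv:
  assumes "cring R" "f \<in> carrier (free_mod R G)"
  shows "\<ominus>\<^bsub>free_mod R G\<^esub> f = (\<lambda>a. \<ominus>\<^bsub>R\<^esub> f a)"
proof -
  interpret R: cring R by fact
  interpret M: module R "free_mod R G" by (rule free_mod_module[OF assms(1)])
  have "(\<lambda>a. \<ominus>\<^bsub>R\<^esub> f a) \<oplus>\<^bsub>free_mod R G\<^esub> f = \<zero>\<^bsub>free_mod R G\<^esub>"
    using assms(2) by (auto simp: free_mod_simps R.l_neg)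
  from M.minus_equality[OF this assms(2) free_mod_minus_closed[OF assms]]
  show ?thesis .
qed

lemma free_single_closed:
  assumes "cring R" "a \<in> G" "r \<in> carrier R"
  shows "free_single R a r \<in> carrier (free_mod R G)"
proof -
  interpret R: cring R by fact
  have "{b. free_single R a r b \<noteq> \<zero>\<^bsub>R\<^esub>} \<subseteq> {a}" by (auto simp: free_single_def)
  then have "finite {b. free_single R a r b \<noteq> \<zero>\<^bsub>R\<^esub>}" by (rule finite_subset) simp
  then show ?thesis
    using assms by (auto simp: free_mod_simps free_single_def)
qed

definition zsubgroup :: "'a::ab_group_add set \<Rightarrow> bool" where
  "zsubgroup G \<longleftrightarrow> 0 \<in> G \<and> (\<forall>x\<in>G. \<forall>y\<in>G. x - y \<in> G)"

lemma zsubgroup_closed: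
  assumes "zsubgroup G"
  shows "0 \<in> G" "x \<in> G \<Longrightarrow> y \<in> G \<Longrightarrow> x - y \<in> G" "x \<in> G \<Longrightarrow> - x \<in> G"
    "x \<in> G \<Longrightarrow> y \<in> G \<Longrightarrow> x + y \<in> G"
proof -
  show 0: "0 \<in> G" and m: "\<And>x y. x \<in> G \<Longrightarrow> y \<in> G \<Longrightarrow> x - y \<in> G"
    using assms by (auto simp: zsubgroup_def)
  show u: "\<And>x. x \<in> G \<Longrightarrow> - x \<in> G" using m[OF 0] by simp
  show "x \<in> G \<Longrightarrow> y \<in> G \<Longrightarrow> x + y \<in> G" using m[of x "- y"] u by simp
qed

lemma zspan_eq_hull: "zspan S = zsubgroup hull S"
  by (simp add: zspan_def zsubgroup_def[abs_def])

lemma zsubgroup_zspan: "zsubgroup (zspan S)"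
  unfolding zspan_eq_hull
  by (rule hull_in) (auto simp: zsubgroup_def)

lemma zspan_superset: "S \<subseteq> zspan S"
  unfolding zspan_eq_hull by (rule hull_subset)

lemma zspan_minimal: "S \<subseteq> G \<Longrightarrow> zsubgroup G \<Longrightarrow> zspan S \<subseteq> G"
  unfolding zspan_eq_hull by (rule hull_minimal)

lemma zspan_mono: "S \<subseteq> T \<Longrightarrow> zspan S \<subseteq> zspan T"
  unfolding zspan_eq_hull by (rule hull_mono)

text \<open>\<open>tensor_rel R G\<close> is the smallest submodule containing these. They are written pointwise, with the
  operations of \<open>R\<close> only, so that a relator does not depend on \<open>G\<close>.\<close>

definition additivity_relators :: "('r, 'm) ring_scheme \<Rightarrow> 'a::ab_group_add set \<Rightarrow> ('a \<Rightarrow> 'r) set" where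
  "additivity_relators R G =
    (\<lambda>(a, b) c. free_single R (a + b) \<one>\<^bsub>R\<^esub> c \<ominus>\<^bsub>R\<^esub> (free_single R a \<one>\<^bsub>R\<^esub> c \<oplus>\<^bsub>R\<^esub> free_single R b \<one>\<^bsub>R\<^esub> c)) `
      (G \<times> G)"

lemma tensor_rel_eq:
  assumes "cring R" "zsubgroup G"
  shows "tensor_rel R G = \<Inter>{H. submodule H R (free_mod R G) \<and> additivity_relators R G \<subseteq> H}"
proof -
  interpret R: cring R by fact
  interpret M: module R "free_mod R G" by (rule free_mod_module[OF assms(1)])
  have eq: "free_single R (a + b) \<one>\<^bsub>R\<^esub> \<ominus>\<^bsub>free_mod R G\<^esub>
      (free_single R a \<one>\<^bsub>R\<^esub> \<oplus>\<^bsub>free_mod R G\<^esub> free_single R b \<one>\<^bsub>R\<^esub>) =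
    (\<lambda>c. free_single R (a + b) \<one>\<^bsub>R\<^esub> c \<ominus>\<^bsub>R\<^esub> (free_single R a \<one>\<^bsub>R\<^esub> c \<oplus>\<^bsub>R\<^esub> free_single R b \<one>\<^bsub>R\<^esub> c))"
    if "a \<in> G" "b \<in> G" for a b
  proof -
    have "free_single R a \<one>\<^bsub>R\<^esub> \<oplus>\<^bsub>free_mod R G\<^esub> free_single R b \<one>\<^bsub>R\<^esub> \<in> carrier (free_mod R G)"
      by (intro M.a_closed free_single_closed[OF assms(1)] that R.one_closed)
    from free_mod_a_inv[OF assms(1) this] show ?thesis
      unfolding a_minus_def[of "free_mod R G"] by (simp only: free_mod_simps(3) a_minus_def)
  qed
  have "additivity_relators R G = (\<lambda>(a, b). free_single R (a + b) \<one>\<^bsub>R\<^esub> \<ominus>\<^bsub>free_mod R G\<^esub>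
      (free_single R a \<one>\<^bsub>R\<^esub> \<oplus>\<^bsub>free_mod R G\<^esub> free_single R b \<one>\<^bsub>R\<^esub>)) ` (G \<times> G)"
    unfolding additivity_relators_def
  proof (rule image_cong[OF refl])
    fix ab assume "ab \<in> G \<times> G"
    then obtain a b where "ab = (a, b)" "a \<in> G" "b \<in> G" by blast
    with eq[OF this(2,3)] show "(case ab of (a, b) \<Rightarrow> \<lambda>c. free_single R (a + b) \<one>\<^bsub>R\<^esub> c \<ominus>\<^bsub>R\<^esub>
        (free_single R a \<one>\<^bsub>R\<^esub> c \<oplus>\<^bsub>R\<^esub> free_single R b \<one>\<^bsub>R\<^esub> c)) =
      (case ab of (a, b) \<Rightarrow> free_single R (a + b) \<one>\<^bsub>R\<^esub> \<ominus>\<^bsub>free_mod R G\<^esub>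
        (free_single R a \<one>\<^bsub>R\<^esub> \<oplus>\<^bsub>free_mod R G\<^esub> free_single R b \<one>\<^bsub>R\<^esub>))"
      by (simp only: prod.case)
  qed
  then have "additivity_relators R G \<subseteq> H \<longleftrightarrow> (\<forall>a\<in>G. \<forall>b\<in>G. free_single R (a + b) \<one>\<^bsub>R\<^esub> \<ominus>\<^bsub>free_mod R G\<^esub>
      (free_single R a \<one>\<^bsub>R\<^esub> \<oplus>\<^bsub>free_mod R G\<^esub> free_single R b \<one>\<^bsub>R\<^esub>) \<in> H)" for H
    by (simp add: image_subset_iff)
  then show ?thesis unfolding tensor_rel_def by (simp only:)
qed

lemma tensor_rel_submodule:
  assumes R: "cring R" and G: "zsubgroup G"
  shows "submodule (tensor_rel R G) R (free_mod R G)"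
    and "additivity_relators R G \<subseteq> tensor_rel R G"
proof -
  interpret R: cring R by fact
  interpret M: module R "free_mod R G" by (rule free_mod_module[OF R])
  have "additivity_relators R G \<subseteq> carrier (free_mod R G)"
  proof
    fix f assume "f \<in> additivity_relators R G"
    then obtain a b where ab: "a \<in> G" "b \<in> G" and f:
      "f = (\<lambda>c. free_single R (a + b) \<one>\<^bsub>R\<^esub> c \<ominus>\<^bsub>R\<^esub> (free_single R a \<one>\<^bsub>R\<^esub> c \<oplus>\<^bsub>R\<^esub> free_single R b \<one>\<^bsub>R\<^esub> c))"
      by (auto simp: additivity_relators_def)
    have "a + b \<in> G" using ab zsubgroup_closed[OF G] by blast
    moreover have "finite {c. f c \<noteq> \<zero>\<^bsub>R\<^esub>}"
      by (rule finite_subset[of _ "{a + b, a, b}"]) (auto simp: f free_single_def)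
    ultimately show "f \<in> carrier (free_mod R G)"
      using ab by (auto simp: f free_mod_simps free_single_def)
  qed
  then have top: "submodule (carrier (free_mod R G)) R (free_mod R G) \<and>
      additivity_relators R G \<subseteq> carrier (free_mod R G)"
    using M.carrier_is_submodule by blast
  show "submodule (tensor_rel R G) R (free_mod R G)"
    unfolding tensor_rel_eq[OF R G]
  proof (rule M.submoduleI)
    let ?S = "{H. submodule H R (free_mod R G) \<and> additivity_relators R G \<subseteq> H}"
    have sub: "submodule H R (free_mod R G)" if "H \<in> ?S" for H using that by blast
    show "\<Inter> ?S \<subseteq> carrier (free_mod R G)" using top by blast
    show "\<zero>\<^bsub>free_mod R G\<^esub> \<in> \<Inter> ?S"
      using subgroup.one_closed[OF submodule.axioms(1)[OF sub]] by simp
    fix f assume f: "f \<in> \<Inter> ?S"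
    show "\<ominus>\<^bsub>free_mod R G\<^esub> f \<in> \<Inter> ?S"
      using f M.submoduleE(3)[OF sub] by blast
    show "r \<odot>\<^bsub>free_mod R G\<^esub> f \<in> \<Inter> ?S" if "r \<in> carrier R" for r
      using f M.submoduleE(4)[OF sub that] by blast
    show "f \<oplus>\<^bsub>free_mod R G\<^esub> g \<in> \<Inter> ?S" if "g \<in> \<Inter> ?S" for g
      using f that M.submoduleE(5)[OF sub] by blast
  qed
  show "additivity_relators R G \<subseteq> tensor_rel R G"
    unfolding tensor_rel_eq[OF R G] by blast
qed

lemma tensor_quotient:
  assumes "cring R" "zsubgroup G"
  shows "quotient_module R (free_mod R G) (tensor_rel R G)"
  by (intro quotient_moduleI free_mod_module tensor_rel_submodule assms)

lemma tensor_module: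
  assumes "cring R" "zsubgroup G"
  shows "module R (tensor_mod R G)"
  unfolding tensor_mod_def by (rule quotient_module.quot_module[OF tensor_quotient[OF assms]])

text \<open>The relations of the larger group that lie in the smaller free module form a submodule containing
  the relators of the smaller group.\<close>

lemma tensor_rel_mono:
  assumes R: "cring R" and G: "zsubgroup G" "zsubgroup G'" "G \<subseteq> G'"
  shows "tensor_rel R G \<subseteq> tensor_rel R G'"
proof -
  interpret R: cring R by fact
  interpret M: module R "free_mod R G" by (rule free_mod_module[OF R])
  interpret M': module R "free_mod R G'" by (rule free_mod_module[OF R])
  let ?H = "tensor_rel R G' \<inter> carrier (free_mod R G)"
  note S' = tensor_rel_submodule(1)[OF R G(2)]
  have "submodule ?H R (free_mod R G)"
  proof (rule M.submoduleI)
    show "?H \<subseteq> carrier (free_mod R G)" by blast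
    show "\<zero>\<^bsub>free_mod R G\<^esub> \<in> ?H"
      using subgroup.one_closed[OF submodule.axioms(1)[OF S']]
      by (simp add: free_mod_simps)
    fix f assume "f \<in> ?H"
    then have f: "f \<in> tensor_rel R G'" "f \<in> carrier (free_mod R G)" by blast+
    then have f': "f \<in> carrier (free_mod R G')" using M'.submoduleE(1)[OF S'] by blast
    show "\<ominus>\<^bsub>free_mod R G\<^esub> f \<in> ?H"
      using M'.submoduleE(3)[OF S' f(1)] M.a_inv_closed[OF f(2)]
      unfolding free_mod_a_inv[OF R f(2)] free_mod_a_inv[OF R f'] by blast
    show "r \<odot>\<^bsub>free_mod R G\<^esub> f \<in> ?H" if r: "r \<in> carrier R" for r
      using M'.submoduleE(4)[OF S' r f(1)] M.smult_closed[OF r f(2)]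
      unfolding free_mod_simps(4) by blast
    show "f \<oplus>\<^bsub>free_mod R G\<^esub> g \<in> ?H" if "g \<in> ?H" for g
      using M'.submoduleE(5)[OF S' f(1), of g] M.a_closed[OF f(2), of g] that
      unfolding free_mod_simps(3) by blast
  qed
  moreover have "additivity_relators R G \<subseteq> ?H"
  proof -
    have "additivity_relators R G \<subseteq> additivity_relators R G'"
      using G(3) by (auto simp: additivity_relators_def)
    then show ?thesis
      using tensor_rel_submodule(2)[OF R G(2)] tensor_rel_submodule(2)[OF R G(1)]
        M.submoduleE(1)[OF tensor_rel_submodule(1)[OF R G(1)]] by blast
  qed
  ultimately show ?thesis unfolding tensor_rel_eq[OF R G(1)] by blast
qed

lemma free_mod_mono: "G \<subseteq> G' \<Longrightarrow> carrier (free_mod R G) \<subseteq> carrier (free_mod R G')"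
  by (auto simp: free_mod_simps) blast

lemma tensor_carrierE:
  assumes "cring R" "zsubgroup G" "X \<in> carrier (tensor_mod R G)"
  obtains f where "f \<in> carrier (free_mod R G)" "X = tensor_rel R G +>\<^bsub>free_mod R G\<^esub> f"
  using assms(3) quotient_module.carrier_quot[OF tensor_quotient[OF assms(1,2)]]
  by (auto simp: tensor_mod_def)

lemma tensor_incl_coset:
  assumes R: "cring R" and G: "zsubgroup G" "zsubgroup G'" "G \<subseteq> G'"
    and f: "f \<in> carrier (free_mod R G)"
  shows "tensor_incl R G' (tensor_rel R G +>\<^bsub>free_mod R G\<^esub> f) = tensor_rel R G' +>\<^bsub>free_mod R G'\<^esub> f"
proof -
  interpret Q: quotient_module R "free_mod R G" "tensor_rel R G" by (rule tensor_quotient[OF R G(1)])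
  interpret Q': quotient_module R "free_mod R G'" "tensor_rel R G'" by (rule tensor_quotient[OF R G(2)])
  show ?thesis unfolding tensor_incl_def
  proof (rule quot_map_coset[OF Q'.abelian_group_axioms Q'.additive])
    show "f \<in> carrier (free_mod R G')" using f free_mod_mono[OF G(3)] by blast
    show "\<zero>\<^bsub>free_mod R G\<^esub> \<in> tensor_rel R G" using additive_subgroup.zero_closed[OF Q.additive] .
    show "\<zero>\<^bsub>free_mod R G\<^esub> \<oplus>\<^bsub>free_mod R G\<^esub> f = f" using f by simp
    fix a assume "a \<in> tensor_rel R G"
    then show "a \<oplus>\<^bsub>free_mod R G\<^esub> f \<in> tensor_rel R G' +>\<^bsub>free_mod R G'\<^esub> f"
      using tensor_rel_mono[OF R G] by (auto simp: a_r_coset_def' free_mod_simps(3))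
  qed
qed

lemma tensor_incl_linear:
  assumes R: "cring R" and G: "zsubgroup G" "zsubgroup G'" "G \<subseteq> G'"
  shows "linear_map R (tensor_mod R G) (tensor_mod R G') (tensor_incl R G')"
proof -
  interpret Q: quotient_module R "free_mod R G" "tensor_rel R G" by (rule tensor_quotient[OF R G(1)])
  interpret Q': quotient_module R "free_mod R G'" "tensor_rel R G'" by (rule tensor_quotient[OF R G(2)])
  let ?c = "\<lambda>f. tensor_rel R G +>\<^bsub>free_mod R G\<^esub> f"
  let ?c' = "\<lambda>f. tensor_rel R G' +>\<^bsub>free_mod R G'\<^esub> f"
  note incl = tensor_incl_coset[OF R G]
  have mono: "f \<in> carrier (free_mod R G')" if "f \<in> carrier (free_mod R G)" for f
    using that free_mod_mono[OF G(3)] by blast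
  have add: "f \<oplus>\<^bsub>free_mod R G\<^esub> g = f \<oplus>\<^bsub>free_mod R G'\<^esub> g" for f g by (simp add: free_mod_simps)
  have smult: "r \<odot>\<^bsub>free_mod R G\<^esub> f = r \<odot>\<^bsub>free_mod R G'\<^esub> f" for f r by (simp add: free_mod_simps)
  show ?thesis
    unfolding linear_map_def tensor_mod_def
  proof (intro conjI ballI funcsetI)
    fix X assume "X \<in> carrier (quot_mod (free_mod R G) (tensor_rel R G))"
    then obtain x where x: "x \<in> carrier (free_mod R G)" and X: "X = ?c x"
      unfolding Q.carrier_quot by blast
    show "tensor_incl R G' X \<in> carrier (quot_mod (free_mod R G') (tensor_rel R G'))"
      unfolding Q'.carrier_quot X incl[OF x] using mono[OF x] by blast
    show "tensor_incl R G' (r \<odot>\<^bsub>quot_mod (free_mod R G) (tensor_rel R G)\<^esub> X) =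
        r \<odot>\<^bsub>quot_mod (free_mod R G') (tensor_rel R G')\<^esub> tensor_incl R G' X" if r: "r \<in> carrier R" for r
      unfolding X Q.smult_quot[OF r x] incl[OF x] incl[OF module.smult_closed[OF Q.module_axioms r x]]
        Q'.smult_quot[OF r mono[OF x]]
      unfolding smult ..
    fix Y assume "Y \<in> carrier (quot_mod (free_mod R G) (tensor_rel R G))"
    then obtain y where y: "y \<in> carrier (free_mod R G)" and Y: "Y = ?c y"
      unfolding Q.carrier_quot by blast
    show "tensor_incl R G' (X \<oplus>\<^bsub>quot_mod (free_mod R G) (tensor_rel R G)\<^esub> Y) =
      tensor_incl R G' X \<oplus>\<^bsub>quot_mod (free_mod R G') (tensor_rel R G')\<^esub> tensor_incl R G' Y"
      unfolding X Y Q.add_quot[OF x y] incl[OF x] incl[OF y] incl[OF Q.M.a_closed[OF x y]]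
        Q'.add_quot[OF mono[OF x] mono[OF y]]
      unfolding add ..
  qed
qed

lemma tensor_incl_trans:
  assumes "cring R" "zsubgroup G" "zsubgroup G'" "zsubgroup G''" "G \<subseteq> G'" "G' \<subseteq> G''"
    and "X \<in> carrier (tensor_mod R G)"
  shows "tensor_incl R G'' (tensor_incl R G' X) = tensor_incl R G'' X"
proof -
  obtain f where f: "f \<in> carrier (free_mod R G)" and X: "X = tensor_rel R G +>\<^bsub>free_mod R G\<^esub> f"
    by (rule tensor_carrierE[OF assms(1,2,7)])
  have f': "f \<in> carrier (free_mod R G')" using f free_mod_mono[OF assms(5)] by blast
  show ?thesis
    unfolding X tensor_incl_coset[OF assms(1,2,3,5) f] tensor_incl_coset[OF assms(1,3,4,6) f']
      tensor_incl_coset[OF assms(1,2,4) order_trans[OF assms(5,6)] f] ..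
qed

lemma tensor_incl_id:
  assumes "cring R" "zsubgroup G" "X \<in> carrier (tensor_mod R G)"
  shows "tensor_incl R G X = X"
proof -
  obtain f where f: "f \<in> carrier (free_mod R G)" and X: "X = tensor_rel R G +>\<^bsub>free_mod R G\<^esub> f"
    by (rule tensor_carrierE[OF assms])
  show ?thesis unfolding X tensor_incl_coset[OF assms(1,2,2) order_refl f] ..
qed

lemma tensor_one_closed:
  assumes "cring R" "zsubgroup G" "a \<in> G"
  shows "tensor_one R G a \<in> carrier (tensor_mod R G)"
proof -
  interpret R: cring R by fact
  show ?thesis
    unfolding tensor_mod_def quotient_module.carrier_quot[OF tensor_quotient[OF assms(1,2)]] tensor_one_def
    using free_single_closed[OF assms(1,3) R.one_closed] by blast
qed

lemma tensor_one_add: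
  assumes R: "cring R" and G: "zsubgroup G" and ab: "a \<in> G" "b \<in> G"
  shows "tensor_one R G (a + b) = tensor_one R G a \<oplus>\<^bsub>tensor_mod R G\<^esub> tensor_one R G b"
proof -
  interpret R: cring R by fact
  interpret Q: quotient_module R "free_mod R G" "tensor_rel R G" by (rule tensor_quotient[OF R G])
  let ?s = "\<lambda>x. free_single R x \<one>\<^bsub>R\<^esub>"
  let ?t = "?s a \<oplus>\<^bsub>free_mod R G\<^esub> ?s b"
  have c: "?s (a + b) \<in> carrier (free_mod R G)" "?s a \<in> carrier (free_mod R G)" "?s b \<in> carrier (free_mod R G)"
    by (intro free_single_closed[OF R] zsubgroup_closed(4)[OF G] ab R.one_closed)+
  have "(\<lambda>c. ?s (a + b) c \<ominus>\<^bsub>R\<^esub> (?s a c \<oplus>\<^bsub>R\<^esub> ?s b c)) \<in> tensor_rel R G"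
    by (rule subsetD[OF tensor_rel_submodule(2)[OF R G]])
       (use ab in \<open>force simp: additivity_relators_def\<close>)
  moreover have "?s (a + b) = (\<lambda>c. ?s (a + b) c \<ominus>\<^bsub>R\<^esub> (?s a c \<oplus>\<^bsub>R\<^esub> ?s b c)) \<oplus>\<^bsub>free_mod R G\<^esub> ?t"
  proof
    fix x
    have "?s (a + b) x \<in> carrier R" "?s a x \<in> carrier R" "?s b x \<in> carrier R"
      by (auto simp: free_single_def)
    then show "?s (a + b) x = ((\<lambda>c. ?s (a + b) c \<ominus>\<^bsub>R\<^esub> (?s a c \<oplus>\<^bsub>R\<^esub> ?s b c)) \<oplus>\<^bsub>free_mod R G\<^esub> ?t) x"
      by (simp add: free_mod_simps a_minus_def R.a_assoc R.l_neg)
  qed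
  ultimately have "?s (a + b) \<in> tensor_rel R G +>\<^bsub>free_mod R G\<^esub> ?t"
    by (auto simp: a_r_coset_def')
  then have "tensor_rel R G +>\<^bsub>free_mod R G\<^esub> ?s (a + b) = tensor_rel R G +>\<^bsub>free_mod R G\<^esub> ?t"
    using Q.a_repr_independence[of "?s (a + b)" "tensor_rel R G" ?t] c Q.subgroup_axioms Q.M.a_closed by simp
  then show ?thesis
    using c by (simp add: tensor_one_def tensor_mod_def Q.add_quot)
qed

lemma tensor_one_diff:
  assumes R: "cring R" and G: "zsubgroup G" and ab: "a \<in> G" "b \<in> G"
  shows "tensor_one R G (a - b) = tensor_one R G a \<ominus>\<^bsub>tensor_mod R G\<^esub> tensor_one R G b"
proof -
  interpret module R "tensor_mod R G" by (rule tensor_module[OF R G])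
  have d: "a - b \<in> G" using zsubgroup_closed[OF G] ab by blast
  have "tensor_one R G a = tensor_one R G (a - b) \<oplus>\<^bsub>tensor_mod R G\<^esub> tensor_one R G b"
    using tensor_one_add[OF R G d ab(2)] by simp
  then show ?thesis
    using tensor_one_closed[OF R G] d ab by (simp add: a_minus_def M.a_assoc M.r_neg)
qed

lemma tensor_one_zero:
  assumes R: "cring R" and G: "zsubgroup G"
  shows "tensor_one R G 0 = \<zero>\<^bsub>tensor_mod R G\<^esub>"
proof -
  interpret module R "tensor_mod R G" by (rule tensor_module[OF R G])
  show ?thesis
    using tensor_one_diff[OF R G, of 0 0] zsubgroup_closed(1)[OF G] tensor_one_closed[OF R G, of 0]
    by (simp add: a_minus_def M.r_neg)
qed

section \<open>Alternating functions\<close>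

lemma (in abelian_group) add_pow_int_zero [simp]: "[(0::int)] \<cdot> x = \<zero>"
  by (simp add: add_pow_def)

text \<open>Additivity in each entry is expressed through differences, matching the closure condition of
  \<open>zsubgroup\<close>. Equal adjacent entries suffice in the last condition: transpositions of neighbours then
  change the sign, so that equal entries can be moved together.\<close>

definition alternating_on ::
  "('a, 'm) ring_scheme \<Rightarrow> 'v::ab_group_add set \<Rightarrow> nat \<Rightarrow> ('v list \<Rightarrow> 'a) \<Rightarrow> bool" where
  "alternating_on M L m F \<longleftrightarrow>
    (\<forall>ys. length ys = m \<and> set ys \<subseteq> L \<longrightarrow> F ys \<in> carrier M) \<and>
    (\<forall>pre post x y. Suc (length pre + length post) = m \<and> set pre \<subseteq> L \<and> set post \<subseteq> L \<and> x \<in> L \<and> y \<in> L \<longrightarrow>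
      F (pre @ (x - y) # post) = F (pre @ x # post) \<ominus>\<^bsub>M\<^esub> F (pre @ y # post)) \<and>
    (\<forall>pre post x. Suc (Suc (length pre + length post)) = m \<and> set pre \<subseteq> L \<and> set post \<subseteq> L \<and> x \<in> L \<longrightarrow>
      F (pre @ x # x # post) = \<zero>\<^bsub>M\<^esub>)"

locale alternating = abelian_group M
  for M :: "('a, 'm) ring_scheme" (structure) +
  fixes L :: "'v::ab_group_add set" and m :: nat and F :: "'v list \<Rightarrow> 'a"
  assumes L: "zsubgroup L" and alternating: "alternating_on M L m F"
begin

lemma closed [simp]: "length ys = m \<Longrightarrow> set ys \<subseteq> L \<Longrightarrow> F ys \<in> carrier M"
  using alternating by (simp add: alternating_on_def)

lemma diff:
  "Suc (length pre + length post) = m \<Longrightarrow> set pre \<subseteq> L \<Longrightarrow> set post \<subseteq> L \<Longrightarrow> x \<in> L \<Longrightarrow> y \<in> L \<Longrightarrow>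
    F (pre @ (x - y) # post) = F (pre @ x # post) \<ominus> F (pre @ y # post)"
  using alternating by (simp add: alternating_on_def)

lemma adjacent_eq:
  "Suc (Suc (length pre + length post)) = m \<Longrightarrow> set pre \<subseteq> L \<Longrightarrow> set post \<subseteq> L \<Longrightarrow> x \<in> L \<Longrightarrow>
    F (pre @ x # x # post) = \<zero>"
  using alternating by (simp add: alternating_on_def)

lemma swap:
  assumes "Suc (Suc (length pre + length post)) = m" "set pre \<subseteq> L" "set post \<subseteq> L" "x \<in> L" "y \<in> L"
  shows "F (pre @ x # y # post) = \<ominus> F (pre @ y # x # post)"
proof -
  have xy: "x - y \<in> L" using zsubgroup_closed[OF L] assms by blast
  have a: "F (pre @ x # y # post) \<in> carrier M" and b: "F (pre @ y # x # post) \<in> carrier M"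
    using assms by simp_all
  have "\<zero> = F (pre @ x # (x - y) # post) \<ominus> F (pre @ y # (x - y) # post)"
    using adjacent_eq[of pre post "x - y"] diff[of pre "(x - y) # post" x y] assms xy by simp
  also have "F (pre @ x # (x - y) # post) = \<zero> \<ominus> F (pre @ x # y # post)"
    using adjacent_eq[of pre post x] diff[of "pre @ [x]" post x y] assms by simp
  also have "F (pre @ y # (x - y) # post) = F (pre @ y # x # post) \<ominus> \<zero>"
    using adjacent_eq[of pre post y] diff[of "pre @ [y]" post x y] assms by simp
  finally have "\<ominus> F (pre @ x # y # post) = F (pre @ y # x # post)"
    using a b by (simp add: a_minus_def) (metis a_inv_closed minus_equality minus_minus r_neg1 r_zero zero_closed)
  then show ?thesis using a b by (metis minus_minus)
qed

lemma move_back: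
  assumes "Suc (length pre + length l + length post) = m"
    "set pre \<subseteq> L" "set l \<subseteq> L" "set post \<subseteq> L" "x \<in> L"
  shows "\<exists>s::int. F (pre @ x # l @ post) = [s] \<cdot> F (pre @ l @ x # post)"
  using assms
proof (induction l arbitrary: pre)
  case Nil
  then show ?case by (intro exI[of _ 1]) simp
next
  case (Cons y l)
  obtain s :: int where s: "F ((pre @ [y]) @ x # l @ post) = [s] \<cdot> F ((pre @ [y]) @ l @ x # post)"
    using Cons.IH[of "pre @ [y]"] Cons.prems by auto
  have c: "F (pre @ y # l @ x # post) \<in> carrier M" using Cons.prems by simp
  have "F (pre @ x # y # l @ post) = \<ominus> F (pre @ y # x # l @ post)"
    using swap[of pre "l @ post" x y] Cons.prems by simp
  also have "\<dots> = [(- s)] \<cdot> F (pre @ (y # l) @ x # post)"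
    using s add.int_pow_neg[OF c, of s] by simp
  finally show ?case by auto
qed

lemma not_distinct_eq_zero:
  assumes "length ys = m" "set ys \<subseteq> L" "\<not> distinct ys"
  shows "F ys = \<zero>"
proof -
  obtain pre l post x where ys: "ys = pre @ [x] @ l @ [x] @ post"
    using not_distinct_decomp[OF assms(3)] by blast
  then obtain s :: int where "F (pre @ x # l @ (x # post)) = [s] \<cdot> F (pre @ l @ x # x # post)"
    using move_back[of pre l "x # post" x] assms by auto
  moreover have "F ((pre @ l) @ x # x # post) = \<zero>"
    by (rule adjacent_eq) (use assms ys in auto)
  ultimately show ?thesis by (simp add: ys)
qed

lemma permuted_entries:
  assumes "mset ws = mset ys" "length pre + length ys = m" "set pre \<subseteq> L" "set ys \<subseteq> L"
  shows "\<exists>D::int. F (pre @ ws) = [D] \<cdot> F (pre @ ys)"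
  using assms
proof (induction ws arbitrary: pre ys)
  case Nil
  then show ?case by (intro exI[of _ 1]) simp
next
  case (Cons a ws)
  then obtain l r where ys: "ys = l @ a # r"
    by (metis list.set_intros(1) set_mset_mset split_list)
  then have ws: "mset ws = mset (l @ r)" using Cons.prems(1) by simp
  obtain D :: int where D: "F ((pre @ [a]) @ ws) = [D] \<cdot> F ((pre @ [a]) @ (l @ r))"
    using Cons.IH[OF ws, of "pre @ [a]"] Cons.prems ys by auto
  have c: "F (pre @ ys) \<in> carrier M" using Cons.prems by simp
  obtain s :: int where "F (pre @ a # l @ r) = [s] \<cdot> F (pre @ l @ a # r)"
    using move_back[of pre l r a] Cons.prems ys by auto
  with D have "F (pre @ a # ws) = [D] \<cdot> ([s] \<cdot> F (pre @ ys))" by (simp add: ys)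
  then show ?case using add.int_pow_pow[OF c] by metis
qed

lemma entries_from_basis:
  assumes "length ys = m" "length ws = m" "set ys \<subseteq> L" "set ws \<subseteq> set ys"
  shows "\<exists>D::int. F ws = [D] \<cdot> F ys"
proof (cases "distinct ws")
  case True
  then have "card (set ws) = m" using assms(2) by (simp add: distinct_card)
  moreover have "card (set ys) \<le> m" using assms(1) card_length by blast
  ultimately have "set ws = set ys" "card (set ys) = length ys"
    using assms card_seteq[of "set ys" "set ws"] by auto
  then have "mset ws = mset ys"
    using True by (metis card_distinct set_eq_iff_mset_eq_distinct)
  then show ?thesis using permuted_entries[of ws ys "[]"] assms by simp
next
  case False
  then have "F ws = [(0::int)] \<cdot> F ys"
    using not_distinct_eq_zero[of ws] assms by simp
  then show ?thesis by blast
qed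

text \<open>Every entry is a combination of entries of \<open>ys\<close>, so expanding the entries one after the other
  expresses \<open>F zs\<close> through values of \<open>F\<close> on rearrangements of \<open>ys\<close>. The factor \<open>D\<close> is the
  determinant of the coordinates; it is not unique if the values have torsion.\<close>

lemma multiple_of_basis_value:
  assumes "length ys = m" "length zs = m" "zspan (set ys) = L" "set zs \<subseteq> L"
  shows "\<exists>D::int. F zs = [D] \<cdot> F ys"
proof -
  have ysL: "set ys \<subseteq> L" using zspan_superset assms(3) by blast
  have c: "F ys \<in> carrier M" using assms(1) ysL by simp
  have "\<exists>D::int. F (pre @ zs) = [D] \<cdot> F ys"
    if "set pre \<subseteq> set ys" "length pre + length zs = m" "set zs \<subseteq> L" for pre
    using that
  proof (induction zs arbitrary: pre)
    case Nil
    then show ?case using entries_from_basis[OF assms(1) _ ysL, of pre] by simp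
  next
    case (Cons z zs)
    let ?G = "{z \<in> L. \<exists>D::int. F (pre @ z # zs) = [D] \<cdot> F ys}"
    have len: "Suc (length pre + length zs) = m" and pre: "set pre \<subseteq> L" and zs: "set zs \<subseteq> L"
      using Cons.prems ysL by auto
    have "set ys \<subseteq> ?G"
      using Cons.IH[of "pre @ [y]" for y] Cons.prems ysL by auto
    moreover have "zsubgroup ?G"
      unfolding zsubgroup_def
    proof (intro conjI ballI)
      have 0: "0 \<in> L" using zsubgroup_closed[OF L] by blast
      then have c0: "F (pre @ 0 # zs) \<in> carrier M" using pre zs len by simp
      have "F (pre @ 0 # zs) = F (pre @ 0 # zs) \<ominus> F (pre @ 0 # zs)"
        using diff[OF len pre zs 0 0] by simp
      also have "\<dots> = [(0::int)] \<cdot> F ys" using c0 by (simp add: a_minus_def r_neg)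
      finally show "0 \<in> ?G" using 0 by blast
      fix x y assume x: "x \<in> ?G" and y: "y \<in> ?G"
      then obtain D E :: int where "F (pre @ x # zs) = [D] \<cdot> F ys" "F (pre @ y # zs) = [E] \<cdot> F ys" by blast
      then have "F (pre @ (x - y) # zs) = [D] \<cdot> F ys \<ominus> [E] \<cdot> F ys"
        using diff[OF len pre zs, of x y] x y by simp
      also have "\<dots> = [(D - E)] \<cdot> F ys" using add.int_pow_diff[OF c] by (simp add: a_minus_def)
      finally show "x - y \<in> ?G" using x y zsubgroup_closed[OF L] by blast
    qed
    ultimately have "L \<subseteq> ?G" using zspan_minimal assms(3) by blast
    then show ?case using Cons.prems by auto
  qed
  from this[of "[]"] assms show ?thesis by simp
qed

end

subsection \<open>Two alternating functions at once\<close>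

text \<open>Records of rings serve as abelian groups here; only their additive part is meaningful.\<close>

definition prod_group :: "('a, 'm) ring_scheme \<Rightarrow> ('b, 'n) ring_scheme \<Rightarrow> ('a \<times> 'b) ring" where
  "prod_group M N = \<lparr>carrier = carrier M \<times> carrier N, mult = undefined, one = undefined,
     zero = (\<zero>\<^bsub>M\<^esub>, \<zero>\<^bsub>N\<^esub>), add = (\<lambda>(a, b) (c, d). (a \<oplus>\<^bsub>M\<^esub> c, b \<oplus>\<^bsub>N\<^esub> d))\<rparr>"

lemma prod_group_simps:
  "carrier (prod_group M N) = carrier M \<times> carrier N" "\<zero>\<^bsub>prod_group M N\<^esub> = (\<zero>\<^bsub>M\<^esub>, \<zero>\<^bsub>N\<^esub>)"
  "(a, b) \<oplus>\<^bsub>prod_group M N\<^esub> (c, d) = (a \<oplus>\<^bsub>M\<^esub> c, b \<oplus>\<^bsub>N\<^esub> d)"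
  by (simp_all add: prod_group_def)

lemma prod_group_abelian:
  assumes "abelian_group M" "abelian_group N"
  shows "abelian_group (prod_group M N)"
    and "a \<in> carrier M \<Longrightarrow> b \<in> carrier N \<Longrightarrow> \<ominus>\<^bsub>prod_group M N\<^esub> (a, b) = (\<ominus>\<^bsub>M\<^esub> a, \<ominus>\<^bsub>N\<^esub> b)"
    and "a \<in> carrier M \<Longrightarrow> b \<in> carrier N \<Longrightarrow>
      [(k::int)] \<cdot>\<^bsub>prod_group M N\<^esub> (a, b) = ([k] \<cdot>\<^bsub>M\<^esub> a, [k] \<cdot>\<^bsub>N\<^esub> b)"
proof -
  interpret M: abelian_group M by fact
  interpret N: abelian_group N by fact
  show P: "abelian_group (prod_group M N)"
  proof (rule abelian_groupI)
    fix x assume "x \<in> carrier (prod_group M N)"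
    then obtain a b where x: "x = (a, b)" "a \<in> carrier M" "b \<in> carrier N"
      by (auto simp: prod_group_simps)
    show "\<exists>y\<in>carrier (prod_group M N). y \<oplus>\<^bsub>prod_group M N\<^esub> x = \<zero>\<^bsub>prod_group M N\<^esub>"
      by (rule bexI[of _ "(\<ominus>\<^bsub>M\<^esub> a, \<ominus>\<^bsub>N\<^esub> b)"]) (use x in \<open>simp_all add: prod_group_simps M.l_neg N.l_neg\<close>)
  qed (auto simp: prod_group_simps M.a_ac N.a_ac)
  interpret P: abelian_group "prod_group M N" by (rule P)
  show "\<ominus>\<^bsub>prod_group M N\<^esub> (a, b) = (\<ominus>\<^bsub>M\<^esub> a, \<ominus>\<^bsub>N\<^esub> b)" if "a \<in> carrier M" "b \<in> carrier N" for a b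
    by (rule P.minus_equality) (use that in \<open>simp_all add: prod_group_simps M.l_neg N.l_neg\<close>)
  show "[k] \<cdot>\<^bsub>prod_group M N\<^esub> (a, b) = ([k] \<cdot>\<^bsub>M\<^esub> a, [k] \<cdot>\<^bsub>N\<^esub> b)" if ab: "a \<in> carrier M" "b \<in> carrier N"
  proof -
    have f: "group_hom (add_monoid (prod_group M N)) (add_monoid M) fst"
      by (intro group_hom.intro group_hom_axioms.intro homI P.add.is_group M.add.is_group)
         (auto simp: prod_group_simps)
    have s: "group_hom (add_monoid (prod_group M N)) (add_monoid N) snd"
      by (intro group_hom.intro group_hom_axioms.intro homI P.add.is_group N.add.is_group)
         (auto simp: prod_group_simps)
    have "(a, b) \<in> carrier (add_monoid (prod_group M N))" using ab by (simp add: prod_group_simps)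
    from group_hom.hom_int_pow[OF f this, of k] group_hom.hom_int_pow[OF s this, of k]
    show ?thesis by (simp add: add_pow_def prod_eq_iff)
  qed
qed

text \<open>A common factor exists because the pair of the two functions is alternating with values in the product
  group. It transfers the sign of a base change from minors to contractions.\<close>

lemma alternating_pair:
  assumes F: "alternating M L m F" and G: "alternating N L m G"
    and bases: "length ys = m" "length zs = m" "zspan (set ys) = L" "set zs \<subseteq> L"
  shows "\<exists>D::int. F zs = [D] \<cdot>\<^bsub>M\<^esub> F ys \<and> G zs = [D] \<cdot>\<^bsub>N\<^esub> G ys"
proof -
  interpret F: alternating M L m F by fact
  interpret G: alternating N L m G by fact
  note P = prod_group_abelian[OF F.abelian_group_axioms G.abelian_group_axioms]
  have "alternating (prod_group M N) L m (\<lambda>ys. (F ys, G ys))"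
  proof (intro alternating.intro alternating_axioms.intro P(1) F.L)
    show "alternating_on (prod_group M N) L m (\<lambda>ys. (F ys, G ys))"
      unfolding alternating_on_def
    proof (intro conjI allI impI)
      fix pre post x y
      assume *: "Suc (length pre + length post) = m \<and> set pre \<subseteq> L \<and> set post \<subseteq> L \<and> x \<in> L \<and> y \<in> L"
      then have "F (pre @ y # post) \<in> carrier M" "G (pre @ y # post) \<in> carrier N" by auto
      with * show "(F (pre @ (x - y) # post), G (pre @ (x - y) # post)) =
          (F (pre @ x # post), G (pre @ x # post)) \<ominus>\<^bsub>prod_group M N\<^esub> (F (pre @ y # post), G (pre @ y # post))"
        by (simp add: F.diff G.diff a_minus_def P(2) prod_group_simps)
    qed (auto simp: prod_group_simps F.adjacent_eq G.adjacent_eq)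
  qed
  then interpret P: alternating "prod_group M N" L m "\<lambda>ys. (F ys, G ys)" .
  obtain D :: int where D: "(F zs, G zs) = [D] \<cdot>\<^bsub>prod_group M N\<^esub> (F ys, G ys)"
    using P.multiple_of_basis_value[OF bases] by blast
  have "set ys \<subseteq> L" using zspan_superset bases(3) by blast
  then show ?thesis using D P(3)[of "F ys" "G ys" D] bases by auto
qed

section \<open>Minors\<close>

definition int_functions :: "('j \<Rightarrow> int) ring" where
  "int_functions = \<lparr>carrier = UNIV, mult = undefined, one = undefined,
     zero = (\<lambda>_. 0), add = (\<lambda>f g j. f j + g j)\<rparr>"

lemma int_functions_abelian: "abelian_group int_functions"
proof (rule abelian_groupI)
  fix f :: "'j \<Rightarrow> int"
  show "\<exists>g\<in>carrier int_functions. g \<oplus>\<^bsub>int_functions\<^esub> f = \<zero>\<^bsub>int_functions\<^esub>"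
    by (rule bexI[of _ "\<lambda>j. - f j"]) (simp_all add: int_functions_def)
qed (simp_all add: int_functions_def algebra_simps)

lemma int_functions_ops:
  "carrier int_functions = UNIV" "\<zero>\<^bsub>int_functions\<^esub> = (\<lambda>_. 0)"
  "f \<oplus>\<^bsub>int_functions\<^esub> g = (\<lambda>j. f j + g j)"
  by (simp_all add: int_functions_def)

lemma int_functions_diff_mult:
  fixes f g :: "'j \<Rightarrow> int"
  shows "f \<ominus>\<^bsub>int_functions\<^esub> g = (\<lambda>j. f j - g j)"
    and "[(k::int)] \<cdot>\<^bsub>int_functions\<^esub> f = (\<lambda>j. k * f j)"
proof -
  interpret abelian_group "int_functions :: ('j \<Rightarrow> int) ring" by (rule int_functions_abelian)
  have inv: "\<ominus>\<^bsub>int_functions\<^esub> g = (\<lambda>j. - g j)" for g :: "'j \<Rightarrow> int"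
    by (rule minus_equality) (simp_all add: int_functions_def)
  show "f \<ominus>\<^bsub>int_functions\<^esub> g = (\<lambda>j. f j - g j)" by (simp add: a_minus_def inv int_functions_ops)
  show "[k] \<cdot>\<^bsub>int_functions\<^esub> f = (\<lambda>j. k * f j)"
  proof (induction k rule: int_induct[where k=0])
    case base
    then show ?case by (simp add: int_functions_ops)
  next
    case (step1 i)
    then show ?case using add.int_pow_mult[of f i 1] by (simp add: int_functions_ops algebra_simps)
  next
    case (step2 i)
    then show ?case using add.int_pow_diff[of f i 1] by (simp add: int_functions_ops inv algebra_simps)
  qed
qed

lemmas int_functions_simps = int_functions_ops int_functions_diff_mult

lemma wedge_length: "length js \<noteq> length ys \<Longrightarrow> wedge ys js = 0"
  by (simp add: wedge_def)

lemma wedge_eq_entries: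
  assumes "i < j" "j < length ys" "ys ! i = ys ! j"
  shows "wedge ys js = 0"
proof (cases "length js = length ys")
  case True
  let ?S = "{..<length ys}"
  let ?t = "Transposition.transpose i j"
  let ?f = "\<lambda>\<pi>. sign \<pi> * (\<Prod>k\<in>?S. (ys ! \<pi> k) $ (js ! k))"
  have t: "?t permutes ?S" using assms by (intro permutes_swap_id) auto
  have "?f (?t \<circ> \<pi>) = - ?f \<pi>" if \<pi>: "\<pi> permutes ?S" for \<pi>
  proof -
    have "sign (?t \<circ> \<pi>) = - sign \<pi>"
      using assms t \<pi> permutes_imp_permutation[OF finite_lessThan] by (simp add: sign_compose sign_swap_id)
    moreover have "ys ! (?t \<circ> \<pi>) k = ys ! \<pi> k" for k
      using assms(3) by (simp add: Transposition.transpose_def)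
    ultimately show ?thesis by simp
  qed
  then have "sum ?f {\<pi>. \<pi> permutes ?S} = - sum ?f {\<pi>. \<pi> permutes ?S}"
    unfolding sum_negf[symmetric]
    by (intro sum.reindex_bij_witness[of _ "\<lambda>\<pi>. ?t \<circ> \<pi>" "\<lambda>\<pi>. ?t \<circ> \<pi>"])
       (auto simp: permutes_compose[OF _ t] simp flip: comp_assoc)
  then show ?thesis by (simp add: wedge_def True)
qed (simp add: wedge_length)

lemma wedge_diff:
  "wedge (pre @ (x - y) # post) js = wedge (pre @ x # post) js - wedge (pre @ y # post) js"
proof (cases "length js = Suc (length pre + length post)")
  case True
  define m where "m = Suc (length pre + length post)"
  let ?S = "{..<m}"
  let ?ys = "\<lambda>z. pre @ z # post"
  have km: "length pre < m" by (simp add: m_def)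
  have "(\<Prod>k\<in>?S. (?ys (x - y) ! \<pi> k) $ (js ! k)) =
      (\<Prod>k\<in>?S. (?ys x ! \<pi> k) $ (js ! k)) - (\<Prod>k\<in>?S. (?ys y ! \<pi> k) $ (js ! k))"
    if \<pi>: "\<pi> permutes ?S" for \<pi>
  proof -
    define i where "i = inv_into UNIV \<pi> (length pre)"
    have i: "\<pi> i = length pre" "i \<in> ?S"
      unfolding i_def using permutes_inverses(1)[OF \<pi>] permutes_in_image[OF permutes_inv[OF \<pi>]] km by auto
    have other: "(?ys z ! \<pi> k) = ?ys 0 ! \<pi> k" if "k \<noteq> i" for z k
    proof -
      have "\<pi> k \<noteq> length pre" using that i(1) permutes_inj[OF \<pi>] by (metis injD)
      then show ?thesis by (auto simp: nth_append nth_Cons split: nat.split)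
    qed
    have "(\<Prod>k\<in>?S. (?ys z ! \<pi> k) $ (js ! k)) =
        z $ (js ! i) * (\<Prod>k\<in>?S - {i}. (?ys 0 ! \<pi> k) $ (js ! k))" for z
    proof -
      have "(\<Prod>k\<in>?S - {i}. (?ys z ! \<pi> k) $ (js ! k)) = (\<Prod>k\<in>?S - {i}. (?ys 0 ! \<pi> k) $ (js ! k))"
      proof (rule prod.cong[OF refl])
        fix k assume "k \<in> ?S - {i}"
        then show "(?ys z ! \<pi> k) $ (js ! k) = (?ys 0 ! \<pi> k) $ (js ! k)" by (subst other) auto
      qed
      moreover have "?ys z ! \<pi> i = z" using i(1) by simp
      ultimately show ?thesis
        by (subst prod.remove[OF _ i(2)]) (simp_all only: finite_lessThan)
    qed
    then show ?thesis by (simp only: vector_minus_component left_diff_distrib)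
  qed
  then show ?thesis
    by (simp add: wedge_def True flip: m_def) (simp add: right_diff_distrib sum_subtractf)
qed (simp add: wedge_def)

lemma wedge_alternating:
  fixes L :: "(int ^ 'n) set"
  assumes "zsubgroup L"
  shows "alternating int_functions L m wedge"
proof (intro alternating.intro alternating_axioms.intro int_functions_abelian assms)
  have "wedge (pre @ x # x # post) js = 0" for pre post :: "(int ^ 'n) list" and x js
    by (rule wedge_eq_entries[of "length pre" "Suc (length pre)"]) (simp_all add: nth_append)
  then show "alternating_on int_functions L m wedge"
    by (simp add: alternating_on_def int_functions_simps fun_eq_iff wedge_diff)
qed

text \<open>Pairing the minors with functionals dual to the independent vectors gives the determinant of the
  identity matrix.\<close>

lemma wedge_nonzero:
  fixes ys :: "(int ^ 'n) list"
  assumes "distinct (map real_vec ys)" "independent (real_vec ` set ys)"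
  shows "\<exists>js. wedge ys js \<noteq> 0"
proof (rule ccontr)
  assume "\<not> ?thesis"
  then have zero: "wedge ys js = 0" for js by blast
  let ?S = "{..<length ys}"
  let ?P = "{\<pi>. \<pi> permutes ?S}"
  have "\<exists>\<phi> :: real ^ 'n \<Rightarrow> real. linear \<phi> \<and> (\<forall>x\<in>real_vec ` set ys. \<phi> x = (if x = real_vec (ys ! k) then 1 else 0))" for k
    by (rule linear_independent_extend[OF assms(2)])
  then obtain \<phi> :: "nat \<Rightarrow> real ^ 'n \<Rightarrow> real" where lin: "\<And>k. linear (\<phi> k)"
    and \<phi>: "\<And>k x. x \<in> real_vec ` set ys \<Longrightarrow> \<phi> k x = (if x = real_vec (ys ! k) then 1 else 0)" by metis
  have \<phi>': "\<phi> k (real_vec (ys ! j)) = (if j = k then 1 else 0)" if "j \<in> ?S" "k \<in> ?S" for j k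
    using \<phi>[of "real_vec (ys ! j)" k] that assms(1) nth_eq_iff_index_eq[of "map real_vec ys" j k] by auto
  define G where "G k i = \<phi> k (axis i 1)" for k i
  have expand: "\<phi> k (real_vec z) = (\<Sum>i\<in>UNIV. G k i * of_int (z $ i))" for k z
  proof -
    have "real_vec z = (\<Sum>i\<in>UNIV. (of_int (z $ i)) *\<^sub>R axis i 1)"
      by (simp add: real_vec_def vec_eq_iff axis_def if_distrib cong: if_cong)
    then have "\<phi> k (real_vec z) = (\<Sum>i\<in>UNIV. \<phi> k (of_int (z $ i) *\<^sub>R axis i 1))"
      using linear_sum[OF lin] by metis
    then show ?thesis by (simp add: G_def linear_cmul[OF lin] mult.commute)
  qed
  have prods: "(\<Prod>k\<in>?S. \<phi> k (real_vec (ys ! \<pi> k))) =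
      (\<Sum>f\<in>PiE ?S (\<lambda>_. UNIV). (\<Prod>k\<in>?S. G k (f k)) * of_int (\<Prod>k\<in>?S. (ys ! \<pi> k) $ (map f [0..<length ys] ! k)))" for \<pi>
    unfolding expand by (subst prod_sum_PiE) (auto simp: prod.distrib intro!: sum.cong)
  have "(\<Sum>\<pi>\<in>?P. of_int (sign \<pi>) * (\<Prod>k\<in>?S. \<phi> k (real_vec (ys ! \<pi> k)))) =
      (\<Sum>f\<in>PiE ?S (\<lambda>_. UNIV). (\<Prod>k\<in>?S. G k (f k)) *
        (\<Sum>\<pi>\<in>?P. of_int (sign \<pi> * (\<Prod>k\<in>?S. (ys ! \<pi> k) $ (map f [0..<length ys] ! k)))))"
    unfolding prods sum_distrib_left by (subst sum.swap) (simp add: ac_simps)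
  also have "\<dots> = (\<Sum>f\<in>PiE ?S (\<lambda>_. UNIV). (\<Prod>k\<in>?S. G k (f k)) * of_int (wedge ys (map f [0..<length ys])))"
    by (simp add: wedge_def)
  also have "\<dots> = 0" by (simp add: zero)
  finally have "(\<Sum>\<pi>\<in>?P. of_int (sign \<pi>) * (\<Prod>k\<in>?S. \<phi> k (real_vec (ys ! \<pi> k)))) = (0::real)" .
  moreover have "(\<Prod>k\<in>?S. \<phi> k (real_vec (ys ! \<pi> k))) = (if \<pi> = id then 1 else 0)" if \<pi>: "\<pi> \<in> ?P" for \<pi>
  proof (cases "\<pi> = id")
    case False
    then obtain k where "\<pi> k \<noteq> k" by (auto simp: fun_eq_iff)
    have perm: "\<pi> permutes ?S" using \<pi> by simp
    have k: "k \<in> ?S" using permutes_not_in[OF perm, of k] \<open>\<pi> k \<noteq> k\<close> by blast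
    then have "\<pi> k \<in> ?S" using permutes_in_image[OF perm, of k] by simp
    then have "\<phi> k (real_vec (ys ! \<pi> k)) = 0" using \<phi>' k \<open>\<pi> k \<noteq> k\<close> by simp
    then show ?thesis using k False by auto
  qed (simp add: \<phi>')
  then have "(\<Sum>\<pi>\<in>?P. of_int (sign \<pi>) * (\<Prod>k\<in>?S. \<phi> k (real_vec (ys ! \<pi> k)))) =
      (\<Sum>\<pi>\<in>?P. if \<pi> = id then 1 else 0)"
    by (intro sum.cong) auto
  moreover have "\<dots> = (1::real)"
    by (simp add: finite_permutations permutes_id)
  ultimately show False by simp
qed

text \<open>The determinant of a change of basis.\<close>

definition basis_sign :: "(int ^ 'n) list \<Rightarrow> (int ^ 'n) list \<Rightarrow> int" where
  "basis_sign ys zs = (if wedge zs = wedge ys then 1 else - 1)"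

lemma basis_sign:
  assumes "length ys = m" "length zs = m" "zspan (set ys) = L" "zspan (set zs) = L"
    and nz: "\<exists>js. wedge ys js \<noteq> 0"
  shows "wedge zs js = basis_sign ys zs * wedge ys js"
    and "alternating M L m F \<Longrightarrow> F zs = [basis_sign ys zs] \<cdot>\<^bsub>M\<^esub> F ys"
proof -
  have L: "zsubgroup L" using zsubgroup_zspan assms(3) by blast
  have sub: "set zs \<subseteq> L" "set ys \<subseteq> L" using zspan_superset assms(3,4) by blast+
  note W = wedge_alternating[OF L, of m]
  obtain D where D: "wedge zs = (\<lambda>j. D * wedge ys j)"
    using alternating.multiple_of_basis_value[OF W assms(1-3) sub(1)] unfolding int_functions_simps by blast
  obtain E where E: "wedge ys = (\<lambda>j. E * wedge zs j)"
    using alternating.multiple_of_basis_value[OF W assms(2,1,4) sub(2)] unfolding int_functions_simps by blast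
  obtain j0 where j0: "wedge ys j0 \<noteq> 0" using nz by blast
  have d: "wedge zs j0 = D * wedge ys j0" by (subst D) (rule refl)
  have e: "wedge ys j0 = E * wedge zs j0" by (subst E) (rule refl)
  have "wedge ys j0 = E * D * wedge ys j0" using e unfolding d by (simp only: mult.assoc)
  with j0 have "E * D = 1" by simp
  then have D1: "D = 1 \<or> D = - 1" by (auto simp: zmult_eq_1_iff)
  have Dsign: "D' = basis_sign ys zs" if D': "wedge zs = (\<lambda>j. D' * wedge ys j)" for D'
  proof -
    have "D' = D" using fun_cong[OF D, of j0] fun_cong[OF D', of j0] j0 by simp
    moreover have "wedge zs = wedge ys \<longleftrightarrow> D = 1"
    proof
      assume "wedge zs = wedge ys"
      then show "D = 1" using fun_cong[OF D, of j0] j0 by simp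
    qed (simp add: D)
    ultimately show ?thesis using D1 by (auto simp: basis_sign_def)
  qed
  show "wedge zs js = basis_sign ys zs * wedge ys js" using fun_cong[OF D, of js] Dsign[OF D] by simp
  assume F: "alternating M L m F"
  obtain D' :: int where "F zs = [D'] \<cdot>\<^bsub>M\<^esub> F ys" "wedge zs = (\<lambda>j. D' * wedge ys j)"
    using alternating_pair[OF F W assms(1-3) sub(1)] unfolding int_functions_simps by blast
  then show "F zs = [basis_sign ys zs] \<cdot>\<^bsub>M\<^esub> F ys" using Dsign[of D'] by simp
qed

lemma basis_sign_cases: "basis_sign ys zs = 1 \<or> basis_sign ys zs = - 1"
  by (simp add: basis_sign_def)

section \<open>Contraction\<close>

lemma (in abelian_group) a_inv_zero [simp]: "\<ominus> \<zero> = \<zero>"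
  using minus_equality[OF l_zero[OF zero_closed] zero_closed zero_closed] .

lemma (in abelian_group) finsum_uminus:
  assumes "f \<in> A \<rightarrow> carrier G"
  shows "(\<Oplus>i\<in>A. \<ominus> f i) = \<ominus> (\<Oplus>i\<in>A. f i)"
  using assms
proof (induction A rule: infinite_finite_induct)
  case (insert i A)
  then have "f i \<in> carrier G" "f \<in> A \<rightarrow> carrier G" by auto
  with insert show ?case by (simp add: finsum_insert finsum_closed minus_add Pi_iff)
qed (simp_all add: finsum_infinite)

lemma (in abelian_group) finsum_diff:
  assumes "f \<in> A \<rightarrow> carrier G" "g \<in> A \<rightarrow> carrier G"
  shows "(\<Oplus>i\<in>A. f i \<ominus> g i) = (\<Oplus>i\<in>A. f i) \<ominus> (\<Oplus>i\<in>A. g i)"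
proof -
  have "(\<lambda>i. \<ominus> g i) \<in> A \<rightarrow> carrier G" using assms(2) by auto
  then show ?thesis
    unfolding a_minus_def using assms finsum_addf[of f A "\<lambda>i. \<ominus> g i"] finsum_uminus[OF assms(2)] by simp
qed

lemma (in abelian_group) add_pow_diff:
  assumes "x \<in> carrier G" "y \<in> carrier G"
  shows "[(k::int)] \<cdot> (x \<ominus> y) = [k] \<cdot> x \<ominus> [k] \<cdot> y"
  using assms add.int_pow_distrib[of x "\<ominus> y" k] add.int_pow_inv[of y k] by (simp add: a_minus_def)

lemma (in abelian_group) add_pow_neg:
  assumes "x \<in> carrier G"
  shows "[(- k::int)] \<cdot> x = \<ominus> ([k] \<cdot> x)"
  using assms add.int_pow_neg[of x k] by simp

lemma (in module) smult_l_diff: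
  assumes "a \<in> carrier R" "b \<in> carrier R" "x \<in> carrier M"
  shows "(a \<ominus>\<^bsub>R\<^esub> b) \<odot>\<^bsub>M\<^esub> x = a \<odot>\<^bsub>M\<^esub> x \<ominus>\<^bsub>M\<^esub> b \<odot>\<^bsub>M\<^esub> x"
  using assms by (simp add: a_minus_def smult_l_distr smult_l_minus)

lemma (in module) smult_r_diff:
  assumes "a \<in> carrier R" "x \<in> carrier M" "y \<in> carrier M"
  shows "a \<odot>\<^bsub>M\<^esub> (x \<ominus>\<^bsub>M\<^esub> y) = a \<odot>\<^bsub>M\<^esub> x \<ominus>\<^bsub>M\<^esub> a \<odot>\<^bsub>M\<^esub> y"
  using assms by (simp add: a_minus_def smult_r_distr smult_r_minus)

text \<open>A selection that hits the inserted entry is itself an insertion of that entry, so conditions on a single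
  entry pass to the two factors of a shuffle.\<close>

lemma selection_of_insertion:
  assumes a: "inj a" and len: "a ` {lo..<hi} \<subseteq> {..<Suc (length pre + length post)}"
    and j: "j \<in> {lo..<hi}" "a j = length pre"
  obtains P Q where "\<And>z. map (\<lambda>i. (pre @ z # post) ! a i) [lo..<hi] = P @ z # Q"
    "Suc (length P + length Q) = hi - lo" "set P \<subseteq> set pre \<union> set post" "set Q \<subseteq> set pre \<union> set post"
proof
  have other: "(pre @ z # post) ! a i = (pre @ undefined # post) ! a i"
    "(pre @ undefined # post) ! a i \<in> set pre \<union> set post" if "i \<in> {lo..<hi}" "i \<noteq> j" for i z
  proof -
    have "a i \<noteq> length pre" using a that j(2) by (metis injD)
    moreover have "a i < Suc (length pre + length post)" using len that by blast
    ultimately show "(pre @ z # post) ! a i = (pre @ undefined # post) ! a i"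
      "(pre @ undefined # post) ! a i \<in> set pre \<union> set post"
      by (auto simp: nth_append nth_Cons split: nat.split)
  qed
  let ?f = "\<lambda>i. (pre @ undefined # post) ! a i"
  have split: "[lo..<hi] = [lo..<j] @ j # [Suc j..<hi]"
    using j(1) upt_add_eq_append[of lo j "hi - j"] upt_conv_Cons[of j hi] by simp
  show "map (\<lambda>i. (pre @ z # post) ! a i) [lo..<hi] = map ?f [lo..<j] @ z # map ?f [Suc j..<hi]" for z
  proof -
    have "map (\<lambda>i. (pre @ z # post) ! a i) [lo..<j] = map ?f [lo..<j]"
      "map (\<lambda>i. (pre @ z # post) ! a i) [Suc j..<hi] = map ?f [Suc j..<hi]"
      using j(1) by (auto intro!: other(1))
    then show ?thesis using j(2) by (simp add: split)
  qed
  show "Suc (length (map ?f [lo..<j]) + length (map ?f [Suc j..<hi])) = hi - lo" using j(1) by auto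
  show "set (map ?f [lo..<j]) \<subseteq> set pre \<union> set post" "set (map ?f [Suc j..<hi]) \<subseteq> set pre \<union> set post"
    unfolding set_map set_upt by (intro image_subsetI other(2); use j(1) in auto)+
qed

lemma selection_avoiding_insertion:
  assumes len: "a ` {lo..<hi} \<subseteq> {..<Suc (length pre + length post)}"
    and k: "length pre \<notin> a ` {lo..<hi}"
  obtains P where "\<And>z. map (\<lambda>i. (pre @ z # post) ! a i) [lo..<hi] = P"
    "length P = hi - lo" "set P \<subseteq> set pre \<union> set post"
proof
  let ?f = "\<lambda>i. (pre @ undefined # post) ! a i"
  have other: "(pre @ z # post) ! a i = ?f i" "?f i \<in> set pre \<union> set post" if "i \<in> {lo..<hi}" for i z
  proof -
    have "a i \<noteq> length pre" using k that by (metis imageI)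
    moreover have "a i < Suc (length pre + length post)" using len that by blast
    ultimately show "(pre @ z # post) ! a i = ?f i" "?f i \<in> set pre \<union> set post"
      by (auto simp: nth_append nth_Cons split: nat.split)
  qed
  show "map (\<lambda>i. (pre @ z # post) ! a i) [lo..<hi] = map ?f [lo..<hi]" for z
    by (rule map_cong[OF refl], rule other(1)) simp
  show "length (map ?f [lo..<hi]) = hi - lo" by simp
  show "set (map ?f [lo..<hi]) \<subseteq> set pre \<union> set post"
    unfolding set_map set_upt by (intro image_subsetI other(2))
qed

lemma alternating_cong:
  assumes "alternating M L m F" "\<And>ys. length ys = m \<Longrightarrow> F' ys = F ys"
  shows "alternating M L m F'"
proof -
  interpret alternating M L m F by fact
  show ?thesis
    by (intro alternating.intro alternating_axioms.intro abelian_group_axioms L)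
       (use alternating in \<open>simp add: alternating_on_def assms(2)\<close>)
qed

text \<open>If two adjacent entries agree, exchanging their positions is an involution on the shuffles that
  put them into different blocks; it reverses the sign and preserves both selections.
  In the other shuffles one of the two factors has a repeated entry.\<close>

lemma shuffle_sum_alternating:
  fixes R :: "('r, 'm) ring_scheme" and M :: "('r, 'a) module" and L :: "'v::ab_group_add set"
  assumes M: "module R M" and A: "alternating R L p A" and B: "alternating M L (m - p) B" and pm: "p \<le> m"
  shows "alternating M L m (\<lambda>ys. \<Oplus>\<^bsub>M\<^esub>a\<in>shuffles_perm p m. [(e * sign a)] \<cdot>\<^bsub>M\<^esub>
    (A (map (\<lambda>i. ys ! a i) [0..<p]) \<odot>\<^bsub>M\<^esub> B (map (\<lambda>i. ys ! a i) [p..<m])))"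
proof -
  interpret M: module R M by fact
  interpret A: alternating R L p A by fact
  interpret B: alternating M L "m - p" B by fact
  define t where "t ys a = [(e * sign a)] \<cdot>\<^bsub>M\<^esub>
    (A (map (\<lambda>i. ys ! a i) [0..<p]) \<odot>\<^bsub>M\<^esub> B (map (\<lambda>i. ys ! a i) [p..<m]))" for ys a
  let ?S = "shuffles_perm p m"
  have fin: "finite ?S"
    by (rule finite_subset[OF _ finite_permutations[of "{..<m}"]]) (auto simp: shuffles_perm_def)
  have perm: "a permutes {..<m}" if "a \<in> ?S" for a using that by (simp add: shuffles_perm_def)
  have sel: "map (\<lambda>i. ys ! a i) [0..<p] \<in> {xs. length xs = p \<and> set xs \<subseteq> L}"
    "map (\<lambda>i. ys ! a i) [p..<m] \<in> {xs. length xs = m - p \<and> set xs \<subseteq> L}"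
    if "length ys = m" "set ys \<subseteq> L" "a \<in> ?S" for ys a
  proof -
    have "ys ! a i \<in> L" if "i < m" for i
      using permutes_in_image[OF perm[OF \<open>a \<in> ?S\<close>], of i] that \<open>length ys = m\<close> \<open>set ys \<subseteq> L\<close>
      by (metis lessThan_iff nth_mem subsetD)
    then show "map (\<lambda>i. ys ! a i) [0..<p] \<in> {xs. length xs = p \<and> set xs \<subseteq> L}"
      "map (\<lambda>i. ys ! a i) [p..<m] \<in> {xs. length xs = m - p \<and> set xs \<subseteq> L}"
      using pm by auto
  qed
  have selA: "A (map (\<lambda>i. ys ! a i) [0..<p]) \<in> carrier R"
    and selB: "B (map (\<lambda>i. ys ! a i) [p..<m]) \<in> carrier M"
    if "length ys = m" "set ys \<subseteq> L" "a \<in> ?S" for ys a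
    using sel[OF that] A.closed B.closed by blast+
  have t_closed: "t ys a \<in> carrier M" if "length ys = m" "set ys \<subseteq> L" "a \<in> ?S" for ys a
    unfolding t_def by (intro M.add.int_pow_closed M.smult_closed selA[OF that] selB[OF that])
  have "alternating_on M L m (\<lambda>ys. \<Oplus>\<^bsub>M\<^esub>a\<in>?S. t ys a)"
    unfolding alternating_on_def
  proof (intro conjI allI impI; elim conjE)
    fix ys :: "'v list" assume "length ys = m" "set ys \<subseteq> L"
    then show "(\<Oplus>\<^bsub>M\<^esub>a\<in>?S. t ys a) \<in> carrier M"
      by (intro M.M.finsum_closed funcsetI t_closed)
  next
    fix pre post :: "'v list" and x y
    assume len: "Suc (length pre + length post) = m" and L: "set pre \<subseteq> L" "set post \<subseteq> L" "x \<in> L" "y \<in> L"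
    let ?ys = "\<lambda>z. pre @ z # post"
    have xy: "x - y \<in> L" using zsubgroup_closed[OF A.L] L by blast
    have ysL: "length (?ys z) = m" "set (?ys z) \<subseteq> L" if "z \<in> L" for z using len L that by auto
    have tt: "t (?ys (x - y)) a = t (?ys x) a \<ominus>\<^bsub>M\<^esub> t (?ys y) a" if a: "a \<in> ?S" for a
    proof -
      have inj: "inj a" using permutes_inj[OF perm[OF a]] .
      have im: "a ` {..<m} = {..<m}" by (rule permutes_image[OF perm[OF a]])
      have "{0..<p} \<subseteq> {..<m}" "{p..<m} \<subseteq> {..<m}" using pm by auto
      from this[THEN image_mono, of a]
      have imA: "a ` {0..<p} \<subseteq> {..<Suc (length pre + length post)}"
        and imB: "a ` {p..<m} \<subseteq> {..<Suc (length pre + length post)}"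
        unfolding im len by simp_all
      have "length pre \<in> a ` {..<m}" unfolding im using len by simp
      then obtain j where j: "j < m" "a j = length pre" by auto
      note cl = selA[OF ysL[OF L(3)] a] selA[OF ysL[OF L(4)] a] selB[OF ysL[OF L(3)] a] selB[OF ysL[OF L(4)] a]
      have "A (map (\<lambda>i. ?ys (x - y) ! a i) [0..<p]) \<odot>\<^bsub>M\<^esub> B (map (\<lambda>i. ?ys (x - y) ! a i) [p..<m]) =
        A (map (\<lambda>i. ?ys x ! a i) [0..<p]) \<odot>\<^bsub>M\<^esub> B (map (\<lambda>i. ?ys x ! a i) [p..<m]) \<ominus>\<^bsub>M\<^esub>
        A (map (\<lambda>i. ?ys y ! a i) [0..<p]) \<odot>\<^bsub>M\<^esub> B (map (\<lambda>i. ?ys y ! a i) [p..<m])"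
      proof (cases "j < p")
        case True
        then have j': "j \<in> {0..<p}" by simp
        have "length pre \<notin> a ` {p..<m}" 
          using inj_image_mem_iff[OF inj, of j "{p..<m}"] True j(2) by simp
        then obtain C where C: "\<And>z. map (\<lambda>i. ?ys z ! a i) [p..<m] = C"
          "length C = m - p" "set C \<subseteq> set pre \<union> set post"
          using selection_avoiding_insertion[OF imB] by blast
        obtain P Q where PQ: "\<And>z. map (\<lambda>i. ?ys z ! a i) [0..<p] = P @ z # Q"
          "Suc (length P + length Q) = p - 0" "set P \<subseteq> set pre \<union> set post" "set Q \<subseteq> set pre \<union> set post"
          using selection_of_insertion[OF inj imA j' j(2)] by blast
        have PQL: "set P \<subseteq> L" "set Q \<subseteq> L" using PQ L by blast+
        show ?thesis
          using A.diff[OF _ PQL L(3,4)] PQ(2) M.smult_l_diff cl unfolding C(1) PQ(1) by simp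
      next
        case False
        then have j': "j \<in> {p..<m}" using j by simp
        have "length pre \<notin> a ` {0..<p}" 
          using inj_image_mem_iff[OF inj, of j "{0..<p}"] False j(2) by simp
        then obtain C where C: "\<And>z. map (\<lambda>i. ?ys z ! a i) [0..<p] = C"
          "length C = p - 0" "set C \<subseteq> set pre \<union> set post"
          using selection_avoiding_insertion[OF imA] by blast
        obtain P Q where PQ: "\<And>z. map (\<lambda>i. ?ys z ! a i) [p..<m] = P @ z # Q"
          "Suc (length P + length Q) = m - p" "set P \<subseteq> set pre \<union> set post" "set Q \<subseteq> set pre \<union> set post"
          using selection_of_insertion[OF inj imB j' j(2)] by blast
        have PQL: "set P \<subseteq> L" "set Q \<subseteq> L" using PQ L by blast+
        show ?thesis
          using B.diff[OF _ PQL L(3,4)] PQ(2) M.smult_r_diff cl unfolding C(1) PQ(1) by simp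
      qed
      then show ?thesis
        unfolding t_def using cl by (simp add: M.M.add_pow_diff)
    qed
    have tc: "t (?ys z) a \<in> carrier M" if "z \<in> L" "a \<in> ?S" for z a
      using t_closed[OF ysL[OF that(1)] that(2)] .
    have "(\<Oplus>\<^bsub>M\<^esub>a\<in>?S. t (?ys (x - y)) a) = (\<Oplus>\<^bsub>M\<^esub>a\<in>?S. t (?ys x) a \<ominus>\<^bsub>M\<^esub> t (?ys y) a)"
      by (rule M.M.finsum_cong'[OF refl]) (intro funcsetI M.M.minus_closed tc L, simp_all only: tt)
    also have "\<dots> = (\<Oplus>\<^bsub>M\<^esub>a\<in>?S. t (?ys x) a) \<ominus>\<^bsub>M\<^esub> (\<Oplus>\<^bsub>M\<^esub>a\<in>?S. t (?ys y) a)"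
      by (rule M.M.finsum_diff) (intro funcsetI tc L; assumption)+
    finally show "(\<Oplus>\<^bsub>M\<^esub>a\<in>?S. t (?ys (x - y)) a) =
      (\<Oplus>\<^bsub>M\<^esub>a\<in>?S. t (?ys x) a) \<ominus>\<^bsub>M\<^esub> (\<Oplus>\<^bsub>M\<^esub>a\<in>?S. t (?ys y) a)" .
  next
    fix pre post :: "'v list" and x
    assume len: "Suc (Suc (length pre + length post)) = m" and L: "set pre \<subseteq> L" "set post \<subseteq> L" "x \<in> L"
    define ys where "ys = pre @ x # x # post"
    define k where "k = length pre"
    have ysL: "length ys = m" "set ys \<subseteq> L" using len L by (auto simp: ys_def)
    have k: "Suc k < m" "ys ! k = ys ! Suc k" using len by (auto simp: k_def ys_def nth_append)
    let ?\<tau> = "Transposition.transpose k (Suc k)"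
    \<comment> \<open>In \<open>X\<close> and \<open>Y\<close> the two equal entries go to different factors, and the transposition exchanges
      the two sets; in \<open>Z\<close> they go to the same factor.\<close>
    define X where "X = {a \<in> ?S. k \<in> a ` {..<p} \<and> Suc k \<notin> a ` {..<p}}"
    define Y where "Y = {a \<in> ?S. k \<notin> a ` {..<p} \<and> Suc k \<in> a ` {..<p}}"
    define Z where "Z = {a \<in> ?S. k \<in> a ` {..<p} \<longleftrightarrow> Suc k \<in> a ` {..<p}}"
    have \<tau>: "?\<tau> permutes {..<m}" using k by (intro permutes_swap_id) auto
    have \<tau>k: "?\<tau> k = Suc k" "?\<tau> (Suc k) = k" by simp_all
    have ys\<tau>: "ys ! ?\<tau> n = ys ! n" for n using k(2) by (simp add: Transposition.transpose_def)
    have mono: "?\<tau> b < ?\<tau> c" if "b < c" "\<not> (b = k \<and> c = Suc k)" for b c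
      using that by (auto simp: Transposition.transpose_def)
    have shuffle: "?\<tau> \<circ> a \<in> ?S" if a: "a \<in> ?S" and k: "k \<in> a ` {..<p} \<longleftrightarrow> Suc k \<notin> a ` {..<p}" for a
    proof -
      have inj: "inj a" using permutes_inj[OF perm[OF a]] .
      have "strict_mono_on {..<p} (?\<tau> \<circ> a)"
      proof (rule strict_mono_onI)
        fix i j assume ij: "i \<in> {..<p}" "j \<in> {..<p}" "i < j"
        then have "a i < a j" using a by (simp add: shuffles_perm_def strict_mono_on_def)
        moreover have "\<not> (a i = k \<and> a j = Suc k)" using ij k by (metis imageI)
        ultimately show "(?\<tau> \<circ> a) i < (?\<tau> \<circ> a) j" using mono by simp
      qed
      moreover have "strict_mono_on {p..<m} (?\<tau> \<circ> a)"
      proof (rule strict_mono_onI)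
        fix i j assume ij: "i \<in> {p..<m}" "j \<in> {p..<m}" "i < j"
        then have "a i < a j" using a by (simp add: shuffles_perm_def strict_mono_on_def)
        moreover have "\<not> (a i = k \<and> a j = Suc k)"
        proof
          assume h: "a i = k \<and> a j = Suc k"
          have "a i \<notin> a ` {..<p}" "a j \<notin> a ` {..<p}" 
            using ij inj_image_mem_iff[OF inj, of _ "{..<p}"] by simp_all
          then show False using h k by simp
        qed
        ultimately show "(?\<tau> \<circ> a) i < (?\<tau> \<circ> a) j" using mono by simp
      qed
      ultimately show ?thesis using permutes_compose[OF perm[OF a] \<tau>] by (simp add: shuffles_perm_def)
    qed
    have im: "n \<in> (?\<tau> \<circ> a) ` {..<p} \<longleftrightarrow> ?\<tau> n \<in> a ` {..<p}" for n a
    proof -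
      have "n = ?\<tau> x \<longleftrightarrow> ?\<tau> n = x" for x by (metis transpose_involutory)
      then show ?thesis by (simp add: image_iff)
    qed
    have im': "n \<in> (\<lambda>x. ?\<tau> (a x)) ` {..<p} \<longleftrightarrow> ?\<tau> n \<in> a ` {..<p}" for n a
      using im[of n a] by (simp add: comp_def)
    have invol: "?\<tau> \<circ> (?\<tau> \<circ> a) = a" for a :: "nat \<Rightarrow> nat" by (simp add: fun_eq_iff)
    have XY: "(\<lambda>a. ?\<tau> \<circ> a) ` X = Y"
    proof (intro equalityI subsetI)
      fix b assume "b \<in> (\<lambda>a. ?\<tau> \<circ> a) ` X"
      then obtain a where a: "a \<in> X" "b = ?\<tau> \<circ> a" by blast
      then show "b \<in> Y" using shuffle[of a] by (simp add: X_def Y_def im' \<tau>k)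
    next
      fix b assume b: "b \<in> Y"
      then have "?\<tau> \<circ> b \<in> X" using shuffle[of b] by (simp add: X_def Y_def im' \<tau>k)
      then show "b \<in> (\<lambda>a. ?\<tau> \<circ> a) ` X" using invol[of b] by (metis image_eqI)
    qed
    have inj: "inj_on (\<lambda>a. ?\<tau> \<circ> a) X" by (rule inj_onI) (metis invol)
    have neg: "t ys (?\<tau> \<circ> a) = \<ominus>\<^bsub>M\<^esub> t ys a" if a: "a \<in> X" for a
    proof -
      have aS: "a \<in> ?S" using a by (simp add: X_def)
      have "sign (?\<tau> \<circ> a) = - sign a"
        using \<tau> perm[OF aS] permutes_imp_permutation[OF finite_lessThan]
        by (simp add: sign_compose sign_swap_id)
      then show ?thesis
        unfolding t_def using selA[OF ysL aS] selB[OF ysL aS]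
        by (simp add: ys\<tau> M.M.add_pow_neg)
    qed
    have zero: "t ys a = \<zero>\<^bsub>M\<^esub>" if a: "a \<in> Z" for a
    proof -
      have aS: "a \<in> ?S" using a by (simp add: Z_def)
      have "k \<in> a ` {..<m}" "Suc k \<in> a ` {..<m}"
        unfolding permutes_image[OF perm[OF aS]] using k by simp_all
      then obtain i j where ij: "i < m" "j < m" "a i = k" "a j = Suc k" by (metis imageE lessThan_iff)
      then have "i \<noteq> j" by auto
      have blocks: "i < p \<longleftrightarrow> j < p"
      proof -
        note inj = inj_image_mem_iff[OF permutes_inj[OF perm[OF aS]], of _ "{..<p}"]
        have "k \<in> a ` {..<p} \<longleftrightarrow> i < p" using inj[of i] ij(3) by simp
        moreover have "Suc k \<in> a ` {..<p} \<longleftrightarrow> j < p" using inj[of j] ij(4) by simp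
        ultimately have "k \<in> a ` {..<p} \<longleftrightarrow> i < p" "Suc k \<in> a ` {..<p} \<longleftrightarrow> j < p" .
        then show ?thesis using a by (simp add: Z_def)
      qed
      show ?thesis
      proof (cases "i < p")
        case True
        have "\<not> inj_on (\<lambda>i. ys ! a i) (set [0..<p])"
          using inj_onD[of "\<lambda>i. ys ! a i" "set [0..<p]" i j] True blocks ij k(2) \<open>i \<noteq> j\<close> by auto
        then have "\<not> distinct (map (\<lambda>i. ys ! a i) [0..<p])" by (simp only: distinct_map) blast
        then have "A (map (\<lambda>i. ys ! a i) [0..<p]) = \<zero>\<^bsub>R\<^esub>"
          using sel(1)[OF ysL aS] by (intro A.not_distinct_eq_zero) auto
        then show ?thesis using selB[OF ysL aS] by (simp add: t_def)
      next
        case False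
        have "\<not> inj_on (\<lambda>i. ys ! a i) (set [p..<m])"
          using inj_onD[of "\<lambda>i. ys ! a i" "set [p..<m]" i j] False blocks ij k(2) \<open>i \<noteq> j\<close> by auto
        then have "\<not> distinct (map (\<lambda>i. ys ! a i) [p..<m])" by (simp only: distinct_map) blast
        then have "B (map (\<lambda>i. ys ! a i) [p..<m]) = \<zero>\<^bsub>M\<^esub>"
          using sel(2)[OF ysL aS] by (intro B.not_distinct_eq_zero) auto
        then show ?thesis using selA[OF ysL aS] by (simp add: t_def)
      qed
    qed
    have fins: "finite X" "finite Y" "finite Z" using fin by (auto simp: X_def Y_def Z_def)
    have tX: "t ys \<in> X \<rightarrow> carrier M" and tY: "t ys \<in> Y \<rightarrow> carrier M" and tZ: "t ys \<in> Z \<rightarrow> carrier M"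
      using t_closed[OF ysL] by (auto simp: X_def Y_def Z_def)
    have S: "?S = Z \<union> (X \<union> Y)" by (auto simp: X_def Y_def Z_def)
    have "(\<Oplus>\<^bsub>M\<^esub>a\<in>?S. t ys a) = (\<Oplus>\<^bsub>M\<^esub>a\<in>Z. t ys a) \<oplus>\<^bsub>M\<^esub> ((\<Oplus>\<^bsub>M\<^esub>a\<in>X. t ys a) \<oplus>\<^bsub>M\<^esub> (\<Oplus>\<^bsub>M\<^esub>a\<in>Y. t ys a))"
    proof -
      have XY: "X \<inter> Y = {}" and ZXY: "Z \<inter> (X \<union> Y) = {}" by (auto simp: X_def Y_def Z_def)
      have "t ys \<in> X \<union> Y \<rightarrow> carrier M" using tX tY by blast
      then show ?thesis
        unfolding S M.M.finsum_Un_disjoint[OF fins(1,2) XY tX tY, symmetric]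
        using fins by (intro M.M.finsum_Un_disjoint ZXY tZ) auto
    qed
    also have "(\<Oplus>\<^bsub>M\<^esub>a\<in>Z. t ys a) = \<zero>\<^bsub>M\<^esub>"
      by (rule M.M.add.finprod_one_eqI) (rule zero)
    also have "(\<Oplus>\<^bsub>M\<^esub>a\<in>Y. t ys a) = (\<Oplus>\<^bsub>M\<^esub>a\<in>X. t ys (?\<tau> \<circ> a))"
      unfolding XY[symmetric] by (rule M.M.finsum_reindex[OF _ inj]) (use tY XY in simp)
    also have "\<dots> = (\<Oplus>\<^bsub>M\<^esub>a\<in>X. \<ominus>\<^bsub>M\<^esub> t ys a)"
      by (rule M.M.finsum_cong'[OF refl _ neg]) (use tX in auto)
    also have "\<dots> = \<ominus>\<^bsub>M\<^esub> (\<Oplus>\<^bsub>M\<^esub>a\<in>X. t ys a)" by (rule M.M.finsum_uminus[OF tX])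
    finally show "(\<Oplus>\<^bsub>M\<^esub>a\<in>?S. t (pre @ x # x # post) a) = \<zero>\<^bsub>M\<^esub>"
      using M.M.finsum_closed[OF tX] by (simp add: ys_def M.M.r_neg)
  qed
  from alternating.intro[OF M.M.abelian_group_axioms alternating_axioms.intro[OF A.L this]]
  show ?thesis unfolding t_def .
qed

lemma tensor_wedge_alternating:
  fixes L :: "(int ^ 'n) set"
  assumes R: "cring R" and L: "zsubgroup L" and G: "zsubgroup G"
    and mem: "\<And>ys. length ys = q \<Longrightarrow> set ys \<subseteq> L \<Longrightarrow> wedge ys \<in> G"
  shows "alternating (tensor_mod R G) L q (\<lambda>ys. tensor_one R G (wedge ys))"
proof (intro alternating.intro alternating_axioms.intro L)
  interpret T: module R "tensor_mod R G" by (rule tensor_module[OF R G])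
  show "abelian_group (tensor_mod R G)" by (rule T.M.abelian_group_axioms)
  interpret W: alternating int_functions L q wedge by (rule wedge_alternating[OF L])
  show "alternating_on (tensor_mod R G) L q (\<lambda>ys. tensor_one R G (wedge ys))"
    unfolding alternating_on_def
  proof (intro conjI allI impI; elim conjE)
    fix ys :: "(int ^ 'n) list" assume "length ys = q" "set ys \<subseteq> L"
    from mem[OF this] show "tensor_one R G (wedge ys) \<in> carrier (tensor_mod R G)"
      by (rule tensor_one_closed[OF R G])
  next
    fix pre post :: "(int ^ 'n) list" and x y
    assume *: "Suc (length pre + length post) = q" "set pre \<subseteq> L" "set post \<subseteq> L" "x \<in> L" "y \<in> L"
    have "wedge (pre @ (x - y) # post) = wedge (pre @ x # post) - wedge (pre @ y # post)"
      by (simp add: fun_eq_iff wedge_diff)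
    moreover have "wedge (pre @ x # post) \<in> G" "wedge (pre @ y # post) \<in> G"
      using * by (auto intro!: mem)
    ultimately show "tensor_one R G (wedge (pre @ (x - y) # post)) =
        tensor_one R G (wedge (pre @ x # post)) \<ominus>\<^bsub>tensor_mod R G\<^esub> tensor_one R G (wedge (pre @ y # post))"
      using tensor_one_diff[OF R G] by simp
  next
    fix pre post :: "(int ^ 'n) list" and x
    assume *: "Suc (Suc (length pre + length post)) = q" "set pre \<subseteq> L" "set post \<subseteq> L" "x \<in> L"
    have "wedge (pre @ x # x # post) = 0"
      using W.adjacent_eq[OF *] by (simp add: int_functions_simps zero_fun_def)
    then show "tensor_one R G (wedge (pre @ x # x # post)) = \<zero>\<^bsub>tensor_mod R G\<^esub>"
      using tensor_one_zero[OF R G] by simp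
  qed
qed

lemma dual_modD:
  assumes "u \<in> carrier (dual_mod R M)"
  shows "x \<in> carrier M \<Longrightarrow> u x \<in> carrier R"
    and "x \<in> carrier M \<Longrightarrow> y \<in> carrier M \<Longrightarrow> u (x \<oplus>\<^bsub>M\<^esub> y) = u x \<oplus>\<^bsub>R\<^esub> u y"
    and "r \<in> carrier R \<Longrightarrow> x \<in> carrier M \<Longrightarrow> u (r \<odot>\<^bsub>M\<^esub> x) = r \<otimes>\<^bsub>R\<^esub> u x"
    and "u \<in> extensional (carrier M)"
  using assms by (auto simp: dual_mod_def PiE_def)

lemma dual_mod_group_hom:
  assumes M: "module R M" and u: "u \<in> carrier (dual_mod R M)"
  shows "group_hom (add_monoid M) (add_monoid R) u"
proof -
  interpret M: module R M by fact
  show ?thesis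
    by (intro group_hom.intro group_hom_axioms.intro homI M.M.add.is_group M.R.add.is_group)
       (simp_all add: dual_modD[OF u])
qed

lemma dual_mod_hom_simps:
  assumes M: "module R M" and u: "u \<in> carrier (dual_mod R M)"
  shows "u \<zero>\<^bsub>M\<^esub> = \<zero>\<^bsub>R\<^esub>"
    and "x \<in> carrier M \<Longrightarrow> u (\<ominus>\<^bsub>M\<^esub> x) = \<ominus>\<^bsub>R\<^esub> u x"
    and "x \<in> carrier M \<Longrightarrow> y \<in> carrier M \<Longrightarrow> u (x \<ominus>\<^bsub>M\<^esub> y) = u x \<ominus>\<^bsub>R\<^esub> u y"
    and "x \<in> carrier M \<Longrightarrow> u ([(k::int)] \<cdot>\<^bsub>M\<^esub> x) = [k] \<cdot>\<^bsub>R\<^esub> u x"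
proof -
  interpret M: module R M by fact
  interpret u: group_hom "add_monoid M" "add_monoid R" u by (rule dual_mod_group_hom[OF assms])
  show "u \<zero>\<^bsub>M\<^esub> = \<zero>\<^bsub>R\<^esub>" using u.hom_one by simp
  show inv: "u (\<ominus>\<^bsub>M\<^esub> x) = \<ominus>\<^bsub>R\<^esub> u x" if "x \<in> carrier M" for x
    using u.hom_inv[of x] that by (simp add: a_inv_def)
  show "u (x \<ominus>\<^bsub>M\<^esub> y) = u x \<ominus>\<^bsub>R\<^esub> u y" if "x \<in> carrier M" "y \<in> carrier M"
    using that inv[of y] dual_modD(2)[OF u that(1) M.M.a_inv_closed[OF that(2)]] by (simp add: a_minus_def)
  show "u ([k] \<cdot>\<^bsub>M\<^esub> x) = [k] \<cdot>\<^bsub>R\<^esub> u x" if "x \<in> carrier M"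
    using u.hom_int_pow[of x k] that by (simp add: add_pow_def)
qed

text \<open>The shuffle sum defining the contraction makes sense for all lists. Being alternating, its value on an
  oriented basis depends on the choice of the basis only through the sign of the base change.\<close>

lemma contraction_alternating:
  fixes R :: "('r, 'm) ring_scheme" and L :: "(int ^ 'n) set"
  assumes R: "cring R" and L: "zsubgroup L" and G: "\<And>q. zsubgroup (FZ \<Sigma> q \<alpha>)"
    and mem: "\<And>ys. set ys \<subseteq> L \<Longrightarrow> wedge ys \<in> FZ \<Sigma> (length ys) \<alpha>"
    and u: "u \<in> carrier (F_up R \<Sigma> p \<alpha>)" and pm: "p \<le> m"
  shows "alternating (F_low R \<Sigma> (m - p) \<alpha>) L m (contraction R \<Sigma> p \<alpha> u)"
proof -
  interpret M: module R "F_low R \<Sigma> (m - p) \<alpha>" unfolding F_low_def by (rule tensor_module[OF R G])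
  have Mp: "module R (F_low R \<Sigma> p \<alpha>)" unfolding F_low_def by (rule tensor_module[OF R G])
  have T: "alternating (F_low R \<Sigma> q \<alpha>) L q (\<lambda>ys. tensor_one R (FZ \<Sigma> q \<alpha>) (wedge ys))" for q
    unfolding F_low_def
  proof (rule tensor_wedge_alternating[OF R L G])
    fix ys :: "(int ^ 'n) list" assume "length ys = q" "set ys \<subseteq> L"
    then show "wedge ys \<in> FZ \<Sigma> q \<alpha>" using mem[of ys] by simp
  qed
  interpret Tp: alternating "F_low R \<Sigma> p \<alpha>" L p "\<lambda>ys. tensor_one R (FZ \<Sigma> p \<alpha>) (wedge ys)" by (rule T)
  note u' = u[unfolded F_up_def]
  have A: "alternating R L p (\<lambda>ys. u (tensor_one R (FZ \<Sigma> p \<alpha>) (wedge ys)))"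
  proof (intro alternating.intro alternating_axioms.intro L M.R.abelian_group_axioms)
    show "alternating_on R L p (\<lambda>ys. u (tensor_one R (FZ \<Sigma> p \<alpha>) (wedge ys)))"
      unfolding alternating_on_def
    proof (intro conjI allI impI; elim conjE)
      fix ys :: "(int ^ 'n) list" assume "length ys = p" "set ys \<subseteq> L"
      then show "u (tensor_one R (FZ \<Sigma> p \<alpha>) (wedge ys)) \<in> carrier R"
        by (intro dual_modD(1)[OF u'] Tp.closed)
    next
      fix pre post :: "(int ^ 'n) list" and x y
      assume *: "Suc (length pre + length post) = p" "set pre \<subseteq> L" "set post \<subseteq> L" "x \<in> L" "y \<in> L"
      show "u (tensor_one R (FZ \<Sigma> p \<alpha>) (wedge (pre @ (x - y) # post))) =
        u (tensor_one R (FZ \<Sigma> p \<alpha>) (wedge (pre @ x # post))) \<ominus>\<^bsub>R\<^esub>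
        u (tensor_one R (FZ \<Sigma> p \<alpha>) (wedge (pre @ y # post)))"
        unfolding Tp.diff[OF *] by (rule dual_mod_hom_simps(3)[OF Mp u']; rule Tp.closed) (use * in auto)
    next
      fix pre post :: "(int ^ 'n) list" and x
      assume *: "Suc (Suc (length pre + length post)) = p" "set pre \<subseteq> L" "set post \<subseteq> L" "x \<in> L"
      show "u (tensor_one R (FZ \<Sigma> p \<alpha>) (wedge (pre @ x # x # post))) = \<zero>\<^bsub>R\<^esub>"
        unfolding Tp.adjacent_eq[OF *] by (rule dual_mod_hom_simps(1)[OF Mp u'])
    qed
  qed
  show ?thesis
    by (rule alternating_cong[OF shuffle_sum_alternating[OF M.module_axioms A T pm]])
       (simp add: contraction_def Let_def)
qed

section \<open>Convex cones and their faces\<close>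

lemma convex_coneD:
  assumes "convex_cone C"
  shows "0 \<in> C" "x \<in> C \<Longrightarrow> y \<in> C \<Longrightarrow> x + y \<in> C" "0 \<le> c \<Longrightarrow> x \<in> C \<Longrightarrow> c *\<^sub>R x \<in> C" "convex C"
proof -
  show "0 \<in> C" "x \<in> C \<Longrightarrow> y \<in> C \<Longrightarrow> x + y \<in> C" "0 \<le> c \<Longrightarrow> x \<in> C \<Longrightarrow> c *\<^sub>R x \<in> C"
    using assms by (auto simp: convex_cone_iff)
  show "convex C" using assms by (simp add: convex_cone_def)
qed

lemma cone_face_iff:
  fixes C :: "'a::euclidean_space set"
  assumes C: "convex_cone C"
  shows "F face_of C \<and> F \<noteq> {} \<longleftrightarrow>
    convex_cone F \<and> F \<subseteq> C \<and> (\<forall>a\<in>C. \<forall>b\<in>C. a + b \<in> F \<longrightarrow> a \<in> F \<and> b \<in> F)"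
proof
  assume F: "F face_of C \<and> F \<noteq> {}"
  have conic: "conic C" using C by (simp add: convex_cone_def)
  have F': "convex_cone F"
    using F face_of_conic[OF conic] face_of_imp_convex by (auto simp: convex_cone_def)
  have "a \<in> F \<and> b \<in> F" if ab: "a \<in> C" "b \<in> C" "a + b \<in> F" for a b
  proof (cases "a = b")
    case True
    then have "(1/2) *\<^sub>R (a + b) = a" by (simp flip: scaleR_2)
    then show ?thesis using convex_coneD(3)[OF F', of "1/2" "a + b"] ab True by simp
  next
    case False
    have "midpoint a b \<in> F" using convex_coneD(3)[OF F', of "1/2" "a + b"] ab by (simp add: midpoint_def)
    moreover have "midpoint a b \<in> open_segment a b" using False by simp
    ultimately show ?thesis using face_ofD[of F C "midpoint a b" a b] F ab by blast
  qed
  then show "convex_cone F \<and> F \<subseteq> C \<and> (\<forall>a\<in>C. \<forall>b\<in>C. a + b \<in> F \<longrightarrow> a \<in> F \<and> b \<in> F)"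
    using F F' face_of_imp_subset by blast
next
  assume F: "convex_cone F \<and> F \<subseteq> C \<and> (\<forall>a\<in>C. \<forall>b\<in>C. a + b \<in> F \<longrightarrow> a \<in> F \<and> b \<in> F)"
  then have F': "convex_cone F" by blast
  have seg: "a \<in> F \<and> b \<in> F" if ab: "a \<in> C" "b \<in> C" "x \<in> F" "x \<in> open_segment a b" for a b x
  proof -
    obtain u where u: "0 < u" "u < 1" "x = (1 - u) *\<^sub>R a + u *\<^sub>R b"
      using ab(4) by (auto simp: in_segment)
    have "(1 - u) *\<^sub>R a \<in> C" "u *\<^sub>R b \<in> C" using u ab convex_coneD(3)[OF C] by simp_all
    moreover have "(1 - u) *\<^sub>R a + u *\<^sub>R b \<in> F" using ab(3) u(3) by simp
    ultimately have "(1 - u) *\<^sub>R a \<in> F" "u *\<^sub>R b \<in> F" using F by auto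
    moreover have "0 \<le> inverse (1 - u)" "0 \<le> inverse u" using u by simp_all
    ultimately have "inverse (1 - u) *\<^sub>R ((1 - u) *\<^sub>R a) \<in> F" "inverse u *\<^sub>R (u *\<^sub>R b) \<in> F"
      using convex_coneD(3)[OF F'] by blast+
    moreover have "inverse (1 - u) *\<^sub>R ((1 - u) *\<^sub>R a) = a" "inverse u *\<^sub>R (u *\<^sub>R b) = b"
      using u by simp_all
    ultimately show ?thesis by simp
  qed
  have "F face_of C"
    unfolding face_of_def
  proof (intro conjI ballI impI)
    show "F \<subseteq> C" using F by simp
    show "convex F" by (rule convex_coneD(4)[OF F'])
    fix a b x assume "a \<in> C" "b \<in> C" "x \<in> F" "x \<in> open_segment a b"
    then show "a \<in> F" "b \<in> F" using seg[of a b x] by simp_all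
  qed
  then show "F face_of C \<and> F \<noteq> {}" using convex_coneD(1)[OF F'] by blast
qed

lemma cone_faceI:
  fixes C :: "'a::euclidean_space set"
  assumes "convex_cone C" "convex_cone F" "F \<subseteq> C"
    "\<And>a b. a \<in> C \<Longrightarrow> b \<in> C \<Longrightarrow> a + b \<in> F \<Longrightarrow> a \<in> F \<and> b \<in> F"
  shows "F face_of C"
  using assms cone_face_iff by blast

lemma cone_faceD:
  fixes C :: "'a::euclidean_space set"
  assumes "convex_cone C" "F face_of C" "F \<noteq> {}"
  shows "convex_cone F" "F \<subseteq> C"
    "a \<in> C \<Longrightarrow> b \<in> C \<Longrightarrow> a + b \<in> F \<Longrightarrow> a \<in> F" "a \<in> C \<Longrightarrow> b \<in> C \<Longrightarrow> a + b \<in> F \<Longrightarrow> b \<in> F"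
  using assms cone_face_iff by blast+

lemma cone_face_dim_eq:
  fixes C :: "'a::euclidean_space set"
  assumes "convex_cone C" "F face_of C" "F \<noteq> {}" "dim C \<le> dim F"
  shows "F = C"
proof (rule ccontr)
  assume "F \<noteq> C"
  then have "aff_dim F < aff_dim C"
    using face_of_aff_dim_lt[of C F] convex_coneD(4)[OF assms(1)] assms(2) by blast
  moreover have "0 \<in> affine hull C" "0 \<in> affine hull F"
    by (intro hull_inc convex_coneD(1) assms(1) cone_faceD(1)[OF assms(1-3)])+
  ultimately show False using assms(4) by (simp add: aff_dim_zero)
qed

lemma span_convex_cone:
  assumes "convex_cone C"
  shows "span C = {x - y | x y. x \<in> C \<and> y \<in> C}"
proof
  let ?D = "{x - y | x y. x \<in> C \<and> y \<in> C}"
  have "subspace ?D"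
  proof (rule subspaceI)
    show "0 \<in> ?D" using convex_coneD(1)[OF assms] by force
    fix v assume "v \<in> ?D"
    then obtain x y where v: "v = x - y" "x \<in> C" "y \<in> C" by blast
    show "c *\<^sub>R v \<in> ?D" for c
    proof (cases "0 \<le> c")
      case True
      then have "c *\<^sub>R x \<in> C" "c *\<^sub>R y \<in> C" using v convex_coneD(3)[OF assms] by blast+
      moreover have "c *\<^sub>R v = c *\<^sub>R x - c *\<^sub>R y" using v by (simp add: scaleR_diff_right)
      ultimately show ?thesis by blast
    next
      case False
      then have "(- c) *\<^sub>R y \<in> C" "(- c) *\<^sub>R x \<in> C" using v by (intro convex_coneD(3)[OF assms]; simp)+
      moreover have "c *\<^sub>R v = (- c) *\<^sub>R y - (- c) *\<^sub>R x" using v by (simp add: scaleR_diff_right)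
      ultimately show ?thesis by blast
    qed
    fix v' assume "v' \<in> ?D"
    then obtain x' y' where v': "v' = x' - y'" "x' \<in> C" "y' \<in> C" by blast
    have "v + v' = (x + x') - (y + y')" "x + x' \<in> C" "y + y' \<in> C"
      using v v' convex_coneD(2)[OF assms] by auto
    then show "v + v' \<in> ?D" by blast
  qed
  moreover have "C \<subseteq> ?D" using convex_coneD(1)[OF assms] by force
  ultimately show "span C \<subseteq> ?D" by (rule span_minimal[rotated])
  show "?D \<subseteq> span C" by (auto intro: span_diff span_base)
qed

lemma face_eq_Int_span:
  fixes C :: "'a::euclidean_space set"
  assumes C: "convex_cone C" and F: "F face_of C" "F \<noteq> {}"
  shows "span F \<inter> C = F"
proof
  show "F \<subseteq> span F \<inter> C" using cone_faceD(2)[OF C F] span_superset by blast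
  show "span F \<inter> C \<subseteq> F"
  proof
    fix z assume z: "z \<in> span F \<inter> C"
    then obtain x y where xy: "z = x - y" "x \<in> F" "y \<in> F"
      using span_convex_cone[OF cone_faceD(1)[OF C F]] by blast
    then have "z + y \<in> F" "y \<in> C" using cone_faceD(2)[OF C F] by auto
    then show "z \<in> F" using cone_faceD(3)[OF C F] z by blast
  qed
qed

text \<open>If \<open>c \<le> 0\<close>, then \<open>a + (- c) b\<close> is a sum of two elements of \<open>C\<close> lying in the span of the face, hence in
  the face, and so do its summands. Thus \<open>C\<close> lies on one side of a face of codimension one.\<close>

lemma face_one_side:
  fixes C :: "'a::euclidean_space set"
  assumes C: "convex_cone C" and F: "F face_of C" "F \<noteq> {}"
    and ab: "a \<in> C" "b \<in> C" "a = c *\<^sub>R b + t" "t \<in> span F" "c \<le> 0"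
  shows "a \<in> F"
proof -
  have b: "(- c) *\<^sub>R b \<in> C" using convex_coneD(3)[OF C, of "- c" b] ab by simp
  have "a + (- c) *\<^sub>R b = t" using ab by simp
  then have "a + (- c) *\<^sub>R b \<in> span F \<inter> C" using ab b convex_coneD(2)[OF C ab(1) b] by simp
  then show "a \<in> F" using face_eq_Int_span[OF C F] cone_faceD(3)[OF C F ab(1) b] by blast
qed

lemma rel_interior_small_step:
  fixes C :: "'a::euclidean_space set"
  assumes C: "convex_cone C" and x: "x \<in> rel_interior C" and t: "t \<in> span C"
  obtains e where "e > 0" "x + e *\<^sub>R t \<in> C"
proof -
  have aff: "affine hull C = span C"
    using affine_hull_span_0 convex_coneD(1)[OF C] hull_inc by metis
  obtain e where e: "e > 0" "ball x e \<inter> span C \<subseteq> C" and xC: "x \<in> C"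
    using x aff by (auto simp: mem_rel_interior_ball)
  define d where "d = e / (2 * (norm t + 1))"
  have "norm t + 1 > 0" by (simp add: add_nonneg_pos)
  then have d: "d > 0" using e by (simp add: d_def)
  have "norm (d *\<^sub>R t) < e"
  proof -
    have "norm (d *\<^sub>R t) = d * norm t" using d by simp
    also have "\<dots> \<le> d * (norm t + 1)" using d by simp
    also have "\<dots> = e / 2" using \<open>norm t + 1 > 0\<close> unfolding d_def by (simp add: field_simps)
    finally show ?thesis using e by simp
  qed
  then have "x + d *\<^sub>R t \<in> ball x e" by (simp add: dist_norm)
  moreover have "x + d *\<^sub>R t \<in> span C" using xC t by (simp add: span_add span_scale span_base)
  ultimately show ?thesis using that[OF d] e by blast
qed

text \<open>A convex cone is not covered by finitely many subspaces unless one of them contains it: on the ray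
  from a point of one subspace towards a point outside, two points would share a subspace.\<close>

lemma cone_covered_by_subspaces:
  fixes C :: "'a::real_vector set"
  assumes C: "convex_cone C" and I: "finite I" and V: "\<And>i. i \<in> I \<Longrightarrow> subspace (V i)"
    and cover: "C \<subseteq> (\<Union>i\<in>I. V i)"
  shows "\<exists>i\<in>I. C \<subseteq> V i"
  using I V cover
proof (induction I rule: finite_induct)
  case empty
  then show ?case using convex_coneD(1)[OF C] by simp
next
  case (insert i I)
  show ?case
  proof (rule ccontr)
    assume no: "\<not> ?case"
    then have "\<not> C \<subseteq> (\<Union>i\<in>I. V i)" using insert by blast
    then obtain a where a: "a \<in> C" "a \<notin> (\<Union>i\<in>I. V i)" by blast
    then have ai: "a \<in> V i" using insert.prems(2) by blast
    obtain b where b: "b \<in> C" "b \<notin> V i" using no by blast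
    let ?p = "\<lambda>n::nat. b + real n *\<^sub>R a"
    have "\<exists>j\<in>I. ?p n \<in> V j" for n
    proof -
      have "?p n \<in> C" using a b convex_coneD(2,3)[OF C] by simp
      moreover have "?p n \<notin> V i"
      proof
        assume "?p n \<in> V i"
        moreover have "real n *\<^sub>R a \<in> V i" using ai insert.prems(1)[of i] by (simp add: subspace_scale)
        ultimately have "?p n - real n *\<^sub>R a \<in> V i" using insert.prems(1)[of i] subspace_diff by blast
        then show False using b by simp
      qed
      ultimately show ?thesis using insert.prems(2) by blast
    qed
    then obtain j where j: "j \<in> I" "infinite {n \<in> UNIV. ?p n \<in> V j}"
      using pigeonhole_infinite_rel[of "UNIV :: nat set" I "\<lambda>n j. ?p n \<in> V j"] insert.hyps(1) by auto
    obtain n where n: "?p n \<in> V j" using j(2) by (metis (mono_tags, lifting) Collect_empty_eq finite.emptyI)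
    have "\<exists>m>n. ?p m \<in> V j" using j(2) by (auto simp: infinite_nat_iff_unbounded)
    then obtain m where m: "m > n" "?p m \<in> V j" by blast
    have Vj: "subspace (V j)" using insert.prems(1) j(1) by blast
    have "?p m - ?p n \<in> V j" using m n Vj subspace_diff by blast
    then have "(real m - real n) *\<^sub>R a \<in> V j" by (simp add: scaleR_diff_left)
    then have "inverse (real m - real n) *\<^sub>R ((real m - real n) *\<^sub>R a) \<in> V j"
      using Vj subspace_scale by blast
    then have "a \<in> V j" using m(1) by simp
    then show False using a j by blast
  qed
qed

section \<open>Rational cones\<close>

lemma rational_coneD:
  assumes "rational_cone \<sigma>"
  shows "convex_cone \<sigma>" "closed \<sigma>" "\<sigma> \<noteq> {}" "x \<in> \<sigma> \<Longrightarrow> - x \<in> \<sigma> \<Longrightarrow> x = 0"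
  using assms unfolding rational_cone_def
  by (auto simp: convex_cone_convex_cone_hull closed_convex_cone_hull convex_cone_hull_nonempty)

lemma rational_cone_generators:
  assumes "rational_cone \<sigma>"
  obtains G where "finite G" "\<sigma> = convex_cone hull (real_vec ` G)" "G \<subseteq> lat \<sigma>"
proof -
  obtain G where G: "finite G" "\<sigma> = convex_cone hull (real_vec ` G)" using assms by (auto simp: rational_cone_def)
  then have "real_vec ` G \<subseteq> \<sigma>" by (simp add: hull_subset)
  then have "G \<subseteq> lat \<sigma>" by (auto simp: lat_def intro: span_base)
  then show ?thesis using that[OF G] by simp
qed

lemma span_lat:
  assumes "rational_cone \<sigma>"
  shows "span (real_vec ` lat \<sigma>) = span \<sigma>"
proof
  show "span (real_vec ` lat \<sigma>) \<subseteq> span \<sigma>" by (rule span_minimal) (auto simp: lat_def)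
  obtain G where G: "\<sigma> = convex_cone hull (real_vec ` G)" "G \<subseteq> lat \<sigma>"
    using rational_cone_generators[OF assms] by metis
  have "\<sigma> \<subseteq> span (real_vec ` lat \<sigma>)"
    unfolding G(1) by (rule hull_minimal)
      (use G(2) span_superset[of "real_vec ` lat \<sigma>"] in \<open>auto simp: convex_cone_span G(1)\<close>)
  then show "span \<sigma> \<subseteq> span (real_vec ` lat \<sigma>)" by (simp add: span_minimal)
qed

lemma lattice_point_off_face:
  assumes \<sigma>: "rational_cone \<sigma>" and \<tau>: "\<tau> face_of \<sigma>" "\<tau> \<noteq> {}" "\<tau> \<noteq> \<sigma>"
  obtains u where "real_vec u \<in> \<sigma>" "real_vec u \<notin> \<tau>"
proof -
  note C = rational_coneD(1)[OF \<sigma>]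
  obtain G where G: "\<sigma> = convex_cone hull (real_vec ` G)"
    using rational_cone_generators[OF \<sigma>] by metis
  have "\<not> real_vec ` G \<subseteq> \<tau>"
  proof
    assume "real_vec ` G \<subseteq> \<tau>"
    then have "\<sigma> \<subseteq> \<tau>" unfolding G by (rule hull_minimal) (rule cone_faceD(1)[OF C \<tau>(1,2)])
    then show False using \<tau> cone_faceD(2)[OF C \<tau>(1,2)] by blast
  qed
  moreover have "real_vec ` G \<subseteq> \<sigma>" unfolding G by (rule hull_subset)
  ultimately show ?thesis using that by blast
qed

lemma vertex_face:
  assumes "rational_cone \<sigma>"
  shows "{0} face_of \<sigma>"
proof (rule cone_faceI)
  note C = rational_coneD[OF assms]
  show "convex_cone \<sigma>" by (rule C)
  show "{0} \<subseteq> \<sigma>" using convex_coneD(1)[OF C(1)] by simp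
  fix a b assume ab: "a \<in> \<sigma>" "b \<in> \<sigma>" "a + b \<in> {0}"
  then have "b = - a" by (simp add: eq_neg_iff_add_eq_0 add.commute)
  then show "a \<in> {0} \<and> b \<in> {0}" using C(4)[of a] ab by simp
qed simp

lemma dim_0_cone:
  fixes \<sigma> :: "'a::euclidean_space set"
  assumes "convex_cone \<sigma>"
  shows "dim \<sigma> = 0 \<longleftrightarrow> \<sigma> = {0}"
proof -
  have "0 \<in> \<sigma>" by (rule convex_coneD(1)[OF assms])
  then show ?thesis unfolding dim_eq_0 by blast
qed

lemma compact_cone_trivial:
  fixes \<sigma> :: "'a::euclidean_space set"
  assumes "convex_cone \<sigma>" "compact \<sigma>"
  shows "\<sigma> = {0}"
proof -
  have "x = 0" if x: "x \<in> \<sigma>" for x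
  proof (rule ccontr)
    assume "x \<noteq> 0"
    obtain B where B: "\<And>y. y \<in> \<sigma> \<Longrightarrow> norm y \<le> B"
      using compact_imp_bounded[OF assms(2)] by (auto simp: bounded_iff)
    have "B \<ge> 0" using B[OF x] norm_ge_zero order_trans by blast
    have "((B + 1) / norm x) *\<^sub>R x \<in> \<sigma>" using convex_coneD(3)[OF assms(1) _ x] \<open>B \<ge> 0\<close> by simp
    from B[OF this] show False using \<open>x \<noteq> 0\<close> \<open>B \<ge> 0\<close> by simp
  qed
  then show ?thesis using convex_coneD(1)[OF assms(1)] by blast
qed

lemma ray_eq:
  fixes \<rho> :: "'a::euclidean_space set"
  assumes C: "convex_cone \<rho>" and pointed: "\<And>x. x \<in> \<rho> \<Longrightarrow> - x \<in> \<rho> \<Longrightarrow> x = 0"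
    and dim: "dim \<rho> = 1" and g: "g \<in> \<rho>" "g \<noteq> 0"
  shows "\<rho> = {t *\<^sub>R g | t. 0 \<le> t}"
proof
  show "{t *\<^sub>R g | t. 0 \<le> t} \<subseteq> \<rho>" using convex_coneD(3)[OF C _ g(1)] by blast
  have "span {g} = span \<rho>"
  proof (rule subspace_dim_equal)
    show "span {g} \<subseteq> span \<rho>" using g(1) by (intro span_mono) simp
    show "dim (span \<rho>) \<le> dim (span {g})" using dim g(2) by (simp add: dim_insert)
  qed simp_all
  then have line: "x \<in> \<rho> \<Longrightarrow> \<exists>t. x = t *\<^sub>R g" for x
    using span_superset[of \<rho>] by (auto simp: span_singleton)
  show "\<rho> \<subseteq> {t *\<^sub>R g | t. 0 \<le> t}"
  proof
    fix x assume x: "x \<in> \<rho>"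
    then obtain t where t: "x = t *\<^sub>R g" using line by blast
    have "0 \<le> t"
    proof (rule ccontr)
      assume neg: "\<not> 0 \<le> t"
      then have "0 \<le> inverse (- t)" by simp
      then have "inverse (- t) *\<^sub>R x \<in> \<rho>" by (rule convex_coneD(3)[OF C _ x])
      moreover have "inverse (- t) *\<^sub>R x = - g" using t neg by simp
      ultimately show False using pointed[OF g(1)] g(2) by simp
    qed
    then show "x \<in> {t *\<^sub>R g | t. 0 \<le> t}" using t by blast
  qed
qed

lemma convex_cone_hull_singleton: "convex_cone hull {g} = {t *\<^sub>R g | t. 0 \<le> t}" (is "_ = ?R")
proof (rule hull_unique)
  show "{g} \<subseteq> ?R" by (auto intro: exI[of _ 1])
  show "convex_cone ?R"
    unfolding convex_cone_iff
  proof (intro conjI ballI allI impI)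
    show "0 \<in> ?R" by (auto intro: exI[of _ 0])
    fix x assume "x \<in> ?R"
    then obtain s where s: "x = s *\<^sub>R g" "0 \<le> s" by blast
    show "c *\<^sub>R x \<in> ?R" if "0 \<le> c" for c
      using s that by (auto intro!: exI[of _ "c * s"])
    fix y assume "y \<in> ?R"
    then obtain t where t: "y = t *\<^sub>R g" "0 \<le> t" by blast
    show "x + y \<in> ?R" using s t by (auto intro!: exI[of _ "s + t"] simp: scaleR_add_left)
  qed
  show "?R \<subseteq> T" if "{g} \<subseteq> T" "convex_cone T" for T using that convex_coneD(3) by blast
qed

text \<open>The members of a smallest generating set span extreme rays: a decomposition of a generator would
  express it through the others.\<close>

lemma extreme_ray_generators:
  assumes \<sigma>: "rational_cone \<sigma>"
  obtains G where "finite G" "\<sigma> = convex_cone hull G"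
    "\<And>g. g \<in> G \<Longrightarrow> g \<noteq> 0 \<and> (convex_cone hull {g}) face_of \<sigma>"
    "\<And>g h. g \<in> G \<Longrightarrow> h \<in> G \<Longrightarrow> h \<in> convex_cone hull {g} \<Longrightarrow> g = h"
proof -
  define P where "P G \<longleftrightarrow> finite G \<and> \<sigma> = convex_cone hull G" for G
  have "\<exists>G. P G" using rational_cone_generators[OF \<sigma>] by (metis P_def finite_imageI)
  then obtain G0 where "P G0" ..
  from ex_has_least_nat[of P G0 card, OF this]
  obtain G where G: "P G" "\<And>H. P H \<Longrightarrow> card G \<le> card H" by blast
  have fin: "finite G" and hull: "\<sigma> = convex_cone hull G" using G(1) by (auto simp: P_def)
  have C: "convex_cone \<sigma>" and pointed: "\<And>x. x \<in> \<sigma> \<Longrightarrow> - x \<in> \<sigma> \<Longrightarrow> x = 0" using rational_coneD[OF \<sigma>] by blast+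
  have minimal: "g \<notin> convex_cone hull (G - {g})" if g: "g \<in> G" for g
  proof
    assume "g \<in> convex_cone hull (G - {g})"
    then have "convex_cone hull (insert g (G - {g})) = convex_cone hull (G - {g})" by (rule hull_redundant)
    then have "P (G - {g})" using hull fin g by (simp add: P_def insert_absorb)
    then show False using G(2)[of "G - {g}"] g fin by (metis card_Diff1_less linorder_not_le)
  qed
  have sub: "convex_cone hull H \<subseteq> \<sigma>" if "H \<subseteq> G" for H using hull hull_mono[OF that] by blast
  have decomp: "\<exists>l a'. x = l *\<^sub>R g + a' \<and> 0 \<le> l \<and> a' \<in> convex_cone hull (G - {g})" if x: "x \<in> \<sigma>" and g: "g \<in> G" for x g
  proof -
    have "{g} \<union> (G - {g}) = G" using g by blast
    then have "x \<in> convex_cone hull ({g} \<union> (G - {g}))" using x hull by simp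
    then obtain y a' where "y \<in> convex_cone hull {g}" "a' \<in> convex_cone hull (G - {g})" "x = y + a'"
      unfolding convex_cone_hull_Un by blast
    then show ?thesis unfolding convex_cone_hull_singleton by blast
  qed
  show ?thesis
  proof (rule that[OF fin hull])
    fix g assume g: "g \<in> G"
    have g\<sigma>: "g \<in> \<sigma>" using g unfolding hull by (rule hull_inc)
    let ?H = "convex_cone hull (G - {g})"
    have H: "convex_cone ?H" by (rule convex_cone_convex_cone_hull)
    have H\<sigma>: "?H \<subseteq> \<sigma>" by (rule sub) blast
    have "g \<noteq> 0" using minimal[OF g] convex_coneD(1)[OF H] by metis
    moreover have "(convex_cone hull {g}) face_of \<sigma>"
    proof (rule cone_faceI[OF C convex_cone_convex_cone_hull])
      show "convex_cone hull {g} \<subseteq> \<sigma>" by (rule sub) (use g in blast)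
      fix a b assume ab: "a \<in> \<sigma>" "b \<in> \<sigma>" "a + b \<in> convex_cone hull {g}"
      obtain t where t: "a + b = t *\<^sub>R g" "0 \<le> t" using ab(3) by (auto simp: convex_cone_hull_singleton)
      obtain l a' where a': "a = l *\<^sub>R g + a'" "0 \<le> l" "a' \<in> ?H" using decomp[OF ab(1) g] by blast
      obtain m b' where b': "b = m *\<^sub>R g + b'" "0 \<le> m" "b' \<in> ?H" using decomp[OF ab(2) g] by blast
      have s: "a' + b' \<in> ?H" using convex_coneD(2)[OF H a'(3) b'(3)] .
      have eq: "(t - l - m) *\<^sub>R g = a' + b'" using t(1) a'(1) b'(1) by (simp add: algebra_simps)
      have "t - l - m \<le> 0"
      proof (rule ccontr)
        assume pos: "\<not> t - l - m \<le> 0"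
        then have "inverse (t - l - m) *\<^sub>R (a' + b') \<in> ?H" using convex_coneD(3)[OF H _ s] by simp
        moreover have "inverse (t - l - m) *\<^sub>R (a' + b') = g" using eq[symmetric] pos by simp
        ultimately show False using minimal[OF g] by simp
      qed
      then have "- (a' + b') \<in> \<sigma>"
        using convex_coneD(3)[OF C _ g\<sigma>, of "- (t - l - m)"] unfolding eq[symmetric] by (simp add: algebra_simps)
      then have z: "a' + b' = 0" using pointed s H\<sigma> by blast
      then have "b' = - a'" by (simp add: eq_neg_iff_add_eq_0 add.commute)
      then have "a' = 0" using pointed[of a'] a'(3) b'(3) H\<sigma> by blast
      then have "a = l *\<^sub>R g" "b = m *\<^sub>R g" using a' b' z by auto
      then show "a \<in> convex_cone hull {g} \<and> b \<in> convex_cone hull {g}"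
        using a'(2) b'(2) by (auto simp: convex_cone_hull_singleton)
    qed
    ultimately show "g \<noteq> 0 \<and> (convex_cone hull {g}) face_of \<sigma>" by blast
    fix h assume h: "h \<in> G" "h \<in> convex_cone hull {g}"
    show "g = h"
    proof (rule ccontr)
      assume "g \<noteq> h"
      then have "convex_cone hull {g} \<subseteq> convex_cone hull (G - {h})" using g by (intro hull_mono) blast
      then show False using minimal[OF h(1)] h(2) by blast
    qed
  qed
qed

lemma dim_ray: "g \<noteq> 0 \<Longrightarrow> dim (convex_cone hull {g :: 'a::euclidean_space}) = 1"
proof -
  assume g: "g \<noteq> 0"
  have "span (convex_cone hull {g}) = span {g}"
  proof
    show "span (convex_cone hull {g}) \<subseteq> span {g}"
      by (rule span_minimal) (auto simp: convex_cone_hull_singleton span_base intro: span_scale)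
    show "span {g} \<subseteq> span (convex_cone hull {g})" by (rule span_mono) (rule hull_subset)
  qed
  then have "dim (convex_cone hull {g}) = dim {g}" by (metis dim_span)
  then show ?thesis using g by (simp add: dim_insert)
qed

lemma cone_has_ray:
  assumes \<sigma>: "rational_cone \<sigma>" and dim: "dim \<sigma> > 0"
  obtains \<rho> where "\<rho> face_of \<sigma>" "dim \<rho> = 1"
proof -
  obtain G where G: "\<sigma> = convex_cone hull G" "\<And>g. g \<in> G \<Longrightarrow> g \<noteq> 0 \<and> (convex_cone hull {g}) face_of \<sigma>"
    using extreme_ray_generators[OF \<sigma>] by metis
  have "G \<noteq> {}" using G(1) dim by auto
  then show ?thesis using that G(2) dim_ray by blast
qed

text \<open>Two generators of extreme rays span the plane. A vector \<open>l g + k h\<close> of a third extreme ray would split along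
  \<open>g\<close> and \<open>h\<close> if both coefficients were nonnegative; if one were negative, the ray of \<open>g\<close> or \<open>h\<close> would not be
  extreme; and if both were, the cone would not be pointed.\<close>

lemma plane_cone_rays:
  assumes \<sigma>: "rational_cone \<sigma>" and dim: "dim \<sigma> = 2"
  obtains g h where "g \<noteq> 0" "h \<noteq> 0" "convex_cone hull {g} \<noteq> convex_cone hull {h}"
    "\<And>\<rho>. \<rho> face_of \<sigma> \<and> dim \<rho> = 1 \<longleftrightarrow> \<rho> = convex_cone hull {g} \<or> \<rho> = convex_cone hull {h}"
proof -
  have C: "convex_cone \<sigma>" and pointed: "\<And>x. x \<in> \<sigma> \<Longrightarrow> - x \<in> \<sigma> \<Longrightarrow> x = 0" using rational_coneD[OF \<sigma>] by blast+
  obtain G where G: "finite G" "\<sigma> = convex_cone hull G" "\<And>g. g \<in> G \<Longrightarrow> g \<noteq> 0 \<and> (convex_cone hull {g}) face_of \<sigma>"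
    "\<And>g h. g \<in> G \<Longrightarrow> h \<in> G \<Longrightarrow> h \<in> convex_cone hull {g} \<Longrightarrow> g = h"
    using extreme_ray_generators[OF \<sigma>] by metis
  have spanG: "span \<sigma> = span G"
  proof
    have "\<sigma> \<subseteq> span G" unfolding G(2) by (rule hull_minimal) (auto simp: span_superset convex_cone_span)
    then show "span \<sigma> \<subseteq> span G" by (simp add: span_minimal)
    show "span G \<subseteq> span \<sigma>" by (rule span_mono) (simp add: G(2) hull_subset)
  qed
  have "G \<noteq> {}" using G(2) dim by auto
  then obtain g where g: "g \<in> G" by (metis ex_in_conv)
  have "\<not> G \<subseteq> span {g}"
  proof
    assume "G \<subseteq> span {g}"
    then have "span G \<subseteq> span {g}" by (rule span_minimal) simp
    then have "\<sigma> \<subseteq> span {g}" using spanG span_superset[of \<sigma>] by simp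
    then have "dim \<sigma> \<le> card {g}" by (rule dim_le_card) simp
    then show False using dim by simp
  qed
  then obtain h where h: "h \<in> G" "h \<notin> span {g}" by blast
  have g0: "g \<noteq> 0" and h0: "h \<noteq> 0" using G(3)[OF g] G(3)[OF h(1)] by simp_all
  have gh: "g \<in> \<sigma>" "h \<in> \<sigma>" unfolding G(2) using g h(1) by (simp_all add: hull_inc)
  have span2: "span {h, g} = span \<sigma>"
  proof (rule subspace_dim_equal)
    show "span {h, g} \<subseteq> span \<sigma>" using gh by (intro span_mono) simp
    show "dim (span \<sigma>) \<le> dim (span {h, g})" using h(2) g0 dim by (simp add: dim_insert)
  qed simp_all
  have hg: "g \<notin> span {h}"
  proof
    assume "g \<in> span {h}"
    then obtain k where "g = k *\<^sub>R h" by (auto simp: span_singleton)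
    then have "h = inverse k *\<^sub>R g" using g0 by simp
    then show False using h(2) by (auto simp: span_singleton)
  qed
  let ?R = "\<lambda>g. convex_cone hull {g}"
  have "h \<in> ?R h" by (simp add: hull_inc)
  moreover have "h \<notin> ?R g" using h(2) by (auto simp: convex_cone_hull_singleton span_singleton)
  ultimately have ne: "?R g \<noteq> ?R h" by metis
  have face: "?R g face_of \<sigma>" "?R h face_of \<sigma>" "?R g \<noteq> {}" "?R h \<noteq> {}"
    using G(3) g h convex_cone_hull_nonempty by blast+
  have "\<rho> = ?R g \<or> \<rho> = ?R h" if \<rho>: "\<rho> face_of \<sigma>" "dim \<rho> = 1" for \<rho>
  proof -
    have \<rho>0: "\<rho> \<noteq> {}" using \<rho>(2) by auto
    note \<rho>C = cone_faceD[OF C \<rho>(1) \<rho>0]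
    have pointed': "\<And>x. x \<in> \<rho> \<Longrightarrow> - x \<in> \<rho> \<Longrightarrow> x = 0" using \<rho>C(2) pointed by blast
    have "\<not> \<rho> \<subseteq> {0}" using \<rho>(2) by (metis dim_eq_0 zero_neq_one)
    then obtain r where r: "r \<in> \<rho>" "r \<noteq> 0" by blast
    have \<rho>r: "\<rho> = ?R r" using ray_eq[OF \<rho>C(1) pointed' \<rho>(2) r] by (simp add: convex_cone_hull_singleton)
    have r\<sigma>: "r \<in> \<sigma>" using r \<rho>C(2) by blast
    have ray_eqI: "\<rho> = ?R x" if "x \<in> \<rho>" "x \<noteq> 0" for x
      using ray_eq[OF \<rho>C(1) pointed' \<rho>(2) that] by (simp add: convex_cone_hull_singleton)
    have "r \<in> span {h, g}" using r\<sigma> span2 span_superset by blast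
    then obtain k where "r - k *\<^sub>R h \<in> span {g}" by (auto simp: span_insert)
    then obtain l where "r - k *\<^sub>R h = l *\<^sub>R g" by (auto simp: span_singleton)
    then have rkl: "r = l *\<^sub>R g + k *\<^sub>R h" by (simp add: algebra_simps)
    consider "l \<ge> 0" "k \<ge> 0" | "l < 0" "k \<ge> 0" | "k < 0" "l \<ge> 0" | "l < 0" "k < 0" by linarith
    then show ?thesis
    proof cases
      case 1
      have s: "l *\<^sub>R g \<in> \<sigma>" "k *\<^sub>R h \<in> \<sigma>" using 1 gh convex_coneD(3)[OF C] by blast+
      then have m: "l *\<^sub>R g \<in> \<rho>" "k *\<^sub>R h \<in> \<rho>" using \<rho>C(3,4)[OF s] r(1) rkl by simp_all
      have "l \<noteq> 0 \<or> k \<noteq> 0" using rkl r(2) by auto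
      then show ?thesis
      proof
        assume l: "l \<noteq> 0"
        have "inverse l *\<^sub>R (l *\<^sub>R g) \<in> \<rho>" using 1 convex_coneD(3)[OF \<rho>C(1) _ m(1)] by simp
        then have "g \<in> \<rho>" using l by simp
        then show ?thesis using ray_eqI g0 by blast
      next
        assume k: "k \<noteq> 0"
        have "inverse k *\<^sub>R (k *\<^sub>R h) \<in> \<rho>" using 1 convex_coneD(3)[OF \<rho>C(1) _ m(2)] by simp
        then have "h \<in> \<rho>" using k by simp
        then show ?thesis using ray_eqI h0 by blast
      qed
    next
      case 2
      have kh: "k *\<^sub>R h \<in> ?R h" using 2 by (auto simp: convex_cone_hull_singleton)
      have s: "(- l) *\<^sub>R g \<in> \<sigma>" using 2 gh convex_coneD(3)[OF C, of "- l" g] by simp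
      have "r + (- l) *\<^sub>R g = k *\<^sub>R h" using rkl by simp
      then have "r \<in> ?R h" using cone_faceD(3)[OF C face(2,4) r\<sigma> s] kh by simp
      then obtain t where t: "r = t *\<^sub>R h" "0 \<le> t" by (auto simp: convex_cone_hull_singleton)
      have "0 \<le> inverse t" using t(2) by simp
      then have "inverse t *\<^sub>R r \<in> \<rho>" by (rule convex_coneD(3)[OF \<rho>C(1) _ r(1)])
      moreover have "inverse t *\<^sub>R r = h" using t(1) r(2) by simp
      ultimately have "h \<in> \<rho>" by simp
      then show ?thesis using ray_eqI h0 by simp
    next
      case 3
      have lg: "l *\<^sub>R g \<in> ?R g" using 3 by (auto simp: convex_cone_hull_singleton)
      have s: "(- k) *\<^sub>R h \<in> \<sigma>" using 3 gh convex_coneD(3)[OF C, of "- k" h] by simp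
      have "r + (- k) *\<^sub>R h = l *\<^sub>R g" using rkl by simp
      then have "r \<in> ?R g" using cone_faceD(3)[OF C face(1,3) r\<sigma> s] lg by simp
      then obtain t where t: "r = t *\<^sub>R g" "0 \<le> t" by (auto simp: convex_cone_hull_singleton)
      have "0 \<le> inverse t" using t(2) by simp
      then have "inverse t *\<^sub>R r \<in> \<rho>" by (rule convex_coneD(3)[OF \<rho>C(1) _ r(1)])
      moreover have "inverse t *\<^sub>R r = g" using t(1) r(2) by simp
      ultimately have "g \<in> \<rho>" by simp
      then show ?thesis using ray_eqI g0 by simp
    next
      case 4
      then have "0 \<le> - l" "0 \<le> - k" by simp_all
      then have "(- l) *\<^sub>R g + (- k) *\<^sub>R h \<in> \<sigma>" by (intro convex_coneD(2,3)[OF C] gh)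
      then have "- r \<in> \<sigma>" using rkl by simp
      then show ?thesis using pointed[OF r\<sigma>] r(2) by blast
    qed
  qed
  then show ?thesis using that[OF g0 h0 ne] face dim_ray g0 h0 by blast
qed

section \<open>Fans\<close>

lemma rational_fanD:
  assumes "rational_fan \<Sigma>"
  shows "finite \<Sigma>" "\<Sigma> \<noteq> {}" "\<sigma> \<in> \<Sigma> \<Longrightarrow> rational_cone \<sigma>"
    "\<sigma> \<in> \<Sigma> \<Longrightarrow> \<tau> face_of \<sigma> \<Longrightarrow> \<tau> \<noteq> {} \<Longrightarrow> \<tau> \<in> \<Sigma>"
    "\<sigma> \<in> \<Sigma> \<Longrightarrow> \<tau> \<in> \<Sigma> \<Longrightarrow> \<sigma> \<inter> \<tau> face_of \<sigma>" "\<sigma> \<in> \<Sigma> \<Longrightarrow> \<tau> \<in> \<Sigma> \<Longrightarrow> \<sigma> \<inter> \<tau> face_of \<tau>"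
    "\<sigma> \<in> \<Sigma> \<Longrightarrow> (\<And>\<kappa>. \<kappa> \<in> \<Sigma> \<Longrightarrow> \<sigma> face_of \<kappa> \<Longrightarrow> \<kappa> = \<sigma>) \<Longrightarrow> dim \<sigma> = fan_dim \<Sigma>"
  using assms unfolding rational_fan_def by simp_all

locale fan =
  fixes \<Sigma> :: "(real ^ 'n) set set"
  assumes fan: "rational_fan \<Sigma>"
begin

lemma finite_fan: "finite \<Sigma>" by (rule rational_fanD(1)[OF fan])

lemma rational: "\<sigma> \<in> \<Sigma> \<Longrightarrow> rational_cone \<sigma>" by (rule rational_fanD(3)[OF fan])

lemma cone: "\<sigma> \<in> \<Sigma> \<Longrightarrow> convex_cone \<sigma>" by (rule rational_coneD(1)[OF rational])

lemma zero_mem: "\<sigma> \<in> \<Sigma> \<Longrightarrow> 0 \<in> \<sigma>" by (rule convex_coneD(1)[OF cone])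

lemma nonempty: "\<sigma> \<in> \<Sigma> \<Longrightarrow> \<sigma> \<noteq> {}" using zero_mem by blast

lemma dim_le: "\<sigma> \<in> \<Sigma> \<Longrightarrow> dim \<sigma> \<le> fan_dim \<Sigma>"
  unfolding fan_dim_def by (rule Max_ge) (simp_all add: finite_fan)

lemma face_mem: "\<sigma> \<in> \<Sigma> \<Longrightarrow> \<tau> face_of \<sigma> \<Longrightarrow> \<tau> \<noteq> {} \<Longrightarrow> \<tau> \<in> \<Sigma>"
  by (rule rational_fanD(4)[OF fan])

lemma face_self: "\<sigma> \<in> \<Sigma> \<Longrightarrow> \<sigma> face_of \<sigma>"
  by (rule face_of_refl) (rule convex_coneD(4)[OF cone])

lemma vertex_face_of: "\<sigma> \<in> \<Sigma> \<Longrightarrow> {0} face_of \<sigma>" by (rule vertex_face[OF rational])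

lemma vertex_mem: "{0} \<in> \<Sigma>"
proof -
  obtain \<sigma> where "\<sigma> \<in> \<Sigma>" using rational_fanD(2)[OF fan] by blast
  from face_mem[OF this vertex_face_of[OF this]] show ?thesis by simp
qed

lemma face_eq_of_dim: "\<sigma> \<in> \<Sigma> \<Longrightarrow> \<tau> \<in> \<Sigma> \<Longrightarrow> \<tau> face_of \<sigma> \<Longrightarrow> dim \<sigma> \<le> dim \<tau> \<Longrightarrow> \<tau> = \<sigma>"
  using cone_face_dim_eq[OF cone _ nonempty] by blast

lemma face_of_subset_cone:
  assumes "\<sigma> \<in> \<Sigma>" "\<tau> \<in> \<Sigma>" "\<tau> \<subseteq> \<sigma>"
  shows "\<tau> face_of \<sigma>"
proof -
  have "\<sigma> \<inter> \<tau> = \<tau>" using assms(3) by blast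
  then show ?thesis using rational_fanD(5)[OF fan assms(1,2)] by simp
qed

lemma Int_mem: "\<sigma> \<in> \<Sigma> \<Longrightarrow> \<tau> \<in> \<Sigma> \<Longrightarrow> \<sigma> \<inter> \<tau> \<in> \<Sigma>"
  by (rule face_mem[OF _ rational_fanD(5)[OF fan]]) (use zero_mem in auto)

lemma max_cones_iff: "\<alpha> \<in> max_cones \<Sigma> \<longleftrightarrow> \<alpha> \<in> \<Sigma> \<and> dim \<alpha> = fan_dim \<Sigma>"
  by (simp add: max_cones_def cones_def)

lemma finite_cones: "finite (cones \<Sigma> q)" "finite (max_cones \<Sigma>)"
  using finite_fan by (simp_all add: cones_def max_cones_def)

lemma max_coneI: "\<alpha> \<in> \<Sigma> \<Longrightarrow> fan_dim \<Sigma> \<le> dim \<alpha> \<Longrightarrow> \<alpha> \<in> max_cones \<Sigma>"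
  using dim_le by (auto simp: max_cones_iff intro: order_antisym)

lemma face_of_max_cone:
  assumes "\<sigma> \<in> \<Sigma>"
  obtains \<alpha> where "\<alpha> \<in> max_cones \<Sigma>" "\<sigma> face_of \<alpha>"
proof -
  let ?K = "{\<kappa> \<in> \<Sigma>. \<sigma> face_of \<kappa>}"
  have K: "finite (dim ` ?K)" "dim ` ?K \<noteq> {}" using finite_fan face_self[OF assms] assms by auto
  obtain \<alpha> where max: "Max (dim ` ?K) = dim \<alpha>" and "\<alpha> \<in> ?K"
    by (rule imageE[OF Max_in[OF K]])
  then have \<alpha>: "\<alpha> \<in> \<Sigma>" "\<sigma> face_of \<alpha>" by simp_all
  have greatest: "dim \<kappa> \<le> dim \<alpha>" if "\<kappa> \<in> \<Sigma>" "\<sigma> face_of \<kappa>" for \<kappa>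
    unfolding max[symmetric] by (rule Max_ge[OF K(1)]) (use that in auto)
  have "dim \<alpha> = fan_dim \<Sigma>"
  proof (rule rational_fanD(7)[OF fan \<alpha>(1)])
    fix \<kappa> assume "\<kappa> \<in> \<Sigma>" "\<alpha> face_of \<kappa>"
    then show "\<kappa> = \<alpha>" using face_eq_of_dim[of \<kappa> \<alpha>] greatest[of \<kappa>] face_of_trans[OF \<alpha>(2)] \<alpha>(1) by blast
  qed
  then show ?thesis using that \<alpha> by (simp add: max_cones_iff)
qed

lemma max_cone_face:
  assumes "\<alpha> \<in> max_cones \<Sigma>" "\<sigma> \<in> \<Sigma>" "\<alpha> face_of \<sigma>"
  shows "\<sigma> = \<alpha>"
  using face_eq_of_dim[of \<sigma> \<alpha>] assms dim_le[of \<sigma>] by (simp add: max_cones_iff)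

lemma FZ_zsubgroup: "zsubgroup (FZ \<Sigma> p \<sigma>)"
  unfolding FZ_def by (rule zsubgroup_zspan)

lemma ext_power_subset_FZ: "\<gamma> \<in> \<Sigma> \<Longrightarrow> \<sigma> face_of \<gamma> \<Longrightarrow> ext_power p (lat \<gamma>) \<subseteq> FZ \<Sigma> p \<sigma>"
  unfolding FZ_def by (rule order_trans[OF _ zspan_superset]) blast

lemma FZ_mono: "\<tau> face_of \<sigma> \<Longrightarrow> FZ \<Sigma> p \<sigma> \<subseteq> FZ \<Sigma> p \<tau>"
  unfolding FZ_def by (intro zspan_mono UN_mono) (auto intro: face_of_trans)

end

lemma lat_cong: "span \<sigma> = span \<sigma>' \<Longrightarrow> lat \<sigma> = lat \<sigma>'"
  by (simp add: lat_def)

lemma real_vec_diff: "real_vec (x - y) = real_vec x - real_vec y"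
  by (simp add: real_vec_def vec_eq_iff)

lemma real_vec_uminus: "real_vec (- x) = - real_vec x"
  by (simp add: real_vec_def vec_eq_iff)

lemma real_vec_zero: "real_vec 0 = 0"
  by (simp add: real_vec_def vec_eq_iff)

lemma zsubgroup_lat: "zsubgroup (lat \<sigma>)"
  by (simp add: zsubgroup_def lat_def real_vec_diff real_vec_zero span_diff span_zero)

lemma ext_power_mono: "L \<subseteq> L' \<Longrightarrow> ext_power p L \<subseteq> ext_power p L'"
  unfolding ext_power_def by (rule zspan_mono) blast

lemma wedge_in_ext_power: "set ys \<subseteq> L \<Longrightarrow> wedge ys \<in> ext_power (length ys) L"
  unfolding ext_power_def by (rule subsetD[OF zspan_superset]) blast

text \<open>Every cone is a face of a maximal one, whose lattice contains its lattice.\<close>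

lemma (in fan) FZ_max_cones:
  "FZ \<Sigma> p \<sigma> = zspan (\<Union>\<alpha>\<in>{\<alpha> \<in> max_cones \<Sigma>. \<sigma> face_of \<alpha>}. ext_power p (lat \<alpha>))"
proof
  let ?M = "\<Union>\<alpha>\<in>{\<alpha> \<in> max_cones \<Sigma>. \<sigma> face_of \<alpha>}. ext_power p (lat \<alpha>)"
  have "ext_power p (lat \<gamma>) \<subseteq> ?M" if \<gamma>: "\<gamma> \<in> \<Sigma>" "\<sigma> face_of \<gamma>" for \<gamma>
  proof -
    obtain \<alpha> where \<alpha>: "\<alpha> \<in> max_cones \<Sigma>" "\<gamma> face_of \<alpha>" using face_of_max_cone[OF \<gamma>(1)] .
    have "span \<gamma> \<subseteq> span \<alpha>" by (rule span_mono) (rule face_of_imp_subset[OF \<alpha>(2)])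
    then have "ext_power p (lat \<gamma>) \<subseteq> ext_power p (lat \<alpha>)" by (intro ext_power_mono) (auto simp: lat_def)
    moreover have "\<sigma> face_of \<alpha>" using face_of_trans[OF \<gamma>(2) \<alpha>(2)] .
    ultimately show ?thesis using \<alpha>(1) by blast
  qed
  then show "FZ \<Sigma> p \<sigma> \<subseteq> zspan ?M" unfolding FZ_def by (intro zspan_mono) blast
  show "zspan ?M \<subseteq> FZ \<Sigma> p \<sigma>" unfolding FZ_def by (intro zspan_mono) (auto simp: max_cones_iff)
qed

section \<open>Stars\<close>

lemma star_cone_eq:
  assumes \<gamma>: "convex_cone \<gamma>" and \<kappa>: "convex_cone \<kappa>"
  shows "star_cone \<gamma> \<kappa> = {x - y | x y. x \<in> \<kappa> \<and> y \<in> \<gamma>}"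
proof
  show "star_cone \<gamma> \<kappa> \<subseteq> {x - y | x y. x \<in> \<kappa> \<and> y \<in> \<gamma>}"
  proof
    fix z assume "z \<in> star_cone \<gamma> \<kappa>"
    then obtain t x y where "z = t *\<^sub>R (x - y)" "0 \<le> t" "x \<in> \<kappa>" "y \<in> \<gamma>" by (auto simp: star_cone_def)
    then have "z = t *\<^sub>R x - t *\<^sub>R y" "t *\<^sub>R x \<in> \<kappa>" "t *\<^sub>R y \<in> \<gamma>"
      using convex_coneD(3)[OF \<gamma>] convex_coneD(3)[OF \<kappa>] by (simp_all add: scaleR_diff_right)
    then show "z \<in> {x - y | x y. x \<in> \<kappa> \<and> y \<in> \<gamma>}" by blast
  qed
  show "{x - y | x y. x \<in> \<kappa> \<and> y \<in> \<gamma>} \<subseteq> star_cone \<gamma> \<kappa>"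
    unfolding star_cone_def by (clarsimp, rule exI[of _ 1]) auto
qed

locale star = fan \<Sigma> for \<Sigma> :: "(real ^ 'n) set set" +
  fixes \<gamma> :: "(real ^ 'n) set" and S :: "(real ^ 'n) set set"
  assumes \<gamma>: "\<gamma> \<in> \<Sigma>" and star: "star_fan \<Sigma> \<gamma> S"
begin

sublocale S: fan S
  using star by unfold_locales (simp add: star_fan_def)

lemma star_cone_mem:
  "\<kappa> \<in> \<Sigma> \<Longrightarrow> z \<in> star_cone \<gamma> \<kappa> \<longleftrightarrow> (\<exists>x\<in>\<kappa>. \<exists>y\<in>\<gamma>. z = x - y)"
  using star_cone_eq[OF cone[OF \<gamma>] cone[of \<kappa>]] by auto

lemma cone_subset_star: "\<kappa> \<in> \<Sigma> \<Longrightarrow> \<kappa> \<subseteq> star_cone \<gamma> \<kappa>"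
  using star_cone_mem[of \<kappa>] zero_mem[OF \<gamma>] by force

lemma star_cone_convex_cone:
  assumes \<kappa>: "\<kappa> \<in> \<Sigma>"
  shows "convex_cone (star_cone \<gamma> \<kappa>)"
  unfolding convex_cone_iff
proof (intro conjI ballI allI impI)
  note C = convex_coneD[OF cone[OF \<kappa>]] and D = convex_coneD[OF cone[OF \<gamma>]]
  show "0 \<in> star_cone \<gamma> \<kappa>" using cone_subset_star[OF \<kappa>] C(1) by blast
  fix z assume "z \<in> star_cone \<gamma> \<kappa>"
  then obtain x y where z: "x \<in> \<kappa>" "y \<in> \<gamma>" "z = x - y" using star_cone_mem[OF \<kappa>] by blast
  show "c *\<^sub>R z \<in> star_cone \<gamma> \<kappa>" if "0 \<le> c" for c
    unfolding star_cone_mem[OF \<kappa>]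
    by (rule bexI[of _ "c *\<^sub>R x"], rule bexI[of _ "c *\<^sub>R y"])
       (use z that C(3) D(3) in \<open>simp_all add: scaleR_diff_right\<close>)
  fix z' assume "z' \<in> star_cone \<gamma> \<kappa>"
  then obtain x' y' where z': "x' \<in> \<kappa>" "y' \<in> \<gamma>" "z' = x' - y'" using star_cone_mem[OF \<kappa>] by blast
  show "z + z' \<in> star_cone \<gamma> \<kappa>"
    unfolding star_cone_mem[OF \<kappa>]
    by (rule bexI[of _ "x + x'"], rule bexI[of _ "y + y'"])
       (use z z' C(2) D(2) in simp_all)
qed

lemma span_star_cone:
  assumes "\<kappa> \<in> \<Sigma>" "\<gamma> face_of \<kappa>"
  shows "span (star_cone \<gamma> \<kappa>) = span \<kappa>"
proof
  have "x - y \<in> span \<kappa>" if "x \<in> \<kappa>" "y \<in> \<gamma>" for x y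
    using that face_of_imp_subset[OF assms(2)] by (intro span_diff span_base) auto
  then show "span (star_cone \<gamma> \<kappa>) \<subseteq> span \<kappa>"
    by (intro span_minimal subsetI) (auto simp: star_cone_mem[OF assms(1)])
  show "span \<kappa> \<subseteq> span (star_cone \<gamma> \<kappa>)" by (rule span_mono[OF cone_subset_star[OF assms(1)]])
qed

lemma dim_star_cone:
  assumes "\<kappa> \<in> \<Sigma>" "\<gamma> face_of \<kappa>"
  shows "dim (star_cone \<gamma> \<kappa>) = dim \<kappa>"
  using span_star_cone[OF assms] by (metis dim_span)

text \<open>If \<open>(x\<^sub>1 - y\<^sub>1) + (x\<^sub>2 - y\<^sub>2)\<close> lies in the smaller star cone, moving all \<open>y\<close> to the other side gives a sum of
  elements of \<open>\<kappa>\<close> lying in the face \<open>\<tau>\<close>.\<close>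

lemma star_cone_face:
  assumes \<kappa>: "\<kappa> \<in> \<Sigma>" and \<tau>: "\<tau> \<in> \<Sigma>" "\<gamma> face_of \<tau>" "\<tau> face_of \<kappa>"
  shows "star_cone \<gamma> \<tau> face_of star_cone \<gamma> \<kappa>"
proof (rule cone_faceI[OF star_cone_convex_cone[OF \<kappa>] star_cone_convex_cone[OF \<tau>(1)]])
  have sub: "\<tau> \<subseteq> \<kappa>" "\<gamma> \<subseteq> \<tau>" using face_of_imp_subset \<tau>(2,3) by blast+
  show "star_cone \<gamma> \<tau> \<subseteq> star_cone \<gamma> \<kappa>"
    using sub(1) unfolding subset_iff star_cone_mem[OF \<kappa>] star_cone_mem[OF \<tau>(1)] by metis
  fix a b assume "a \<in> star_cone \<gamma> \<kappa>" "b \<in> star_cone \<gamma> \<kappa>" "a + b \<in> star_cone \<gamma> \<tau>"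
  then obtain x1 y1 x2 y2 x y where z: "x1 \<in> \<kappa>" "y1 \<in> \<gamma>" "a = x1 - y1" "x2 \<in> \<kappa>" "y2 \<in> \<gamma>" "b = x2 - y2"
    "x \<in> \<tau>" "y \<in> \<gamma>" "a + b = x - y"
    unfolding star_cone_mem[OF \<kappa>] star_cone_mem[OF \<tau>(1)] by blast
  note F = cone_faceD[OF cone[OF \<kappa>] \<tau>(3) nonempty[OF \<tau>(1)]]
  note T = convex_coneD(2)[OF cone[OF \<tau>(1)]] and K = convex_coneD(2)[OF cone[OF \<kappa>]]
  have "x1 + (x2 + y) = (a + b) + (y + (y1 + y2))" unfolding z(3,6) by (simp add: algebra_simps)
  also have "\<dots> = x + (y1 + y2)" unfolding z(9) by (simp add: algebra_simps)
  finally have "x1 + (x2 + y) = x + (y1 + y2)" .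
  moreover have "x + (y1 + y2) \<in> \<tau>" using z sub by (intro T) auto
  ultimately have s: "x1 + (x2 + y) \<in> \<tau>" by simp
  have y\<kappa>: "y \<in> \<kappa>" using z sub by blast
  have "x1 \<in> \<tau>" "x2 + y \<in> \<tau>" using F(3,4)[OF z(1) K[OF z(4) y\<kappa>] s] by blast+
  then have "x1 \<in> \<tau>" "x2 \<in> \<tau>" using F(3)[OF z(4) y\<kappa>] by blast+
  then show "a \<in> star_cone \<gamma> \<tau> \<and> b \<in> star_cone \<gamma> \<tau>"
    unfolding star_cone_mem[OF \<tau>(1)] using z by blast
qed

lemma gamma_face_Int:
  assumes "\<kappa> \<in> \<Sigma>" "\<gamma> face_of \<kappa>" "\<kappa>' \<in> \<Sigma>" "\<gamma> face_of \<kappa>'"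
  shows "\<gamma> face_of (\<kappa> \<inter> \<kappa>')"
  by (rule face_of_subset_cone[OF Int_mem[OF assms(1,3)] \<gamma>])
     (use face_of_imp_subset[OF assms(2)] face_of_imp_subset[OF assms(4)] in blast)

lemma star_cone_Int:
  assumes \<kappa>: "\<kappa> \<in> \<Sigma>" "\<gamma> face_of \<kappa>" and \<kappa>': "\<kappa>' \<in> \<Sigma>" "\<gamma> face_of \<kappa>'"
  shows "star_cone \<gamma> \<kappa> \<inter> star_cone \<gamma> \<kappa>' = star_cone \<gamma> (\<kappa> \<inter> \<kappa>')"
proof
  note I = Int_mem[OF \<kappa>(1) \<kappa>'(1)]
  show "star_cone \<gamma> (\<kappa> \<inter> \<kappa>') \<subseteq> star_cone \<gamma> \<kappa> \<inter> star_cone \<gamma> \<kappa>'"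
    unfolding subset_iff Int_iff star_cone_mem[OF \<kappa>(1)] star_cone_mem[OF \<kappa>'(1)] star_cone_mem[OF I] Bex_def
    by metis
  show "star_cone \<gamma> \<kappa> \<inter> star_cone \<gamma> \<kappa>' \<subseteq> star_cone \<gamma> (\<kappa> \<inter> \<kappa>')"
  proof
    fix z assume "z \<in> star_cone \<gamma> \<kappa> \<inter> star_cone \<gamma> \<kappa>'"
    then obtain x y x' y' where z: "x \<in> \<kappa>" "y \<in> \<gamma>" "z = x - y" "x' \<in> \<kappa>'" "y' \<in> \<gamma>" "z = x' - y'"
      unfolding Int_iff star_cone_mem[OF \<kappa>(1)] star_cone_mem[OF \<kappa>'(1)] by blast
    have sub: "\<gamma> \<subseteq> \<kappa>" "\<gamma> \<subseteq> \<kappa>'" using face_of_imp_subset \<kappa>(2) \<kappa>'(2) by blast+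
    have y: "y \<in> \<kappa>'" "y' \<in> \<kappa>" using z sub by blast+
    have "x + y' = x' + y" using z by (simp add: algebra_simps)
    moreover have "x + y' \<in> \<kappa>" using convex_coneD(2)[OF cone[OF \<kappa>(1)] z(1) y(2)] .
    moreover have "x' + y \<in> \<kappa>'" using convex_coneD(2)[OF cone[OF \<kappa>'(1)] z(4) y(1)] .
    ultimately have "x + y' \<in> \<kappa> \<inter> \<kappa>'" by simp
    then have "x \<in> \<kappa> \<inter> \<kappa>'"
      using cone_faceD(3)[OF cone[OF \<kappa>(1)] rational_fanD(5)[OF fan \<kappa>(1) \<kappa>'(1)] nonempty[OF I] z(1) y(2)] by blast
    then show "z \<in> star_cone \<gamma> (\<kappa> \<inter> \<kappa>')" unfolding star_cone_mem[OF I] using z by blast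
  qed
qed

lemma subdivision_cell:
  assumes "\<beta> \<in> S"
  obtains \<kappa> where "\<kappa> \<in> \<Sigma>" "\<gamma> face_of \<kappa>" "\<beta> \<subseteq> star_cone \<gamma> \<kappa>"
  using star assms unfolding star_fan_def star_complex_def by blast

lemma star_cone_covered:
  assumes "\<kappa> \<in> \<Sigma>" "\<gamma> face_of \<kappa>"
  shows "star_cone \<gamma> \<kappa> \<subseteq> \<Union>S"
  using star assms unfolding star_fan_def star_complex_def by blast

lemma dim_subset_star_cone:
  assumes "\<beta> \<subseteq> star_cone \<gamma> \<kappa>" "\<kappa> \<in> \<Sigma>" "\<gamma> face_of \<kappa>"
  shows "dim \<beta> \<le> dim \<kappa>"
  using dim_subset[OF assms(1)] dim_star_cone[OF assms(2,3)] by simp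

lemma carrier_face:
  assumes \<beta>: "\<beta> \<subseteq> star_cone \<gamma> \<kappa>" "\<beta> \<subseteq> star_cone \<gamma> \<kappa>'"
    and \<kappa>: "\<kappa> \<in> \<Sigma>" "\<gamma> face_of \<kappa>" and \<kappa>': "\<kappa>' \<in> \<Sigma>" "\<gamma> face_of \<kappa>'" and dim: "dim \<kappa> \<le> dim \<beta>"
  shows "\<kappa> face_of \<kappa>'"
proof -
  have "\<beta> \<subseteq> star_cone \<gamma> (\<kappa> \<inter> \<kappa>')" using \<beta> by (simp flip: star_cone_Int[OF \<kappa> \<kappa>'])
  then have "dim \<beta> \<le> dim (\<kappa> \<inter> \<kappa>')"
    by (rule dim_subset_star_cone[OF _ Int_mem[OF \<kappa>(1) \<kappa>'(1)] gamma_face_Int[OF \<kappa> \<kappa>']])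
  then have "dim \<kappa> \<le> dim (\<kappa> \<inter> \<kappa>')" using dim by simp
  then have "\<kappa> \<inter> \<kappa>' = \<kappa>"
    by (rule face_eq_of_dim[OF \<kappa>(1) Int_mem[OF \<kappa>(1) \<kappa>'(1)] rational_fanD(5)[OF fan \<kappa>(1) \<kappa>'(1)]])
  then show ?thesis using rational_fanD(6)[OF fan \<kappa>(1) \<kappa>'(1)] by simp
qed

lemma span_carrier:
  assumes "\<beta> \<subseteq> star_cone \<gamma> \<kappa>" "\<kappa> \<in> \<Sigma>" "\<gamma> face_of \<kappa>" "dim \<kappa> \<le> dim \<beta>"
  shows "span \<beta> = span \<kappa>"
proof (rule subspace_dim_equal)
  show "span \<beta> \<subseteq> span \<kappa>" using span_mono[OF assms(1)] span_star_cone[OF assms(2,3)] by simp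
qed (use assms(4) in simp_all)

text \<open>The cells cover the star cone of \<open>\<kappa>\<close>, so the part of some cell in it has the full dimension. The cell lies in
  a star cone, which meets that of \<open>\<kappa>\<close> in a face; so this part is a face of the cell and belongs to the
  subdivision.\<close>

lemma full_cell:
  assumes \<kappa>: "\<kappa> \<in> \<Sigma>" "\<gamma> face_of \<kappa>"
  obtains \<beta> where "\<beta> \<in> S" "\<beta> \<subseteq> star_cone \<gamma> \<kappa>" "dim \<beta> = dim \<kappa>"
proof -
  let ?A = "star_cone \<gamma> \<kappa>"
  have "?A \<subseteq> (\<Union>\<beta>\<in>S. span (\<beta> \<inter> ?A))"
  proof
    fix z assume z: "z \<in> ?A"
    then obtain \<beta> where "\<beta> \<in> S" "z \<in> \<beta>" using star_cone_covered[OF \<kappa>] by (metis UnionE subsetD)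
    then show "z \<in> (\<Union>\<beta>\<in>S. span (\<beta> \<inter> ?A))" using z span_base[of z "\<beta> \<inter> ?A"] by auto
  qed
  then obtain \<beta> where \<beta>: "\<beta> \<in> S" "?A \<subseteq> span (\<beta> \<inter> ?A)"
    using cone_covered_by_subspaces[OF star_cone_convex_cone[OF \<kappa>(1)] S.finite_fan, of "\<lambda>\<beta>. span (\<beta> \<inter> ?A)"] by auto
  have "dim ?A \<le> dim (\<beta> \<inter> ?A)" using dim_subset[OF \<beta>(2)] by simp
  then have "dim \<kappa> \<le> dim (\<beta> \<inter> ?A)" using dim_star_cone[OF \<kappa>] by simp
  moreover have "dim (\<beta> \<inter> ?A) \<le> dim \<kappa>" by (rule dim_subset_star_cone[OF _ \<kappa>]) blast
  ultimately have dim: "dim (\<beta> \<inter> ?A) = dim \<kappa>" by simp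
  obtain \<kappa>' where \<kappa>': "\<kappa>' \<in> \<Sigma>" "\<gamma> face_of \<kappa>'" "\<beta> \<subseteq> star_cone \<gamma> \<kappa>'" using subdivision_cell[OF \<beta>(1)] .
  let ?F = "star_cone \<gamma> (\<kappa> \<inter> \<kappa>')"
  have eq: "\<beta> \<inter> ?A = ?F \<inter> \<beta>" using \<kappa>'(3) star_cone_Int[OF \<kappa> \<kappa>'(1,2)] by blast
  have "?F face_of star_cone \<gamma> \<kappa>'"
    by (rule star_cone_face[OF \<kappa>'(1) Int_mem[OF \<kappa>(1) \<kappa>'(1)] gamma_face_Int[OF \<kappa> \<kappa>'(1,2)] rational_fanD(6)[OF fan \<kappa>(1) \<kappa>'(1)]])
  then have "(?F \<inter> \<beta>) face_of (star_cone \<gamma> \<kappa>' \<inter> \<beta>)"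
    by (rule face_of_slice) (rule convex_coneD(4)[OF S.cone[OF \<beta>(1)]])
  moreover have "star_cone \<gamma> \<kappa>' \<inter> \<beta> = \<beta>" using \<kappa>'(3) by blast
  ultimately have "(\<beta> \<inter> ?A) face_of \<beta>" using eq by simp
  moreover have "0 \<in> \<beta> \<inter> ?A" using S.zero_mem[OF \<beta>(1)] convex_coneD(1)[OF star_cone_convex_cone[OF \<kappa>(1)]] by blast
  ultimately have "\<beta> \<inter> ?A \<in> S" using S.face_mem[OF \<beta>(1)] by blast
  then show ?thesis using that dim by blast
qed

lemma fan_dim_star: "fan_dim S = fan_dim \<Sigma>"
proof (rule order_antisym)
  obtain \<alpha> where \<alpha>: "\<alpha> \<in> max_cones \<Sigma>" "\<gamma> face_of \<alpha>" using face_of_max_cone[OF \<gamma>] .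
  then obtain \<beta> where "\<beta> \<in> S" "dim \<beta> = dim \<alpha>" using full_cell[of \<alpha>] by (auto simp: max_cones_iff)
  then show "fan_dim \<Sigma> \<le> fan_dim S" using S.dim_le[of \<beta>] \<alpha>(1) by (simp add: max_cones_iff)
  obtain \<beta> where \<beta>: "\<beta> \<in> max_cones S" using S.face_of_max_cone[OF S.vertex_mem] .
  then obtain \<kappa> where "\<kappa> \<in> \<Sigma>" "\<gamma> face_of \<kappa>" "\<beta> \<subseteq> star_cone \<gamma> \<kappa>"
    using subdivision_cell by (auto simp: S.max_cones_iff)
  then have "dim \<beta> \<le> fan_dim \<Sigma>" using dim_subset_star_cone[of \<beta> \<kappa>] dim_le[of \<kappa>] by simp
  then show "fan_dim S \<le> fan_dim \<Sigma>" using \<beta> by (simp add: S.max_cones_iff)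
qed

definition around :: "(real ^ 'n) set set" where
  "around = {\<alpha> \<in> max_cones \<Sigma>. \<gamma> face_of \<alpha>}"

lemma aroundD: "\<alpha> \<in> around \<Longrightarrow> \<alpha> \<in> \<Sigma>" "\<alpha> \<in> around \<Longrightarrow> \<gamma> face_of \<alpha>" "\<alpha> \<in> around \<Longrightarrow> dim \<alpha> = fan_dim \<Sigma>"
  "\<alpha> \<in> around \<Longrightarrow> \<alpha> \<in> max_cones \<Sigma>"
  by (simp_all add: around_def max_cones_iff)

text \<open>Two star cones meet in the star cone of a common face, whose dimension is smaller unless they agree.\<close>

lemma around_unique:
  assumes "\<beta> \<subseteq> star_cone \<gamma> \<alpha>" "\<beta> \<subseteq> star_cone \<gamma> \<alpha>'" "\<alpha> \<in> around" "\<alpha>' \<in> around" "fan_dim \<Sigma> \<le> dim \<beta>"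
  shows "\<alpha> = \<alpha>'"
proof -
  have "\<alpha> face_of \<alpha>'"
    by (rule carrier_face[OF assms(1,2)]) (use aroundD[OF assms(3)] aroundD[OF assms(4)] assms(5) in auto)
  then show ?thesis using max_cone_face[of \<alpha> \<alpha>'] aroundD[OF assms(3)] aroundD[OF assms(4)] by blast
qed

text \<open>The maximal cone whose weight \<open>star_weight\<close> gives to the cell.\<close>

definition cell_carrier :: "(real ^ 'n) set \<Rightarrow> (real ^ 'n) set" where
  "cell_carrier \<beta> = (THE \<alpha>. \<alpha> \<in> max_cones \<Sigma> \<and> \<gamma> face_of \<alpha> \<and> \<beta> \<subseteq> star_cone \<gamma> \<alpha>)"

lemma cell_carrier_eq:
  assumes "\<beta> \<in> max_cones S" "\<alpha> \<in> around" "\<beta> \<subseteq> star_cone \<gamma> \<alpha>"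
  shows "cell_carrier \<beta> = \<alpha>"
  unfolding cell_carrier_def
proof (rule the_equality)
  show "\<alpha> \<in> max_cones \<Sigma> \<and> \<gamma> face_of \<alpha> \<and> \<beta> \<subseteq> star_cone \<gamma> \<alpha>" using assms aroundD by blast
  fix \<alpha>' assume "\<alpha>' \<in> max_cones \<Sigma> \<and> \<gamma> face_of \<alpha>' \<and> \<beta> \<subseteq> star_cone \<gamma> \<alpha>'"
  then show "\<alpha>' = \<alpha>"
    using around_unique[of \<beta> \<alpha>' \<alpha>] assms by (simp add: around_def S.max_cones_iff fan_dim_star)
qed

lemma cell_carrier:
  assumes "\<beta> \<in> max_cones S"
  shows "cell_carrier \<beta> \<in> around" "\<beta> \<subseteq> star_cone \<gamma> (cell_carrier \<beta>)"
proof -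
  obtain \<kappa> where \<kappa>: "\<kappa> \<in> \<Sigma>" "\<gamma> face_of \<kappa>" "\<beta> \<subseteq> star_cone \<gamma> \<kappa>"
    using subdivision_cell assms by (auto simp: S.max_cones_iff)
  have "fan_dim \<Sigma> \<le> dim \<kappa>"
    using dim_subset_star_cone[OF \<kappa>(3,1,2)] assms by (simp add: S.max_cones_iff fan_dim_star)
  then have "\<kappa> \<in> around" using max_coneI \<kappa> by (simp add: around_def)
  with cell_carrier_eq[OF assms this \<kappa>(3)] \<kappa>(3)
  show "cell_carrier \<beta> \<in> around" "\<beta> \<subseteq> star_cone \<gamma> (cell_carrier \<beta>)" by simp_all
qed

lemma star_weight_eq: "star_weight \<Sigma> w \<gamma> \<beta> = w (cell_carrier \<beta>)"
  by (simp add: star_weight_def cell_carrier_def)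

lemma span_cell_carrier:
  assumes "\<beta> \<in> max_cones S"
  shows "span \<beta> = span (cell_carrier \<beta>)"
  by (rule span_carrier[OF cell_carrier(2)[OF assms]])
     (use aroundD[OF cell_carrier(1)[OF assms]] assms in \<open>simp_all add: S.max_cones_iff fan_dim_star\<close>)

lemma lat_cell_carrier: "\<beta> \<in> max_cones S \<Longrightarrow> lat (cell_carrier \<beta>) = lat \<beta>"
  using lat_cong[OF span_cell_carrier] by metis

lemma cell_in_max_cone:
  assumes "\<alpha> \<in> around"
  obtains \<beta> where "\<beta> \<in> max_cones S" "cell_carrier \<beta> = \<alpha>"
proof -
  obtain \<beta> where \<beta>: "\<beta> \<in> S" "\<beta> \<subseteq> star_cone \<gamma> \<alpha>" "dim \<beta> = dim \<alpha>"
    using full_cell[OF aroundD(1,2)[OF assms]] by blast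
  then have "\<beta> \<in> max_cones S" using aroundD(3)[OF assms] by (simp add: S.max_cones_iff fan_dim_star)
  then show ?thesis using that cell_carrier_eq[OF _ assms \<beta>(2)] by blast
qed

lemma FZ_star_max:
  assumes "\<beta> \<in> max_cones S"
  shows "FZ S p \<beta> = FZ \<Sigma> p (cell_carrier \<beta>)"
proof -
  have "{\<alpha> \<in> max_cones S. \<beta> face_of \<alpha>} = {\<beta>}"
    using S.max_cone_face[OF assms] assms S.face_self[of \<beta>] by (auto simp: S.max_cones_iff)
  moreover have "{\<alpha> \<in> max_cones \<Sigma>. cell_carrier \<beta> face_of \<alpha>} = {cell_carrier \<beta>}"
    using max_cone_face[OF aroundD(4)[OF cell_carrier(1)[OF assms]]] aroundD[OF cell_carrier(1)[OF assms]]
      face_self[of "cell_carrier \<beta>"] by (auto simp: max_cones_iff)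
  ultimately show ?thesis
    unfolding FZ_max_cones S.FZ_max_cones by (simp add: lat_cell_carrier[OF assms])
qed

lemma FZ_star_vertex: "FZ S p {0} = FZ \<Sigma> p \<gamma>"
proof -
  have "{\<beta> \<in> max_cones S. {0} face_of \<beta>} = max_cones S" using S.vertex_face_of by (auto simp: S.max_cones_iff)
  moreover have "(\<Union>\<beta>\<in>max_cones S. ext_power p (lat \<beta>)) = (\<Union>\<alpha>\<in>around. ext_power p (lat \<alpha>))"
  proof (intro equalityI UN_least)
    fix \<beta> assume \<beta>: "\<beta> \<in> max_cones S"
    show "ext_power p (lat \<beta>) \<subseteq> (\<Union>\<alpha>\<in>around. ext_power p (lat \<alpha>))"
      using cell_carrier(1)[OF \<beta>] lat_cell_carrier[OF \<beta>] by (metis UN_upper)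
  next
    fix \<alpha> assume "\<alpha> \<in> around"
    then obtain \<beta> where \<beta>: "\<beta> \<in> max_cones S" "cell_carrier \<beta> = \<alpha>" using cell_in_max_cone by blast
    show "ext_power p (lat \<alpha>) \<subseteq> (\<Union>\<beta>\<in>max_cones S. ext_power p (lat \<beta>))"
      using lat_cell_carrier[OF \<beta>(1)] \<beta> by (metis UN_upper)
  qed
  ultimately show ?thesis unfolding FZ_max_cones S.FZ_max_cones by (simp add: around_def)
qed

end

section \<open>Orientations and relative signs\<close>

lemma orientationD:
  assumes "orientation \<Sigma> ori" "\<sigma> \<in> \<Sigma>"
  shows "length (ori \<sigma>) = dim \<sigma>" "zspan (set (ori \<sigma>)) = lat \<sigma>"
  using assms by (simp_all add: orientation_def)

lemma real_vec_zspan: "real_vec ` zspan S \<subseteq> span (real_vec ` S)"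
proof -
  have "zspan S \<subseteq> {z. real_vec z \<in> span (real_vec ` S)}"
    by (rule zspan_minimal)
       (auto simp: zsubgroup_def real_vec_diff real_vec_zero span_diff span_zero span_base)
  then show ?thesis by auto
qed

text \<open>A generating list of the lattice whose length is the dimension is a basis.\<close>

lemma basis_of_cone:
  assumes \<sigma>: "rational_cone \<sigma>" and ys: "length ys = dim \<sigma>" "zspan (set ys) = lat \<sigma>"
  shows "span (real_vec ` set ys) = span \<sigma>" "distinct (map real_vec ys)" "independent (real_vec ` set ys)"
    "\<exists>js. wedge ys js \<noteq> 0"
proof -
  have sub: "set ys \<subseteq> lat \<sigma>" using zspan_superset[of "set ys"] ys(2) by simp
  show span: "span (real_vec ` set ys) = span \<sigma>"
  proof
    show "span (real_vec ` set ys) \<subseteq> span \<sigma>"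
      by (rule span_minimal) (use sub in \<open>auto simp: lat_def\<close>)
    have "real_vec ` lat \<sigma> \<subseteq> span (real_vec ` set ys)" using real_vec_zspan[of "set ys"] ys(2) by simp
    then have "span (real_vec ` lat \<sigma>) \<subseteq> span (real_vec ` set ys)" by (rule span_minimal) simp
    then show "span \<sigma> \<subseteq> span (real_vec ` set ys)" using span_lat[OF \<sigma>] by simp
  qed
  have dim: "dim (real_vec ` set ys) = dim \<sigma>" using span by (metis dim_span)
  have "card (real_vec ` set ys) \<le> card (set ys)" by (rule card_image_le) simp
  moreover have "card (set ys) \<le> length ys" by (rule card_length)
  moreover have "dim (real_vec ` set ys) \<le> card (real_vec ` set ys)" by (rule dim_le_card') simp
  ultimately have card: "card (real_vec ` set ys) = length ys" using dim ys(1) by linarith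
  then show d: "distinct (map real_vec ys)" by (intro card_distinct) simp
  show i: "independent (real_vec ` set ys)"
    by (rule card_le_dim_spanning[of _ "real_vec ` set ys"]) (use card dim ys(1) in \<open>auto simp: span_superset\<close>)
  show "\<exists>js. wedge ys js \<noteq> 0" by (rule wedge_nonzero[OF d i])
qed

lemma oriented_basis:
  assumes "rational_fan \<Sigma>" "orientation \<Sigma> ori" "\<sigma> \<in> \<Sigma>"
  shows "span (real_vec ` set (ori \<sigma>)) = span \<sigma>" "distinct (map real_vec (ori \<sigma>))"
    "independent (real_vec ` set (ori \<sigma>))" "\<exists>js. wedge (ori \<sigma>) js \<noteq> 0"
  using basis_of_cone[OF rational_fanD(3)[OF assms(1,3)] orientationD[OF assms(2,3)]] by blast+

text \<open>The coefficient by which \<open>(- u) \<and> t\<^sub>1 \<and> \<dots>\<close> differs from \<open>s\<^sub>1 \<and> \<dots>\<close> is a linear functional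
  of \<open>u\<close>; in a codimension one situation it vanishes exactly on the span of \<open>t\<close>. Its sign on a
  cone adjacent to that span is the relative sign.\<close>

definition side_functional :: "(int ^ 'n) list \<Rightarrow> (int ^ 'n) list \<Rightarrow> (real ^ 'n \<Rightarrow> real) \<Rightarrow> bool" where
  "side_functional t s \<phi> \<longleftrightarrow> linear \<phi> \<and>
    (\<forall>u. real_vec u \<in> span (real_vec ` set s) \<longrightarrow>
      (\<forall>js. of_int (wedge (- u # t) js) = \<phi> (real_vec u) * of_int (wedge s js))) \<and>
    (\<forall>x\<in>span (real_vec ` set s). \<phi> x = 0 \<longleftrightarrow> x \<in> span (real_vec ` set t))"

lemma wedge_Cons_additive:
  "wedge ((x - y) # t) js = wedge (x # t) js - wedge (y # t) js"
  using wedge_diff[of "[]" x y t js] by simp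

lemma wedge_Cons_alternating:
  fixes L :: "(int ^ 'n) set"
  assumes "zsubgroup L"
  shows "alternating int_functions L m (\<lambda>ys. wedge (u # ys))"
proof (intro alternating.intro alternating_axioms.intro int_functions_abelian assms)
  have "wedge (u # pre @ x # x # post) js = 0" for pre post :: "(int ^ 'n) list" and x js
    by (rule wedge_eq_entries[of "Suc (length pre)" "Suc (Suc (length pre))"]) (simp_all add: nth_append)
  moreover have "wedge (u # pre @ (x - y) # post) js = wedge (u # pre @ x # post) js - wedge (u # pre @ y # post) js"
    for pre post :: "(int ^ 'n) list" and x y js
    using wedge_diff[of "u # pre" x y post js] by simp
  ultimately show "alternating_on int_functions L m (\<lambda>ys. wedge (u # ys))"
    by (simp add: alternating_on_def int_functions_simps fun_eq_iff)
qed

lemma wedge_Cons_linear_extension: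
  fixes t :: "(int ^ 'n) list"
  obtains \<psi> :: "real ^ 'n \<Rightarrow> real" where "linear \<psi>" "\<And>u. \<psi> (real_vec u) = of_int (wedge (u # t) js)"
proof
  define e where "e i = wedge ((axis i 1 :: int ^ 'n) # t) js" for i
  define \<psi> where "\<psi> x = (\<Sum>i\<in>UNIV. (x $ i) * of_int (e i))" for x :: "real ^ 'n"
  show "linear \<psi>"
    by (rule linearI) (simp_all add: \<psi>_def algebra_simps sum.distrib sum_distrib_left)
  have zero: "wedge (0 # t) js = 0" using wedge_Cons_additive[of 0 0 t js] by simp
  have minus: "wedge ((- x) # t) js = - wedge (x # t) js" for x using wedge_Cons_additive[of 0 x t js] zero by simp
  have add: "wedge ((x + y) # t) js = wedge (x # t) js + wedge (y # t) js" for x y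
    using wedge_Cons_additive[of x "- y" t js] minus by simp
  have sum: "wedge ((\<Sum>i\<in>I. f i) # t) js = (\<Sum>i\<in>I. wedge (f i # t) js)" if "finite I" for I and f :: "'n \<Rightarrow> int ^ 'n"
    using that by (induction I rule: finite_induct) (simp_all add: zero add)
  have mult: "wedge ((k *s x) # t) js = k * wedge (x # t) js" for k :: int and x
  proof (induction k rule: int_induct[where k=0])
    case base
    then show ?case by (simp add: zero)
  next
    case (step1 i)
    have "(i + 1) *s x = i *s x + x" by (simp add: vec_eq_iff algebra_simps)
    then show ?case using step1 by (simp add: add algebra_simps)
  next
    case (step2 i)
    have "(i - 1) *s x = i *s x - x" by (simp add: vec_eq_iff algebra_simps)
    then show ?case using step2 by (simp add: wedge_Cons_additive algebra_simps)
  qed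
  show "\<psi> (real_vec u) = of_int (wedge (u # t) js)" for u
  proof -
    have "u = (\<Sum>i\<in>UNIV. (u $ i) *s axis i 1)"
      by (simp add: vec_eq_iff axis_def if_distrib cong: if_cong)
    then have "wedge (u # t) js = wedge ((\<Sum>i\<in>UNIV. (u $ i) *s axis i 1) # t) js" by simp
    also have "\<dots> = (\<Sum>i\<in>UNIV. u $ i * e i)" by (simp add: sum mult e_def)
    finally show ?thesis by (simp add: \<psi>_def real_vec_def)
  qed
qed

text \<open>For lattice vectors \<open>u\<close> the minors of \<open>(- u) # t\<close> are a common multiple of the minors of \<open>s\<close>, and the multiple
  can be computed from one nonvanishing minor, as a linear function of \<open>u\<close>.\<close>

lemma side_functional_exists:
  fixes s t :: "(int ^ 'n) list"
  assumes L: "zspan (set s) = L" and satur: "\<And>u. real_vec u \<in> span (real_vec ` set s) \<Longrightarrow> u \<in> L"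
    and s: "independent (real_vec ` set s)" "distinct (map real_vec s)"
    and t: "set t \<subseteq> L" "independent (real_vec ` set t)" "distinct (map real_vec t)"
    and len: "length s = Suc (length t)"
  obtains \<phi> where "side_functional t s \<phi>"
proof -
  have zL: "zsubgroup L" using zsubgroup_zspan L by metis
  have sL: "set s \<subseteq> L" using zspan_superset L by metis
  obtain j0 where j0: "wedge s j0 \<noteq> 0" using wedge_nonzero[OF s(2,1)] by metis
  obtain \<psi> :: "real ^ 'n \<Rightarrow> real" where \<psi>: "linear \<psi>" "\<And>u. \<psi> (real_vec u) = of_int (wedge (u # t) j0)"
    using wedge_Cons_linear_extension by metis
  define \<phi> where "\<phi> x = - \<psi> x / of_int (wedge s j0)" for x
  have lin: "linear \<phi>"
    by (rule linearI) (simp_all add: \<phi>_def linear_add[OF \<psi>(1)] linear_cmul[OF \<psi>(1)] add_divide_distrib diff_divide_distrib)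
  have neg: "wedge ((- u) # t) js = - wedge (u # t) js" for u js
    using wedge_Cons_additive[of 0 u t js] wedge_Cons_additive[of 0 0 t js] by simp
  interpret W: alternating int_functions L "length s" wedge by (rule wedge_alternating[OF zL])
  have coeff: "of_int (wedge (- u # t) js) = \<phi> (real_vec u) * of_int (wedge s js)"
    if u: "real_vec u \<in> span (real_vec ` set s)" for u js
  proof -
    have "- u \<in> L" by (rule zsubgroup_closed(3)[OF zL satur[OF u]])
    then have "set (- u # t) \<subseteq> L" using t(1) by simp
    from W.multiple_of_basis_value[OF refl _ L this] len
    obtain D :: int where "wedge (- u # t) = [D] \<cdot>\<^bsub>int_functions\<^esub> wedge s" by auto
    then have D: "wedge (- u # t) = (\<lambda>j. D * wedge s j)" by (simp add: int_functions_simps)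
    have "\<phi> (real_vec u) = of_int (wedge (- u # t) j0) / of_int (wedge s j0)"
      by (simp add: \<phi>_def \<psi>(2) neg)
    also have "\<dots> = of_int D" using j0 by (subst D) simp
    finally show ?thesis by (subst D) simp
  qed
  have t0: "\<phi> x = 0" if "x \<in> span (real_vec ` set t)" for x
  proof (rule linear_eq_0_on_span[OF lin _ that])
    fix x assume "x \<in> real_vec ` set t"
    then obtain y where y: "y \<in> set t" "x = real_vec y" by auto
    have "wedge (y # t) j0 = 0"
    proof -
      have "\<not> distinct (y # t)" using y by simp
      moreover have "set (y # t) \<subseteq> L" using t(1) y by auto
      ultimately have "wedge (y # t) = \<zero>\<^bsub>int_functions\<^esub>"
        using W.not_distinct_eq_zero[of "y # t"] len by simp
      then show ?thesis by (simp add: int_functions_simps)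
    qed
    then show "\<phi> x = 0" by (simp add: \<phi>_def \<psi>(2) y)
  qed
  have nz: "\<phi> (real_vec u) \<noteq> 0" if u: "real_vec u \<in> span (real_vec ` set s)" "real_vec u \<notin> span (real_vec ` set t)" for u
  proof -
    have neg_u: "real_vec (- u) \<notin> span (real_vec ` set t)" using u(2) span_neg by (metis real_vec_uminus minus_minus)
    have "independent (real_vec ` set (- u # t))"
      unfolding list.set(2) image_insert by (rule independent_insertI[OF neg_u t(2)])
    moreover have "real_vec (- u) \<notin> real_vec ` set t" using neg_u span_base by metis
    then have "distinct (map real_vec (- u # t))" using t(3) by simp
    ultimately obtain js where "wedge (- u # t) js \<noteq> 0" using wedge_nonzero by metis
    then show ?thesis using coeff[OF u(1), of js] by auto
  qed
  have "\<phi> x = 0 \<longleftrightarrow> x \<in> span (real_vec ` set t)" if x: "x \<in> span (real_vec ` set s)" for x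
  proof
    assume \<phi>x: "\<phi> x = 0"
    show "x \<in> span (real_vec ` set t)"
    proof (rule ccontr)
      assume no: "x \<notin> span (real_vec ` set t)"
      have dim_s: "dim (real_vec ` set s) = length s" "dim (real_vec ` set t) = length t"
        using s t by (metis dim_eq_card_independent distinct_card length_map set_map)+
      have "span (insert x (real_vec ` set t)) = span (real_vec ` set s)"
      proof (rule subspace_dim_equal)
        have "real_vec ` set t \<subseteq> span (real_vec ` set s)"
          using real_vec_zspan[of "set s"] t(1) L by blast
        then show "span (insert x (real_vec ` set t)) \<subseteq> span (real_vec ` set s)"
          using x by (intro span_minimal) auto
        show "dim (span (real_vec ` set s)) \<le> dim (span (insert x (real_vec ` set t)))"
          using no dim_s len by (simp add: dim_insert)
      qed simp_all
      moreover have "\<phi> y = 0" if "y \<in> span (insert x (real_vec ` set t))" for y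
      proof (rule linear_eq_0_on_span[OF lin _ that])
        fix z assume "z \<in> insert x (real_vec ` set t)"
        then show "\<phi> z = 0" by (elim insertE) (simp_all add: \<phi>x t0 span_base)
      qed
      ultimately have all0: "\<phi> y = 0" if "y \<in> span (real_vec ` set s)" for y using that by simp
      have "\<not> real_vec ` set s \<subseteq> span (real_vec ` set t)"
      proof
        assume "real_vec ` set s \<subseteq> span (real_vec ` set t)"
        from dim_subset[OF this] show False using dim_s len by simp
      qed
      then obtain u where u: "u \<in> set s" "real_vec u \<notin> span (real_vec ` set t)" by auto
      have "real_vec u \<in> span (real_vec ` set s)" using u(1) by (simp add: span_base)
      from nz[OF this u(2)] all0[OF this] show False by simp
    qed
  qed (rule t0)
  then show ?thesis using that[of \<phi>] lin coeff by (simp add: side_functional_def)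
qed

lemma side_functional_unique_sign:
  assumes \<phi>: "side_functional t s \<phi>" and nz: "\<exists>js. wedge s js \<noteq> 0"
    and u: "real_vec u \<in> span (real_vec ` set s)" and c: "\<And>js. wedge (- u # t) js = c * wedge s js"
  shows "\<phi> (real_vec u) = of_int c"
proof -
  obtain j where j: "wedge s j \<noteq> 0" using nz by metis
  have "of_int (wedge (- u # t) j) = \<phi> (real_vec u) * of_int (wedge s j)"
    using \<phi> u by (simp add: side_functional_def)
  then have "(of_int c :: real) * of_int (wedge s j) = \<phi> (real_vec u) * of_int (wedge s j)" using c[of j] by simp
  then show ?thesis using j by simp
qed

text \<open>The functional has one sign on \<open>\<sigma>\<close> outside the face \<open>\<tau>\<close>; at a lattice vector it is the factor in the
  definition of the relative sign.\<close>

lemma rel_sign_side: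
  assumes fan: "rational_fan \<Sigma>" and ori: "orientation \<Sigma> ori"
    and \<sigma>: "\<sigma> \<in> \<Sigma>" and \<tau>: "\<tau> face_of \<sigma>" "\<tau> \<in> \<Sigma>" and dim: "dim \<sigma> = Suc (dim \<tau>)"
    and \<phi>: "side_functional (ori \<tau>) (ori \<sigma>) \<phi>" and b: "b \<in> \<sigma>" "b \<notin> \<tau>"
  shows "rel_sign ori \<tau> \<sigma> = (if \<phi> b > 0 then 1 else - 1)" and "\<phi> b \<noteq> 0"
proof -
  note C = rational_coneD(1)[OF rational_fanD(3)[OF fan \<sigma>]]
  have ne: "\<tau> \<noteq> {}" using rational_coneD(3)[OF rational_fanD(3)[OF fan \<tau>(2)]] .
  note B = oriented_basis[OF fan ori \<sigma>] and T = oriented_basis[OF fan ori \<tau>(2)]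
  have lin: "linear \<phi>" and coeff: "\<And>u js. real_vec u \<in> span \<sigma> \<Longrightarrow>
      of_int (wedge (- u # ori \<tau>) js) = \<phi> (real_vec u) * of_int (wedge (ori \<sigma>) js)"
    and ker: "\<And>x. x \<in> span \<sigma> \<Longrightarrow> \<phi> x = 0 \<longleftrightarrow> x \<in> span \<tau>"
    using \<phi> unfolding side_functional_def B(1) T(1) by blast+
  have off: "\<phi> x \<noteq> 0" if "x \<in> \<sigma>" "x \<notin> \<tau>" for x
    using ker[of x] face_eq_Int_span[OF C \<tau>(1) ne] that span_base[of x \<sigma>] by blast
  show nzb: "\<phi> b \<noteq> 0" by (rule off[OF b])
  have same: "\<phi> x > 0 \<longleftrightarrow> \<phi> b > 0" if x: "x \<in> \<sigma>" "x \<notin> \<tau>" for x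
  proof (rule ccontr)
    assume no: "\<not> (\<phi> x > 0 \<longleftrightarrow> \<phi> b > 0)"
    define c where "c = \<phi> x / \<phi> b"
    have "c \<le> 0" using no nzb off[OF x] by (auto simp: c_def divide_le_0_iff)
    have "x - c *\<^sub>R b \<in> span \<sigma>" using x b by (intro span_diff span_scale span_base)
    moreover have "\<phi> (x - c *\<^sub>R b) = 0" using nzb by (simp add: linear_diff[OF lin] linear_cmul[OF lin] c_def)
    ultimately have "x - c *\<^sub>R b \<in> span \<tau>" using ker by blast
    then have "x \<in> \<tau>" using face_one_side[OF C \<tau>(1) ne x(1) b(1), of c "x - c *\<^sub>R b"] \<open>c \<le> 0\<close> by simp
    then show False using x(2) by blast
  qed
  have "(\<exists>u c. real_vec u \<in> \<sigma> - \<tau> \<and> c > 0 \<and> (\<forall>js. wedge (- u # ori \<tau>) js = c * wedge (ori \<sigma>) js)) \<longleftrightarrow> \<phi> b > 0"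
  proof
    assume "\<exists>u c. real_vec u \<in> \<sigma> - \<tau> \<and> c > 0 \<and> (\<forall>js. wedge (- u # ori \<tau>) js = c * wedge (ori \<sigma>) js)"
    then obtain u and c :: int where u: "real_vec u \<in> \<sigma>" "real_vec u \<notin> \<tau>" "c > 0"
      "\<And>js. wedge (- u # ori \<tau>) js = c * wedge (ori \<sigma>) js" by auto
    have "\<phi> (real_vec u) = of_int c"
      by (rule side_functional_unique_sign[OF \<phi> B(4) _ u(4)]) (use u(1) in \<open>simp add: B(1) span_base\<close>)
    then show "\<phi> b > 0" using same[OF u(1,2)] u(3) by simp
  next
    assume pos: "\<phi> b > 0"
    have "\<tau> \<noteq> \<sigma>" using dim by auto
    then obtain u where u: "real_vec u \<in> \<sigma>" "real_vec u \<notin> \<tau>"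
      using lattice_point_off_face[OF rational_fanD(3)[OF fan \<sigma>] \<tau>(1) ne] by metis
    have L: "zspan (set (ori \<sigma>)) = lat \<sigma>" by (rule orientationD(2)[OF ori \<sigma>])
    have "span \<tau> \<subseteq> span \<sigma>" by (rule span_mono[OF face_of_imp_subset[OF \<tau>(1)]])
    then have t: "set (ori \<tau>) \<subseteq> lat \<sigma>"
      using zspan_superset[of "set (ori \<tau>)"] orientationD(2)[OF ori \<tau>(2)] by (auto simp: lat_def)
    have uL: "- u \<in> lat \<sigma>" using u(1) by (simp add: lat_def real_vec_uminus span_neg span_base)
    have zL: "zsubgroup (lat \<sigma>)" by (rule zsubgroup_lat)
    obtain D :: int where "wedge (- u # ori \<tau>) = [D] \<cdot>\<^bsub>int_functions\<^esub> wedge (ori \<sigma>)"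
      using alternating.multiple_of_basis_value[OF wedge_alternating[OF zL, of "length (ori \<sigma>)"] refl _ L, of "- u # ori \<tau>"]
        t uL dim orientationD(1)[OF ori \<sigma>] orientationD(1)[OF ori \<tau>(2)] by auto
    then have D: "wedge (- u # ori \<tau>) js = D * wedge (ori \<sigma>) js" for js by (simp add: int_functions_simps)
    have "\<phi> (real_vec u) = of_int D"
      by (rule side_functional_unique_sign[OF \<phi> B(4) _ D]) (use u(1) in \<open>simp add: B(1) span_base\<close>)
    then have "D > 0" using same[OF u] pos by simp
    then show "\<exists>u c. real_vec u \<in> \<sigma> - \<tau> \<and> c > 0 \<and> (\<forall>js. wedge (- u # ori \<tau>) js = c * wedge (ori \<sigma>) js)"
      using u D by auto
  qed
  then show "rel_sign ori \<tau> \<sigma> = (if \<phi> b > 0 then 1 else - 1)" by (simp add: rel_sign_def)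
qed

lemma side_functional_facet:
  assumes fan: "rational_fan \<Sigma>" and ori: "orientation \<Sigma> ori"
    and \<sigma>: "\<sigma> \<in> \<Sigma>" and t: "distinct (map real_vec t)" "independent (real_vec ` set t)"
      "real_vec ` set t \<subseteq> span \<sigma>" and dim: "dim \<sigma> = Suc (length t)"
  obtains \<phi> where "side_functional t (ori \<sigma>) \<phi>"
proof -
  note B = oriented_basis[OF fan ori \<sigma>]
  show ?thesis
  proof (rule side_functional_exists[OF orientationD(2)[OF ori \<sigma>] _ B(3,2) _ t(2,1)])
    show "u \<in> lat \<sigma>" if "real_vec u \<in> span (real_vec ` set (ori \<sigma>))" for u
      using that B(1) by (simp add: lat_def)
    show "set t \<subseteq> lat \<sigma>" using t(3) by (auto simp: lat_def)
    show "length (ori \<sigma>) = Suc (length t)" using orientationD(1)[OF ori \<sigma>] dim by simp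
  qed (rule that)
qed

text \<open>Changing the bases multiplies the functional by the signs of the base changes.\<close>

lemma side_functional_change:
  assumes \<phi>: "side_functional t s \<phi>"
    and t': "\<And>u js. wedge (u # t') js = e * wedge (u # t) js" "span (real_vec ` set t') = span (real_vec ` set t)"
    and s': "\<And>js. wedge s' js = f * wedge s js" "span (real_vec ` set s') = span (real_vec ` set s)"
    and ef: "e = 1 \<or> e = - 1" "f = 1 \<or> f = - 1"
  shows "side_functional t' s' (\<lambda>x. of_int (e * f) * \<phi> x)"
proof -
  have lin: "linear \<phi>" using \<phi> by (simp add: side_functional_def)
  have "f * f = 1" using ef(2) by auto
  then have "of_int (wedge (- u # t') js) = of_int (e * f) * \<phi> (real_vec u) * of_int (wedge s' js)"
    if "real_vec u \<in> span (real_vec ` set s')" for u js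
  proof -
    have "of_int (wedge (- u # t) js) = \<phi> (real_vec u) * of_int (wedge s js)"
      using \<phi> that s'(2) by (simp add: side_functional_def)
    then show ?thesis using \<open>f * f = 1\<close> ef(2) by (auto simp: t'(1) s'(1))
  qed
  moreover have "linear (\<lambda>x. of_int (e * f) * \<phi> x)"
    by (rule linearI) (simp_all add: linear_add[OF lin] linear_cmul[OF lin] algebra_simps)
  moreover have "of_int (e * f) \<noteq> (0::real)" using ef by auto
  ultimately show ?thesis using \<phi> s'(2) t'(2) by (simp add: side_functional_def)
qed

section \<open>Cells of a star around a cell of codimension one\<close>

context star
begin

text \<open>Points approaching an interior point of \<open>\<tau>\<close> from a fixed direction lie in finitely many cells,
  so one cell contains infinitely many of them and, being closed, also the limit.\<close>

lemma adjacent_cell_exists: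
  assumes \<tau>: "\<tau> \<in> S" "Suc (dim \<tau>) = fan_dim \<Sigma>" and \<alpha>: "\<alpha> \<in> around" "\<tau> \<subseteq> star_cone \<gamma> \<alpha>"
    and a: "a \<in> star_cone \<gamma> \<alpha>" "a \<notin> span \<tau>"
  obtains \<beta> x e where "\<beta> \<in> max_cones S" "\<tau> face_of \<beta>" "cell_carrier \<beta> = \<alpha>" "e > 0" "x \<in> \<tau>" "x + e *\<^sub>R a \<in> \<beta>"
proof -
  let ?A = "star_cone \<gamma> \<alpha>"
  note \<alpha>\<Sigma> = aroundD(1,2)[OF \<alpha>(1)]
  have A: "convex_cone ?A" by (rule star_cone_convex_cone[OF \<alpha>\<Sigma>(1)])
  have conv: "convex \<tau>" by (rule convex_coneD(4)[OF S.cone[OF \<tau>(1)]])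
  have "rel_interior \<tau> \<noteq> {}" using rel_interior_eq_empty[OF conv] S.nonempty[OF \<tau>(1)] by simp
  then obtain x where x: "x \<in> rel_interior \<tau>" by (metis ex_in_conv)
  then have x\<tau>: "x \<in> \<tau>" using rel_interior_subset by (metis subsetD)
  let ?p = "\<lambda>n. x + inverse (real (Suc n)) *\<^sub>R a"
  have "\<exists>\<beta>\<in>S. ?p n \<in> \<beta>" for n
  proof -
    have "inverse (real (Suc n)) *\<^sub>R a \<in> ?A" by (rule convex_coneD(3)[OF A _ a(1)]) simp
    then have "?p n \<in> ?A" using convex_coneD(2)[OF A] x\<tau> \<alpha>(2) by (metis subsetD)
    then show ?thesis using star_cone_covered[OF \<alpha>\<Sigma>] by (metis UnionE subsetD)
  qed
  then obtain \<beta> where \<beta>: "\<beta> \<in> S" and inf: "infinite {n \<in> UNIV. ?p n \<in> \<beta>}"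
    using pigeonhole_infinite_rel[of "UNIV :: nat set" S "\<lambda>n \<beta>. ?p n \<in> \<beta>"] S.finite_fan by auto
  have "x \<in> \<beta>"
  proof (rule iffD1[OF closed_approachable], rule rational_coneD(2)[OF S.rational[OF \<beta>]], intro allI impI)
    fix r :: real assume r: "r > 0"
    obtain N :: nat where N: "norm a / r < real N" using reals_Archimedean2 by metis
    obtain n where n: "n > N" "?p n \<in> \<beta>" using inf by (auto simp: infinite_nat_iff_unbounded)
    have "norm a < r * real (Suc n)"
    proof -
      have "norm a < r * real N" using N r by (simp add: field_simps)
      also have "\<dots> \<le> r * real (Suc n)" using n(1) r by simp
      finally show ?thesis .
    qed
    then have "dist (?p n) x < r" by (simp add: dist_norm field_simps)
    then show "\<exists>y\<in>\<beta>. dist y x < r" using n(2) by (metis (no_types))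
  qed
  then have "(\<beta> \<inter> \<tau>) \<inter> rel_interior \<tau> \<noteq> {}" using x x\<tau> by auto
  then have sub: "\<tau> \<subseteq> \<beta> \<inter> \<tau>"
    using subset_of_face_of[OF rational_fanD(6)[OF S.fan \<beta> \<tau>(1)] order_refl] by simp
  then have face: "\<tau> face_of \<beta>" using S.face_of_subset_cone[OF \<beta> \<tau>(1)] by simp
  obtain n where n: "?p n \<in> \<beta>" using inf by (metis (mono_tags, lifting) Collect_empty_eq finite.emptyI)
  define e where "e = inverse (real (Suc n))"
  have e: "e > 0" "x + e *\<^sub>R a \<in> \<beta>" using n by (simp_all add: e_def)
  have off: "x + e *\<^sub>R a \<notin> span \<tau>"
  proof
    assume "x + e *\<^sub>R a \<in> span \<tau>"
    then have "(x + e *\<^sub>R a) - x \<in> span \<tau>" by (rule span_diff[OF _ span_base[OF x\<tau>]])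
    then have "e *\<^sub>R a \<in> span \<tau>" by simp
    then have "inverse e *\<^sub>R (e *\<^sub>R a) \<in> span \<tau>" by (rule span_scale)
    then show False using a(2) e(1) by simp
  qed
  have bigger: "fan_dim \<Sigma> \<le> dim X" if X: "\<tau> \<subseteq> X" "x + e *\<^sub>R a \<in> X" for X
    using dim_subset[of "insert (x + e *\<^sub>R a) \<tau>" X] X off \<tau>(2) by (simp add: dim_insert)
  have max: "\<beta> \<in> max_cones S"
    using S.max_coneI[OF \<beta>] bigger[of \<beta>] sub e(2) fan_dim_star by simp
  note car = cell_carrier[OF max]
  have "x + e *\<^sub>R a \<in> ?A"
    using convex_coneD(2,3)[OF A] x\<tau> \<alpha>(2) a(1) e(1) by (simp add: subset_iff)
  then have "\<alpha> = cell_carrier \<beta>"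
    using car sub e(2) \<alpha> bigger[of "insert (x + e *\<^sub>R a) \<tau>"]
    by (intro around_unique[of "insert (x + e *\<^sub>R a) \<tau>"]) auto
  then show ?thesis using that[OF max face _ e(1) x\<tau> e(2)] by simp
qed

text \<open>If \<open>b1\<close> and \<open>b2\<close> point to the same side of \<open>\<tau>\<close>, then a small step along \<open>b2\<close> from an interior point of \<open>\<tau>\<close>
  ends in both cells. Their intersection then contains \<open>\<tau>\<close> and a point outside the span of \<open>\<tau>\<close>, so it is
  a common face of full dimension.\<close>

lemma adjacent_cell_unique:
  assumes \<tau>: "\<tau> \<in> S" "Suc (dim \<tau>) = fan_dim \<Sigma>"
    and \<beta>1: "\<beta>1 \<in> max_cones S" "\<tau> face_of \<beta>1" "b1 \<in> \<beta>1"
    and \<beta>2: "\<beta>2 \<in> max_cones S" "\<tau> face_of \<beta>2" "b2 \<in> \<beta>2" "b2 \<notin> \<tau>"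
    and b: "b2 = c *\<^sub>R b1 + t" "c > 0" "t \<in> span \<tau>"
  shows "\<beta>1 = \<beta>2"
proof -
  have S1: "\<beta>1 \<in> S" and S2: "\<beta>2 \<in> S" using \<beta>1 \<beta>2 by (simp_all add: S.max_cones_iff)
  note C1 = convex_coneD[OF S.cone[OF S1]] and C2 = convex_coneD[OF S.cone[OF S2]]
  have sub: "\<tau> \<subseteq> \<beta>1" "\<tau> \<subseteq> \<beta>2" using \<beta>1(2) \<beta>2(2) by (simp_all add: face_of_imp_subset)
  have conv: "convex \<tau>" by (rule convex_coneD(4)[OF S.cone[OF \<tau>(1)]])
  have "rel_interior \<tau> \<noteq> {}" using rel_interior_eq_empty[OF conv] S.nonempty[OF \<tau>(1)] by simp
  then obtain x where x: "x \<in> rel_interior \<tau>" by (metis ex_in_conv)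
  then have x\<tau>: "x \<in> \<tau>" using rel_interior_subset by (metis subsetD)
  obtain e where e: "e > 0" "x + e *\<^sub>R t \<in> \<tau>" using rel_interior_small_step[OF S.cone[OF \<tau>(1)] x b(3)] .
  define y where "y = x + e *\<^sub>R b2"
  have y2: "y \<in> \<beta>2" using C2(2,3) x\<tau> sub \<beta>2(3) e(1) by (simp add: y_def subset_iff)
  have "(e * c) *\<^sub>R b1 \<in> \<beta>1" using C1(3) e(1) b(2) \<beta>1(3) by simp
  moreover have "x + e *\<^sub>R t \<in> \<beta>1" using e(2) sub by (simp add: subset_iff)
  ultimately have "(x + e *\<^sub>R t) + (e * c) *\<^sub>R b1 \<in> \<beta>1" by (rule C1(2)[rotated])
  moreover have "(x + e *\<^sub>R t) + (e * c) *\<^sub>R b1 = y" by (simp add: y_def b(1) algebra_simps)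
  ultimately have y1: "y \<in> \<beta>1" by simp
  have off: "b2 \<notin> span \<tau>"
    using face_eq_Int_span[OF S.cone[OF S2] \<beta>2(2) S.nonempty[OF \<tau>(1)]] \<beta>2(3,4) by (metis IntI)
  have "y \<notin> span \<tau>"
  proof
    assume "y \<in> span \<tau>"
    then have "y - x \<in> span \<tau>" by (rule span_diff[OF _ span_base[OF x\<tau>]])
    then have "inverse e *\<^sub>R (y - x) \<in> span \<tau>" by (rule span_scale)
    then show False using off e(1) by (simp add: y_def)
  qed
  then have "fan_dim \<Sigma> \<le> dim (insert y \<tau>)" using \<tau>(2) by (simp add: dim_insert)
  moreover have "insert y \<tau> \<subseteq> \<beta>1 \<inter> \<beta>2" using sub y1 y2 by simp
  ultimately have "fan_dim \<Sigma> \<le> dim (\<beta>1 \<inter> \<beta>2)" using dim_subset order_trans by metis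
  then have "\<beta>1 \<inter> \<beta>2 = \<beta>1" "\<beta>1 \<inter> \<beta>2 = \<beta>2"
    using S.face_eq_of_dim[OF S1 S.Int_mem[OF S1 S2] rational_fanD(5)[OF S.fan S1 S2]]
      S.face_eq_of_dim[OF S2 S.Int_mem[OF S1 S2] rational_fanD(6)[OF S.fan S1 S2]] \<beta>1(1) \<beta>2(1)
    by (simp_all add: S.max_cones_iff fan_dim_star)
  then show ?thesis by simp
qed

text \<open>On one side of its kernel the functional is a supporting functional: its zeros in \<open>\<alpha>\<close> form a face \<open>\<kappa>\<close>, and
  the star cone of \<open>\<kappa>\<close> contains \<open>\<tau>\<close>.\<close>

lemma codim_one_carrier_if_one_sided:
  assumes \<tau>: "\<tau> \<in> S" "Suc (dim \<tau>) = fan_dim \<Sigma>" and \<alpha>: "\<alpha> \<in> around" "\<tau> \<subseteq> star_cone \<gamma> \<alpha>"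
    and lin: "linear (\<phi> :: _ \<Rightarrow> real)" and ker: "\<And>x. x \<in> span \<alpha> \<Longrightarrow> \<phi> x = 0 \<longleftrightarrow> x \<in> span \<tau>"
    and side: "\<And>x. x \<in> star_cone \<gamma> \<alpha> \<Longrightarrow> 0 \<le> \<phi> x"
  obtains \<kappa> where "\<kappa> \<in> \<Sigma>" "\<gamma> face_of \<kappa>" "dim \<kappa> = dim \<tau>" "\<tau> \<subseteq> star_cone \<gamma> \<kappa>"
proof -
  note \<alpha>\<Sigma> = aroundD(1,2)[OF \<alpha>(1)]
  have A: "convex_cone (star_cone \<gamma> \<alpha>)" by (rule star_cone_convex_cone[OF \<alpha>\<Sigma>(1)])
  have \<alpha>A: "\<alpha> \<subseteq> star_cone \<gamma> \<alpha>" by (rule cone_subset_star[OF \<alpha>\<Sigma>(1)])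
  have \<gamma>\<alpha>: "\<gamma> \<subseteq> \<alpha>" by (rule face_of_imp_subset[OF \<alpha>\<Sigma>(2)])
  note C = convex_coneD[OF cone[OF \<alpha>\<Sigma>(1)]]
  have \<gamma>0: "\<phi> y = 0" if y: "y \<in> \<gamma>" for y
  proof -
    have "0 - y \<in> star_cone \<gamma> \<alpha>" unfolding star_cone_mem[OF \<alpha>\<Sigma>(1)] using C(1) y by metis
    then have "0 \<le> - \<phi> y" using side[of "- y"] by (simp add: linear_neg[OF lin])
    moreover have "0 \<le> \<phi> y" by (rule side) (use y \<gamma>\<alpha> \<alpha>A in \<open>simp add: subset_iff\<close>)
    ultimately show ?thesis by simp
  qed
  define \<kappa> where "\<kappa> = {x \<in> \<alpha>. \<phi> x = 0}"
  have "\<kappa> face_of \<alpha>"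
  proof (rule cone_faceI[OF cone[OF \<alpha>\<Sigma>(1)]])
    show "convex_cone \<kappa>"
      unfolding convex_cone_iff \<kappa>_def
      using C(1-3) by (auto simp: linear_0[OF lin] linear_add[OF lin] linear_cmul[OF lin])
    show "\<kappa> \<subseteq> \<alpha>" by (simp add: \<kappa>_def)
    fix a b assume ab: "a \<in> \<alpha>" "b \<in> \<alpha>" "a + b \<in> \<kappa>"
    have "0 \<le> \<phi> a" "0 \<le> \<phi> b" using side ab \<alpha>A by (simp_all add: subset_iff)
    moreover have "\<phi> a + \<phi> b = 0" using ab(3) by (simp add: \<kappa>_def linear_add[OF lin])
    ultimately show "a \<in> \<kappa> \<and> b \<in> \<kappa>" using ab by (simp add: \<kappa>_def)
  qed
  moreover have \<gamma>\<kappa>: "\<gamma> \<subseteq> \<kappa>" using \<gamma>\<alpha> \<gamma>0 by (simp add: \<kappa>_def subset_iff)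
  moreover have "\<kappa> \<noteq> {}" using \<gamma>\<kappa> nonempty[OF \<gamma>] by auto
  ultimately have \<kappa>: "\<kappa> \<in> \<Sigma>" using face_mem[OF \<alpha>\<Sigma>(1)] by simp
  have \<gamma>f: "\<gamma> face_of \<kappa>" by (rule face_of_subset_cone[OF \<kappa> \<gamma> \<gamma>\<kappa>])
  have \<tau>\<kappa>: "\<tau> \<subseteq> star_cone \<gamma> \<kappa>"
  proof
    fix z assume z: "z \<in> \<tau>"
    then obtain x y where xy: "x \<in> \<alpha>" "y \<in> \<gamma>" "z = x - y"
      using \<alpha>(2) star_cone_mem[OF \<alpha>\<Sigma>(1)] by (metis subsetD)
    have "z \<in> span \<alpha>" using z \<alpha>(2) span_star_cone[OF \<alpha>\<Sigma>] span_base by (metis subsetD)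
    then have "\<phi> z = 0" using ker z span_base by metis
    then have "\<phi> x = 0" using xy \<gamma>0 by (simp add: linear_diff[OF lin])
    then have "x \<in> \<kappa>" using xy by (simp add: \<kappa>_def)
    then show "z \<in> star_cone \<gamma> \<kappa>" unfolding star_cone_mem[OF \<kappa>] using xy by metis
  qed
  have "\<kappa> \<subseteq> span \<tau>"
  proof
    fix x assume "x \<in> \<kappa>"
    then have "x \<in> span \<alpha>" "\<phi> x = 0" by (simp_all add: \<kappa>_def span_base)
    then show "x \<in> span \<tau>" using ker by metis
  qed
  from dim_subset[OF this] dim_subset_star_cone[OF \<tau>\<kappa> \<kappa> \<gamma>f]
  have "dim \<kappa> = dim \<tau>" by simp
  then show ?thesis using that[OF \<kappa> \<gamma>f _ \<tau>\<kappa>] by simp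
qed

end

locale oriented_star = star \<Sigma> \<gamma> S for \<Sigma> :: "(real ^ 'n) set set" and \<gamma> S +
  fixes ori so :: "(real ^ 'n) set \<Rightarrow> (int ^ 'n) list"
  assumes ori: "orientation \<Sigma> ori" and so: "orientation S so"
begin

definition cell_sign :: "(real ^ 'n) set \<Rightarrow> int" where
  "cell_sign \<beta> = basis_sign (ori (cell_carrier \<beta>)) (so \<beta>)"

lemma wedge_so:
  assumes \<beta>: "\<beta> \<in> max_cones S"
  shows "wedge (so \<beta>) js = cell_sign \<beta> * wedge (ori (cell_carrier \<beta>)) js"
    and "span (real_vec ` set (so \<beta>)) = span (real_vec ` set (ori (cell_carrier \<beta>)))"
    and "alternating M (lat \<beta>) (fan_dim \<Sigma>) F \<Longrightarrow> F (so \<beta>) = [cell_sign \<beta>] \<cdot>\<^bsub>M\<^esub> F (ori (cell_carrier \<beta>))"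
proof -
  have S\<beta>: "\<beta> \<in> S" "dim \<beta> = fan_dim \<Sigma>" using \<beta> by (simp_all add: S.max_cones_iff fan_dim_star)
  note \<alpha> = aroundD[OF cell_carrier(1)[OF \<beta>]]
  note B = oriented_basis[OF fan ori \<alpha>(1)] and T = oriented_basis[OF S.fan so S\<beta>(1)]
  show "span (real_vec ` set (so \<beta>)) = span (real_vec ` set (ori (cell_carrier \<beta>)))"
    unfolding B(1) T(1) by (rule span_cell_carrier[OF \<beta>])
  note hyps = orientationD(1)[OF ori \<alpha>(1), unfolded \<alpha>(3)] orientationD(1)[OF so S\<beta>(1), unfolded S\<beta>(2)]
    orientationD(2)[OF ori \<alpha>(1), unfolded lat_cell_carrier[OF \<beta>]] orientationD(2)[OF so S\<beta>(1)] B(4)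
  show "wedge (so \<beta>) js = cell_sign \<beta> * wedge (ori (cell_carrier \<beta>)) js"
    unfolding cell_sign_def by (rule basis_sign(1)[OF hyps])
  show "F (so \<beta>) = [cell_sign \<beta>] \<cdot>\<^bsub>M\<^esub> F (ori (cell_carrier \<beta>))" if "alternating M (lat \<beta>) (fan_dim \<Sigma>) F"
    unfolding cell_sign_def by (rule basis_sign(2)[OF hyps that])
qed

lemma cell_sign_cases: "cell_sign \<beta> = 1 \<or> cell_sign \<beta> = - 1"
  unfolding cell_sign_def by (rule basis_sign_cases)

lemma facet_side_functional:
  assumes \<tau>: "\<tau> \<in> S" "Suc (dim \<tau>) = fan_dim \<Sigma>" and \<alpha>: "\<alpha> \<in> around" "\<tau> \<subseteq> star_cone \<gamma> \<alpha>"
  obtains \<phi> where "side_functional (so \<tau>) (ori \<alpha>) \<phi>" "linear \<phi>"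
    "\<And>x. x \<in> span \<alpha> \<Longrightarrow> \<phi> x = 0 \<longleftrightarrow> x \<in> span \<tau>"
proof -
  note a = aroundD[OF \<alpha>(1)]
  note T = oriented_basis[OF S.fan so \<tau>(1)]
  have "real_vec ` set (so \<tau>) \<subseteq> span \<alpha>"
    using T(1) span_superset[of "real_vec ` set (so \<tau>)"] span_mono[OF \<alpha>(2)] span_star_cone[OF a(1,2)] by simp
  moreover have "dim \<alpha> = Suc (length (so \<tau>))" using a(3) \<tau> orientationD(1)[OF so \<tau>(1)] by simp
  ultimately obtain \<phi> where \<phi>: "side_functional (so \<tau>) (ori \<alpha>) \<phi>"
    using side_functional_facet[OF fan ori a(1) T(2,3)] by metis
  then show ?thesis
    using that[OF \<phi>] unfolding side_functional_def T(1) oriented_basis(1)[OF fan ori a(1)] by metis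
qed

lemma adjacent_sign:
  assumes \<tau>: "\<tau> \<in> S" "Suc (dim \<tau>) = fan_dim \<Sigma>" and \<beta>: "\<beta> \<in> max_cones S" "\<tau> face_of \<beta>"
    and \<phi>: "side_functional (so \<tau>) (ori (cell_carrier \<beta>)) \<phi>" and b: "b \<in> \<beta>" "b \<notin> \<tau>"
  shows "rel_sign so \<tau> \<beta> * cell_sign \<beta> = (if \<phi> b > 0 then 1 else - 1)" "\<phi> b \<noteq> 0"
proof -
  have S\<beta>: "\<beta> \<in> S" "dim \<beta> = Suc (dim \<tau>)" using \<beta> \<tau> by (simp_all add: S.max_cones_iff fan_dim_star)
  have \<psi>: "side_functional (so \<tau>) (so \<beta>) (\<lambda>x. of_int (1 * cell_sign \<beta>) * \<phi> x)"
    by (rule side_functional_change[OF \<phi> _ refl wedge_so(1,2)[OF \<beta>(1)] _ cell_sign_cases]) simp_all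
  note r = rel_sign_side[OF S.fan so S\<beta>(1) \<beta>(2) \<tau>(1) S\<beta>(2) \<psi> b]
  show "\<phi> b \<noteq> 0" using r(2) by auto
  then show "rel_sign so \<tau> \<beta> * cell_sign \<beta> = (if \<phi> b > 0 then 1 else - 1)"
    using r(1) cell_sign_cases[of \<beta>] by auto
qed

end

section \<open>Top-dimensional cycles of a star\<close>

definition facet_sum ::
  "('r, 'm) ring_scheme \<Rightarrow> (real ^ 'n) set set \<Rightarrow> ((real ^ 'n) set \<Rightarrow> (int ^ 'n) list) \<Rightarrow> nat
    \<Rightarrow> (real ^ 'n) set \<Rightarrow> ((real ^ 'n) set \<Rightarrow> ('r, 'n) mvec) \<Rightarrow> ('r, 'n) mvec" where
  "facet_sum R \<Sigma> ori p \<tau> c = (\<Oplus>\<^bsub>F_low R \<Sigma> p \<tau>\<^esub>\<sigma>\<in>{\<sigma> \<in> max_cones \<Sigma>. \<tau> face_of \<sigma>}.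
     [rel_sign ori \<tau> \<sigma>] \<cdot>\<^bsub>F_low R \<Sigma> p \<tau>\<^esub> iota R \<Sigma> p \<tau> (c \<sigma>))"

lemma (in abelian_group) add_pow_add_pow:
  assumes "x \<in> carrier G"
  shows "[(a::int)] \<cdot> ([(b::int)] \<cdot> x) = [(a * b)] \<cdot> x"
  using add.int_pow_pow[OF assms, of a b] by (simp add: mult.commute)

lemma (in abelian_group) add_pow_finsum_sign:
  assumes "f \<in> A \<rightarrow> carrier G" "e = 1 \<or> e = - 1"
  shows "[(e::int)] \<cdot> (\<Oplus>i\<in>A. f i) = (\<Oplus>i\<in>A. [e] \<cdot> f i)"
proof -
  have c: "(\<Oplus>i\<in>A. f i) \<in> carrier G" by (rule finsum_closed[OF assms(1)])
  have f: "f i \<in> carrier G" if "i \<in> A" for i using assms(1) that by (simp add: Pi_iff)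
  from assms(2) show ?thesis
  proof
    assume "e = 1"
    moreover have "(\<Oplus>i\<in>A. f i) = (\<Oplus>i\<in>A. [(1::int)] \<cdot> f i)"
      by (rule finsum_cong'[OF refl]) (simp_all add: f)
    ultimately show ?thesis using c by simp
  next
    assume "e = - 1"
    moreover have "(\<Oplus>i\<in>A. [(- 1::int)] \<cdot> f i) = (\<Oplus>i\<in>A. \<ominus> f i)"
      by (rule finsum_cong'[OF refl]) (simp_all add: f)
    ultimately show ?thesis using c finsum_uminus[OF assms(1)] by simp
  qed
qed

context fan
begin

lemma F_low_module: "cring R \<Longrightarrow> module R (F_low R \<Sigma> p \<sigma>)"
  unfolding F_low_def by (rule tensor_module[OF _ FZ_zsubgroup])

lemma iota_linear:
  assumes "cring R" "\<tau> face_of \<sigma>"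
  shows "linear_map R (F_low R \<Sigma> p \<sigma>) (F_low R \<Sigma> p \<tau>) (iota R \<Sigma> p \<tau>)"
  unfolding F_low_def iota_def
  by (rule tensor_incl_linear[OF assms(1) FZ_zsubgroup FZ_zsubgroup FZ_mono[OF assms(2)]])

lemma iota_trans:
  assumes "cring R" "\<tau> face_of \<sigma>" "\<sigma> face_of \<kappa>" "x \<in> carrier (F_low R \<Sigma> p \<kappa>)"
  shows "iota R \<Sigma> p \<tau> (iota R \<Sigma> p \<sigma> x) = iota R \<Sigma> p \<tau> x"
  unfolding iota_def
  by (rule tensor_incl_trans[OF assms(1) FZ_zsubgroup FZ_zsubgroup FZ_zsubgroup
        FZ_mono[OF assms(3)] FZ_mono[OF assms(2)] assms(4)[unfolded F_low_def]])

lemma iota_id: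
  assumes "cring R" "x \<in> carrier (F_low R \<Sigma> p \<sigma>)"
  shows "iota R \<Sigma> p \<sigma> x = x"
  unfolding iota_def by (rule tensor_incl_id[OF assms(1) FZ_zsubgroup assms(2)[unfolded F_low_def]])

end

text \<open>Subdivision turns a chain on the fan into a chain on the star. The factor corrects for the orientations,
  as a value at \<open>\<alpha>\<close> is to be read as a multiple of the generator that the orientation of \<open>\<alpha>\<close> selects.\<close>

definition (in oriented_star) lifted_family ::
  "('r, 'm) ring_scheme \<Rightarrow> nat \<Rightarrow> ((real ^ 'n) set \<Rightarrow> ('r, 'n) mvec) \<Rightarrow> (real ^ 'n) set \<Rightarrow> ('r, 'n) mvec" where
  "lifted_family R p c \<beta> = [cell_sign \<beta>] \<cdot>\<^bsub>F_low R S p \<beta>\<^esub> c (cell_carrier \<beta>)"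

locale star_chain = oriented_star \<Sigma> \<gamma> S ori so for \<Sigma> :: "(real ^ 'n) set set" and \<gamma> S ori so +
  fixes R :: "('r, 'm) ring_scheme" and p :: nat and c :: "(real ^ 'n) set \<Rightarrow> ('r, 'n) mvec"
  assumes R: "cring R" and c: "\<And>\<alpha>. \<alpha> \<in> around \<Longrightarrow> c \<alpha> \<in> carrier (F_low R \<Sigma> p \<alpha>)"
begin

abbreviation star_family :: "(real ^ 'n) set \<Rightarrow> ('r, 'n) mvec" where
  "star_family \<equiv> lifted_family R p c"

lemma F_low_cell: "\<beta> \<in> max_cones S \<Longrightarrow> F_low R S p \<beta> = F_low R \<Sigma> p (cell_carrier \<beta>)"
  by (simp add: F_low_def FZ_star_max)

lemma c_cell: "\<beta> \<in> max_cones S \<Longrightarrow> c (cell_carrier \<beta>) \<in> carrier (F_low R S p \<beta>)"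
  by (simp add: F_low_cell c cell_carrier)

lemma star_family_closed:
  assumes "\<beta> \<in> max_cones S"
  shows "star_family \<beta> \<in> carrier (F_low R S p \<beta>)"
proof -
  interpret M: module R "F_low R S p \<beta>" by (rule S.F_low_module[OF R])
  show ?thesis unfolding lifted_family_def by (rule M.M.add.int_pow_closed[OF c_cell[OF assms]])
qed

lemma iota_c_closed:
  assumes \<beta>: "\<beta> \<in> max_cones S" "\<tau> face_of \<beta>"
  shows "iota R S p \<tau> (c (cell_carrier \<beta>)) \<in> carrier (F_low R S p \<tau>)"
  by (rule linear_mapD(1)[OF S.iota_linear[OF R \<beta>(2)] c_cell[OF \<beta>(1)]])

lemma facet_term:
  assumes \<beta>: "\<beta> \<in> max_cones S" "\<tau> face_of \<beta>"
  shows "[k] \<cdot>\<^bsub>F_low R S p \<tau>\<^esub> iota R S p \<tau> (star_family \<beta>) =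
    [(k * cell_sign \<beta>)] \<cdot>\<^bsub>F_low R S p \<tau>\<^esub> iota R S p \<tau> (c (cell_carrier \<beta>))"
proof -
  interpret M: module R "F_low R S p \<tau>" by (rule S.F_low_module[OF R])
  have "iota R S p \<tau> (star_family \<beta>) = [cell_sign \<beta>] \<cdot>\<^bsub>F_low R S p \<tau>\<^esub> iota R S p \<tau> (c (cell_carrier \<beta>))"
    unfolding lifted_family_def
    by (rule linear_map_add_pow[OF S.F_low_module[OF R] S.F_low_module[OF R] S.iota_linear[OF R \<beta>(2)] c_cell[OF \<beta>(1)]])
  then show ?thesis using M.M.add_pow_add_pow[OF iota_c_closed[OF \<beta>]] by simp
qed

lemma same_side_positive_multiple:
  assumes ab: "a \<in> span \<alpha>" "b \<in> span \<alpha>" and lin: "linear \<phi>"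
    and ker: "\<And>x. x \<in> span \<alpha> \<Longrightarrow> \<phi> x = 0 \<longleftrightarrow> x \<in> span \<tau>" and b: "\<phi> b \<noteq> 0"
  shows "a = (\<phi> a / \<phi> b) *\<^sub>R b + (a - (\<phi> a / \<phi> b) *\<^sub>R b)" "a - (\<phi> a / \<phi> b) *\<^sub>R b \<in> span \<tau>"
proof -
  have "a - (\<phi> a / \<phi> b) *\<^sub>R b \<in> span \<alpha>" using ab by (intro span_diff span_scale)
  moreover have "\<phi> (a - (\<phi> a / \<phi> b) *\<^sub>R b) = 0" using b by (simp add: linear_diff[OF lin] linear_cmul[OF lin])
  ultimately show "a - (\<phi> a / \<phi> b) *\<^sub>R b \<in> span \<tau>" using ker by metis
qed simp

lemma cell_in_span: "\<beta> \<in> max_cones S \<Longrightarrow> b \<in> \<beta> \<Longrightarrow> b \<in> span (cell_carrier \<beta>)"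
  using span_cell_carrier span_base by metis

lemma point_off_facet:
  assumes "\<tau> \<in> S" "Suc (dim \<tau>) = fan_dim \<Sigma>" "\<beta> \<in> max_cones S" "\<tau> face_of \<beta>"
  obtains b where "b \<in> \<beta>" "b \<notin> \<tau>"
proof -
  have "\<tau> \<noteq> \<beta>" using assms by (auto simp: S.max_cones_iff fan_dim_star)
  then show ?thesis using that face_of_imp_subset[OF assms(4)] by (metis subsetI subset_antisym)
qed

text \<open>A wall that lies in no star cone of codimension one has a cell of the same star cone on either side. Both carry the same value, and a side
  functional of \<open>\<tau>\<close> takes opposite signs on them.\<close>

lemma facet_sum_star_interior:
  assumes \<tau>: "\<tau> \<in> S" "Suc (dim \<tau>) = fan_dim \<Sigma>"
    and none: "\<And>\<kappa>. \<kappa> \<in> \<Sigma> \<Longrightarrow> \<gamma> face_of \<kappa> \<Longrightarrow> dim \<kappa> = dim \<tau> \<Longrightarrow> \<not> \<tau> \<subseteq> star_cone \<gamma> \<kappa>"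
  shows "facet_sum R S so p \<tau> star_family = \<zero>\<^bsub>F_low R S p \<tau>\<^esub>"
proof -
  interpret M: module R "F_low R S p \<tau>" by (rule S.F_low_module[OF R])
  let ?B = "{\<beta> \<in> max_cones S. \<tau> face_of \<beta>}"
  obtain \<beta>0 where \<beta>0: "\<beta>0 \<in> max_cones S" "\<tau> face_of \<beta>0" using S.face_of_max_cone[OF \<tau>(1)] .
  define \<alpha> where "\<alpha> = cell_carrier \<beta>0"
  have inside: "\<tau> \<subseteq> star_cone \<gamma> (cell_carrier \<beta>)" if "\<beta> \<in> ?B" for \<beta>
    using that cell_carrier(2)[of \<beta>] face_of_imp_subset[of \<tau> \<beta>] by auto
  have \<alpha>: "\<alpha> \<in> around" "\<tau> \<subseteq> star_cone \<gamma> \<alpha>" using cell_carrier(1)[OF \<beta>0(1)] inside \<beta>0 by (simp_all add: \<alpha>_def)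
  note a\<alpha> = aroundD[OF \<alpha>(1)]
  have carrier: "cell_carrier \<beta> = \<alpha>" if \<beta>: "\<beta> \<in> ?B" for \<beta>
  proof (rule ccontr)
    let ?\<alpha>' = "cell_carrier \<beta>"
    assume ne: "?\<alpha>' \<noteq> \<alpha>"
    have "?\<alpha>' \<in> around" using \<beta> cell_carrier(1) by simp
    note a' = aroundD[OF this]
    note I = Int_mem[OF a\<alpha>(1) a'(1)] and G = gamma_face_Int[OF a\<alpha>(1,2) a'(1,2)]
    have sub: "\<tau> \<subseteq> star_cone \<gamma> (\<alpha> \<inter> ?\<alpha>')"
      using \<alpha>(2) inside[OF \<beta>] by (simp flip: star_cone_Int[OF a\<alpha>(1,2) a'(1,2)])
    have "dim \<tau> \<le> dim (\<alpha> \<inter> ?\<alpha>')" by (rule dim_subset_star_cone[OF sub I G])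
    moreover have "\<not> dim \<alpha> \<le> dim (\<alpha> \<inter> ?\<alpha>')"
    proof
      assume "dim \<alpha> \<le> dim (\<alpha> \<inter> ?\<alpha>')"
      from face_eq_of_dim[OF a\<alpha>(1) I rational_fanD(5)[OF fan a\<alpha>(1) a'(1)] this]
      have "\<alpha> face_of ?\<alpha>'" using rational_fanD(6)[OF fan a\<alpha>(1) a'(1)] by simp
      then show False using max_cone_face[OF a\<alpha>(4) a'(1)] ne by simp
    qed
    ultimately have "dim (\<alpha> \<inter> ?\<alpha>') = dim \<tau>" using \<tau>(2) a\<alpha>(3) by simp
    then show False using none[OF I G] sub by simp
  qed
  obtain \<phi> where \<phi>: "side_functional (so \<tau>) (ori \<alpha>) \<phi>" and lin: "linear \<phi>"
    and ker: "\<And>x. x \<in> span \<alpha> \<Longrightarrow> \<phi> x = 0 \<longleftrightarrow> x \<in> span \<tau>"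
    by (rule facet_side_functional[OF \<tau> \<alpha>], rule that) auto
  have A: "x \<in> span \<alpha>" if "x \<in> star_cone \<gamma> \<alpha>" for x
    using that span_star_cone[OF a\<alpha>(1,2)] span_base by metis
  have cell: "\<exists>\<beta> b. \<beta> \<in> ?B \<and> b \<in> \<beta> \<and> b \<notin> \<tau> \<and> (0 < \<phi> b \<longleftrightarrow> 0 < \<phi> a)"
    if a: "a \<in> star_cone \<gamma> \<alpha>" "\<phi> a \<noteq> 0" for a
  proof -
    have "a \<notin> span \<tau>" using ker[OF A[OF a(1)]] a(2) by simp
    then obtain \<beta> x e where \<beta>: "\<beta> \<in> max_cones S" "\<tau> face_of \<beta>" "e > 0" "x \<in> \<tau>" "x + e *\<^sub>R a \<in> \<beta>"
      using adjacent_cell_exists[OF \<tau> \<alpha> a(1)] by metis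
    have x: "\<phi> x = 0"
    proof -
      have "x \<in> span \<alpha>" by (rule A) (use \<beta>(4) \<alpha>(2) in \<open>simp add: subset_iff\<close>)
      then show ?thesis using ker span_base[OF \<beta>(4)] by simp
    qed
    have val: "\<phi> (x + e *\<^sub>R a) = e * \<phi> a" using x by (simp add: linear_add[OF lin] linear_cmul[OF lin])
    have "x + e *\<^sub>R a \<notin> \<tau>"
    proof
      assume t: "x + e *\<^sub>R a \<in> \<tau>"
      have "x + e *\<^sub>R a \<in> span \<alpha>" by (rule A) (use t \<alpha>(2) in \<open>simp add: subset_iff\<close>)
      then have "\<phi> (x + e *\<^sub>R a) = 0" using ker span_base[OF t] by simp
      then show False using val \<beta>(3) a(2) by simp
    qed
    moreover have "0 < \<phi> (x + e *\<^sub>R a) \<longleftrightarrow> 0 < \<phi> a" using \<beta>(3) by (simp add: val zero_less_mult_iff)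
    ultimately show ?thesis using \<beta> by (intro exI[of _ \<beta>] exI[of _ "x + e *\<^sub>R a"]) simp
  qed
  have "\<exists>a\<in>star_cone \<gamma> \<alpha>. 0 < \<phi> a"
  proof (rule ccontr)
    assume "\<not> ?thesis"
    then have side: "\<And>x. x \<in> star_cone \<gamma> \<alpha> \<Longrightarrow> 0 \<le> - \<phi> x" by (simp add: not_less)
    have "linear (\<lambda>x. - \<phi> x)" by (rule linear_compose_neg[OF lin])
    from codim_one_carrier_if_one_sided[OF \<tau> \<alpha> this _ side] ker none show False by (metis neg_equal_0_iff_equal)
  qed
  then obtain a1 where a1: "a1 \<in> star_cone \<gamma> \<alpha>" "0 < \<phi> a1" by (rule bexE)
  then have "\<phi> a1 \<noteq> 0" by simp
  from cell[OF a1(1) this] obtain \<beta>1 b1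
    where \<beta>1: "\<beta>1 \<in> ?B" "b1 \<in> \<beta>1" "b1 \<notin> \<tau>" "0 < \<phi> b1" using a1(2) by (elim exE conjE) simp
  have "\<exists>a\<in>star_cone \<gamma> \<alpha>. \<phi> a < 0"
  proof (rule ccontr)
    assume "\<not> ?thesis"
    then have side: "\<And>x. x \<in> star_cone \<gamma> \<alpha> \<Longrightarrow> 0 \<le> \<phi> x" by (simp add: not_less)
    from codim_one_carrier_if_one_sided[OF \<tau> \<alpha> lin ker side] none show False by metis
  qed
  then obtain a2 where a2: "a2 \<in> star_cone \<gamma> \<alpha>" "\<phi> a2 < 0" by (rule bexE)
  then have "\<phi> a2 \<noteq> 0" by simp
  from cell[OF a2(1) this] obtain \<beta>2 b2
    where \<beta>2: "\<beta>2 \<in> ?B" "b2 \<in> \<beta>2" "b2 \<notin> \<tau>" "\<not> 0 < \<phi> b2" using a2(2) by (elim exE conjE) simp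
  have sign: "rel_sign so \<tau> \<beta> * cell_sign \<beta> = (if \<phi> b > 0 then 1 else - 1)" "\<phi> b \<noteq> 0"
    if "\<beta> \<in> ?B" "b \<in> \<beta>" "b \<notin> \<tau>" for \<beta> b
    using adjacent_sign[OF \<tau> _ _ _ that(2,3), of \<phi>] that(1) \<phi> carrier[OF that(1)] by simp_all
  have ne: "\<beta>1 \<noteq> \<beta>2" using sign(1)[OF \<beta>1(1-3)] sign(1)[OF \<beta>2(1-3)] \<beta>1(4) \<beta>2(4) by auto
  have inspan: "b \<in> span \<alpha>" if "\<beta> \<in> ?B" "b \<in> \<beta>" for \<beta> b
    using cell_in_span[of \<beta> b] that carrier[OF that(1)] by simp
  have eq: "\<beta>' = \<beta>" if \<beta>': "\<beta>' \<in> ?B" "b' \<in> \<beta>'" "b' \<notin> \<tau>" and \<beta>: "\<beta> \<in> ?B" "b \<in> \<beta>" "b \<notin> \<tau>"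
    and same: "0 < \<phi> b' \<longleftrightarrow> 0 < \<phi> b" for \<beta>' b' \<beta> b
  proof -
    note nz = sign(2)[OF \<beta>'] sign(2)[OF \<beta>]
    have pos: "0 < \<phi> b' / \<phi> b" using nz same by (auto simp: zero_less_divide_iff)
    note d = same_side_positive_multiple[OF inspan[OF \<beta>'(1,2)] inspan[OF \<beta>(1,2)] lin ker nz(2)]
    show ?thesis
      using adjacent_cell_unique[OF \<tau> _ _ \<beta>(2) _ _ \<beta>'(2,3) d(1) pos d(2)] \<beta>(1) \<beta>'(1) by simp
  qed
  have B: "?B = {\<beta>1, \<beta>2}"
  proof (intro equalityI subsetI)
    fix \<beta> assume \<beta>: "\<beta> \<in> ?B"
    then obtain b where b: "b \<in> \<beta>" "b \<notin> \<tau>" using point_off_facet[OF \<tau>] by auto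
    show "\<beta> \<in> {\<beta>1, \<beta>2}"
      using eq[OF \<beta> b \<beta>1(1-3)] eq[OF \<beta> b \<beta>2(1-3)] \<beta>1(4) \<beta>2(4) by (cases "0 < \<phi> b") simp_all
  qed (use \<beta>1(1) \<beta>2(1) in auto)
  let ?t = "\<lambda>\<beta>. [rel_sign so \<tau> \<beta>] \<cdot>\<^bsub>F_low R S p \<tau>\<^esub> iota R S p \<tau> (star_family \<beta>)"
  have ic: "iota R S p \<tau> (c \<alpha>) \<in> carrier (F_low R S p \<tau>)"
    using iota_c_closed[OF \<beta>0] by (simp add: \<alpha>_def)
  have t: "?t \<beta> = [(rel_sign so \<tau> \<beta> * cell_sign \<beta>)] \<cdot>\<^bsub>F_low R S p \<tau>\<^esub> iota R S p \<tau> (c \<alpha>)" if "\<beta> \<in> ?B" for \<beta>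
    using facet_term[of \<beta> \<tau>] that carrier[OF that] by simp
  have t1: "?t \<beta>1 = iota R S p \<tau> (c \<alpha>)"
    using t[OF \<beta>1(1)] sign(1)[OF \<beta>1(1-3)] \<beta>1(4) ic by simp
  have t2: "?t \<beta>2 = \<ominus>\<^bsub>F_low R S p \<tau>\<^esub> iota R S p \<tau> (c \<alpha>)"
    using t[OF \<beta>2(1)] sign(1)[OF \<beta>2(1-3)] \<beta>2(4) ic by simp
  have "facet_sum R S so p \<tau> star_family = ?t \<beta>1 \<oplus>\<^bsub>F_low R S p \<tau>\<^esub> ?t \<beta>2"
    unfolding facet_sum_def B using ne t1 t2 ic by (simp add: M.M.finsum_insert)
  also have "\<dots> = \<zero>\<^bsub>F_low R S p \<tau>\<^esub>" unfolding t1 t2 by (rule M.M.r_neg[OF ic])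
  finally show ?thesis .
qed

text \<open>Around a wall inside the star cone of \<open>\<kappa>\<close> there is one cell for each maximal cone around \<open>\<kappa>\<close>: the star cone
  of \<open>\<kappa>\<close> is a face of that of the maximal cone, so that cone lies on a single side of the wall. As \<open>\<tau>\<close> and
  \<open>\<kappa>\<close> have the same span, one functional gives the signs in the star and in the fan; they differ by
  the sign \<open>e\<close> comparing the orientations of \<open>\<tau>\<close> and \<open>\<kappa>\<close>.\<close>

lemma facet_sum_star_carrier:
  assumes \<tau>: "\<tau> \<in> S" "Suc (dim \<tau>) = fan_dim \<Sigma>"
    and \<kappa>: "\<kappa> \<in> \<Sigma>" "\<gamma> face_of \<kappa>" "dim \<kappa> = dim \<tau>" "\<tau> \<subseteq> star_cone \<gamma> \<kappa>"
  shows "F_low R S p \<tau> = F_low R \<Sigma> p \<kappa>"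
    and "\<exists>e. (e = 1 \<or> e = - 1) \<and>
      facet_sum R S so p \<tau> star_family = [(e::int)] \<cdot>\<^bsub>F_low R \<Sigma> p \<kappa>\<^esub> facet_sum R \<Sigma> ori p \<kappa> c"
proof -
  let ?B = "{\<beta> \<in> max_cones S. \<tau> face_of \<beta>}" and ?K = "{\<alpha> \<in> max_cones \<Sigma>. \<kappa> face_of \<alpha>}"
  let ?A = "star_cone \<gamma>"
  have span_\<tau>: "span \<tau> = span \<kappa>" by (rule span_carrier[OF \<kappa>(4,1,2)]) (simp add: \<kappa>(3))
  have K: "\<alpha> \<in> around" "\<tau> \<subseteq> ?A \<alpha>" "?A \<kappa> face_of ?A \<alpha>" if "\<alpha> \<in> ?K" for \<alpha>
  proof -
    have \<alpha>: "\<alpha> \<in> max_cones \<Sigma>" "\<kappa> face_of \<alpha>" "\<alpha> \<in> \<Sigma>" using that by (simp_all add: max_cones_iff)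
    show "\<alpha> \<in> around" using \<alpha> face_of_trans[OF \<kappa>(2)] by (simp add: around_def)
    show "?A \<kappa> face_of ?A \<alpha>" by (rule star_cone_face[OF \<alpha>(3) \<kappa>(1,2) \<alpha>(2)])
    then show "\<tau> \<subseteq> ?A \<alpha>" using \<kappa>(4) face_of_imp_subset by (metis order_trans)
  qed
  have BK: "cell_carrier \<beta> \<in> ?K" if "\<beta> \<in> ?B" for \<beta>
  proof -
    have \<beta>: "\<beta> \<in> max_cones S" "\<tau> face_of \<beta>" using that by simp_all
    note a = aroundD[OF cell_carrier(1)[OF \<beta>(1)]]
    have "\<tau> \<subseteq> ?A (cell_carrier \<beta>)" using cell_carrier(2)[OF \<beta>(1)] face_of_imp_subset[OF \<beta>(2)] by simp
    from carrier_face[OF \<kappa>(4) this \<kappa>(1,2) a(1,2)] \<kappa>(3) a(4) show ?thesis by simp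
  qed
  have inspan: "x \<in> span \<alpha>" if "x \<in> ?A \<alpha>" "\<alpha> \<in> ?K" for x \<alpha>
    using that(1) span_star_cone[OF aroundD(1,2)[OF K(1)[OF that(2)]]] span_base by metis
  have side: "0 < \<phi> a / \<phi> b"
    if \<alpha>: "\<alpha> \<in> ?K" and \<phi>: "linear \<phi>" "\<And>x. x \<in> span \<alpha> \<Longrightarrow> \<phi> x = 0 \<longleftrightarrow> x \<in> span \<tau>"
      and ab: "a \<in> ?A \<alpha>" "b \<in> ?A \<alpha>" "\<phi> a \<noteq> 0" "\<phi> b \<noteq> 0" for \<alpha> a b and \<phi> :: "_ \<Rightarrow> real"
  proof (rule ccontr)
    assume "\<not> 0 < \<phi> a / \<phi> b"
    then have le: "\<phi> a / \<phi> b \<le> 0" by simp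
    note d = same_side_positive_multiple[OF inspan[OF ab(1) \<alpha>] inspan[OF ab(2) \<alpha>] \<phi> ab(4)]
    note a\<Sigma> = aroundD[OF K(1)[OF \<alpha>]]
    have "span (?A \<kappa>) = span \<tau>" using span_star_cone[OF \<kappa>(1,2)] span_\<tau> by simp
    then have "a \<in> ?A \<kappa>"
      using face_one_side[OF star_cone_convex_cone[OF a\<Sigma>(1)] K(3)[OF \<alpha>] _ ab(1,2) d(1) _ le] d(2)
        convex_coneD(1)[OF star_cone_convex_cone[OF \<kappa>(1)]] by auto
    then have "a \<in> span \<tau>" using \<open>span (?A \<kappa>) = span \<tau>\<close> span_base by metis
    then show False using \<phi>(2)[OF inspan[OF ab(1) \<alpha>]] ab(3) by simp
  qed
  have bij: "bij_betw cell_carrier ?B ?K"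
    unfolding bij_betw_def
  proof (intro conjI)
    show "inj_on cell_carrier ?B"
    proof (rule inj_onI)
    fix \<beta>1 \<beta>2 assume \<beta>: "\<beta>1 \<in> ?B" "\<beta>2 \<in> ?B" and eq: "cell_carrier \<beta>1 = cell_carrier \<beta>2"
    note \<alpha> = BK[OF \<beta>(1)]
    obtain \<phi> where \<phi>: "side_functional (so \<tau>) (ori (cell_carrier \<beta>1)) \<phi>" "linear \<phi>"
      "\<And>x. x \<in> span (cell_carrier \<beta>1) \<Longrightarrow> \<phi> x = 0 \<longleftrightarrow> x \<in> span \<tau>"
      by (rule facet_side_functional[OF \<tau> K(1,2)[OF \<alpha>]], rule that) auto
    obtain b1 where b1: "b1 \<in> \<beta>1" "b1 \<notin> \<tau>" using point_off_facet[OF \<tau>] \<beta>(1) by auto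
    obtain b2 where b2: "b2 \<in> \<beta>2" "b2 \<notin> \<tau>" using point_off_facet[OF \<tau>] \<beta>(2) by auto
    have nz: "\<phi> b1 \<noteq> 0" "\<phi> b2 \<noteq> 0"
      using adjacent_sign(2)[OF \<tau> _ _ _ b1, of \<phi>] adjacent_sign(2)[OF \<tau> _ _ _ b2, of \<phi>] \<phi>(1) \<beta> eq by simp_all
    have bA: "b1 \<in> ?A (cell_carrier \<beta>1)" "b2 \<in> ?A (cell_carrier \<beta>1)"
      using cell_carrier(2)[of \<beta>1] cell_carrier(2)[of \<beta>2] \<beta> eq b1 b2 by auto
    note d = same_side_positive_multiple[OF inspan[OF bA(2) \<alpha>] inspan[OF bA(1) \<alpha>] \<phi>(2,3) nz(1)]
    show "\<beta>1 = \<beta>2"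
      using adjacent_cell_unique[OF \<tau> _ _ b1(1) _ _ b2 d(1) side[OF \<alpha> \<phi>(2,3) bA(2,1) nz(2,1)] d(2)] \<beta> by simp
    qed
  next
    show "cell_carrier ` ?B = ?K"
    proof (intro equalityI subsetI)
    fix \<alpha> assume "\<alpha> \<in> cell_carrier ` ?B"
    then show "\<alpha> \<in> ?K" using BK by auto
    next
    fix \<alpha> assume \<alpha>: "\<alpha> \<in> ?K"
    note a = aroundD[OF K(1)[OF \<alpha>]]
    have "\<not> ?A \<alpha> \<subseteq> span \<tau>"
    proof
      assume "?A \<alpha> \<subseteq> span \<tau>"
      from dim_subset[OF this] dim_star_cone[OF a(1,2)] a(3) \<tau>(2) show False by simp
    qed
    then obtain a where a: "a \<in> ?A \<alpha>" "a \<notin> span \<tau>" by (metis subsetI)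
    obtain \<beta> where "\<beta> \<in> max_cones S" "\<tau> face_of \<beta>" "cell_carrier \<beta> = \<alpha>"
      using adjacent_cell_exists[OF \<tau> K(1,2)[OF \<alpha>] a] by metis
    then show "\<alpha> \<in> cell_carrier ` ?B" by (intro image_eqI[of _ _ \<beta>]) simp_all
    qed
  qed
  have FZ: "FZ S p \<tau> = FZ \<Sigma> p \<kappa>"
  proof -
    have "(\<Union>\<beta>\<in>?B. ext_power p (lat \<beta>)) = (\<Union>\<beta>\<in>?B. ext_power p (lat (cell_carrier \<beta>)))"
      by (rule SUP_cong[OF refl]) (simp add: lat_cell_carrier)
    also have "\<dots> = (\<Union>\<alpha>\<in>cell_carrier ` ?B. ext_power p (lat \<alpha>))" by (simp add: image_image)
    finally show ?thesis
      unfolding FZ_max_cones S.FZ_max_cones bij_betw_imp_surj_on[OF bij] by simp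
  qed
  then show FL: "F_low R S p \<tau> = F_low R \<Sigma> p \<kappa>" by (simp add: F_low_def)
  have io: "iota R S p \<tau> = iota R \<Sigma> p \<kappa>" by (simp add: iota_def FZ)
  define e where "e = basis_sign (ori \<kappa>) (so \<tau>)"
  have e: "e = 1 \<or> e = - 1" unfolding e_def by (rule basis_sign_cases)
  then have ee: "e * e = 1" by auto
  have wedge_e: "wedge (u # ori \<kappa>) js = e * wedge (u # so \<tau>) js" for u js
  proof -
    have L: "zsubgroup (lat \<kappa>)" by (rule zsubgroup_lat)
    have "lat \<tau> = lat \<kappa>" by (rule lat_cong[OF span_\<tau>])
    then have "zspan (set (so \<tau>)) = lat \<kappa>" using orientationD(2)[OF so \<tau>(1)] by simp
    moreover have "length (so \<tau>) = dim \<kappa>" using orientationD(1)[OF so \<tau>(1)] \<kappa>(3) by simp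
    ultimately have "wedge (u # so \<tau>) = [e] \<cdot>\<^bsub>int_functions\<^esub> wedge (u # ori \<kappa>)"
      unfolding e_def
      using basis_sign(2)[OF orientationD(1)[OF ori \<kappa>(1)] _ orientationD(2)[OF ori \<kappa>(1)] _
          oriented_basis(4)[OF fan ori \<kappa>(1)] wedge_Cons_alternating[OF L]] by simp
    then have "wedge (u # so \<tau>) js = e * wedge (u # ori \<kappa>) js" by (simp add: int_functions_simps)
    then show ?thesis using ee by (simp flip: mult.assoc)
  qed
  have sign: "rel_sign so \<tau> \<beta> * cell_sign \<beta> = e * rel_sign ori \<kappa> (cell_carrier \<beta>)" if \<beta>: "\<beta> \<in> ?B" for \<beta>
  proof -
    let ?\<alpha> = "cell_carrier \<beta>"
    note \<alpha> = BK[OF \<beta>] and a = aroundD[OF K(1)[OF BK[OF \<beta>]]]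
    obtain \<phi> where \<phi>: "side_functional (so \<tau>) (ori ?\<alpha>) \<phi>" "linear \<phi>"
      "\<And>x. x \<in> span ?\<alpha> \<Longrightarrow> \<phi> x = 0 \<longleftrightarrow> x \<in> span \<tau>"
      by (rule facet_side_functional[OF \<tau> K(1,2)[OF \<alpha>]], rule that) auto
    obtain b where b: "b \<in> \<beta>" "b \<notin> \<tau>" using point_off_facet[OF \<tau>] \<beta> by auto
    have s1: "rel_sign so \<tau> \<beta> * cell_sign \<beta> = (if \<phi> b > 0 then 1 else - 1)" "\<phi> b \<noteq> 0"
      using adjacent_sign[OF \<tau> _ _ \<phi>(1) b] \<beta> by simp_all
    have "\<kappa> face_of ?\<alpha>" using \<alpha> by simp
    have "\<kappa> \<noteq> ?\<alpha>" using a(3) \<kappa>(3) \<tau>(2) by auto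
    then obtain x where x: "x \<in> ?\<alpha>" "x \<notin> \<kappa>" using face_of_imp_subset[OF \<open>\<kappa> face_of ?\<alpha>\<close>] by (metis subsetI subset_antisym)
    have sp: "span (real_vec ` set (ori \<kappa>)) = span (real_vec ` set (so \<tau>))"
      using oriented_basis(1)[OF fan ori \<kappa>(1)] oriented_basis(1)[OF S.fan so \<tau>(1)] span_\<tau> by simp
    have \<psi>: "side_functional (ori \<kappa>) (ori ?\<alpha>) (\<lambda>x. of_int (e * 1) * \<phi> x)"
      by (rule side_functional_change[OF \<phi>(1) wedge_e sp _ refl e]) simp_all
    have dim: "dim ?\<alpha> = Suc (dim \<kappa>)" using a(3) \<kappa>(3) \<tau>(2) by simp
    note s2 = rel_sign_side[OF fan ori a(1) \<open>\<kappa> face_of ?\<alpha>\<close> \<kappa>(1) dim \<psi> x]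
    have xA: "x \<in> ?A ?\<alpha>" using x(1) cone_subset_star[OF a(1)] by (simp add: subset_iff)
    have bA: "b \<in> ?A ?\<alpha>" using b(1) cell_carrier(2)[of \<beta>] \<beta> by auto
    have "\<phi> x \<noteq> 0" using s2(2) by auto
    then have "0 < \<phi> x / \<phi> b" using side[OF \<alpha> \<phi>(2,3) xA bA _ s1(2)] by simp
    then have "\<phi> x > 0 \<longleftrightarrow> \<phi> b > 0" by (auto simp: zero_less_divide_iff)
    then show ?thesis using s1 s2 \<open>\<phi> x \<noteq> 0\<close> e by auto
  qed
  interpret M: module R "F_low R \<Sigma> p \<kappa>" by (rule F_low_module[OF R])
  let ?f = "\<lambda>\<alpha>. [rel_sign ori \<kappa> \<alpha>] \<cdot>\<^bsub>F_low R \<Sigma> p \<kappa>\<^esub> iota R \<Sigma> p \<kappa> (c \<alpha>)"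
  have ic: "iota R \<Sigma> p \<kappa> (c \<alpha>) \<in> carrier (F_low R \<Sigma> p \<kappa>)" if "\<alpha> \<in> ?K" for \<alpha>
    by (rule linear_mapD(1)[OF iota_linear[OF R] c[OF K(1)[OF that]]]) (use that in simp)
  have f: "?f \<in> ?K \<rightarrow> carrier (F_low R \<Sigma> p \<kappa>)"
    by (intro funcsetI M.M.add.int_pow_closed ic)
  have ef: "(\<lambda>\<alpha>. [e] \<cdot>\<^bsub>F_low R \<Sigma> p \<kappa>\<^esub> ?f \<alpha>) \<in> ?K \<rightarrow> carrier (F_low R \<Sigma> p \<kappa>)"
    by (intro funcsetI M.M.add.int_pow_closed ic)
  have "facet_sum R S so p \<tau> star_family =
      (\<Oplus>\<^bsub>F_low R \<Sigma> p \<kappa>\<^esub>\<beta>\<in>?B. [rel_sign so \<tau> \<beta>] \<cdot>\<^bsub>F_low R \<Sigma> p \<kappa>\<^esub> iota R \<Sigma> p \<kappa> (star_family \<beta>))"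
    unfolding facet_sum_def FL io ..
  also have "\<dots> = (\<Oplus>\<^bsub>F_low R \<Sigma> p \<kappa>\<^esub>\<beta>\<in>?B. [e] \<cdot>\<^bsub>F_low R \<Sigma> p \<kappa>\<^esub> ?f (cell_carrier \<beta>))"
  proof (rule M.M.finsum_cong'[OF refl])
    show "(\<lambda>\<beta>. [e] \<cdot>\<^bsub>F_low R \<Sigma> p \<kappa>\<^esub> ?f (cell_carrier \<beta>)) \<in> ?B \<rightarrow> carrier (F_low R \<Sigma> p \<kappa>)"
      by (intro funcsetI M.M.add.int_pow_closed ic BK)
    fix \<beta> assume \<beta>: "\<beta> \<in> ?B"
    then have \<beta>': "\<beta> \<in> max_cones S" "\<tau> face_of \<beta>" by simp_all
    show "[rel_sign so \<tau> \<beta>] \<cdot>\<^bsub>F_low R \<Sigma> p \<kappa>\<^esub> iota R \<Sigma> p \<kappa> (star_family \<beta>) =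
        [e] \<cdot>\<^bsub>F_low R \<Sigma> p \<kappa>\<^esub> ?f (cell_carrier \<beta>)"
      using facet_term[OF \<beta>', of "rel_sign so \<tau> \<beta>"] M.M.add_pow_add_pow[OF ic[OF BK[OF \<beta>]]]
      unfolding FL io sign[OF \<beta>] by simp
  qed
  also have "\<dots> = (\<Oplus>\<^bsub>F_low R \<Sigma> p \<kappa>\<^esub>\<alpha>\<in>?K. [e] \<cdot>\<^bsub>F_low R \<Sigma> p \<kappa>\<^esub> ?f \<alpha>)"
    using M.M.finsum_reindex[of "\<lambda>\<alpha>. [e] \<cdot>\<^bsub>F_low R \<Sigma> p \<kappa>\<^esub> ?f \<alpha>" cell_carrier ?B] ef
    unfolding bij_betw_imp_surj_on[OF bij] using bij_betw_imp_inj_on[OF bij] by simp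
  also have "\<dots> = [e] \<cdot>\<^bsub>F_low R \<Sigma> p \<kappa>\<^esub> facet_sum R \<Sigma> ori p \<kappa> c"
    unfolding facet_sum_def by (rule M.M.add_pow_finsum_sign[OF f e, symmetric])
  finally show "\<exists>e. (e = 1 \<or> e = - 1) \<and>
      facet_sum R S so p \<tau> star_family = [(e::int)] \<cdot>\<^bsub>F_low R \<Sigma> p \<kappa>\<^esub> facet_sum R \<Sigma> ori p \<kappa> c"
    using e by (intro exI[of _ e] conjI)
qed

lemma facet_sum_closed:
  assumes "\<kappa> \<in> \<Sigma>" "\<gamma> face_of \<kappa>"
  shows "facet_sum R \<Sigma> ori p \<kappa> c \<in> carrier (F_low R \<Sigma> p \<kappa>)"
proof -
  interpret M: module R "F_low R \<Sigma> p \<kappa>" by (rule F_low_module[OF R])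
  have "iota R \<Sigma> p \<kappa> (c \<alpha>) \<in> carrier (F_low R \<Sigma> p \<kappa>)" if \<alpha>: "\<alpha> \<in> max_cones \<Sigma>" "\<kappa> face_of \<alpha>" for \<alpha>
    by (rule linear_mapD(1)[OF iota_linear[OF R \<alpha>(2)] c])
       (use \<alpha> face_of_trans[OF assms(2)] in \<open>simp add: around_def\<close>)
  then show ?thesis
    unfolding facet_sum_def by (intro M.M.finsum_closed funcsetI M.M.add.int_pow_closed) simp
qed

text \<open>Every cone of codimension one around \<open>\<gamma>\<close> has a wall in its star cone, and all other walls impose no condition.\<close>

theorem star_family_cycle_iff:
  "(\<forall>\<tau>\<in>S. Suc (dim \<tau>) = fan_dim \<Sigma> \<longrightarrow> facet_sum R S so p \<tau> star_family = \<zero>\<^bsub>F_low R S p \<tau>\<^esub>) \<longleftrightarrow>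
   (\<forall>\<kappa>\<in>\<Sigma>. \<gamma> face_of \<kappa> \<and> Suc (dim \<kappa>) = fan_dim \<Sigma> \<longrightarrow> facet_sum R \<Sigma> ori p \<kappa> c = \<zero>\<^bsub>F_low R \<Sigma> p \<kappa>\<^esub>)"
  (is "?L \<longleftrightarrow> ?R")
proof
  assume L: ?L
  show ?R
  proof (intro ballI impI; elim conjE)
    fix \<kappa> assume \<kappa>: "\<kappa> \<in> \<Sigma>" "\<gamma> face_of \<kappa>" "Suc (dim \<kappa>) = fan_dim \<Sigma>"
    obtain \<tau> where \<tau>: "\<tau> \<in> S" "\<tau> \<subseteq> star_cone \<gamma> \<kappa>" "dim \<tau> = dim \<kappa>" using full_cell[OF \<kappa>(1,2)] .
    have d: "Suc (dim \<tau>) = fan_dim \<Sigma>" "dim \<kappa> = dim \<tau>" using \<tau>(3) \<kappa>(3) by simp_all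
    note T = facet_sum_star_carrier[OF \<tau>(1) d(1) \<kappa>(1,2) d(2) \<tau>(2)]
    interpret M: module R "F_low R \<Sigma> p \<kappa>" by (rule F_low_module[OF R])
    note cl = facet_sum_closed[OF \<kappa>(1,2)]
    obtain e :: int where e: "e = 1 \<or> e = - 1"
      "facet_sum R S so p \<tau> star_family = [e] \<cdot>\<^bsub>F_low R \<Sigma> p \<kappa>\<^esub> facet_sum R \<Sigma> ori p \<kappa> c"
      using T(2) by metis
    have "facet_sum R S so p \<tau> star_family = \<zero>\<^bsub>F_low R \<Sigma> p \<kappa>\<^esub>" using L \<tau>(1) d(1) T(1) by simp
    then have z: "[e] \<cdot>\<^bsub>F_low R \<Sigma> p \<kappa>\<^esub> facet_sum R \<Sigma> ori p \<kappa> c = \<zero>\<^bsub>F_low R \<Sigma> p \<kappa>\<^esub>" using e(2) by simp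
    have "[e] \<cdot>\<^bsub>F_low R \<Sigma> p \<kappa>\<^esub> ([e] \<cdot>\<^bsub>F_low R \<Sigma> p \<kappa>\<^esub> facet_sum R \<Sigma> ori p \<kappa> c) = facet_sum R \<Sigma> ori p \<kappa> c"
      unfolding M.M.add_pow_add_pow[OF cl] using e(1) cl by auto
    then show "facet_sum R \<Sigma> ori p \<kappa> c = \<zero>\<^bsub>F_low R \<Sigma> p \<kappa>\<^esub>" unfolding z using e(1) by auto
  qed
next
  assume ?R
  show ?L
  proof (intro ballI impI)
    fix \<tau> assume \<tau>: "\<tau> \<in> S" "Suc (dim \<tau>) = fan_dim \<Sigma>"
    show "facet_sum R S so p \<tau> star_family = \<zero>\<^bsub>F_low R S p \<tau>\<^esub>"
    proof (cases "\<exists>\<kappa>\<in>\<Sigma>. \<gamma> face_of \<kappa> \<and> dim \<kappa> = dim \<tau> \<and> \<tau> \<subseteq> star_cone \<gamma> \<kappa>")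
      case True
      then obtain \<kappa> where \<kappa>: "\<kappa> \<in> \<Sigma>" "\<gamma> face_of \<kappa>" "dim \<kappa> = dim \<tau>" "\<tau> \<subseteq> star_cone \<gamma> \<kappa>" by metis
      interpret M: module R "F_low R \<Sigma> p \<kappa>" by (rule F_low_module[OF R])
      have "facet_sum R \<Sigma> ori p \<kappa> c = \<zero>\<^bsub>F_low R \<Sigma> p \<kappa>\<^esub>" using \<open>?R\<close> \<kappa> \<tau>(2) by simp
      then show ?thesis
        using facet_sum_star_carrier[OF \<tau> \<kappa>] by auto
    next
      case False
      then show ?thesis by (intro facet_sum_star_interior[OF \<tau>]) metis
    qed
  qed
qed

end

section \<open>Duality in degree zero as a bijection of cycles\<close>

lemma dual_mod_simps:
  "u \<in> carrier (dual_mod R M) \<longleftrightarrow> u \<in> carrier M \<rightarrow>\<^sub>E carrier R \<and>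
    (\<forall>x\<in>carrier M. \<forall>y\<in>carrier M. u (x \<oplus>\<^bsub>M\<^esub> y) = u x \<oplus>\<^bsub>R\<^esub> u y) \<and>
    (\<forall>r\<in>carrier R. \<forall>x\<in>carrier M. u (r \<odot>\<^bsub>M\<^esub> x) = r \<otimes>\<^bsub>R\<^esub> u x)"
  "\<zero>\<^bsub>dual_mod R M\<^esub> = (\<lambda>x\<in>carrier M. \<zero>\<^bsub>R\<^esub>)"
  "u \<oplus>\<^bsub>dual_mod R M\<^esub> v = (\<lambda>x\<in>carrier M. u x \<oplus>\<^bsub>R\<^esub> v x)"
  "r \<odot>\<^bsub>dual_mod R M\<^esub> u = (\<lambda>x\<in>carrier M. r \<otimes>\<^bsub>R\<^esub> u x)"
  by (simp_all add: dual_mod_def)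

lemma dual_modI:
  assumes "u \<in> extensional (carrier M)" "\<And>x. x \<in> carrier M \<Longrightarrow> u x \<in> carrier R"
    "\<And>x y. x \<in> carrier M \<Longrightarrow> y \<in> carrier M \<Longrightarrow> u (x \<oplus>\<^bsub>M\<^esub> y) = u x \<oplus>\<^bsub>R\<^esub> u y"
    "\<And>r x. r \<in> carrier R \<Longrightarrow> x \<in> carrier M \<Longrightarrow> u (r \<odot>\<^bsub>M\<^esub> x) = r \<otimes>\<^bsub>R\<^esub> u x"
  shows "u \<in> carrier (dual_mod R M)"
  unfolding dual_mod_simps using assms by (simp add: PiE_iff)

lemma dual_mod_ext:
  assumes "u \<in> carrier (dual_mod R M)" "v \<in> carrier (dual_mod R M)" "\<And>x. x \<in> carrier M \<Longrightarrow> u x = v x"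
  shows "u = v"
  by (rule extensionalityI[OF dual_modD(4)[OF assms(1)] dual_modD(4)[OF assms(2)] assms(3)])

lemma dual_mod_closed:
  assumes M: "module R M"
  shows "\<zero>\<^bsub>dual_mod R M\<^esub> \<in> carrier (dual_mod R M)"
    and "u \<in> carrier (dual_mod R M) \<Longrightarrow> v \<in> carrier (dual_mod R M) \<Longrightarrow>
      u \<oplus>\<^bsub>dual_mod R M\<^esub> v \<in> carrier (dual_mod R M)"
    and "r \<in> carrier R \<Longrightarrow> u \<in> carrier (dual_mod R M) \<Longrightarrow> r \<odot>\<^bsub>dual_mod R M\<^esub> u \<in> carrier (dual_mod R M)"
    and "u \<in> carrier (dual_mod R M) \<Longrightarrow> \<zero>\<^bsub>dual_mod R M\<^esub> \<oplus>\<^bsub>dual_mod R M\<^esub> u = u"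
proof -
  interpret M: module R M by fact
  note sm = module.smult_closed[OF M]
  show "\<zero>\<^bsub>dual_mod R M\<^esub> \<in> carrier (dual_mod R M)"
    by (rule dual_modI) (simp_all add: dual_mod_simps(2) sm)
  {
    assume u: "u \<in> carrier (dual_mod R M)"
    note U = dual_modD[OF u]
    show "\<zero>\<^bsub>dual_mod R M\<^esub> \<oplus>\<^bsub>dual_mod R M\<^esub> u = u"
      by (rule extensionalityI[OF _ U(4)]) (simp_all add: dual_mod_simps(2,3) U)
    show "r \<odot>\<^bsub>dual_mod R M\<^esub> u \<in> carrier (dual_mod R M)" if r: "r \<in> carrier R"
      by (rule dual_modI) (simp_all add: dual_mod_simps(4) U sm r M.R.r_distr M.R.m_lcomm)
    assume v: "v \<in> carrier (dual_mod R M)"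
    note V = dual_modD[OF v]
    show "u \<oplus>\<^bsub>dual_mod R M\<^esub> v \<in> carrier (dual_mod R M)"
      by (rule dual_modI) (simp_all add: dual_mod_simps(3) U V sm M.R.r_distr M.R.a_ac)
  }
qed

lemma finsum_empty_general: "\<zero>\<^bsub>G\<^esub> \<in> carrier G \<Longrightarrow> (\<Oplus>\<^bsub>G\<^esub>i\<in>{}. f i) = \<zero>\<^bsub>G\<^esub>"
  by (simp add: finsum_def finprod_def)

context fan
begin

lemma rho_eq: "rho R \<Sigma> p \<tau> \<sigma> u = (\<lambda>x\<in>carrier (F_low R \<Sigma> p \<sigma>). u (iota R \<Sigma> p \<tau> x))"
  by (simp add: rho_def)

lemma rho_closed:
  assumes R: "cring R" and f: "\<tau> face_of \<sigma>" and u: "u \<in> carrier (F_up R \<Sigma> p \<tau>)"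
  shows "rho R \<Sigma> p \<tau> \<sigma> u \<in> carrier (F_up R \<Sigma> p \<sigma>)"
proof -
  interpret M: module R "F_low R \<Sigma> p \<sigma>" by (rule F_low_module[OF R])
  note i = linear_mapD[OF iota_linear[OF R f]] and U = dual_modD[OF u[unfolded F_up_def]]
  show ?thesis
    unfolding F_up_def
    by (rule dual_modI)
       (simp_all add: rho_eq i U module.smult_closed[OF M.module_axioms])
qed

lemma rho_apply: "x \<in> carrier (F_low R \<Sigma> p \<sigma>) \<Longrightarrow> rho R \<Sigma> p \<tau> \<sigma> u x = u (iota R \<Sigma> p \<tau> x)"
  by (simp add: rho_eq)

lemma rho_trans:
  assumes R: "cring R" and f: "\<tau> face_of \<sigma>" "\<sigma> face_of \<kappa>"
  shows "rho R \<Sigma> p \<sigma> \<kappa> (rho R \<Sigma> p \<tau> \<sigma> u) = rho R \<Sigma> p \<tau> \<kappa> u"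
proof
  fix x
  show "rho R \<Sigma> p \<sigma> \<kappa> (rho R \<Sigma> p \<tau> \<sigma> u) x = rho R \<Sigma> p \<tau> \<kappa> u x"
  proof (cases "x \<in> carrier (F_low R \<Sigma> p \<kappa>)")
    case True
    then show ?thesis
      using linear_mapD(1)[OF iota_linear[OF R f(2)] True] iota_trans[OF R f True] by (simp add: rho_apply)
  qed (simp add: rho_eq)
qed

definition cap_at ::
  "('r, 'm) ring_scheme \<Rightarrow> ((real ^ 'n) set \<Rightarrow> (int ^ 'n) list) \<Rightarrow> ((real ^ 'n) set \<Rightarrow> 'r) \<Rightarrow> nat
    \<Rightarrow> (real ^ 'n) set \<Rightarrow> (real ^ 'n) set \<Rightarrow> (('r, 'n) mvec \<Rightarrow> 'r) \<Rightarrow> ('r, 'n) mvec" where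
  "cap_at R ori w p \<gamma> \<alpha> u =
    w \<alpha> \<odot>\<^bsub>F_low R \<Sigma> (fan_dim \<Sigma> - p) \<alpha>\<^esub> contraction R \<Sigma> p \<alpha> (rho R \<Sigma> p \<gamma> \<alpha> u) (ori \<alpha>)"

lemma cap_at_face:
  assumes "cring R" "\<tau> face_of \<sigma>" "\<sigma> face_of \<alpha>"
  shows "cap_at R ori w p \<sigma> \<alpha> (rho R \<Sigma> p \<tau> \<sigma> u) = cap_at R ori w p \<tau> \<alpha> u"
  by (simp add: cap_at_def rho_trans[OF assms])

lemma contraction_alternating_max:
  assumes R: "cring R" and \<alpha>: "\<alpha> \<in> max_cones \<Sigma>" and u: "u \<in> carrier (F_up R \<Sigma> p \<alpha>)" and p: "p \<le> fan_dim \<Sigma>"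
  shows "alternating (F_low R \<Sigma> (fan_dim \<Sigma> - p) \<alpha>) (lat \<alpha>) (fan_dim \<Sigma>) (contraction R \<Sigma> p \<alpha> u)"
proof (rule contraction_alternating[OF R zsubgroup_lat FZ_zsubgroup _ u p])
  fix ys :: "(int ^ 'n) list" assume "set ys \<subseteq> lat \<alpha>"
  have \<alpha>': "\<alpha> \<in> \<Sigma>" using \<alpha> by (simp add: max_cones_iff)
  show "wedge ys \<in> FZ \<Sigma> (length ys) \<alpha>"
    using wedge_in_ext_power[OF \<open>set ys \<subseteq> lat \<alpha>\<close>] ext_power_subset_FZ[OF \<alpha>' face_self[OF \<alpha>']] by (rule subsetD[rotated])
qed

lemma contraction_closed:
  assumes R: "cring R" and ori: "orientation \<Sigma> ori" and \<alpha>: "\<alpha> \<in> max_cones \<Sigma>"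
    and u: "u \<in> carrier (F_up R \<Sigma> p \<alpha>)" and p: "p \<le> fan_dim \<Sigma>"
  shows "contraction R \<Sigma> p \<alpha> u (ori \<alpha>) \<in> carrier (F_low R \<Sigma> (fan_dim \<Sigma> - p) \<alpha>)"
proof (rule alternating.closed[OF contraction_alternating_max[OF R \<alpha> u p]])
  have \<alpha>': "\<alpha> \<in> \<Sigma>" "dim \<alpha> = fan_dim \<Sigma>" using \<alpha> by (simp_all add: max_cones_iff)
  show "length (ori \<alpha>) = fan_dim \<Sigma>" using orientationD(1)[OF ori \<alpha>'(1)] \<alpha>'(2) by simp
  show "set (ori \<alpha>) \<subseteq> lat \<alpha>" using zspan_superset[of "set (ori \<alpha>)"] orientationD(2)[OF ori \<alpha>'(1)] by simp
qed

end

locale weighted_fan = fan \<Sigma> for \<Sigma> :: "(real ^ 'n) set set" +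
  fixes R :: "('r, 'm) ring_scheme" and ori :: "(real ^ 'n) set \<Rightarrow> (int ^ 'n) list"
    and w :: "(real ^ 'n) set \<Rightarrow> 'r"
  assumes R: "cring R" and ori: "orientation \<Sigma> ori"
    and w: "\<And>\<alpha>. \<alpha> \<in> max_cones \<Sigma> \<Longrightarrow> w \<alpha> \<in> carrier R"
begin

abbreviation "cap p \<gamma> \<alpha> u \<equiv> cap_at R ori w p \<gamma> \<alpha> u"

lemma cap_closed:
  assumes "\<alpha> \<in> max_cones \<Sigma>" "\<gamma> face_of \<alpha>" "u \<in> carrier (F_up R \<Sigma> p \<gamma>)" "p \<le> fan_dim \<Sigma>"
  shows "cap p \<gamma> \<alpha> u \<in> carrier (F_low R \<Sigma> (fan_dim \<Sigma> - p) \<alpha>)"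
  unfolding cap_at_def
  by (intro module.smult_closed[OF F_low_module[OF R]] w[OF assms(1)]
      contraction_closed[OF R ori assms(1) rho_closed[OF R assms(2,3)] assms(4)])

lemma contraction_linear:
  assumes \<alpha>: "\<alpha> \<in> max_cones \<Sigma>" and p: "p \<le> fan_dim \<Sigma>"
    and u: "u \<in> carrier (F_up R \<Sigma> p \<alpha>)"
  shows "v \<in> carrier (F_up R \<Sigma> p \<alpha>) \<Longrightarrow>
      contraction R \<Sigma> p \<alpha> (u \<oplus>\<^bsub>F_up R \<Sigma> p \<alpha>\<^esub> v) (ori \<alpha>) =
      contraction R \<Sigma> p \<alpha> u (ori \<alpha>) \<oplus>\<^bsub>F_low R \<Sigma> (fan_dim \<Sigma> - p) \<alpha>\<^esub> contraction R \<Sigma> p \<alpha> v (ori \<alpha>)"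
    and "r \<in> carrier R \<Longrightarrow>
      contraction R \<Sigma> p \<alpha> (r \<odot>\<^bsub>F_up R \<Sigma> p \<alpha>\<^esub> u) (ori \<alpha>) =
      r \<odot>\<^bsub>F_low R \<Sigma> (fan_dim \<Sigma> - p) \<alpha>\<^esub> contraction R \<Sigma> p \<alpha> u (ori \<alpha>)"
proof -
  let ?M = "F_low R \<Sigma> (fan_dim \<Sigma> - p) \<alpha>" and ?ys = "ori \<alpha>" and ?S = "shuffles_perm p (fan_dim \<Sigma>)"
  interpret M: module R ?M by (rule F_low_module[OF R])
  note sm = module.smult_closed[OF M.module_axioms]
  have \<alpha>': "\<alpha> \<in> \<Sigma>" "dim \<alpha> = fan_dim \<Sigma>" using \<alpha> by (simp_all add: max_cones_iff)
  have len: "length ?ys = fan_dim \<Sigma>" using orientationD(1)[OF ori \<alpha>'(1)] \<alpha>'(2) by simp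
  have sub: "set ?ys \<subseteq> lat \<alpha>" using zspan_superset[of "set ?ys"] orientationD(2)[OF ori \<alpha>'(1)] by simp
  define A where "A a = tensor_one R (FZ \<Sigma> p \<alpha>) (wedge (map (\<lambda>i. ?ys ! a i) [0..<p]))" for a
  define B where "B a = tensor_one R (FZ \<Sigma> (fan_dim \<Sigma> - p) \<alpha>) (wedge (map (\<lambda>i. ?ys ! a i) [p..<fan_dim \<Sigma>]))" for a
  define k :: "(nat \<Rightarrow> nat) \<Rightarrow> int" where "k a = (- 1) ^ (p * (p - 1) div 2) * sign a" for a
  have contr: "contraction R \<Sigma> p \<alpha> x ?ys = (\<Oplus>\<^bsub>?M\<^esub>a\<in>?S. [k a] \<cdot>\<^bsub>?M\<^esub> (x (A a) \<odot>\<^bsub>?M\<^esub> B a))" for x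
    by (simp add: contraction_def Let_def len A_def B_def k_def)
  have wedge_mem: "wedge zs \<in> FZ \<Sigma> (length zs) \<alpha>" if "set zs \<subseteq> lat \<alpha>" for zs
    using wedge_in_ext_power[OF that] ext_power_subset_FZ[OF \<alpha>'(1) face_self[OF \<alpha>'(1)]] by (rule subsetD[rotated])
  have mem: "?ys ! a i \<in> lat \<alpha>" if "a \<in> ?S" "i < fan_dim \<Sigma>" for a i
  proof -
    have "a permutes {..<fan_dim \<Sigma>}" using that(1) by (simp add: shuffles_perm_def)
    then have "a i < length ?ys" using permutes_in_image[of a "{..<fan_dim \<Sigma>}" i] that(2) len by simp
    then show ?thesis using sub nth_mem by (metis subsetD)
  qed
  have Ac: "A a \<in> carrier (F_low R \<Sigma> p \<alpha>)" if a: "a \<in> ?S" for a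
  proof -
    have "set (map (\<lambda>i. ?ys ! a i) [0..<p]) \<subseteq> lat \<alpha>" using mem[OF a] p by auto
    from wedge_mem[OF this] show ?thesis
      unfolding A_def F_low_def by (intro tensor_one_closed[OF R FZ_zsubgroup]) simp
  qed
  have Bc: "B a \<in> carrier ?M" if a: "a \<in> ?S" for a
  proof -
    have "set (map (\<lambda>i. ?ys ! a i) [p..<fan_dim \<Sigma>]) \<subseteq> lat \<alpha>" using mem[OF a] by auto
    from wedge_mem[OF this] show ?thesis
      unfolding B_def F_low_def by (intro tensor_one_closed[OF R FZ_zsubgroup]) simp
  qed
  note U = dual_modD[OF u[unfolded F_up_def]]
  have uB: "u (A a) \<odot>\<^bsub>?M\<^esub> B a \<in> carrier ?M" if "a \<in> ?S" for a by (intro sm U(1) Ac Bc that)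
  {
    assume v: "v \<in> carrier (F_up R \<Sigma> p \<alpha>)"
    note V = dual_modD[OF v[unfolded F_up_def]]
    have vB: "v (A a) \<odot>\<^bsub>?M\<^esub> B a \<in> carrier ?M" if "a \<in> ?S" for a by (intro sm V(1) Ac Bc that)
    have fu: "(\<lambda>a. [k a] \<cdot>\<^bsub>?M\<^esub> (u (A a) \<odot>\<^bsub>?M\<^esub> B a)) \<in> ?S \<rightarrow> carrier ?M"
      and fv: "(\<lambda>a. [k a] \<cdot>\<^bsub>?M\<^esub> (v (A a) \<odot>\<^bsub>?M\<^esub> B a)) \<in> ?S \<rightarrow> carrier ?M"
      by (intro funcsetI M.M.add.int_pow_closed uB vB; assumption)+
    have "contraction R \<Sigma> p \<alpha> (u \<oplus>\<^bsub>F_up R \<Sigma> p \<alpha>\<^esub> v) ?ys =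
      (\<Oplus>\<^bsub>?M\<^esub>a\<in>?S. [k a] \<cdot>\<^bsub>?M\<^esub> (u (A a) \<odot>\<^bsub>?M\<^esub> B a) \<oplus>\<^bsub>?M\<^esub> [k a] \<cdot>\<^bsub>?M\<^esub> (v (A a) \<odot>\<^bsub>?M\<^esub> B a))"
      unfolding contr
    proof (rule M.M.finsum_cong'[OF refl])
      show "(\<lambda>a. [k a] \<cdot>\<^bsub>?M\<^esub> (u (A a) \<odot>\<^bsub>?M\<^esub> B a) \<oplus>\<^bsub>?M\<^esub> [k a] \<cdot>\<^bsub>?M\<^esub> (v (A a) \<odot>\<^bsub>?M\<^esub> B a)) \<in> ?S \<rightarrow> carrier ?M"
        by (intro funcsetI M.M.a_closed M.M.add.int_pow_closed uB vB)
      fix a assume a: "a \<in> ?S"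
      have "(u \<oplus>\<^bsub>F_up R \<Sigma> p \<alpha>\<^esub> v) (A a) = u (A a) \<oplus>\<^bsub>R\<^esub> v (A a)"
        using Ac[OF a] by (simp add: F_up_def dual_mod_simps(3))
      then show "[k a] \<cdot>\<^bsub>?M\<^esub> ((u \<oplus>\<^bsub>F_up R \<Sigma> p \<alpha>\<^esub> v) (A a) \<odot>\<^bsub>?M\<^esub> B a) =
        [k a] \<cdot>\<^bsub>?M\<^esub> (u (A a) \<odot>\<^bsub>?M\<^esub> B a) \<oplus>\<^bsub>?M\<^esub> [k a] \<cdot>\<^bsub>?M\<^esub> (v (A a) \<odot>\<^bsub>?M\<^esub> B a)"
        using module.smult_l_distr[OF M.module_axioms U(1)[OF Ac[OF a]] V(1)[OF Ac[OF a]] Bc[OF a]]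
          M.M.add.int_pow_distrib[OF uB[OF a] vB[OF a]] by simp
    qed
    also have "\<dots> = contraction R \<Sigma> p \<alpha> u ?ys \<oplus>\<^bsub>?M\<^esub> contraction R \<Sigma> p \<alpha> v ?ys"
      unfolding contr by (rule M.M.finsum_addf[OF fu fv])
    finally show "contraction R \<Sigma> p \<alpha> (u \<oplus>\<^bsub>F_up R \<Sigma> p \<alpha>\<^esub> v) ?ys =
      contraction R \<Sigma> p \<alpha> u ?ys \<oplus>\<^bsub>?M\<^esub> contraction R \<Sigma> p \<alpha> v ?ys" .
  next
    assume r: "r \<in> carrier R"
    have lin: "linear_map R ?M ?M (\<lambda>x. r \<odot>\<^bsub>?M\<^esub> x)"
      unfolding linear_map_def
    proof (intro conjI ballI funcsetI)
      fix x assume x: "x \<in> carrier ?M"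
      show "r \<odot>\<^bsub>?M\<^esub> x \<in> carrier ?M" by (rule sm[OF r x])
      show "r \<odot>\<^bsub>?M\<^esub> (x \<oplus>\<^bsub>?M\<^esub> y) = r \<odot>\<^bsub>?M\<^esub> x \<oplus>\<^bsub>?M\<^esub> r \<odot>\<^bsub>?M\<^esub> y" if "y \<in> carrier ?M" for y
        by (rule module.smult_r_distr[OF M.module_axioms r x that])
      show "r \<odot>\<^bsub>?M\<^esub> (s \<odot>\<^bsub>?M\<^esub> x) = s \<odot>\<^bsub>?M\<^esub> (r \<odot>\<^bsub>?M\<^esub> x)" if s: "s \<in> carrier R" for s
        using module.smult_assoc1[OF M.module_axioms r s x] module.smult_assoc1[OF M.module_axioms s r x]
          M.R.m_comm[OF r s] by simp
    qed
    have fu: "(\<lambda>a. [k a] \<cdot>\<^bsub>?M\<^esub> (u (A a) \<odot>\<^bsub>?M\<^esub> B a)) \<in> ?S \<rightarrow> carrier ?M"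
      by (intro funcsetI M.M.add.int_pow_closed uB)
    have "contraction R \<Sigma> p \<alpha> (r \<odot>\<^bsub>F_up R \<Sigma> p \<alpha>\<^esub> u) ?ys =
      (\<Oplus>\<^bsub>?M\<^esub>a\<in>?S. r \<odot>\<^bsub>?M\<^esub> ([k a] \<cdot>\<^bsub>?M\<^esub> (u (A a) \<odot>\<^bsub>?M\<^esub> B a)))"
      unfolding contr
    proof (rule M.M.finsum_cong'[OF refl])
      show "(\<lambda>a. r \<odot>\<^bsub>?M\<^esub> ([k a] \<cdot>\<^bsub>?M\<^esub> (u (A a) \<odot>\<^bsub>?M\<^esub> B a))) \<in> ?S \<rightarrow> carrier ?M"
        by (intro funcsetI sm r M.M.add.int_pow_closed uB)
      fix a assume a: "a \<in> ?S"
      have "(r \<odot>\<^bsub>F_up R \<Sigma> p \<alpha>\<^esub> u) (A a) = r \<otimes>\<^bsub>R\<^esub> u (A a)"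
        using Ac[OF a] by (simp add: F_up_def dual_mod_simps(4))
      then show "[k a] \<cdot>\<^bsub>?M\<^esub> ((r \<odot>\<^bsub>F_up R \<Sigma> p \<alpha>\<^esub> u) (A a) \<odot>\<^bsub>?M\<^esub> B a) = r \<odot>\<^bsub>?M\<^esub> ([k a] \<cdot>\<^bsub>?M\<^esub> (u (A a) \<odot>\<^bsub>?M\<^esub> B a))"
        using module.smult_assoc1[OF M.module_axioms r U(1)[OF Ac[OF a]] Bc[OF a]]
          linear_map_add_pow[OF M.module_axioms M.module_axioms lin uB[OF a], of "k a"] by simp
    qed
    also have "\<dots> = r \<odot>\<^bsub>?M\<^esub> contraction R \<Sigma> p \<alpha> u ?ys"
      unfolding contr by (rule linear_map_finsum[OF M.module_axioms M.module_axioms lin fu, symmetric])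
    finally show "contraction R \<Sigma> p \<alpha> (r \<odot>\<^bsub>F_up R \<Sigma> p \<alpha>\<^esub> u) ?ys = r \<odot>\<^bsub>?M\<^esub> contraction R \<Sigma> p \<alpha> u ?ys" .
  }
qed

lemma rho_linear:
  assumes f: "\<tau> face_of \<sigma>"
  shows "rho R \<Sigma> p \<tau> \<sigma> (u \<oplus>\<^bsub>F_up R \<Sigma> p \<tau>\<^esub> v) = rho R \<Sigma> p \<tau> \<sigma> u \<oplus>\<^bsub>F_up R \<Sigma> p \<sigma>\<^esub> rho R \<Sigma> p \<tau> \<sigma> v"
    and "rho R \<Sigma> p \<tau> \<sigma> (r \<odot>\<^bsub>F_up R \<Sigma> p \<tau>\<^esub> u) = r \<odot>\<^bsub>F_up R \<Sigma> p \<sigma>\<^esub> rho R \<Sigma> p \<tau> \<sigma> u"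
proof -
  note i = linear_mapD(1)[OF iota_linear[OF R f]]
  show "rho R \<Sigma> p \<tau> \<sigma> (u \<oplus>\<^bsub>F_up R \<Sigma> p \<tau>\<^esub> v) = rho R \<Sigma> p \<tau> \<sigma> u \<oplus>\<^bsub>F_up R \<Sigma> p \<sigma>\<^esub> rho R \<Sigma> p \<tau> \<sigma> v"
    unfolding rho_eq F_up_def dual_mod_simps(3) by (rule restrict_ext) (simp add: i)
  show "rho R \<Sigma> p \<tau> \<sigma> (r \<odot>\<^bsub>F_up R \<Sigma> p \<tau>\<^esub> u) = r \<odot>\<^bsub>F_up R \<Sigma> p \<sigma>\<^esub> rho R \<Sigma> p \<tau> \<sigma> u"
    unfolding rho_eq F_up_def dual_mod_simps(4) by (rule restrict_ext) (simp add: i)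
qed

lemma cap_linear:
  assumes \<alpha>: "\<alpha> \<in> max_cones \<Sigma>" "\<gamma> face_of \<alpha>" and p: "p \<le> fan_dim \<Sigma>" and u: "u \<in> carrier (F_up R \<Sigma> p \<gamma>)"
  shows "v \<in> carrier (F_up R \<Sigma> p \<gamma>) \<Longrightarrow>
      cap p \<gamma> \<alpha> (u \<oplus>\<^bsub>F_up R \<Sigma> p \<gamma>\<^esub> v) = cap p \<gamma> \<alpha> u \<oplus>\<^bsub>F_low R \<Sigma> (fan_dim \<Sigma> - p) \<alpha>\<^esub> cap p \<gamma> \<alpha> v"
    and "r \<in> carrier R \<Longrightarrow>
      cap p \<gamma> \<alpha> (r \<odot>\<^bsub>F_up R \<Sigma> p \<gamma>\<^esub> u) = r \<odot>\<^bsub>F_low R \<Sigma> (fan_dim \<Sigma> - p) \<alpha>\<^esub> cap p \<gamma> \<alpha> u"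
proof -
  let ?M = "F_low R \<Sigma> (fan_dim \<Sigma> - p) \<alpha>"
  interpret M: module R ?M by (rule F_low_module[OF R])
  note ru = rho_closed[OF R \<alpha>(2) u]
  note cu = contraction_closed[OF R ori \<alpha>(1) ru p]
  note wa = w[OF \<alpha>(1)]
  show "cap p \<gamma> \<alpha> (u \<oplus>\<^bsub>F_up R \<Sigma> p \<gamma>\<^esub> v) = cap p \<gamma> \<alpha> u \<oplus>\<^bsub>?M\<^esub> cap p \<gamma> \<alpha> v" if v: "v \<in> carrier (F_up R \<Sigma> p \<gamma>)"
  proof -
    note rv = rho_closed[OF R \<alpha>(2) v]
    show ?thesis
      unfolding cap_at_def rho_linear(1)[OF \<alpha>(2)] contraction_linear(1)[OF \<alpha>(1) p ru rv]
      by (rule module.smult_r_distr[OF M.module_axioms wa cu contraction_closed[OF R ori \<alpha>(1) rv p]])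
  qed
  show "cap p \<gamma> \<alpha> (r \<odot>\<^bsub>F_up R \<Sigma> p \<gamma>\<^esub> u) = r \<odot>\<^bsub>?M\<^esub> cap p \<gamma> \<alpha> u" if r: "r \<in> carrier R"
    unfolding cap_at_def rho_linear(2)[OF \<alpha>(2)] contraction_linear(2)[OF \<alpha>(1) p ru r]
    using module.smult_assoc1[OF M.module_axioms wa r cu] module.smult_assoc1[OF M.module_axioms r wa cu]
      M.R.m_comm[OF wa r] by simp
qed

text \<open>For \<open>\<gamma> = {0}\<close> these are the cycles of top dimension.\<close>

definition local_cycles :: "nat \<Rightarrow> (real ^ 'n) set \<Rightarrow> ((real ^ 'n) set \<Rightarrow> ('r, 'n) mvec) set" where
  "local_cycles p \<gamma> = {c \<in> (\<Pi>\<^sub>E \<alpha>\<in>{\<alpha> \<in> max_cones \<Sigma>. \<gamma> face_of \<alpha>}. carrier (F_low R \<Sigma> p \<alpha>)).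
     \<forall>\<kappa>\<in>\<Sigma>. \<gamma> face_of \<kappa> \<and> Suc (dim \<kappa>) = fan_dim \<Sigma> \<longrightarrow> facet_sum R \<Sigma> ori p \<kappa> c = \<zero>\<^bsub>F_low R \<Sigma> p \<kappa>\<^esub>}"

definition local_cap ::
  "nat \<Rightarrow> (real ^ 'n) set \<Rightarrow> (('r, 'n) mvec \<Rightarrow> 'r) \<Rightarrow> (real ^ 'n) set \<Rightarrow> ('r, 'n) mvec" where
  "local_cap p \<gamma> u = (\<lambda>\<alpha>\<in>{\<alpha> \<in> max_cones \<Sigma>. \<gamma> face_of \<alpha>}. cap p \<gamma> \<alpha> u)"

text \<open>For \<open>\<gamma> = {0}\<close> this is duality of the fan in degree zero, for other cones that of the star.\<close>

definition local_duality :: "nat \<Rightarrow> (real ^ 'n) set \<Rightarrow> bool" where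
  "local_duality p \<gamma> \<longleftrightarrow>
    bij_betw (local_cap p \<gamma>) (carrier (F_up R \<Sigma> p \<gamma>)) (local_cycles (fan_dim \<Sigma> - p) \<gamma>)"

lemma cones_below: "q < 0 \<Longrightarrow> cones \<Sigma> q = {}" by (auto simp: cones_def)

lemma cones_above: "int (fan_dim \<Sigma>) < q \<Longrightarrow> cones \<Sigma> q = {}"
  using dim_le by (fastforce simp: cones_def)

lemma cones_0: "cones \<Sigma> 0 = {{0}}"
proof -
  have "\<sigma> = {0}" if "\<sigma> \<in> \<Sigma>" "dim \<sigma> = 0" for \<sigma> using dim_0_cone[OF cone[OF that(1)]] that(2) by simp
  then show ?thesis using vertex_mem by (auto simp: cones_def)
qed

lemma compact_cones_eq: "compact_cones \<Sigma> q = (if q = 0 then {{0}} else {})"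
proof -
  have eq: "\<sigma> \<in> \<Sigma> \<and> compact \<sigma> \<longleftrightarrow> \<sigma> = {0}" for \<sigma>
    using compact_cone_trivial[OF cone[of \<sigma>]] vertex_mem compact_sing by metis
  have "compact_cones \<Sigma> q = {\<sigma>. (\<sigma> \<in> \<Sigma> \<and> compact \<sigma>) \<and> int (dim \<sigma>) = q}"
    by (auto simp: compact_cones_def cones_def)
  then show ?thesis unfolding eq by auto
qed

lemma codim_one_cones: "cones \<Sigma> (int (fan_dim \<Sigma>) - 1) = {\<kappa> \<in> \<Sigma>. Suc (dim \<kappa>) = fan_dim \<Sigma>}"
  by (auto simp: cones_def)

lemma dsum_simps:
  "carrier (dsum_mod I M) = (\<Pi>\<^sub>E i\<in>I. carrier (M i))" "\<zero>\<^bsub>dsum_mod I M\<^esub> = (\<lambda>i\<in>I. \<zero>\<^bsub>M i\<^esub>)"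
  "f \<oplus>\<^bsub>dsum_mod I M\<^esub> g = (\<lambda>i\<in>I. f i \<oplus>\<^bsub>M i\<^esub> g i)" "r \<odot>\<^bsub>dsum_mod I M\<^esub> f = (\<lambda>i\<in>I. r \<odot>\<^bsub>M i\<^esub> f i)"
  by (simp_all add: dsum_mod_def)

lemma restrict_eq_iff: "(\<lambda>i\<in>I. f i) = (\<lambda>i\<in>I. g i) \<longleftrightarrow> (\<forall>i\<in>I. f i = g i)"
  by (metis restrict_apply' restrict_ext)

lemma top_cycles: "BM_cycles R \<Sigma> ori p (int (fan_dim \<Sigma>)) = local_cycles p {0}"
proof -
  have v: "{\<alpha> \<in> max_cones \<Sigma>. {0} face_of \<alpha>} = max_cones \<Sigma>"
    using vertex_face_of by (auto simp: max_cones_iff)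
  have k: "(\<forall>\<kappa>\<in>{\<kappa> \<in> \<Sigma>. Suc (dim \<kappa>) = fan_dim \<Sigma>}. P \<kappa>) \<longleftrightarrow>
      (\<forall>\<kappa>\<in>\<Sigma>. {0} face_of \<kappa> \<and> Suc (dim \<kappa>) = fan_dim \<Sigma> \<longrightarrow> P \<kappa>)" for P
    using vertex_face_of by auto
  show ?thesis
    unfolding BM_cycles_def a_kernel_def' local_cycles_def BM_chains_def dsum_simps BM_boundary_def
      codim_one_cones restrict_eq_iff v k[symmetric]
    by (simp add: facet_sum_def max_cones_def)
qed

lemma top_boundaries:
  "BM_boundaries R \<Sigma> ori p (int (fan_dim \<Sigma>)) = {\<zero>\<^bsub>BM_chains R \<Sigma> p (int (fan_dim \<Sigma>))\<^esub>}"
proof -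
  have "cones \<Sigma> (int (fan_dim \<Sigma>) + 1) = {}" by (rule cones_above) simp
  then have "BM_boundary R \<Sigma> ori p (int (fan_dim \<Sigma>) + 1) z = \<zero>\<^bsub>BM_chains R \<Sigma> p (int (fan_dim \<Sigma>))\<^esub>" for z
    by (simp add: BM_boundary_def BM_chains_def dsum_simps finsum_empty_general[OF abelian_monoid.zero_closed[
          OF abelian_group.axioms(1)[OF module.axioms(2)[OF F_low_module[OF R]]]]])
  moreover have "carrier (BM_chains R \<Sigma> p (int (fan_dim \<Sigma>) + 1)) \<noteq> {}"
    using \<open>cones \<Sigma> (int (fan_dim \<Sigma>) + 1) = {}\<close> by (simp add: BM_chains_def dsum_simps)
  ultimately show ?thesis unfolding BM_boundaries_def by (auto simp: image_constant_conv)
qed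

end

lemma zero_coset_map:
  assumes "\<zero>\<^bsub>N\<^esub> \<oplus>\<^bsub>N\<^esub> f x = f x"
  shows "quot_map N {\<zero>\<^bsub>N\<^esub>} f {x} = {f x}"
  using assms by (simp add: quot_map_def a_r_coset_def')

lemma quot_by_zero:
  assumes zero: "\<forall>x\<in>Z. \<zero>\<^bsub>M\<^esub> \<oplus>\<^bsub>M\<^esub> x = x"
  shows "carrier (quot_mod (M\<lparr>carrier := Z\<rparr>) {\<zero>\<^bsub>M\<^esub>}) = (\<lambda>x. {x}) ` Z"
    and "{x} \<oplus>\<^bsub>quot_mod (M\<lparr>carrier := Z\<rparr>) {\<zero>\<^bsub>M\<^esub>}\<^esub> {y} = {x \<oplus>\<^bsub>M\<^esub> y}"
    and "r \<odot>\<^bsub>M\<^esub> x \<in> Z \<Longrightarrow> r \<odot>\<^bsub>quot_mod (M\<lparr>carrier := Z\<rparr>) {\<zero>\<^bsub>M\<^esub>}\<^esub> {x} = {r \<odot>\<^bsub>M\<^esub> x}"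
proof -
  have "a_rcosets\<^bsub>M\<lparr>carrier := Z\<rparr>\<^esub> {\<zero>\<^bsub>M\<^esub>} = (\<Union>x\<in>Z. {{\<zero>\<^bsub>M\<^esub> \<oplus>\<^bsub>M\<^esub> x}})"
    by (simp add: A_RCOSETS_def' a_r_coset_def')
  also have "\<dots> = (\<Union>x\<in>Z. {{x}})" by (rule SUP_cong[OF refl]) (simp add: zero)
  finally show "carrier (quot_mod (M\<lparr>carrier := Z\<rparr>) {\<zero>\<^bsub>M\<^esub>}) = (\<lambda>x. {x}) ` Z"
    by (simp add: quot_mod_simps UNION_singleton_eq_range)
  show "{x} \<oplus>\<^bsub>quot_mod (M\<lparr>carrier := Z\<rparr>) {\<zero>\<^bsub>M\<^esub>}\<^esub> {y} = {x \<oplus>\<^bsub>M\<^esub> y}"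
    by (simp add: quot_mod_simps set_add_def')
  show "r \<odot>\<^bsub>quot_mod (M\<lparr>carrier := Z\<rparr>) {\<zero>\<^bsub>M\<^esub>}\<^esub> {x} = {r \<odot>\<^bsub>M\<^esub> x}" if "r \<odot>\<^bsub>M\<^esub> x \<in> Z"
    using bspec[OF zero that] by (simp add: quot_mod_simps quot_map_def a_r_coset_def')
qed

text \<open>Cohomology in degree zero and homology in the top degree are quotients by zero; an isomorphism
  between them is an isomorphism of the modules of cocycles and cycles.\<close>

lemma mod_iso_quot_by_zero:
  assumes Z: "\<And>x. x \<in> Z \<Longrightarrow> \<zero>\<^bsub>M\<^esub> \<oplus>\<^bsub>M\<^esub> x = x" and W: "\<And>x. x \<in> W \<Longrightarrow> \<zero>\<^bsub>N\<^esub> \<oplus>\<^bsub>N\<^esub> x = x"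
    and f: "\<And>x. x \<in> Z \<Longrightarrow> \<zero>\<^bsub>N\<^esub> \<oplus>\<^bsub>N\<^esub> f x = f x"
    and Z_closed: "\<And>x y. x \<in> Z \<Longrightarrow> y \<in> Z \<Longrightarrow> x \<oplus>\<^bsub>M\<^esub> y \<in> Z" "\<And>r x. r \<in> carrier R \<Longrightarrow> x \<in> Z \<Longrightarrow> r \<odot>\<^bsub>M\<^esub> x \<in> Z"
    and add: "\<And>x y. x \<in> Z \<Longrightarrow> y \<in> Z \<Longrightarrow> f (x \<oplus>\<^bsub>M\<^esub> y) = f x \<oplus>\<^bsub>N\<^esub> f y"
    and smult: "\<And>r x. r \<in> carrier R \<Longrightarrow> x \<in> Z \<Longrightarrow> f (r \<odot>\<^bsub>M\<^esub> x) = r \<odot>\<^bsub>N\<^esub> f x"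
  shows "mod_iso R (quot_mod (M\<lparr>carrier := Z\<rparr>) {\<zero>\<^bsub>M\<^esub>}) (quot_mod (N\<lparr>carrier := W\<rparr>) {\<zero>\<^bsub>N\<^esub>})
      (quot_map N {\<zero>\<^bsub>N\<^esub>} f) \<longleftrightarrow> bij_betw f Z W"
proof -
  let ?s = "\<lambda>x. {x}" and ?g = "quot_map N {\<zero>\<^bsub>N\<^esub>} f"
  have "\<forall>x\<in>Z. \<zero>\<^bsub>M\<^esub> \<oplus>\<^bsub>M\<^esub> x = x" "\<forall>x\<in>W. \<zero>\<^bsub>N\<^esub> \<oplus>\<^bsub>N\<^esub> x = x" using Z W by simp_all
  note QM = quot_by_zero[OF this(1)] and QN = quot_by_zero[OF this(2)]
  have g: "?g {x} = {f x}" if "x \<in> Z" for x by (rule zero_coset_map[of N f x, OF f[OF that]])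
  have sZ: "bij_betw ?s Z (?s ` Z)" and sW: "bij_betw ?s W (?s ` W)"
    by (simp_all add: bij_betw_def inj_on_def)
  have "bij_betw ?g (?s ` Z) (?s ` W) \<longleftrightarrow> bij_betw (?g \<circ> ?s) Z (?s ` W)"
    by (rule bij_betw_comp_iff[OF sZ])
  also have "\<dots> \<longleftrightarrow> bij_betw (\<lambda>x. {f x}) Z (?s ` W)" by (rule bij_betw_cong) (simp add: g)
  also have "\<dots> \<longleftrightarrow> bij_betw f Z W"
  proof
    assume b: "bij_betw (\<lambda>x. {f x}) Z (?s ` W)"
    have "inj_on f Z" using bij_betw_imp_inj_on[OF b] by (simp add: inj_on_def)
    moreover have "?s ` (f ` Z) = ?s ` W" using bij_betw_imp_surj_on[OF b] by (simp add: image_image)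
    then have "f ` Z = W" by (simp add: inj_image_eq_iff inj_def)
    ultimately show "bij_betw f Z W" by (simp add: bij_betw_def)
  next
    assume b: "bij_betw f Z W"
    show "bij_betw (\<lambda>x. {f x}) Z (?s ` W)" using bij_betw_trans[OF b sW] by (simp add: comp_def)
  qed
  finally have bij: "bij_betw ?g (?s ` Z) (?s ` W) \<longleftrightarrow> bij_betw f Z W" .
  have lin: "?g (X \<oplus>\<^bsub>quot_mod (M\<lparr>carrier := Z\<rparr>) {\<zero>\<^bsub>M\<^esub>}\<^esub> Y) = ?g X \<oplus>\<^bsub>quot_mod (N\<lparr>carrier := W\<rparr>) {\<zero>\<^bsub>N\<^esub>}\<^esub> ?g Y"
    if X: "X \<in> ?s ` Z" and Y: "Y \<in> ?s ` Z" for X Y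
  proof -
    obtain x y where x: "X = {x}" "x \<in> Z" and y: "Y = {y}" "y \<in> Z" using X Y by auto
    show ?thesis
      unfolding x(1) y(1) QM(2) g[OF x(2)] g[OF y(2)] g[OF Z_closed(1)[OF x(2) y(2)]] QN(2) add[OF x(2) y(2)] ..
  qed
  show ?thesis
  proof
    assume "mod_iso R (quot_mod (M\<lparr>carrier := Z\<rparr>) {\<zero>\<^bsub>M\<^esub>}) (quot_mod (N\<lparr>carrier := W\<rparr>) {\<zero>\<^bsub>N\<^esub>}) ?g"
    then have "bij_betw ?g (?s ` Z) (?s ` W)" unfolding mod_iso_def QM(1) QN(1) by simp
    then show "bij_betw f Z W" unfolding bij .
  next
    assume b: "bij_betw f Z W"
    have "?g (r \<odot>\<^bsub>quot_mod (M\<lparr>carrier := Z\<rparr>) {\<zero>\<^bsub>M\<^esub>}\<^esub> X) = r \<odot>\<^bsub>quot_mod (N\<lparr>carrier := W\<rparr>) {\<zero>\<^bsub>N\<^esub>}\<^esub> ?g X"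
      if r: "r \<in> carrier R" and X: "X \<in> ?s ` Z" for r X
    proof -
      obtain x where x: "X = {x}" "x \<in> Z" using X by auto
      have "f (r \<odot>\<^bsub>M\<^esub> x) \<in> W" using bij_betwE[OF b] Z_closed(2)[OF r x(2)] by simp
      then have rf: "r \<odot>\<^bsub>N\<^esub> f x \<in> W" unfolding smult[OF r x(2)] .
      show ?thesis
        unfolding x(1) QM(3)[OF Z_closed(2)[OF r x(2)]] g[OF x(2)] g[OF Z_closed(2)[OF r x(2)]] QN(3)[OF rf]
          smult[OF r x(2)] ..
    qed
    then show "mod_iso R (quot_mod (M\<lparr>carrier := Z\<rparr>) {\<zero>\<^bsub>M\<^esub>}) (quot_mod (N\<lparr>carrier := W\<rparr>) {\<zero>\<^bsub>N\<^esub>}) ?g"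
      unfolding mod_iso_def QM(1) QN(1) using lin b bij by simp
  qed
qed

context weighted_fan
begin

abbreviation "d \<equiv> fan_dim \<Sigma>"

lemma chains_zero_add:
  assumes "z \<in> carrier (BM_chains R \<Sigma> p q)"
  shows "\<zero>\<^bsub>BM_chains R \<Sigma> p q\<^esub> \<oplus>\<^bsub>BM_chains R \<Sigma> p q\<^esub> z = z"
proof -
  have z: "z \<in> (\<Pi>\<^sub>E \<sigma>\<in>cones \<Sigma> q. carrier (F_low R \<Sigma> p \<sigma>))" using assms by (simp add: BM_chains_def dsum_simps)
  have "\<zero>\<^bsub>F_low R \<Sigma> p \<sigma>\<^esub> \<oplus>\<^bsub>F_low R \<Sigma> p \<sigma>\<^esub> z \<sigma> = z \<sigma>" if "\<sigma> \<in> cones \<Sigma> q" for \<sigma>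
    using abelian_monoid.l_zero[OF abelian_group.axioms(1)[OF module.axioms(2)[OF F_low_module[OF R]]]] PiE_mem[OF z that] by simp
  then show ?thesis
    unfolding BM_chains_def dsum_simps
    by (intro extensionalityI[of _ "cones \<Sigma> q"]) (use z in \<open>simp_all add: PiE_iff\<close>)
qed

lemma cochains_0:
  "carrier (cochains R \<Sigma> p 0) = (\<Pi>\<^sub>E \<sigma>\<in>{{0}}. carrier (F_up R \<Sigma> p \<sigma>))"
  "cocycles R \<Sigma> ori p 0 = carrier (cochains R \<Sigma> p 0)"
  "coboundaries R \<Sigma> ori p 0 = {\<zero>\<^bsub>cochains R \<Sigma> p 0\<^esub>}"
proof -
  show "carrier (cochains R \<Sigma> p 0) = (\<Pi>\<^sub>E \<sigma>\<in>{{0}}. carrier (F_up R \<Sigma> p \<sigma>))"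
    by (simp add: cochains_def dsum_simps compact_cones_eq)
  have "coboundary R \<Sigma> ori p 0 u = \<zero>\<^bsub>cochains R \<Sigma> p (0 + 1)\<^esub>" for u
    by (simp add: coboundary_def cochains_def dsum_simps compact_cones_eq restrict_def)
  then show "cocycles R \<Sigma> ori p 0 = carrier (cochains R \<Sigma> p 0)"
    by (simp add: cocycles_def a_kernel_def')
  have "coboundary R \<Sigma> ori p (0 - 1) u = \<zero>\<^bsub>cochains R \<Sigma> p 0\<^esub>" for u
    by (simp add: coboundary_def cochains_def dsum_simps compact_cones_eq F_up_def
        finsum_empty_general[OF dual_mod_closed(1)[OF F_low_module[OF R]]])
  moreover have "carrier (cochains R \<Sigma> p (0 - 1)) \<noteq> {}"
    by (simp add: cochains_def dsum_simps compact_cones_eq)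
  ultimately show "coboundaries R \<Sigma> ori p 0 = {\<zero>\<^bsub>cochains R \<Sigma> p 0\<^esub>}"
    by (simp add: coboundaries_def image_constant_conv)
qed

lemma cap_chain_0:
  assumes p: "p \<le> d" and u: "u \<in> carrier (cochains R \<Sigma> p 0)"
  shows "cap_chain R \<Sigma> ori w p 0 u = local_cap p {0} (u {0})"
proof -
  have u0: "u {0} \<in> carrier (F_up R \<Sigma> p {0})" using u unfolding cochains_0 by (simp add: PiE_iff)
  have v: "{\<alpha> \<in> max_cones \<Sigma>. {0} face_of \<alpha>} = max_cones \<Sigma>"
    using vertex_face_of by (auto simp: max_cones_iff)
  show ?thesis
    unfolding cap_chain_def local_cap_def v
  proof (simp only: diff_zero, unfold max_cones_def[symmetric], rule restrict_ext)
    fix \<alpha> assume \<alpha>: "\<alpha> \<in> max_cones \<Sigma>"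
    then have \<alpha>': "\<alpha> \<in> \<Sigma>" by (simp add: max_cones_iff)
    let ?M = "F_low R \<Sigma> (d - p) \<alpha>"
    interpret M: module R ?M by (rule F_low_module[OF R])
    have one: "{\<alpha>' \<in> max_cones \<Sigma>. {0} face_of \<alpha>' \<and> \<alpha> face_of \<alpha>'} = {\<alpha>}"
      using max_cone_face[OF \<alpha>] \<alpha> face_self[OF \<alpha>'] vertex_face_of[OF \<alpha>'] by (auto simp: max_cones_iff)
    note cl = contraction_closed[OF R ori \<alpha> rho_closed[OF R vertex_face_of[OF \<alpha>'] u0] p]
    note cap = cap_closed[OF \<alpha> vertex_face_of[OF \<alpha>'] u0 p]
    have "(\<Oplus>\<^bsub>?M\<^esub>\<alpha>'\<in>{\<alpha>}. w \<alpha>' \<odot>\<^bsub>?M\<^esub> iota R \<Sigma> (d - p) \<alpha> (contraction R \<Sigma> p \<alpha>' (rho R \<Sigma> p {0} \<alpha>' (u {0})) (ori \<alpha>'))) =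
        cap p {0} \<alpha> (u {0})"
      using cap iota_id[OF R cl] by (simp add: M.M.finsum_insert cap_at_def)
    then have "(\<Oplus>\<^bsub>?M\<^esub>\<gamma>\<in>{{0}}. \<Oplus>\<^bsub>?M\<^esub>\<alpha>'\<in>{\<alpha>' \<in> max_cones \<Sigma>. \<gamma> face_of \<alpha>' \<and> \<alpha> face_of \<alpha>'}.
        w \<alpha>' \<odot>\<^bsub>?M\<^esub> iota R \<Sigma> (d - p) \<alpha> (contraction R \<Sigma> p \<alpha>' (rho R \<Sigma> p \<gamma> \<alpha>' (u \<gamma>)) (ori \<alpha>'))) =
        cap p {0} \<alpha> (u {0})"
      using cap by (simp add: M.M.finsum_insert one)
    then show "(let M = ?M in \<Oplus>\<^bsub>M\<^esub>\<gamma>\<in>compact_cones \<Sigma> 0. \<Oplus>\<^bsub>M\<^esub>\<alpha>'\<in>{\<alpha>' \<in> max_cones \<Sigma>. \<gamma> face_of \<alpha>' \<and> \<alpha> face_of \<alpha>'}.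
        w \<alpha>' \<odot>\<^bsub>M\<^esub> iota R \<Sigma> (d - p) \<alpha> (contraction R \<Sigma> p \<alpha>' (rho R \<Sigma> p \<gamma> \<alpha>' (u \<gamma>)) (ori \<alpha>'))) =
        cap p {0} \<alpha> (u {0})"
      by (simp add: compact_cones_eq Let_def)
  qed
qed

lemma local_cap_closed:
  assumes "p \<le> d" "u \<in> carrier (F_up R \<Sigma> p \<gamma>)"
  shows "local_cap p \<gamma> u \<in> (\<Pi>\<^sub>E \<alpha>\<in>{\<alpha> \<in> max_cones \<Sigma>. \<gamma> face_of \<alpha>}. carrier (F_low R \<Sigma> (d - p) \<alpha>))"
  unfolding local_cap_def by (intro restrict_PiE_iff[THEN iffD2] ballI) (use assms in \<open>simp add: cap_closed\<close>)

theorem duality_in_degree_0: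
  assumes p: "p \<le> d"
  shows "mod_iso R (cohomology R \<Sigma> ori p 0) (BM_homology R \<Sigma> ori (d - p) (int d - 0)) (cap_product R \<Sigma> ori w p 0)
    \<longleftrightarrow> local_duality p {0}"
proof -
  let ?M = "cochains R \<Sigma> p 0" and ?N = "BM_chains R \<Sigma> (d - p) (int d)" and ?f = "cap_chain R \<Sigma> ori w p 0"
  have v: "{\<alpha> \<in> max_cones \<Sigma>. {0} face_of \<alpha>} = max_cones \<Sigma>"
    using vertex_face_of by (auto simp: max_cones_iff)
  have vf: "{0} face_of \<alpha>" if "\<alpha> \<in> max_cones \<Sigma>" for \<alpha> using that vertex_face_of by (simp add: max_cones_iff)
  have N: "carrier ?N = (\<Pi>\<^sub>E \<alpha>\<in>max_cones \<Sigma>. carrier (F_low R \<Sigma> (d - p) \<alpha>))"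
    by (simp add: BM_chains_def dsum_simps max_cones_def)
  have U: "u {0} \<in> carrier (F_up R \<Sigma> p {0})" if "u \<in> carrier ?M" for u
    using that unfolding cochains_0 by (simp add: PiE_iff)
  note D = dual_mod_closed[OF F_low_module[OF R], folded F_up_def]
  have ops: "\<zero>\<^bsub>?M\<^esub> = (\<lambda>\<sigma>\<in>{{0}}. \<zero>\<^bsub>F_up R \<Sigma> p \<sigma>\<^esub>)"
    "u \<oplus>\<^bsub>?M\<^esub> u' = (\<lambda>\<sigma>\<in>{{0}}. u \<sigma> \<oplus>\<^bsub>F_up R \<Sigma> p \<sigma>\<^esub> u' \<sigma>)"
    "r \<odot>\<^bsub>?M\<^esub> u = (\<lambda>\<sigma>\<in>{{0}}. r \<odot>\<^bsub>F_up R \<Sigma> p \<sigma>\<^esub> u \<sigma>)" for u u' r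
    by (simp_all add: cochains_def dsum_simps compact_cones_eq)
  have M1: "u \<oplus>\<^bsub>?M\<^esub> u' \<in> carrier ?M" if "u \<in> carrier ?M" "u' \<in> carrier ?M" for u u'
    unfolding ops cochains_0(1) using D(2)[OF U[OF that(1)] U[OF that(2)]] by (simp add: PiE_iff)
  have M2: "r \<odot>\<^bsub>?M\<^esub> u \<in> carrier ?M" if "r \<in> carrier R" "u \<in> carrier ?M" for u r
    unfolding ops cochains_0(1) using D(3)[OF that(1) U[OF that(2)]] by (simp add: PiE_iff)
  have f: "?f u = (\<lambda>\<alpha>\<in>max_cones \<Sigma>. cap p {0} \<alpha> (u {0}))" if "u \<in> carrier ?M" for u
    unfolding cap_chain_0[OF p that] local_cap_def v ..
  have fN: "?f u \<in> carrier ?N" if "u \<in> carrier ?M" for u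
    unfolding cap_chain_0[OF p that] N using local_cap_closed[OF p U[OF that]] unfolding v .
  have W: "BM_cycles R \<Sigma> ori (d - p) (int d) \<subseteq> carrier ?N"
    by (simp add: BM_cycles_def a_kernel_def')
  have "mod_iso R (quot_mod (?M\<lparr>carrier := carrier ?M\<rparr>) {\<zero>\<^bsub>?M\<^esub>})
      (quot_mod (?N\<lparr>carrier := BM_cycles R \<Sigma> ori (d - p) (int d)\<rparr>) {\<zero>\<^bsub>?N\<^esub>}) (quot_map ?N {\<zero>\<^bsub>?N\<^esub>} ?f)
    \<longleftrightarrow> bij_betw ?f (carrier ?M) (BM_cycles R \<Sigma> ori (d - p) (int d))"
  proof (rule mod_iso_quot_by_zero)
    show "\<zero>\<^bsub>?N\<^esub> \<oplus>\<^bsub>?N\<^esub> x = x" if "x \<in> BM_cycles R \<Sigma> ori (d - p) (int d)" for x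
      by (rule chains_zero_add[OF subsetD[OF W that]])
    fix u assume u: "u \<in> carrier ?M"
    show "\<zero>\<^bsub>?N\<^esub> \<oplus>\<^bsub>?N\<^esub> ?f u = ?f u" by (rule chains_zero_add[OF fN[OF u]])
    show "\<zero>\<^bsub>?M\<^esub> \<oplus>\<^bsub>?M\<^esub> u = u"
    proof (rule extensionalityI[of _ "{{0}}"])
      show "u \<in> extensional {{0}}" using u unfolding cochains_0 by (simp add: PiE_iff)
    qed (simp_all add: ops D(4)[OF U[OF u]])
    show "r \<odot>\<^bsub>?M\<^esub> u \<in> carrier ?M" if "r \<in> carrier R" for r by (rule M2[OF that u])
    show "?f (r \<odot>\<^bsub>?M\<^esub> u) = r \<odot>\<^bsub>?N\<^esub> ?f u" if r: "r \<in> carrier R" for r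
      unfolding f[OF u] f[OF M2[OF r u]] BM_chains_def dsum_simps max_cones_def[symmetric]
      by (rule restrict_ext) (simp add: ops cap_linear(2)[OF _ vf p U[OF u] r])
    fix u' assume u': "u' \<in> carrier ?M"
    show "u \<oplus>\<^bsub>?M\<^esub> u' \<in> carrier ?M" by (rule M1[OF u u'])
    show "?f (u \<oplus>\<^bsub>?M\<^esub> u') = ?f u \<oplus>\<^bsub>?N\<^esub> ?f u'"
      unfolding f[OF u] f[OF u'] f[OF M1[OF u u']] BM_chains_def dsum_simps max_cones_def[symmetric]
      by (rule restrict_ext) (simp add: ops cap_linear(1)[OF _ vf p U[OF u] U[OF u']])
  qed
  also have "\<dots> \<longleftrightarrow> bij_betw (?f \<circ> (\<lambda>u. \<lambda>\<sigma>\<in>{{0}}. u)) (carrier (F_up R \<Sigma> p {0})) (BM_cycles R \<Sigma> ori (d - p) (int d))"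
  proof (rule bij_betw_comp_iff)
    show "bij_betw (\<lambda>u. \<lambda>\<sigma>\<in>{{0}}. u) (carrier (F_up R \<Sigma> p {0})) (carrier ?M)"
      unfolding cochains_0
    proof (rule bij_betw_byWitness[where f' = "\<lambda>u. u {0}"])
      show "\<forall>u\<in>carrier (F_up R \<Sigma> p {0}). (\<lambda>\<sigma>\<in>{{0}}. u) {0} = u" by simp
      show "\<forall>u\<in>\<Pi>\<^sub>E \<sigma>\<in>{{0}}. carrier (F_up R \<Sigma> p \<sigma>). (\<lambda>\<sigma>\<in>{{0}}. u {0}) = u"
      proof
        fix u assume u: "u \<in> (\<Pi>\<^sub>E \<sigma>\<in>{{0}}. carrier (F_up R \<Sigma> p \<sigma>))"
        show "(\<lambda>\<sigma>\<in>{{0}}. u {0}) = u"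
          by (rule extensionalityI[of _ "{{0}}"]) (use u in \<open>simp_all add: PiE_iff\<close>)
      qed
      show "(\<lambda>u. \<lambda>\<sigma>\<in>{{0}}. u) ` carrier (F_up R \<Sigma> p {0}) \<subseteq> (\<Pi>\<^sub>E \<sigma>\<in>{{0}}. carrier (F_up R \<Sigma> p \<sigma>))"
        by (auto simp: PiE_iff)
      show "(\<lambda>u. u {0}) ` (\<Pi>\<^sub>E \<sigma>\<in>{{0}}. carrier (F_up R \<Sigma> p \<sigma>)) \<subseteq> carrier (F_up R \<Sigma> p {0})"
        by (auto simp: PiE_iff)
    qed
  qed
  also have "\<dots> \<longleftrightarrow> local_duality p {0}"
    unfolding local_duality_def top_cycles
  proof (rule bij_betw_cong)
    fix u assume u: "u \<in> carrier (F_up R \<Sigma> p {0})"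
    then have "(\<lambda>\<sigma>\<in>{{0}}. u) \<in> carrier ?M" unfolding cochains_0 by (simp add: PiE_iff)
    from cap_chain_0[OF p this] show "(?f \<circ> (\<lambda>u. \<lambda>\<sigma>\<in>{{0}}. u)) u = local_cap p {0} u" by simp
  qed
  finally show ?thesis
    by (simp add: cohomology_def BM_homology_def cap_product_def cochains_0(2,3) top_boundaries)
qed

lemma facet_sum_cong:
  assumes "\<And>\<sigma>. \<sigma> \<in> max_cones \<Sigma> \<Longrightarrow> \<tau> face_of \<sigma> \<Longrightarrow> c \<sigma> = c' \<sigma> \<and> c' \<sigma> \<in> carrier (F_low R \<Sigma> p \<sigma>)"
  shows "facet_sum R \<Sigma> ori p \<tau> c = facet_sum R \<Sigma> ori p \<tau> c'"
proof -
  interpret M: module R "F_low R \<Sigma> p \<tau>" by (rule F_low_module[OF R])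
  have it: "iota R \<Sigma> p \<tau> (c' \<sigma>) \<in> carrier (F_low R \<Sigma> p \<tau>)" if "\<sigma> \<in> max_cones \<Sigma>" "\<tau> face_of \<sigma>" for \<sigma>
    by (rule linear_mapD(1)[OF iota_linear[OF R that(2)]]) (use assms[OF that] in simp)
  show ?thesis
    unfolding facet_sum_def
  proof (rule M.M.finsum_cong'[OF refl])
    show "(\<lambda>\<sigma>. [rel_sign ori \<tau> \<sigma>] \<cdot>\<^bsub>F_low R \<Sigma> p \<tau>\<^esub> iota R \<Sigma> p \<tau> (c' \<sigma>)) \<in> {\<sigma> \<in> max_cones \<Sigma>. \<tau> face_of \<sigma>} \<rightarrow> carrier (F_low R \<Sigma> p \<tau>)"
      by (intro funcsetI M.M.add.int_pow_closed it) simp_all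
  qed (use assms in simp)
qed

end

section \<open>Duality of a star as local duality\<close>

locale weighted_star = weighted_fan \<Sigma> R ori w + oriented_star \<Sigma> \<gamma> S ori so
  for \<Sigma> :: "(real ^ 'n) set set" and R :: "('r, 'm) ring_scheme" and ori w \<gamma> S so
begin

sublocale SW: weighted_fan S R so "star_weight \<Sigma> w \<gamma>"
proof (intro weighted_fan.intro weighted_fan_axioms.intro)
  show "fan S" by (rule S.fan_axioms)
  show "cring R" by (rule R)
  show "orientation S so" by (rule so)
  show "star_weight \<Sigma> w \<gamma> \<beta> \<in> carrier R" if "\<beta> \<in> max_cones S" for \<beta>
    unfolding star_weight_eq by (rule w) (rule aroundD(4)[OF cell_carrier(1)[OF that]])
qed

lemma star_chainI:
  assumes "\<And>\<alpha>. \<alpha> \<in> around \<Longrightarrow> c \<alpha> \<in> carrier (F_low R \<Sigma> p \<alpha>)"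
  shows "star_chain \<Sigma> \<gamma> S ori so R p c"
  by (intro star_chain.intro star_chain_axioms.intro oriented_star_axioms R assms)

lemma F_up_star_vertex: "F_up R S p {0} = F_up R \<Sigma> p \<gamma>"
  by (simp add: F_up_def F_low_def FZ_star_vertex)

text \<open>A functional at \<open>\<gamma>\<close> is a functional at the vertex of the star. Its contractions by a cell and by the carrier are
  values of the same alternating function at two oriented bases.\<close>

lemma cap_star:
  assumes p: "p \<le> d" and \<beta>: "\<beta> \<in> max_cones S" and u: "u \<in> carrier (F_up R \<Sigma> p \<gamma>)"
  shows "SW.cap p {0} \<beta> u = lifted_family R (d - p) (\<lambda>\<alpha>. cap p \<gamma> \<alpha> u) \<beta>"
proof -
  let ?\<alpha> = "cell_carrier \<beta>" and ?M = "F_low R S (d - p) \<beta>"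
  note \<alpha> = aroundD[OF cell_carrier(1)[OF \<beta>]]
  have S\<beta>: "\<beta> \<in> S" using \<beta> by (simp add: S.max_cones_iff)
  have FL: "F_low R S q \<beta> = F_low R \<Sigma> q ?\<alpha>" for q by (simp add: F_low_def FZ_star_max[OF \<beta>])
  interpret M: module R ?M by (rule S.F_low_module[OF R])
  define x where "x = rho R S p {0} \<beta> u"
  have x: "x = rho R \<Sigma> p \<gamma> ?\<alpha> u"
    unfolding x_def rho_def FL iota_def FZ_star_vertex ..
  have contr: "contraction R S p \<beta> x ys = contraction R \<Sigma> p ?\<alpha> x ys" for ys
    unfolding contraction_def FL FZ_star_max[OF \<beta>] ..
  have xc: "x \<in> carrier (F_up R S p \<beta>)"
    unfolding x_def by (rule S.rho_closed[OF R S.vertex_face_of[OF S\<beta>]]) (use u in \<open>simp add: F_up_star_vertex\<close>)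
  have alt: "alternating ?M (lat \<beta>) (fan_dim \<Sigma>) (contraction R S p \<beta> x)"
    using S.contraction_alternating_max[OF R \<beta> xc] p by (simp add: fan_dim_star)
  have wa: "w ?\<alpha> \<in> carrier R" by (rule w[OF \<alpha>(4)])
  have cl: "contraction R S p \<beta> x (ori ?\<alpha>) \<in> carrier ?M"
    unfolding contr[unfolded x] x FL by (rule contraction_closed[OF R ori \<alpha>(4) rho_closed[OF R \<alpha>(2) u] p])
  have lin: "linear_map R ?M ?M (\<lambda>y. w ?\<alpha> \<odot>\<^bsub>?M\<^esub> y)"
    unfolding linear_map_def
  proof (intro conjI ballI funcsetI)
    fix y assume y: "y \<in> carrier ?M"
    show "w ?\<alpha> \<odot>\<^bsub>?M\<^esub> y \<in> carrier ?M" by (rule module.smult_closed[OF M.module_axioms wa y])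
    show "w ?\<alpha> \<odot>\<^bsub>?M\<^esub> (y \<oplus>\<^bsub>?M\<^esub> z) = w ?\<alpha> \<odot>\<^bsub>?M\<^esub> y \<oplus>\<^bsub>?M\<^esub> w ?\<alpha> \<odot>\<^bsub>?M\<^esub> z" if "z \<in> carrier ?M" for z
      by (rule module.smult_r_distr[OF M.module_axioms wa y that])
    show "w ?\<alpha> \<odot>\<^bsub>?M\<^esub> (s \<odot>\<^bsub>?M\<^esub> y) = s \<odot>\<^bsub>?M\<^esub> (w ?\<alpha> \<odot>\<^bsub>?M\<^esub> y)" if s: "s \<in> carrier R" for s
      using module.smult_assoc1[OF M.module_axioms wa s y] module.smult_assoc1[OF M.module_axioms s wa y]
        M.R.m_comm[OF wa s] by simp
  qed
  have "SW.cap p {0} \<beta> u = w ?\<alpha> \<odot>\<^bsub>?M\<^esub> contraction R S p \<beta> x (so \<beta>)"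
    by (simp add: S.cap_at_def x_def star_weight_eq fan_dim_star)
  also have "contraction R S p \<beta> x (so \<beta>) = [cell_sign \<beta>] \<cdot>\<^bsub>?M\<^esub> contraction R S p \<beta> x (ori ?\<alpha>)"
    by (rule wedge_so(3)[OF \<beta> alt])
  also have "w ?\<alpha> \<odot>\<^bsub>?M\<^esub> \<dots> = [cell_sign \<beta>] \<cdot>\<^bsub>?M\<^esub> (w ?\<alpha> \<odot>\<^bsub>?M\<^esub> contraction R S p \<beta> x (ori ?\<alpha>))"
    by (rule linear_map_add_pow[OF M.module_axioms M.module_axioms lin cl])
  finally show ?thesis
    by (simp add: lifted_family_def cap_at_def contr[unfolded x] x FL)
qed

lemma lifted_family_inj:
  assumes c: "\<And>\<alpha>. \<alpha> \<in> around \<Longrightarrow> c \<alpha> \<in> carrier (F_low R \<Sigma> p \<alpha>)" "\<And>\<alpha>. \<alpha> \<in> around \<Longrightarrow> c' \<alpha> \<in> carrier (F_low R \<Sigma> p \<alpha>)"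
    and eq: "\<And>\<beta>. \<beta> \<in> max_cones S \<Longrightarrow> lifted_family R p c \<beta> = lifted_family R p c' \<beta>" and \<alpha>: "\<alpha> \<in> around"
  shows "c \<alpha> = c' \<alpha>"
proof -
  obtain \<beta> where \<beta>: "\<beta> \<in> max_cones S" "cell_carrier \<beta> = \<alpha>" using cell_in_max_cone[OF \<alpha>] .
  let ?M = "F_low R S p \<beta>"
  interpret M: module R ?M by (rule S.F_low_module[OF R])
  have FL: "?M = F_low R \<Sigma> p \<alpha>" using \<beta> by (simp add: F_low_def FZ_star_max)
  have cc: "c \<alpha> \<in> carrier ?M" "c' \<alpha> \<in> carrier ?M" using c \<alpha> FL by simp_all
  have twice: "[cell_sign \<beta>] \<cdot>\<^bsub>?M\<^esub> ([cell_sign \<beta>] \<cdot>\<^bsub>?M\<^esub> z) = z" if "z \<in> carrier ?M" for z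
    using M.M.add_pow_add_pow[OF that] cell_sign_cases[of \<beta>] that by auto
  have "[cell_sign \<beta>] \<cdot>\<^bsub>?M\<^esub> c \<alpha> = [cell_sign \<beta>] \<cdot>\<^bsub>?M\<^esub> c' \<alpha>"
    using eq[OF \<beta>(1)] \<beta>(2) by (simp add: lifted_family_def)
  then have "[cell_sign \<beta>] \<cdot>\<^bsub>?M\<^esub> ([cell_sign \<beta>] \<cdot>\<^bsub>?M\<^esub> c \<alpha>) = [cell_sign \<beta>] \<cdot>\<^bsub>?M\<^esub> ([cell_sign \<beta>] \<cdot>\<^bsub>?M\<^esub> c' \<alpha>)"
    by (rule arg_cong)
  then show ?thesis unfolding twice[OF cc(1)] twice[OF cc(2)] .
qed

lemma lifted_family_local_cycle:
  assumes c: "\<And>\<alpha>. \<alpha> \<in> around \<Longrightarrow> c \<alpha> \<in> carrier (F_low R \<Sigma> p \<alpha>)"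
  shows "(\<lambda>\<beta>\<in>max_cones S. lifted_family R p c \<beta>) \<in> SW.local_cycles p {0} \<longleftrightarrow>
    (\<lambda>\<alpha>\<in>around. c \<alpha>) \<in> local_cycles p \<gamma>"
proof -
  interpret C: star_chain \<Sigma> \<gamma> S ori so R p c by (rule star_chainI[OF c])
  have v: "{\<beta> \<in> max_cones S. {0} face_of \<beta>} = max_cones S"
    using S.vertex_face_of by (auto simp: S.max_cones_iff)
  have cS: "facet_sum R S so p \<tau> (\<lambda>\<beta>\<in>max_cones S. lifted_family R p c \<beta>) = facet_sum R S so p \<tau> (lifted_family R p c)" for \<tau>
    by (rule SW.facet_sum_cong) (simp add: C.star_family_closed)
  have c\<Sigma>: "facet_sum R \<Sigma> ori p \<kappa> (\<lambda>\<alpha>\<in>around. c \<alpha>) = facet_sum R \<Sigma> ori p \<kappa> c" if "\<gamma> face_of \<kappa>" for \<kappa>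
  proof (rule facet_sum_cong)
    fix \<sigma> assume "\<sigma> \<in> max_cones \<Sigma>" "\<kappa> face_of \<sigma>"
    then have "\<sigma> \<in> around" using face_of_trans[OF that] by (simp add: around_def)
    then show "(\<lambda>\<alpha>\<in>around. c \<alpha>) \<sigma> = c \<sigma> \<and> c \<sigma> \<in> carrier (F_low R \<Sigma> p \<sigma>)" using c by simp
  qed
  have "(\<lambda>\<beta>\<in>max_cones S. lifted_family R p c \<beta>) \<in> SW.local_cycles p {0} \<longleftrightarrow>
      (\<forall>\<tau>\<in>S. Suc (dim \<tau>) = fan_dim \<Sigma> \<longrightarrow> facet_sum R S so p \<tau> (lifted_family R p c) = \<zero>\<^bsub>F_low R S p \<tau>\<^esub>)"
    unfolding SW.local_cycles_def v using S.vertex_face_of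
    by (simp add: cS fan_dim_star C.star_family_closed)
  also have "\<dots> \<longleftrightarrow> (\<forall>\<kappa>\<in>\<Sigma>. \<gamma> face_of \<kappa> \<and> Suc (dim \<kappa>) = fan_dim \<Sigma> \<longrightarrow> facet_sum R \<Sigma> ori p \<kappa> c = \<zero>\<^bsub>F_low R \<Sigma> p \<kappa>\<^esub>)"
    by (rule C.star_family_cycle_iff)
  also have "\<dots> \<longleftrightarrow> (\<lambda>\<alpha>\<in>around. c \<alpha>) \<in> local_cycles p \<gamma>"
    unfolding local_cycles_def around_def[symmetric] by (auto simp: c\<Sigma> c)
  finally show ?thesis .
qed

text \<open>Lifting of families is injective, turns cap products into cap products and detects cycles. A local cycle
  lifts to a cycle of the star; the functional producing the lift produces the cycle.\<close>

theorem star_duality_local: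
  assumes p: "p \<le> d" and duality: "SW.local_duality p {0}"
  shows "local_duality p \<gamma>"
proof -
  have v: "{\<beta> \<in> max_cones S. {0} face_of \<beta>} = max_cones S"
    using S.vertex_face_of by (auto simp: S.max_cones_iff)
  let ?U = "carrier (F_up R \<Sigma> p \<gamma>)"
  have bij: "bij_betw (SW.local_cap p {0}) ?U (SW.local_cycles (d - p) {0})"
    using duality unfolding SW.local_duality_def F_up_star_vertex fan_dim_star .
  define c where "c u \<alpha> = cap p \<gamma> \<alpha> u" for u \<alpha>
  have cc: "c u \<alpha> \<in> carrier (F_low R \<Sigma> (d - p) \<alpha>)" if "u \<in> ?U" "\<alpha> \<in> around" for u \<alpha>
    unfolding c_def by (rule cap_closed[OF aroundD(4,2)[OF that(2)] that(1) p])
  have lc: "local_cap p \<gamma> u = (\<lambda>\<alpha>\<in>around. c u \<alpha>)" for u by (simp add: local_cap_def c_def around_def)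
  have SWc: "SW.local_cap p {0} u = (\<lambda>\<beta>\<in>max_cones S. lifted_family R (d - p) (c u) \<beta>)" if "u \<in> ?U" for u
    unfolding SW.local_cap_def v
  proof (rule restrict_ext)
    fix \<beta> assume "\<beta> \<in> max_cones S"
    from cap_star[OF p this that] show "SW.cap p {0} \<beta> u = lifted_family R (d - p) (c u) \<beta>" by (simp add: c_def[abs_def])
  qed
  show ?thesis
    unfolding local_duality_def bij_betw_def
  proof (intro conjI inj_onI equalityI subsetI)
    fix u u' assume u: "u \<in> ?U" and u': "u' \<in> ?U" and eq: "local_cap p \<gamma> u = local_cap p \<gamma> u'"
    have "c u \<alpha> = c u' \<alpha>" if "\<alpha> \<in> around" for \<alpha> using fun_cong[OF eq, of \<alpha>] that by (simp add: lc)
    then have "SW.local_cap p {0} u = SW.local_cap p {0} u'"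
      unfolding SWc[OF u] SWc[OF u'] by (intro restrict_ext) (simp add: lifted_family_def cell_carrier)
    then show "u = u'" using bij_betw_imp_inj_on[OF bij] u u' by (simp add: inj_on_def)
  next
    fix z assume "z \<in> local_cap p \<gamma> ` ?U"
    then obtain u where u: "u \<in> ?U" "z = local_cap p \<gamma> u" by auto
    have "SW.local_cap p {0} u \<in> SW.local_cycles (d - p) {0}" using bij_betwE[OF bij] u(1) by simp
    then show "z \<in> local_cycles (d - p) \<gamma>"
      unfolding u(2) lc SWc[OF u(1)] using lifted_family_local_cycle[of "c u", OF cc[OF u(1)]] by simp
  next
    fix z assume z: "z \<in> local_cycles (d - p) \<gamma>"
    have zc: "z \<alpha> \<in> carrier (F_low R \<Sigma> (d - p) \<alpha>)" if "\<alpha> \<in> around" for \<alpha>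
      using z that unfolding local_cycles_def around_def by (auto simp: PiE_iff)
    have zr: "(\<lambda>\<alpha>\<in>around. z \<alpha>) = z"
      by (rule extensionalityI[of _ around]) (use z in \<open>simp_all add: local_cycles_def around_def PiE_iff\<close>)
    have "(\<lambda>\<beta>\<in>max_cones S. lifted_family R (d - p) z \<beta>) \<in> SW.local_cycles (d - p) {0}"
      using lifted_family_local_cycle[of z, OF zc] z unfolding zr by simp
    then have "(\<lambda>\<beta>\<in>max_cones S. lifted_family R (d - p) z \<beta>) \<in> SW.local_cap p {0} ` ?U"
      using bij_betw_imp_surj_on[OF bij] by simp
    then obtain u where u: "u \<in> ?U"
      and eq: "(\<lambda>\<beta>\<in>max_cones S. lifted_family R (d - p) z \<beta>) = SW.local_cap p {0} u" by auto
    have "lifted_family R (d - p) (c u) \<beta> = lifted_family R (d - p) z \<beta>" if "\<beta> \<in> max_cones S" for \<beta>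
      using fun_cong[OF eq, of \<beta>] that by (simp add: SWc[OF u])
    then have "c u \<alpha> = z \<alpha>" if "\<alpha> \<in> around" for \<alpha>
      using lifted_family_inj[of "c u" _ z, OF cc[OF u] zc] that by metis
    then have "local_cap p \<gamma> u = z"
      unfolding lc by (subst zr[symmetric]) (rule restrict_ext, simp)
    then show "z \<in> local_cap p \<gamma> ` ?U" using u by (metis image_eqI)
  qed
qed

end

section \<open>Rays and planes\<close>

lemma (in abelian_monoid) finsum_swap:
  assumes "finite A" "finite B" "\<And>a b. a \<in> A \<Longrightarrow> b \<in> B \<Longrightarrow> f a b \<in> carrier G"
  shows "(\<Oplus>a\<in>A. \<Oplus>b\<in>B. f a b) = (\<Oplus>b\<in>B. \<Oplus>a\<in>A. f a b)"
  using assms(1,3)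
proof (induction A rule: finite_induct)
  case empty
  then show ?case by simp
next
  case (insert a A)
  note c = insert.prems
  have row: "(\<Oplus>b\<in>B. f a' b) \<in> carrier G" if "a' \<in> insert a A" for a'
    by (intro finsum_closed funcsetI c[OF that])
  have col: "(\<Oplus>a\<in>A. f a b) \<in> carrier G" if "b \<in> B" for b
    by (intro finsum_closed funcsetI c[OF insertI2 that])
  have "(\<Oplus>a\<in>insert a A. \<Oplus>b\<in>B. f a b) = (\<Oplus>b\<in>B. f a b) \<oplus> (\<Oplus>a\<in>A. \<Oplus>b\<in>B. f a b)"
    by (rule finsum_insert) (use insert.hyps row in auto)
  also have "\<dots> = (\<Oplus>b\<in>B. f a b) \<oplus> (\<Oplus>b\<in>B. \<Oplus>a\<in>A. f a b)"
    using insert.IH insert.prems by simp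
  also have "\<dots> = (\<Oplus>b\<in>B. f a b \<oplus> (\<Oplus>a\<in>A. f a b))"
    by (intro finsum_addf[symmetric] funcsetI col c[OF insertI1])
  also have "\<dots> = (\<Oplus>b\<in>B. \<Oplus>a\<in>insert a A. f a b)"
  proof (rule finsum_cong'[OF refl])
    show "(\<lambda>b. \<Oplus>a\<in>insert a A. f a b) \<in> B \<rightarrow> carrier G"
      by (intro funcsetI finsum_closed c)
    fix b assume "b \<in> B"
    then show "f a b \<oplus> (\<Oplus>a\<in>A. f a b) = (\<Oplus>a\<in>insert a A. f a b)"
      using insert.hyps insert.prems by (simp add: finsum_insert Pi_iff)
  qed
  finally show ?case .
qed

context weighted_fan
begin

text \<open>The boundary sign compares \<open>- u\<close>, for a vector \<open>u\<close> of the ray, with the oriented generator \<open>r\<close>; so it is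
  negative exactly if \<open>r\<close> points along the ray.\<close>

lemma ray_orientation:
  assumes \<rho>: "\<rho> \<in> \<Sigma>" "dim \<rho> = 1" and g: "g \<in> \<rho>" "g \<noteq> 0"
  obtains r t where "ori \<rho> = [r]" "real_vec r = t *\<^sub>R g" "t \<noteq> 0" "rel_sign ori {0} \<rho> = (if t < 0 then 1 else - 1)"
proof -
  have len: "length (ori \<rho>) = Suc 0" using orientationD(1)[OF ori \<rho>(1)] \<rho>(2) by simp
  then obtain r where r: "ori \<rho> = [r]" by (metis length_0_conv length_Suc_conv)
  have ori0: "ori {0} = []" using orientationD(1)[OF ori vertex_mem] by simp
  note B = oriented_basis[OF fan ori \<rho>(1)]
  have "span {g} = span \<rho>"
  proof (rule subspace_dim_equal)
    show "span {g} \<subseteq> span \<rho>" using g(1) by (intro span_mono) simp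
    show "dim (span \<rho>) \<le> dim (span {g})" using \<rho>(2) g(2) by (simp add: dim_insert)
  qed simp_all
  moreover have r\<rho>: "real_vec r \<in> span \<rho>" using B(1) r span_base[of "real_vec r" "real_vec ` set (ori \<rho>)"] by simp
  ultimately obtain t where t: "real_vec r = t *\<^sub>R g" by (auto simp: span_singleton)
  have "real_vec r \<noteq> 0" using B(3) r by (auto simp: dependent_zero)
  then have t0: "t \<noteq> 0" using t by auto
  obtain \<phi> where \<phi>: "side_functional (ori {0}) (ori \<rho>) \<phi>"
    by (rule side_functional_facet[OF fan ori \<rho>(1), of "ori {0}"]) (use ori0 \<rho>(2) in \<open>simp_all add: independent_empty\<close>)
  have lin: "linear \<phi>" using \<phi> by (simp add: side_functional_def)
  have "\<phi> (real_vec r) = of_int (- 1)"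
  proof (rule side_functional_unique_sign[OF \<phi> B(4)])
    show "real_vec r \<in> span (real_vec ` set (ori \<rho>))" using r\<rho> B(1) by simp
    show "wedge (- r # ori {0}) js = - 1 * wedge (ori \<rho>) js" for js
      using wedge_Cons_additive[of 0 r "[]" js] wedge_Cons_additive[of 0 0 "[]" js] by (simp add: ori0 r)
  qed
  then have \<phi>g: "t * \<phi> g = - 1" using t by (simp add: linear_cmul[OF lin])
  have dim: "dim \<rho> = Suc (dim {0 :: real ^ 'n})" using \<rho>(2) by (simp add: dim_insert span_zero)
  have "rel_sign ori {0} \<rho> = (if \<phi> g > 0 then 1 else - 1)"
    by (rule rel_sign_side(1)[OF fan ori \<rho>(1) vertex_face_of[OF \<rho>(1)] vertex_mem dim \<phi> g(1)]) (use g(2) in simp)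
  moreover have "\<phi> g > 0 \<longleftrightarrow> t < 0"
  proof -
    have "t * \<phi> g < 0" using \<phi>g by simp
    then show ?thesis by (auto simp: mult_less_0_iff)
  qed
  ultimately show ?thesis using that[OF r t t0] by simp
qed

lemma wedge_pair_antisym:
  fixes x y :: "int ^ 'n"
  shows "wedge [x, y] js = - wedge [y, x] js" "wedge [- x, y] js = wedge [y, x] js"
proof -
  have "zsubgroup (UNIV :: (int ^ 'n) set)" by (simp add: zsubgroup_def)
  then interpret W: alternating int_functions "UNIV :: (int ^ 'n) set" 2 wedge by (rule wedge_alternating)
  have add0: "wedge [x, y] \<oplus>\<^bsub>int_functions\<^esub> wedge [y, x] = \<zero>\<^bsub>int_functions\<^esub>"
    using W.swap[of "[]" "[]" x y] abelian_group.l_neg[OF int_functions_abelian, of "wedge [y, x]"] by (simp add: int_functions_ops(1))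
  have "wedge [x, y] js + wedge [y, x] js = 0"
    using fun_cong[OF add0, of js] by (simp add: int_functions_ops)
  then show a: "wedge [x, y] js = - wedge [y, x] js" by simp
  have "wedge [- x, y] js = - wedge [x, y] js"
    using wedge_Cons_additive[of 0 x "[y]" js] wedge_Cons_additive[of 0 0 "[y]" js] by simp
  then show "wedge [- x, y] js = wedge [y, x] js" using a by simp
qed

text \<open>For the oriented generators \<open>r1\<close> and \<open>r2\<close> of the rays, \<open>(- r2) \<and> r1\<close> and \<open>(- r1) \<and> r2\<close> are opposite; so the side
  functionals of the two rays satisfy \<open>\<phi>1 r2 = - \<phi>2 r1\<close>. This is the sign rule by which the composite of two
  boundary maps vanishes.\<close>

lemma plane_signs:
  assumes \<sigma>: "\<sigma> \<in> \<Sigma>" "dim \<sigma> = 2"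
  obtains \<rho>1 \<rho>2 where "\<rho>1 \<noteq> \<rho>2" "{\<rho> \<in> cones \<Sigma> 1. \<rho> face_of \<sigma>} = {\<rho>1, \<rho>2}"
    "rel_sign ori {0} \<rho>1 * rel_sign ori \<rho>1 \<sigma> = - (rel_sign ori {0} \<rho>2 * rel_sign ori \<rho>2 \<sigma>)"
proof -
  have "\<exists>g h. g \<noteq> 0 \<and> h \<noteq> 0 \<and> convex_cone hull {g} \<noteq> convex_cone hull {h} \<and>
    (\<forall>\<rho>. \<rho> face_of \<sigma> \<and> dim \<rho> = 1 \<longleftrightarrow> \<rho> = convex_cone hull {g} \<or> \<rho> = convex_cone hull {h})"
  proof (rule plane_cone_rays[OF rational[OF \<sigma>(1)] \<sigma>(2)])
    fix g h assume gh: "g \<noteq> 0" "h \<noteq> 0" "convex_cone hull {g} \<noteq> convex_cone hull {h}"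
      "\<And>\<rho>. \<rho> face_of \<sigma> \<and> dim \<rho> = 1 \<longleftrightarrow> \<rho> = convex_cone hull {g} \<or> \<rho> = convex_cone hull {h}"
    show ?thesis by (intro exI[of _ g] exI[of _ h] conjI allI gh)
  qed
  then obtain g h where gh: "g \<noteq> 0" "h \<noteq> 0" "convex_cone hull {g} \<noteq> convex_cone hull {h}"
    and rays': "\<forall>\<rho>. \<rho> face_of \<sigma> \<and> dim \<rho> = 1 \<longleftrightarrow> \<rho> = convex_cone hull {g} \<or> \<rho> = convex_cone hull {h}"
    by (elim exE conjE) (rule that)
  have rays: "\<rho> face_of \<sigma> \<and> dim \<rho> = 1 \<longleftrightarrow> \<rho> = convex_cone hull {g} \<or> \<rho> = convex_cone hull {h}" for \<rho>
    by (rule spec[OF rays'])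
  define \<rho>1 where "\<rho>1 = convex_cone hull {g}"
  define \<rho>2 where "\<rho>2 = convex_cone hull {h}"
  have g1: "g \<in> \<rho>1" and h2: "h \<in> \<rho>2" by (simp_all add: \<rho>1_def \<rho>2_def hull_inc)
  have f1: "\<rho>1 face_of \<sigma>" "dim \<rho>1 = 1" and f2: "\<rho>2 face_of \<sigma>" "dim \<rho>2 = 1"
    using rays[of "convex_cone hull {g}"] rays[of "convex_cone hull {h}"] by (simp_all add: \<rho>1_def \<rho>2_def)
  have m1: "\<rho>1 \<in> \<Sigma>" and m2: "\<rho>2 \<in> \<Sigma>" using face_mem[OF \<sigma>(1)] f1(1) f2(1) g1 h2 by (metis empty_iff)+
  have ne: "\<rho>1 \<noteq> \<rho>2" using gh(3) by (simp add: \<rho>1_def \<rho>2_def)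
  have set: "{\<rho> \<in> cones \<Sigma> 1. \<rho> face_of \<sigma>} = {\<rho>1, \<rho>2}"
  proof -
    have "\<rho> \<in> cones \<Sigma> 1 \<and> \<rho> face_of \<sigma> \<longleftrightarrow> \<rho> = \<rho>1 \<or> \<rho> = \<rho>2" for \<rho>
      using rays[of \<rho>] m1 m2 f1 f2 by (auto simp: cones_def \<rho>1_def \<rho>2_def)
    then show ?thesis by auto
  qed
  have g\<sigma>: "g \<in> \<sigma>" and h\<sigma>: "h \<in> \<sigma>" using g1 h2 face_of_imp_subset f1(1) f2(1) by (metis subsetD)+
  have ray_unique: "\<rho> = convex_cone hull {x}" if "\<rho> \<in> \<Sigma>" "dim \<rho> = 1" "x \<in> \<rho>" "x \<noteq> 0" for \<rho> x
    using ray_eq[OF cone[OF that(1)] rational_coneD(4)[OF rational[OF that(1)]] that(2-4)]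
    by (simp add: convex_cone_hull_singleton)
  have h1: "h \<notin> \<rho>1" using ray_unique[OF m1 f1(2) _ gh(2)] ne by (auto simp: \<rho>2_def)
  have g2: "g \<notin> \<rho>2" using ray_unique[OF m2 f2(2) _ gh(1)] ne by (auto simp: \<rho>1_def)
  obtain r1 t1 where r1: "ori \<rho>1 = [r1]" "real_vec r1 = t1 *\<^sub>R g" "t1 \<noteq> 0"
    "rel_sign ori {0} \<rho>1 = (if t1 < 0 then 1 else - 1)" using ray_orientation[OF m1 f1(2) g1 gh(1)] .
  obtain r2 t2 where r2: "ori \<rho>2 = [r2]" "real_vec r2 = t2 *\<^sub>R h" "t2 \<noteq> 0"
    "rel_sign ori {0} \<rho>2 = (if t2 < 0 then 1 else - 1)" using ray_orientation[OF m2 f2(2) h2 gh(2)] .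
  note B = oriented_basis[OF fan ori \<sigma>(1)]
  have facet: "\<exists>\<phi>. side_functional (ori \<rho>) (ori \<sigma>) \<phi>" if "\<rho> \<in> \<Sigma>" "\<rho> face_of \<sigma>" "dim \<rho> = 1" for \<rho>
  proof -
    note T = oriented_basis[OF fan ori that(1)]
    have "real_vec ` set (ori \<rho>) \<subseteq> span \<sigma>"
      using T(1) span_superset[of "real_vec ` set (ori \<rho>)"] span_mono[OF face_of_imp_subset[OF that(2)]] by simp
    moreover have "dim \<sigma> = Suc (length (ori \<rho>))" using orientationD(1)[OF ori that(1)] that(3) \<sigma>(2) by simp
    ultimately show ?thesis using side_functional_facet[OF fan ori \<sigma>(1) T(2,3)] by metis
  qed
  obtain \<phi>1 where \<phi>1: "side_functional (ori \<rho>1) (ori \<sigma>) \<phi>1" using facet[OF m1 f1] by metis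
  obtain \<phi>2 where \<phi>2: "side_functional (ori \<rho>2) (ori \<sigma>) \<phi>2" using facet[OF m2 f2] by metis
  have d: "dim \<sigma> = Suc (dim \<rho>1)" "dim \<sigma> = Suc (dim \<rho>2)" using \<sigma>(2) f1(2) f2(2) by simp_all
  note s1 = rel_sign_side[OF fan ori \<sigma>(1) f1(1) m1 d(1) \<phi>1 h\<sigma> h1]
  note s2 = rel_sign_side[OF fan ori \<sigma>(1) f2(1) m2 d(2) \<phi>2 g\<sigma> g2]
  obtain js where js: "wedge (ori \<sigma>) js \<noteq> 0" using B(4) by metis
  have in1: "real_vec r1 \<in> span (real_vec ` set (ori \<sigma>))" "real_vec r2 \<in> span (real_vec ` set (ori \<sigma>))"
    using B(1) r1(2) r2(2) g\<sigma> h\<sigma> by (simp_all add: span_scale span_base)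
  have "of_int (wedge [- r2, r1] js) = \<phi>1 (real_vec r2) * of_int (wedge (ori \<sigma>) js)"
    using \<phi>1 in1(2) by (simp add: side_functional_def r1(1))
  moreover have "of_int (wedge [- r1, r2] js) = \<phi>2 (real_vec r1) * of_int (wedge (ori \<sigma>) js)"
    using \<phi>2 in1(1) by (simp add: side_functional_def r2(1))
  moreover have "wedge [- r2, r1] js = - wedge [- r1, r2] js"
    using wedge_pair_antisym[of r1 r2 js] wedge_pair_antisym[of r2 r1 js] by simp
  ultimately have "\<phi>1 (real_vec r2) * of_int (wedge (ori \<sigma>) js) = (- \<phi>2 (real_vec r1)) * of_int (wedge (ori \<sigma>) js)"
    by simp
  then have "\<phi>1 (real_vec r2) = - \<phi>2 (real_vec r1)" using js unfolding mult_cancel_right by simp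
  moreover have "linear \<phi>1" "linear \<phi>2" using \<phi>1 \<phi>2 by (simp_all add: side_functional_def)
  ultimately have eq: "t2 * \<phi>1 h = - (t1 * \<phi>2 g)" using r1(2) r2(2) by (simp add: linear_cmul)
  have opposite: "0 < b \<longleftrightarrow> \<not> 0 < a" if "b = - a" "a \<noteq> 0" for a b :: real using that by auto
  have "t1 * \<phi>2 g \<noteq> 0" using r1(3) s2(2) by simp
  from opposite[OF eq this] have "0 < t2 * \<phi>1 h \<longleftrightarrow> \<not> 0 < t1 * \<phi>2 g" .
  then have "rel_sign ori {0} \<rho>1 * rel_sign ori \<rho>1 \<sigma> = - (rel_sign ori {0} \<rho>2 * rel_sign ori \<rho>2 \<sigma>)"
    unfolding s1(1) s2(1) r1(4) r2(4) using r1(3) r2(3) s1(2) s2(2)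
    by (auto simp: zero_less_mult_iff not_less)
  then show ?thesis using that[OF ne set] by simp
qed

section \<open>Exactness of the chain complex at the vertex and the rays\<close>

lemma boundary_of_zero: "BM_boundary R \<Sigma> ori p q \<zero>\<^bsub>BM_chains R \<Sigma> p q\<^esub> = \<zero>\<^bsub>BM_chains R \<Sigma> p (q - 1)\<^esub>"
  unfolding BM_boundary_def BM_chains_def dsum_simps
proof (rule restrict_ext)
  fix \<tau> assume "\<tau> \<in> cones \<Sigma> (q - 1)"
  interpret M: module R "F_low R \<Sigma> p \<tau>" by (rule F_low_module[OF R])
  show "(\<Oplus>\<^bsub>F_low R \<Sigma> p \<tau>\<^esub>\<sigma>\<in>{\<sigma> \<in> cones \<Sigma> q. \<tau> face_of \<sigma>}.
      [rel_sign ori \<tau> \<sigma>] \<cdot>\<^bsub>F_low R \<Sigma> p \<tau>\<^esub> iota R \<Sigma> p \<tau> ((\<lambda>i\<in>cones \<Sigma> q. \<zero>\<^bsub>F_low R \<Sigma> p i\<^esub>) \<sigma>)) = \<zero>\<^bsub>F_low R \<Sigma> p \<tau>\<^esub>"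
  proof (rule M.M.add.finprod_one_eqI)
    fix \<sigma> assume \<sigma>: "\<sigma> \<in> {\<sigma> \<in> cones \<Sigma> q. \<tau> face_of \<sigma>}"
    have "iota R \<Sigma> p \<tau> \<zero>\<^bsub>F_low R \<Sigma> p \<sigma>\<^esub> = \<zero>\<^bsub>F_low R \<Sigma> p \<tau>\<^esub>"
      by (rule linear_map_zero[OF F_low_module[OF R] F_low_module[OF R] iota_linear[OF R]]) (use \<sigma> in simp)
    then show "[rel_sign ori \<tau> \<sigma>] \<cdot>\<^bsub>F_low R \<Sigma> p \<tau>\<^esub> iota R \<Sigma> p \<tau> ((\<lambda>i\<in>cones \<Sigma> q. \<zero>\<^bsub>F_low R \<Sigma> p i\<^esub>) \<sigma>) = \<zero>\<^bsub>F_low R \<Sigma> p \<tau>\<^esub>"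
      using \<sigma> by (simp add: M.M.add.int_pow_one)
  qed
qed

lemma chains_zero_closed: "\<zero>\<^bsub>BM_chains R \<Sigma> p q\<^esub> \<in> carrier (BM_chains R \<Sigma> p q)"
  unfolding BM_chains_def dsum_simps
  using abelian_monoid.zero_closed[OF abelian_group.axioms(1)[OF module.axioms(2)[OF F_low_module[OF R]]]]
  by (simp add: PiE_iff)

lemma cycle_is_boundary:
  assumes vanish: "carrier (BM_homology R \<Sigma> ori p q) = {\<zero>\<^bsub>BM_homology R \<Sigma> ori p q\<^esub>}"
    and z: "z \<in> BM_cycles R \<Sigma> ori p q"
  shows "z \<in> BM_boundaries R \<Sigma> ori p q"
proof -
  let ?K = "BM_boundaries R \<Sigma> ori p q" and ?C = "BM_chains R \<Sigma> p q"
  have "?K +>\<^bsub>?C\<^esub> z \<in> carrier (BM_homology R \<Sigma> ori p q)"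
    unfolding BM_homology_def quot_mod_simps using z by (auto simp: A_RCOSETS_def' a_r_coset_def')
  then have eq: "?K +>\<^bsub>?C\<^esub> z = ?K" unfolding vanish by (simp add: BM_homology_def quot_mod_simps)
  have "\<zero>\<^bsub>?C\<^esub> \<in> ?K"
    unfolding BM_boundaries_def using boundary_of_zero[of p "q + 1"] chains_zero_closed[of p "q + 1"] by force
  moreover have "\<zero>\<^bsub>?C\<^esub> \<oplus>\<^bsub>?C\<^esub> z = z" by (rule chains_zero_add) (use z in \<open>simp add: BM_cycles_def a_kernel_def'\<close>)
  ultimately have "z \<in> ?K +>\<^bsub>?C\<^esub> z" unfolding a_r_coset_def' by force
  then show ?thesis unfolding eq .
qed

lemma boundary_at_vertex:
  "BM_boundary R \<Sigma> ori p 1 b {0} =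
    (\<Oplus>\<^bsub>F_low R \<Sigma> p {0}\<^esub>\<rho>\<in>cones \<Sigma> 1. [rel_sign ori {0} \<rho>] \<cdot>\<^bsub>F_low R \<Sigma> p {0}\<^esub> iota R \<Sigma> p {0} (b \<rho>))"
proof -
  have "{\<sigma> \<in> cones \<Sigma> 1. {0} face_of \<sigma>} = cones \<Sigma> 1" using vertex_face_of by (auto simp: cones_def)
  then show ?thesis by (simp add: BM_boundary_def cones_0)
qed

lemma exact_at_vertex:
  assumes vanish: "carrier (BM_homology R \<Sigma> ori p 0) = {\<zero>\<^bsub>BM_homology R \<Sigma> ori p 0\<^esub>}"
    and x: "x \<in> carrier (F_low R \<Sigma> p {0})"
  obtains b where "b \<in> carrier (BM_chains R \<Sigma> p 1)" "BM_boundary R \<Sigma> ori p 1 b {0} = x"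
proof -
  have e: "restrict f {} = (\<lambda>_. undefined)" for f :: "(real ^ 'n) set \<Rightarrow> ('r, 'n) mvec" by (simp add: restrict_def)
  have "(\<lambda>\<sigma>\<in>{{0}}. x) \<in> BM_cycles R \<Sigma> ori p 0"
    unfolding BM_cycles_def a_kernel_def' BM_chains_def dsum_simps BM_boundary_def
    using x by (simp add: cones_0 cones_below PiE_iff e)
  from cycle_is_boundary[OF vanish this] obtain b where b: "b \<in> carrier (BM_chains R \<Sigma> p 1)"
    "(\<lambda>\<sigma>\<in>{{0}}. x) = BM_boundary R \<Sigma> ori p 1 b" by (auto simp: BM_boundaries_def)
  have "BM_boundary R \<Sigma> ori p 1 b {0} = x" unfolding b(2)[symmetric] by simp
  then show ?thesis using that b(1) by simp
qed

lemma exact_at_rays: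
  assumes vanish: "carrier (BM_homology R \<Sigma> ori p 1) = {\<zero>\<^bsub>BM_homology R \<Sigma> ori p 1\<^esub>}"
    and b: "b \<in> carrier (BM_chains R \<Sigma> p 1)" "BM_boundary R \<Sigma> ori p 1 b {0} = \<zero>\<^bsub>F_low R \<Sigma> p {0}\<^esub>"
  obtains e where "e \<in> carrier (BM_chains R \<Sigma> p 2)" "b = BM_boundary R \<Sigma> ori p 2 e"
proof -
  have "BM_boundary R \<Sigma> ori p 1 b = (\<lambda>\<sigma>\<in>{{0}}. BM_boundary R \<Sigma> ori p 1 b \<sigma>)"
    by (simp add: BM_boundary_def cones_0 restrict_eq_iff)
  also have "\<dots> = \<zero>\<^bsub>BM_chains R \<Sigma> p (1 - 1)\<^esub>"
    unfolding BM_chains_def dsum_simps by (simp add: cones_0 restrict_eq_iff b(2))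
  finally have "b \<in> BM_cycles R \<Sigma> ori p 1" using b(1) by (simp add: BM_cycles_def a_kernel_def')
  from cycle_is_boundary[OF vanish this] show ?thesis using that by (auto simp: BM_boundaries_def)
qed

section \<open>Gluing functionals on the rays\<close>

text \<open>The value at the boundary of \<open>b\<close> of a functional on the vertex whose restrictions to the rays are \<open>U\<close>.\<close>

definition ray_pairing :: "nat \<Rightarrow> ((real ^ 'n) set \<Rightarrow> ('r, 'n) mvec \<Rightarrow> 'r) \<Rightarrow> ((real ^ 'n) set \<Rightarrow> ('r, 'n) mvec) \<Rightarrow> 'r" where
  "ray_pairing p U b = (\<Oplus>\<^bsub>R\<^esub>\<rho>\<in>cones \<Sigma> 1. [rel_sign ori {0} \<rho>] \<cdot>\<^bsub>R\<^esub> U \<rho> (b \<rho>))"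

lemma dual_finsum:
  assumes M: "module R M" and u: "u \<in> carrier (dual_mod R M)" and f: "f \<in> I \<rightarrow> carrier M" and I: "finite I"
  shows "u (\<Oplus>\<^bsub>M\<^esub>i\<in>I. f i) = (\<Oplus>\<^bsub>R\<^esub>i\<in>I. u (f i))"
proof -
  interpret M: module R M by fact
  show ?thesis using I f
  proof (induction I rule: finite_induct)
    case empty
    then show ?case by (simp add: dual_mod_hom_simps(1)[OF M u])
  next
    case (insert i I)
    have fi: "f i \<in> carrier M" "f \<in> I \<rightarrow> carrier M" using insert.prems by auto
    have uf: "(\<lambda>i. u (f i)) \<in> I \<rightarrow> carrier R" using fi(2) dual_modD(1)[OF u] by auto
    have "u (\<Oplus>\<^bsub>M\<^esub>i\<in>insert i I. f i) = u (f i \<oplus>\<^bsub>M\<^esub> (\<Oplus>\<^bsub>M\<^esub>i\<in>I. f i))"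
      using M.M.finsum_insert[OF insert.hyps fi(2,1)] by simp
    also have "\<dots> = u (f i) \<oplus>\<^bsub>R\<^esub> (\<Oplus>\<^bsub>R\<^esub>i\<in>I. u (f i))"
      using dual_modD(2)[OF u fi(1) M.M.finsum_closed[OF fi(2)]] insert.IH[OF fi(2)] by simp
    also have "\<dots> = (\<Oplus>\<^bsub>R\<^esub>i\<in>insert i I. u (f i))"
      using M.R.finsum_insert[OF insert.hyps uf] dual_modD(1)[OF u fi(1)] by simp
    finally show ?case .
  qed
qed

lemma chain_mem: "b \<in> carrier (BM_chains R \<Sigma> p q) \<Longrightarrow> \<sigma> \<in> cones \<Sigma> q \<Longrightarrow> b \<sigma> \<in> carrier (F_low R \<Sigma> p \<sigma>)"
  by (simp add: BM_chains_def dsum_simps PiE_iff)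

lemma ray_face: "\<rho> \<in> cones \<Sigma> q \<Longrightarrow> {0} face_of \<rho>"
  using vertex_face_of by (simp add: cones_def)

lemma R_group: "abelian_group R"
proof -
  interpret cring R by (rule R)
  show ?thesis by (rule abelian_group_axioms)
qed

text \<open>A cone of dimension two contributes the same value through both of its rays, with opposite signs.\<close>

lemma ray_pairing_boundary:
  assumes U: "\<And>\<rho>. \<rho> \<in> cones \<Sigma> 1 \<Longrightarrow> U \<rho> \<in> carrier (F_up R \<Sigma> p \<rho>)"
    and compatible: "\<And>\<sigma> \<rho> \<rho>'. \<sigma> \<in> cones \<Sigma> 2 \<Longrightarrow> \<rho> \<in> cones \<Sigma> 1 \<Longrightarrow> \<rho>' \<in> cones \<Sigma> 1 \<Longrightarrow> \<rho> face_of \<sigma> \<Longrightarrow> \<rho>' face_of \<sigma> \<Longrightarrow>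
      rho R \<Sigma> p \<rho> \<sigma> (U \<rho>) = rho R \<Sigma> p \<rho>' \<sigma> (U \<rho>')"
    and e: "e \<in> carrier (BM_chains R \<Sigma> p 2)"
  shows "ray_pairing p U (BM_boundary R \<Sigma> ori p 2 e) = \<zero>\<^bsub>R\<^esub>"
proof -
  interpret A: abelian_group R by (rule R_group)
  let ?rays = "cones \<Sigma> 1" and ?planes = "cones \<Sigma> 2"
  define v where "v \<rho> \<sigma> = U \<rho> (iota R \<Sigma> p \<rho> (e \<sigma>))" for \<rho> \<sigma>
  define f where "f \<rho> \<sigma> = (if \<rho> face_of \<sigma> then [(rel_sign ori {0} \<rho> * rel_sign ori \<rho> \<sigma>)] \<cdot>\<^bsub>R\<^esub> v \<rho> \<sigma> else \<zero>\<^bsub>R\<^esub>)" for \<rho> \<sigma>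
  note e' = chain_mem[OF e]
  note U' = U[unfolded F_up_def]
  have ie: "iota R \<Sigma> p \<rho> (e \<sigma>) \<in> carrier (F_low R \<Sigma> p \<rho>)" if "\<rho> \<in> ?rays" "\<sigma> \<in> ?planes" "\<rho> face_of \<sigma>" for \<rho> \<sigma>
    by (rule linear_mapD(1)[OF iota_linear[OF R that(3)] e'[OF that(2)]])
  have vc: "v \<rho> \<sigma> \<in> carrier R" if "\<rho> \<in> ?rays" "\<sigma> \<in> ?planes" "\<rho> face_of \<sigma>" for \<rho> \<sigma>
    unfolding v_def by (rule dual_modD(1)[OF U'[OF that(1)] ie[OF that]])
  have fc: "f \<rho> \<sigma> \<in> carrier R" if "\<rho> \<in> ?rays" "\<sigma> \<in> ?planes" for \<rho> \<sigma>
    unfolding f_def using vc[OF that] by (auto intro!: A.add.int_pow_closed)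
  have inner: "[rel_sign ori {0} \<rho>] \<cdot>\<^bsub>R\<^esub> U \<rho> (BM_boundary R \<Sigma> ori p 2 e \<rho>) = (\<Oplus>\<^bsub>R\<^esub>\<sigma>\<in>?planes. f \<rho> \<sigma>)"
    if \<rho>: "\<rho> \<in> ?rays" for \<rho>
  proof -
    let ?P = "{\<sigma> \<in> ?planes. \<rho> face_of \<sigma>}" and ?M = "F_low R \<Sigma> p \<rho>"
    interpret M: module R ?M by (rule F_low_module[OF R])
    have fin: "finite ?P" using finite_cones(1)[of 2] by simp
    have eps: "rel_sign ori {0} \<rho> = 1 \<or> rel_sign ori {0} \<rho> = - 1" by (simp add: rel_sign_def)
    have vP: "(\<lambda>\<sigma>. [rel_sign ori \<rho> \<sigma>] \<cdot>\<^bsub>R\<^esub> v \<rho> \<sigma>) \<in> ?P \<rightarrow> carrier R"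
      by (intro funcsetI A.add.int_pow_closed) (use vc[OF \<rho>] in simp)
    have terms: "(\<lambda>\<sigma>. [rel_sign ori \<rho> \<sigma>] \<cdot>\<^bsub>?M\<^esub> iota R \<Sigma> p \<rho> (e \<sigma>)) \<in> ?P \<rightarrow> carrier ?M"
      by (intro funcsetI M.M.add.int_pow_closed) (use ie[OF \<rho>] in simp)
    have "BM_boundary R \<Sigma> ori p 2 e \<rho> = (\<Oplus>\<^bsub>?M\<^esub>\<sigma>\<in>?P. [rel_sign ori \<rho> \<sigma>] \<cdot>\<^bsub>?M\<^esub> iota R \<Sigma> p \<rho> (e \<sigma>))"
      using \<rho> by (simp add: BM_boundary_def)
    then have "U \<rho> (BM_boundary R \<Sigma> ori p 2 e \<rho>) = (\<Oplus>\<^bsub>R\<^esub>\<sigma>\<in>?P. U \<rho> ([rel_sign ori \<rho> \<sigma>] \<cdot>\<^bsub>?M\<^esub> iota R \<Sigma> p \<rho> (e \<sigma>)))"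
      using dual_finsum[OF F_low_module[OF R] U'[OF \<rho>] terms fin] by simp
    also have "\<dots> = (\<Oplus>\<^bsub>R\<^esub>\<sigma>\<in>?P. [rel_sign ori \<rho> \<sigma>] \<cdot>\<^bsub>R\<^esub> v \<rho> \<sigma>)"
    proof (rule A.finsum_cong'[OF refl vP])
      fix \<sigma> assume "\<sigma> \<in> ?P"
      then show "U \<rho> ([rel_sign ori \<rho> \<sigma>] \<cdot>\<^bsub>?M\<^esub> iota R \<Sigma> p \<rho> (e \<sigma>)) = [rel_sign ori \<rho> \<sigma>] \<cdot>\<^bsub>R\<^esub> v \<rho> \<sigma>"
        unfolding v_def using dual_mod_hom_simps(4)[OF F_low_module[OF R] U'[OF \<rho>] ie[OF \<rho>]] by simp
    qed
    finally have "[rel_sign ori {0} \<rho>] \<cdot>\<^bsub>R\<^esub> U \<rho> (BM_boundary R \<Sigma> ori p 2 e \<rho>) =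
        (\<Oplus>\<^bsub>R\<^esub>\<sigma>\<in>?P. [rel_sign ori {0} \<rho>] \<cdot>\<^bsub>R\<^esub> ([rel_sign ori \<rho> \<sigma>] \<cdot>\<^bsub>R\<^esub> v \<rho> \<sigma>))"
      using A.add_pow_finsum_sign[OF vP eps] by simp
    also have "\<dots> = (\<Oplus>\<^bsub>R\<^esub>\<sigma>\<in>?planes. f \<rho> \<sigma>)"
    proof (rule A.add.finprod_mono_neutral_cong_left)
      show "finite ?planes" by (rule finite_cones)
      show "?P \<subseteq> ?planes" by auto
      show "f \<rho> \<in> ?planes \<rightarrow> carrier R" using fc[OF \<rho>] by simp
      show "f \<rho> \<sigma> = \<zero>\<^bsub>R\<^esub>" if "\<sigma> \<in> ?planes - ?P" for \<sigma> using that by (simp add: f_def)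
      show "[rel_sign ori {0} \<rho>] \<cdot>\<^bsub>R\<^esub> ([rel_sign ori \<rho> \<sigma>] \<cdot>\<^bsub>R\<^esub> v \<rho> \<sigma>) = f \<rho> \<sigma>" if "\<sigma> \<in> ?P" for \<sigma>
        using A.add_pow_add_pow[OF vc[OF \<rho>]] that by (simp add: f_def)
    qed
    finally show ?thesis .
  qed
  have column: "(\<Oplus>\<^bsub>R\<^esub>\<rho>\<in>?rays. f \<rho> \<sigma>) = \<zero>\<^bsub>R\<^esub>" if \<sigma>: "\<sigma> \<in> ?planes" for \<sigma>
  proof -
    have \<sigma>': "\<sigma> \<in> \<Sigma>" "dim \<sigma> = 2" using \<sigma> by (simp_all add: cones_def)
    obtain \<rho>1 \<rho>2 where \<rho>: "\<rho>1 \<noteq> \<rho>2" "{\<rho> \<in> ?rays. \<rho> face_of \<sigma>} = {\<rho>1, \<rho>2}"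
      "rel_sign ori {0} \<rho>1 * rel_sign ori \<rho>1 \<sigma> = - (rel_sign ori {0} \<rho>2 * rel_sign ori \<rho>2 \<sigma>)"
      using plane_signs[OF \<sigma>'] .
    have mem: "\<rho>1 \<in> ?rays" "\<rho>1 face_of \<sigma>" "\<rho>2 \<in> ?rays" "\<rho>2 face_of \<sigma>" using \<rho>(2) by auto
    have "rho R \<Sigma> p \<rho>1 \<sigma> (U \<rho>1) = rho R \<Sigma> p \<rho>2 \<sigma> (U \<rho>2)" by (rule compatible[OF \<sigma> mem(1,3,2,4)])
    from fun_cong[OF this, of "e \<sigma>"] have same: "v \<rho>1 \<sigma> = v \<rho>2 \<sigma>"
      by (simp add: rho_apply[OF e'[OF \<sigma>]] v_def)
    note v2 = vc[OF mem(3) \<sigma> mem(4)]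
    have "(\<Oplus>\<^bsub>R\<^esub>\<rho>\<in>?rays. f \<rho> \<sigma>) = (\<Oplus>\<^bsub>R\<^esub>\<rho>\<in>{\<rho>1, \<rho>2}. f \<rho> \<sigma>)"
    proof (rule A.add.finprod_mono_neutral_cong_right)
      show "finite ?rays" by (rule finite_cones)
      show "{\<rho>1, \<rho>2} \<subseteq> ?rays" using mem by simp
      show "(\<lambda>\<rho>. f \<rho> \<sigma>) \<in> ?rays \<rightarrow> carrier R" using fc \<sigma> by simp
      show "f \<rho> \<sigma> = \<zero>\<^bsub>R\<^esub>" if "\<rho> \<in> ?rays - {\<rho>1, \<rho>2}" for \<rho>
        using that \<rho>(2) by (auto simp: f_def)
    qed simp
    also have "\<dots> = f \<rho>1 \<sigma> \<oplus>\<^bsub>R\<^esub> f \<rho>2 \<sigma>"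
      using \<rho>(1) fc[OF mem(1) \<sigma>] fc[OF mem(3) \<sigma>] by (simp add: A.finsum_insert)
    also have "f \<rho>1 \<sigma> = \<ominus>\<^bsub>R\<^esub> f \<rho>2 \<sigma>"
      unfolding f_def using mem same \<rho>(3) A.add_pow_neg[OF v2] by simp
    also have "(\<ominus>\<^bsub>R\<^esub> f \<rho>2 \<sigma>) \<oplus>\<^bsub>R\<^esub> f \<rho>2 \<sigma> = \<zero>\<^bsub>R\<^esub>" by (rule A.l_neg[OF fc[OF mem(3) \<sigma>]])
    finally show ?thesis .
  qed
  have "ray_pairing p U (BM_boundary R \<Sigma> ori p 2 e) = (\<Oplus>\<^bsub>R\<^esub>\<rho>\<in>?rays. \<Oplus>\<^bsub>R\<^esub>\<sigma>\<in>?planes. f \<rho> \<sigma>)"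
    unfolding ray_pairing_def
    by (rule A.finsum_cong'[OF refl]) (use inner fc in \<open>auto intro!: A.finsum_closed\<close>)
  also have "\<dots> = (\<Oplus>\<^bsub>R\<^esub>\<sigma>\<in>?planes. \<Oplus>\<^bsub>R\<^esub>\<rho>\<in>?rays. f \<rho> \<sigma>)"
    by (rule A.finsum_swap[OF finite_cones(1) finite_cones(1) fc])
  also have "\<dots> = \<zero>\<^bsub>R\<^esub>" by (rule A.add.finprod_one_eqI) (rule column)
  finally show ?thesis .
qed

lemma chain_add_smult:
  assumes "b \<in> carrier (BM_chains R \<Sigma> p q)" "b' \<in> carrier (BM_chains R \<Sigma> p q)" "r \<in> carrier R"
  shows "b \<oplus>\<^bsub>BM_chains R \<Sigma> p q\<^esub> b' \<in> carrier (BM_chains R \<Sigma> p q)" "r \<odot>\<^bsub>BM_chains R \<Sigma> p q\<^esub> b \<in> carrier (BM_chains R \<Sigma> p q)"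
proof -
  note b = chain_mem[OF assms(1)] and b' = chain_mem[OF assms(2)]
  show "b \<oplus>\<^bsub>BM_chains R \<Sigma> p q\<^esub> b' \<in> carrier (BM_chains R \<Sigma> p q)"
    unfolding BM_chains_def dsum_simps
    using abelian_monoid.a_closed[OF abelian_group.axioms(1)[OF module.axioms(2)[OF F_low_module[OF R]]] b b'] by simp
  show "r \<odot>\<^bsub>BM_chains R \<Sigma> p q\<^esub> b \<in> carrier (BM_chains R \<Sigma> p q)"
    unfolding BM_chains_def dsum_simps
    using module.smult_closed[OF F_low_module[OF R] assms(3) b] by simp
qed

lemma boundary_linear:
  assumes \<tau>: "\<tau> \<in> cones \<Sigma> (q - 1)" and b: "b \<in> carrier (BM_chains R \<Sigma> p q)" and b': "b' \<in> carrier (BM_chains R \<Sigma> p q)" and r: "r \<in> carrier R"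
  defines "bd \<equiv> \<lambda>b. BM_boundary R \<Sigma> ori p q b \<tau>" and "M \<equiv> F_low R \<Sigma> p \<tau>"
  shows "bd b \<in> carrier M" "bd (b \<oplus>\<^bsub>BM_chains R \<Sigma> p q\<^esub> b') = bd b \<oplus>\<^bsub>M\<^esub> bd b'" "bd (r \<odot>\<^bsub>BM_chains R \<Sigma> p q\<^esub> b) = r \<odot>\<^bsub>M\<^esub> bd b"
proof -
  let ?P = "{\<sigma> \<in> cones \<Sigma> q. \<tau> face_of \<sigma>}"
  have fin: "finite ?P" using finite_cones(1)[of q] by simp
  interpret M: module R M unfolding M_def by (rule F_low_module[OF R])
  define t where "t b \<rho> = [rel_sign ori \<tau> \<rho>] \<cdot>\<^bsub>M\<^esub> iota R \<Sigma> p \<tau> (b \<rho>)" for b \<rho>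
  have bd: "bd b = (\<Oplus>\<^bsub>M\<^esub>\<rho>\<in>?P. t b \<rho>)" for b
    unfolding bd_def BM_boundary_def t_def M_def using \<tau> by simp
  have P: "\<rho> \<in> cones \<Sigma> q" "\<tau> face_of \<rho>" if "\<rho> \<in> ?P" for \<rho> using that by simp_all
  have i: "linear_map R (F_low R \<Sigma> p \<rho>) M (iota R \<Sigma> p \<tau>)" if "\<rho> \<in> ?P" for \<rho>
    unfolding M_def by (rule iota_linear[OF R P(2)[OF that]])
  have ic: "iota R \<Sigma> p \<tau> (b \<rho>) \<in> carrier M" if "b \<in> carrier (BM_chains R \<Sigma> p q)" "\<rho> \<in> ?P" for b \<rho>
    by (rule linear_mapD(1)[OF i[OF that(2)] chain_mem[OF that(1) P(1)[OF that(2)]]])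
  have tc: "t b \<in> ?P \<rightarrow> carrier M" if "b \<in> carrier (BM_chains R \<Sigma> p q)" for b
    unfolding t_def by (intro funcsetI M.M.add.int_pow_closed ic[OF that])
  show "bd b \<in> carrier M" unfolding bd by (rule M.M.finsum_closed[OF tc[OF b]])
  have "bd (b \<oplus>\<^bsub>BM_chains R \<Sigma> p q\<^esub> b') = (\<Oplus>\<^bsub>M\<^esub>\<rho>\<in>?P. t b \<rho> \<oplus>\<^bsub>M\<^esub> t b' \<rho>)"
    unfolding bd
  proof (rule M.M.finsum_cong'[OF refl])
    show "(\<lambda>\<rho>. t b \<rho> \<oplus>\<^bsub>M\<^esub> t b' \<rho>) \<in> ?P \<rightarrow> carrier M" using tc[OF b] tc[OF b'] by (simp add: Pi_iff)
    fix \<rho> assume \<rho>: "\<rho> \<in> ?P"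
    have "(b \<oplus>\<^bsub>BM_chains R \<Sigma> p q\<^esub> b') \<rho> = b \<rho> \<oplus>\<^bsub>F_low R \<Sigma> p \<rho>\<^esub> b' \<rho>" using \<rho> by (simp add: BM_chains_def dsum_simps)
    then show "t (b \<oplus>\<^bsub>BM_chains R \<Sigma> p q\<^esub> b') \<rho> = t b \<rho> \<oplus>\<^bsub>M\<^esub> t b' \<rho>"
      unfolding t_def using linear_mapD(2)[OF i[OF \<rho>] chain_mem[OF b P(1)[OF \<rho>]] chain_mem[OF b' P(1)[OF \<rho>]]]
        M.M.add.int_pow_distrib[OF ic[OF b \<rho>] ic[OF b' \<rho>]] by simp
  qed
  also have "\<dots> = bd b \<oplus>\<^bsub>M\<^esub> bd b'" unfolding bd by (rule M.M.finsum_addf[OF tc[OF b] tc[OF b']])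
  finally show "bd (b \<oplus>\<^bsub>BM_chains R \<Sigma> p q\<^esub> b') = bd b \<oplus>\<^bsub>M\<^esub> bd b'" .
  have "bd (r \<odot>\<^bsub>BM_chains R \<Sigma> p q\<^esub> b) = (\<Oplus>\<^bsub>M\<^esub>\<rho>\<in>?P. r \<odot>\<^bsub>M\<^esub> t b \<rho>)"
    unfolding bd
  proof (rule M.M.finsum_cong'[OF refl])
    show "(\<lambda>\<rho>. r \<odot>\<^bsub>M\<^esub> t b \<rho>) \<in> ?P \<rightarrow> carrier M"
      by (intro funcsetI module.smult_closed[OF M.module_axioms r]) (use tc[OF b] in \<open>simp add: Pi_iff\<close>)
    fix \<rho> assume \<rho>: "\<rho> \<in> ?P"
    have "(r \<odot>\<^bsub>BM_chains R \<Sigma> p q\<^esub> b) \<rho> = r \<odot>\<^bsub>F_low R \<Sigma> p \<rho>\<^esub> b \<rho>" using \<rho> by (simp add: BM_chains_def dsum_simps)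
    moreover have "rel_sign ori \<tau> \<rho> = 1 \<or> rel_sign ori \<tau> \<rho> = - 1" by (simp add: rel_sign_def)
    ultimately show "t (r \<odot>\<^bsub>BM_chains R \<Sigma> p q\<^esub> b) \<rho> = r \<odot>\<^bsub>M\<^esub> t b \<rho>"
      unfolding t_def using linear_mapD(3)[OF i[OF \<rho>] r chain_mem[OF b P(1)[OF \<rho>]]] ic[OF b \<rho>]
        module.smult_closed[OF M.module_axioms r ic[OF b \<rho>]] module.smult_r_minus[OF M.module_axioms r ic[OF b \<rho>]]
      by auto
  qed
  also have "\<dots> = r \<odot>\<^bsub>M\<^esub> bd b"
    unfolding bd by (rule module.finsum_smult_ldistr[OF M.module_axioms fin r tc[OF b], symmetric])
  finally show "bd (r \<odot>\<^bsub>BM_chains R \<Sigma> p q\<^esub> b) = r \<odot>\<^bsub>M\<^esub> bd b" .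
qed

lemma boundaries_submodule:
  defines "K \<equiv> \<lambda>p q. BM_boundaries R \<Sigma> ori p q" and "N \<equiv> \<lambda>p q. BM_chains R \<Sigma> p q"
  assumes k: "k \<in> K p q" and k': "k' \<in> K p q" and r: "r \<in> carrier R"
  shows "k \<in> carrier (N p q)" "k \<oplus>\<^bsub>N p q\<^esub> k' \<in> K p q" "r \<odot>\<^bsub>N p q\<^esub> k \<in> K p q"
proof -
  let ?C = "BM_chains R \<Sigma> p (q + 1)"
  obtain b where b: "b \<in> carrier ?C" "k = BM_boundary R \<Sigma> ori p (q + 1) b"
    using k unfolding K_def BM_boundaries_def by (rule imageE)
  obtain b' where b': "b' \<in> carrier ?C" "k' = BM_boundary R \<Sigma> ori p (q + 1) b'"
    using k' unfolding K_def BM_boundaries_def by (rule imageE)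
  have ext: "BM_boundary R \<Sigma> ori p (q + 1) c \<in> extensional (cones \<Sigma> q)" for c
    by (simp add: BM_boundary_def)
  note L = boundary_linear[OF _ b(1) b'(1) r, unfolded b(2)[symmetric] b'(2)[symmetric], simplified]
  show "k \<in> carrier (N p q)"
    unfolding N_def BM_chains_def dsum_simps PiE_iff using L(1) ext[of b] b(2) by simp
  have "k \<oplus>\<^bsub>N p q\<^esub> k' = BM_boundary R \<Sigma> ori p (q + 1) (b \<oplus>\<^bsub>?C\<^esub> b')"
    by (rule extensionalityI[OF _ ext]) (simp_all add: N_def BM_chains_def[of R \<Sigma> p q] dsum_simps L(2))
  then show "k \<oplus>\<^bsub>N p q\<^esub> k' \<in> K p q"
    unfolding K_def BM_boundaries_def by (rule image_eqI[OF _ chain_add_smult(1)[OF b(1) b'(1) r]])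
  have "r \<odot>\<^bsub>N p q\<^esub> k = BM_boundary R \<Sigma> ori p (q + 1) (r \<odot>\<^bsub>?C\<^esub> b)"
    by (rule extensionalityI[OF _ ext]) (simp_all add: N_def BM_chains_def[of R \<Sigma> p q] dsum_simps L(3))
  then show "r \<odot>\<^bsub>N p q\<^esub> k \<in> K p q"
    unfolding K_def BM_boundaries_def by (rule image_eqI[OF _ chain_add_smult(2)[OF b(1) b'(1) r]])
qed

lemma chains_zero:
  "z \<in> carrier (BM_chains R \<Sigma> p q) \<Longrightarrow> z \<oplus>\<^bsub>BM_chains R \<Sigma> p q\<^esub> \<zero>\<^bsub>BM_chains R \<Sigma> p q\<^esub> = z"
  "r \<in> carrier R \<Longrightarrow> r \<odot>\<^bsub>BM_chains R \<Sigma> p q\<^esub> \<zero>\<^bsub>BM_chains R \<Sigma> p q\<^esub> = \<zero>\<^bsub>BM_chains R \<Sigma> p q\<^esub>"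
proof -
  note M = F_low_module[OF R]
  assume z: "z \<in> carrier (BM_chains R \<Sigma> p q)"
  have "z \<in> extensional (cones \<Sigma> q)" using z by (simp add: BM_chains_def dsum_simps PiE_iff)
  moreover have "z \<sigma> \<oplus>\<^bsub>F_low R \<Sigma> p \<sigma>\<^esub> \<zero>\<^bsub>F_low R \<Sigma> p \<sigma>\<^esub> = z \<sigma>" if "\<sigma> \<in> cones \<Sigma> q" for \<sigma>
    by (rule abelian_monoid.r_zero[OF abelian_group.axioms(1)[OF module.axioms(2)[OF M]] chain_mem[OF z that]])
  ultimately show "z \<oplus>\<^bsub>BM_chains R \<Sigma> p q\<^esub> \<zero>\<^bsub>BM_chains R \<Sigma> p q\<^esub> = z"
    unfolding BM_chains_def dsum_simps by (intro extensionalityI[of _ "cones \<Sigma> q"]) simp_all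
next
  assume r: "r \<in> carrier R"
  show "r \<odot>\<^bsub>BM_chains R \<Sigma> p q\<^esub> \<zero>\<^bsub>BM_chains R \<Sigma> p q\<^esub> = \<zero>\<^bsub>BM_chains R \<Sigma> p q\<^esub>"
    unfolding BM_chains_def dsum_simps
    by (rule restrict_ext) (simp add: module.smult_r_null[OF F_low_module[OF R] r])
qed

lemma ray_pairing_linear:
  assumes U: "\<forall>\<rho>\<in>cones \<Sigma> 1. U \<rho> \<in> carrier (F_up R \<Sigma> p \<rho>)"
    and b: "b \<in> carrier (BM_chains R \<Sigma> p 1)" and b': "b' \<in> carrier (BM_chains R \<Sigma> p 1)" and r: "r \<in> carrier R"
  defines "\<Phi> \<equiv> ray_pairing p U"
  shows "\<Phi> b \<in> carrier R" "\<Phi> (b \<oplus>\<^bsub>BM_chains R \<Sigma> p 1\<^esub> b') = \<Phi> b \<oplus>\<^bsub>R\<^esub> \<Phi> b'" "\<Phi> (r \<odot>\<^bsub>BM_chains R \<Sigma> p 1\<^esub> b) = r \<otimes>\<^bsub>R\<^esub> \<Phi> b"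
proof -
  interpret A: cring R by (rule R)
  define t where "t b \<rho> = [rel_sign ori {0} \<rho>] \<cdot>\<^bsub>R\<^esub> U \<rho> (b \<rho>)" for b \<rho>
  have \<Phi>: "\<Phi> b = (\<Oplus>\<^bsub>R\<^esub>\<rho>\<in>cones \<Sigma> 1. t b \<rho>)" for b
    unfolding \<Phi>_def ray_pairing_def t_def ..
  note U' = bspec[OF U, unfolded F_up_def]
  have ic: "U \<rho> (b \<rho>) \<in> carrier R" if "b \<in> carrier (BM_chains R \<Sigma> p 1)" "\<rho> \<in> cones \<Sigma> 1" for b \<rho>
    by (rule dual_modD(1)[OF U'[OF that(2)] chain_mem[OF that]])
  have tc: "t b \<in> cones \<Sigma> 1 \<rightarrow> carrier R" if "b \<in> carrier (BM_chains R \<Sigma> p 1)" for b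
    unfolding t_def by (intro funcsetI A.add.int_pow_closed ic[OF that])
  show "\<Phi> b \<in> carrier R" unfolding \<Phi> by (rule A.finsum_closed[OF tc[OF b]])
  have "\<Phi> (b \<oplus>\<^bsub>BM_chains R \<Sigma> p 1\<^esub> b') = (\<Oplus>\<^bsub>R\<^esub>\<rho>\<in>cones \<Sigma> 1. t b \<rho> \<oplus>\<^bsub>R\<^esub> t b' \<rho>)"
    unfolding \<Phi>
  proof (rule A.finsum_cong'[OF refl])
    show "(\<lambda>\<rho>. t b \<rho> \<oplus>\<^bsub>R\<^esub> t b' \<rho>) \<in> cones \<Sigma> 1 \<rightarrow> carrier R" using tc[OF b] tc[OF b'] by (simp add: Pi_iff)
    fix \<rho> assume \<rho>: "\<rho> \<in> cones \<Sigma> 1"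
    have "(b \<oplus>\<^bsub>BM_chains R \<Sigma> p 1\<^esub> b') \<rho> = b \<rho> \<oplus>\<^bsub>F_low R \<Sigma> p \<rho>\<^esub> b' \<rho>" using \<rho> by (simp add: BM_chains_def dsum_simps)
    then show "t (b \<oplus>\<^bsub>BM_chains R \<Sigma> p 1\<^esub> b') \<rho> = t b \<rho> \<oplus>\<^bsub>R\<^esub> t b' \<rho>"
      unfolding t_def using dual_modD(2)[OF U'[OF \<rho>] chain_mem[OF b \<rho>] chain_mem[OF b' \<rho>]]
        A.add.int_pow_distrib[OF ic[OF b \<rho>] ic[OF b' \<rho>]] by simp
  qed
  also have "\<dots> = \<Phi> b \<oplus>\<^bsub>R\<^esub> \<Phi> b'" unfolding \<Phi> by (rule A.finsum_addf[OF tc[OF b] tc[OF b']])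
  finally show "\<Phi> (b \<oplus>\<^bsub>BM_chains R \<Sigma> p 1\<^esub> b') = \<Phi> b \<oplus>\<^bsub>R\<^esub> \<Phi> b'" .
  have "\<Phi> (r \<odot>\<^bsub>BM_chains R \<Sigma> p 1\<^esub> b) = (\<Oplus>\<^bsub>R\<^esub>\<rho>\<in>cones \<Sigma> 1. r \<otimes>\<^bsub>R\<^esub> t b \<rho>)"
    unfolding \<Phi>
  proof (rule A.finsum_cong'[OF refl])
    show "(\<lambda>\<rho>. r \<otimes>\<^bsub>R\<^esub> t b \<rho>) \<in> cones \<Sigma> 1 \<rightarrow> carrier R"
      by (intro funcsetI A.m_closed r) (use tc[OF b] in \<open>simp add: Pi_iff\<close>)
    fix \<rho> assume \<rho>: "\<rho> \<in> cones \<Sigma> 1"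
    have "(r \<odot>\<^bsub>BM_chains R \<Sigma> p 1\<^esub> b) \<rho> = r \<odot>\<^bsub>F_low R \<Sigma> p \<rho>\<^esub> b \<rho>" using \<rho> by (simp add: BM_chains_def dsum_simps)
    moreover have "rel_sign ori {0} \<rho> = 1 \<or> rel_sign ori {0} \<rho> = - 1" by (simp add: rel_sign_def)
    ultimately show "t (r \<odot>\<^bsub>BM_chains R \<Sigma> p 1\<^esub> b) \<rho> = r \<otimes>\<^bsub>R\<^esub> t b \<rho>"
      unfolding t_def using dual_modD(3)[OF U'[OF \<rho>] r chain_mem[OF b \<rho>]] ic[OF b \<rho>] r
      by (auto simp: A.r_minus)
  qed
  also have "\<dots> = r \<otimes>\<^bsub>R\<^esub> \<Phi> b"
    unfolding \<Phi> by (rule A.finsum_rdistr[OF finite_cones(1) r tc[OF b], symmetric])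
  finally show "\<Phi> (r \<odot>\<^bsub>BM_chains R \<Sigma> p 1\<^esub> b) = r \<otimes>\<^bsub>R\<^esub> \<Phi> b" .
qed

text \<open>By exactness at the vertex every element is the boundary of a chain \<open>b\<close> on the rays, and its value has to be
  \<open>ray_pairing p U b\<close>. By exactness at the rays two such chains differ by a boundary, on which the
  pairing vanishes.\<close>

lemma glue_ray_functionals:
  assumes vanish0: "carrier (BM_homology R \<Sigma> ori p 0) = {\<zero>\<^bsub>BM_homology R \<Sigma> ori p 0\<^esub>}"
    and vanish1: "carrier (BM_homology R \<Sigma> ori p 1) = {\<zero>\<^bsub>BM_homology R \<Sigma> ori p 1\<^esub>}"
    and U: "\<And>\<rho>. \<rho> \<in> cones \<Sigma> 1 \<Longrightarrow> U \<rho> \<in> carrier (F_up R \<Sigma> p \<rho>)"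
    and compatible: "\<And>\<sigma> \<rho> \<rho>'. \<sigma> \<in> cones \<Sigma> 2 \<Longrightarrow> \<rho> \<in> cones \<Sigma> 1 \<Longrightarrow> \<rho>' \<in> cones \<Sigma> 1 \<Longrightarrow> \<rho> face_of \<sigma> \<Longrightarrow> \<rho>' face_of \<sigma> \<Longrightarrow>
      rho R \<Sigma> p \<rho> \<sigma> (U \<rho>) = rho R \<Sigma> p \<rho>' \<sigma> (U \<rho>')"
  obtains u where "u \<in> carrier (F_up R \<Sigma> p {0})" "\<And>\<rho>. \<rho> \<in> cones \<Sigma> 1 \<Longrightarrow> rho R \<Sigma> p {0} \<rho> u = U \<rho>"
proof -
  interpret A: cring R by (rule R)
  let ?M = "F_low R \<Sigma> p {0}" and ?C = "BM_chains R \<Sigma> p 1"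
  interpret M: module R ?M by (rule F_low_module[OF R])
  define bd where "bd b = BM_boundary R \<Sigma> ori p 1 b {0}" for b
  define \<Phi> where "\<Phi> = ray_pairing p U"
  have UB: "\<forall>\<rho>\<in>cones \<Sigma> 1. U \<rho> \<in> carrier (F_up R \<Sigma> p \<rho>)" using U by simp
  have vertex: "{0} \<in> cones \<Sigma> (1 - 1)" by (simp add: cones_0)
  note L = boundary_linear[OF vertex, of _ p, folded bd_def] and P = ray_pairing_linear[OF UB, folded \<Phi>_def]
  have unique: "\<Phi> b = \<Phi> b'" if b: "b \<in> carrier ?C" and b': "b' \<in> carrier ?C" and eq: "bd b = bd b'" for b b'
  proof -
    have m1: "\<ominus>\<^bsub>R\<^esub> \<one>\<^bsub>R\<^esub> \<in> carrier R" by simp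
    note nb = chain_add_smult(2)[OF b' b' m1]
    let ?b = "b \<oplus>\<^bsub>?C\<^esub> (\<ominus>\<^bsub>R\<^esub> \<one>\<^bsub>R\<^esub> \<odot>\<^bsub>?C\<^esub> b')"
    note bb = chain_add_smult(1)[OF b nb m1]
    have "bd ?b = bd b \<oplus>\<^bsub>?M\<^esub> \<ominus>\<^bsub>R\<^esub> \<one>\<^bsub>R\<^esub> \<odot>\<^bsub>?M\<^esub> bd b'"
      unfolding L(2)[OF b nb m1] L(3)[OF b' b' m1] ..
    also have "\<dots> = \<zero>\<^bsub>?M\<^esub>"
      using L(1)[OF b' b' m1] eq module.smult_l_minus[OF M.module_axioms A.one_closed L(1)[OF b' b' m1]]
      by (simp add: module.smult_one[OF M.module_axioms] M.M.r_neg)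
    finally have "BM_boundary R \<Sigma> ori p 1 ?b {0} = \<zero>\<^bsub>?M\<^esub>" unfolding bd_def .
    then obtain e where e: "e \<in> carrier (BM_chains R \<Sigma> p 2)" "?b = BM_boundary R \<Sigma> ori p 2 e"
      by (rule exact_at_rays[OF vanish1 bb])
    have "\<Phi> ?b = \<zero>\<^bsub>R\<^esub>"
      unfolding e(2) \<Phi>_def by (rule ray_pairing_boundary[OF U compatible e(1)])
    moreover have "\<Phi> ?b = \<Phi> b \<oplus>\<^bsub>R\<^esub> \<ominus>\<^bsub>R\<^esub> \<one>\<^bsub>R\<^esub> \<otimes>\<^bsub>R\<^esub> \<Phi> b'"
      unfolding P(2)[OF b nb m1] P(3)[OF b' b' m1] ..
    ultimately have "\<Phi> b \<ominus>\<^bsub>R\<^esub> \<Phi> b' = \<zero>\<^bsub>R\<^esub>"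
      using P(1)[OF b' b' m1] by (simp add: a_minus_def A.l_minus)
    then show ?thesis using P(1)[OF b b m1] P(1)[OF b' b' m1] by simp
  qed
  define lift where "lift x = (SOME b. b \<in> carrier ?C \<and> bd b = x)" for x
  have lift: "lift x \<in> carrier ?C" "bd (lift x) = x" if x: "x \<in> carrier ?M" for x
  proof -
    have "\<exists>b. b \<in> carrier ?C \<and> bd b = x" using exact_at_vertex[OF vanish0 x] unfolding bd_def by metis
    from someI_ex[OF this] show "lift x \<in> carrier ?C" "bd (lift x) = x" by (simp_all add: lift_def)
  qed
  define u where "u = (\<lambda>x\<in>carrier ?M. \<Phi> (lift x))"
  have u_bd: "u (bd b) = \<Phi> b" if b: "b \<in> carrier ?C" for b
  proof -
    have c: "bd b \<in> carrier ?M" by (rule L(1)[OF b b A.one_closed])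
    then show ?thesis using unique[OF lift(1)[OF c] b lift(2)[OF c]] by (simp add: u_def)
  qed
  have u: "u \<in> carrier (F_up R \<Sigma> p {0})"
    unfolding F_up_def
  proof (rule dual_modI)
    show "u \<in> extensional (carrier ?M)" by (simp add: u_def)
    fix x assume x: "x \<in> carrier ?M"
    note lx = lift[OF x]
    show "u x \<in> carrier R" using P(1)[OF lx(1) lx(1) A.one_closed] x by (simp add: u_def)
    show "u (r \<odot>\<^bsub>?M\<^esub> x) = r \<otimes>\<^bsub>R\<^esub> u x" if r: "r \<in> carrier R" for r
      using u_bd[OF chain_add_smult(2)[OF lx(1) lx(1) r]] u_bd[OF lx(1)]
      unfolding L(3)[OF lx(1) lx(1) r] P(3)[OF lx(1) lx(1) r] lx(2) by simp
    fix y assume y: "y \<in> carrier ?M"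
    note ly = lift[OF y]
    show "u (x \<oplus>\<^bsub>?M\<^esub> y) = u x \<oplus>\<^bsub>R\<^esub> u y"
      using u_bd[OF chain_add_smult(1)[OF lx(1) ly(1) A.one_closed]] u_bd[OF lx(1)] u_bd[OF ly(1)]
      unfolding L(2)[OF lx(1) ly(1) A.one_closed] P(2)[OF lx(1) ly(1) A.one_closed] lx(2) ly(2) by simp
  qed
  moreover have "rho R \<Sigma> p {0} \<rho> u = U \<rho>" if \<rho>: "\<rho> \<in> cones \<Sigma> 1" for \<rho>
  proof (rule dual_mod_ext)
    show "rho R \<Sigma> p {0} \<rho> u \<in> carrier (dual_mod R (F_low R \<Sigma> p \<rho>))"
      using rho_closed[OF R ray_face[OF \<rho>] u] by (simp add: F_up_def)
    show "U \<rho> \<in> carrier (dual_mod R (F_low R \<Sigma> p \<rho>))" using U[OF \<rho>] by (simp add: F_up_def)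
    note U' = this
    fix y assume y: "y \<in> carrier (F_low R \<Sigma> p \<rho>)"
    define \<epsilon> where "\<epsilon> = rel_sign ori {0} \<rho>"
    have \<epsilon>: "\<epsilon> = 1 \<or> \<epsilon> = - 1" by (simp add: \<epsilon>_def rel_sign_def)
    then have \<epsilon>2: "\<epsilon> * \<epsilon> = 1" by auto
    interpret F: module R "F_low R \<Sigma> p \<rho>" by (rule F_low_module[OF R])
    \<comment> \<open>The chain on the single ray \<open>\<rho>\<close> with boundary \<open>y\<close>: the factor \<open>\<epsilon>\<close> cancels the boundary sign.\<close>
    define y' where "y' = [\<epsilon>] \<cdot>\<^bsub>F_low R \<Sigma> p \<rho>\<^esub> y"
    have y': "y' \<in> carrier (F_low R \<Sigma> p \<rho>)" unfolding y'_def by (rule F.M.add.int_pow_closed[OF y])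
    have yy: "[\<epsilon>] \<cdot>\<^bsub>F_low R \<Sigma> p \<rho>\<^esub> y' = y"
      unfolding y'_def F.M.add_pow_add_pow[OF y] \<epsilon>2 using y by simp
    define b where "b = (\<lambda>\<rho>'\<in>cones \<Sigma> 1. if \<rho>' = \<rho> then y' else \<zero>\<^bsub>F_low R \<Sigma> p \<rho>'\<^esub>)"
    have zc: "\<zero>\<^bsub>F_low R \<Sigma> p \<rho>'\<^esub> \<in> carrier (F_low R \<Sigma> p \<rho>')" for \<rho>'
      by (rule abelian_monoid.zero_closed[OF abelian_group.axioms(1)[OF module.axioms(2)[OF F_low_module[OF R]]]])
    have b: "b \<in> carrier ?C"
      unfolding BM_chains_def dsum_simps b_def using y' zc by (auto simp: PiE_iff)
    have ioc: "iota R \<Sigma> p {0} y' \<in> carrier ?M" by (rule linear_mapD(1)[OF iota_linear[OF R ray_face[OF \<rho>]] y'])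
    have Uc: "U \<rho> y' \<in> carrier R" by (rule dual_modD(1)[OF U' y'])
    have "bd b = (\<Oplus>\<^bsub>?M\<^esub>\<rho>'\<in>{\<rho>}. [rel_sign ori {0} \<rho>'] \<cdot>\<^bsub>?M\<^esub> iota R \<Sigma> p {0} (b \<rho>'))"
      unfolding bd_def boundary_at_vertex
    proof (rule M.M.add.finprod_mono_neutral_cong_right)
      show "finite (cones \<Sigma> 1)" by (rule finite_cones)
      show "{\<rho>} \<subseteq> cones \<Sigma> 1" using \<rho> by simp
      show "(\<lambda>\<rho>'. [rel_sign ori {0} \<rho>'] \<cdot>\<^bsub>?M\<^esub> iota R \<Sigma> p {0} (b \<rho>')) \<in> cones \<Sigma> 1 \<rightarrow> carrier ?M"
        using M.M.add.int_pow_closed linear_mapD(1)[OF iota_linear[OF R ray_face] chain_mem[OF b]] by simp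
      fix \<rho>' assume \<rho>': "\<rho>' \<in> cones \<Sigma> 1 - {\<rho>}"
      have "iota R \<Sigma> p {0} \<zero>\<^bsub>F_low R \<Sigma> p \<rho>'\<^esub> = \<zero>\<^bsub>?M\<^esub>"
        by (rule linear_map_zero[OF F_low_module[OF R] F_low_module[OF R] iota_linear[OF R ray_face]]) (use \<rho>' in auto)
      then show "[rel_sign ori {0} \<rho>'] \<cdot>\<^bsub>?M\<^esub> iota R \<Sigma> p {0} (b \<rho>') = \<zero>\<^bsub>?M\<^esub>"
        using \<rho>' by (simp add: b_def M.M.add.int_pow_one)
    qed simp
    also have "\<dots> = [\<epsilon>] \<cdot>\<^bsub>?M\<^esub> iota R \<Sigma> p {0} y'"
      using \<rho> ioc M.M.add.int_pow_closed[OF ioc] by (simp add: M.M.finsum_insert b_def \<epsilon>_def)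
    also have "\<dots> = iota R \<Sigma> p {0} y"
      using linear_map_add_pow[OF F_low_module[OF R] F_low_module[OF R] iota_linear[OF R ray_face[OF \<rho>]] y', of \<epsilon>] yy by simp
    finally have bdb: "bd b = iota R \<Sigma> p {0} y" .
    have "\<Phi> b = (\<Oplus>\<^bsub>R\<^esub>\<rho>'\<in>{\<rho>}. [rel_sign ori {0} \<rho>'] \<cdot>\<^bsub>R\<^esub> U \<rho>' (b \<rho>'))"
      unfolding \<Phi>_def ray_pairing_def
    proof (rule A.add.finprod_mono_neutral_cong_right)
      show "finite (cones \<Sigma> 1)" by (rule finite_cones)
      show "{\<rho>} \<subseteq> cones \<Sigma> 1" using \<rho> by simp
      show "(\<lambda>\<rho>'. [rel_sign ori {0} \<rho>'] \<cdot>\<^bsub>R\<^esub> U \<rho>' (b \<rho>')) \<in> cones \<Sigma> 1 \<rightarrow> carrier R"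
        using A.add.int_pow_closed dual_modD(1)[OF U[unfolded F_up_def] chain_mem[OF b]] by simp
      fix \<rho>' assume \<rho>': "\<rho>' \<in> cones \<Sigma> 1 - {\<rho>}"
      have "U \<rho>' \<zero>\<^bsub>F_low R \<Sigma> p \<rho>'\<^esub> = \<zero>\<^bsub>R\<^esub>"
        by (rule dual_mod_hom_simps(1)[OF F_low_module[OF R] U[unfolded F_up_def]]) (use \<rho>' in auto)
      then show "[rel_sign ori {0} \<rho>'] \<cdot>\<^bsub>R\<^esub> U \<rho>' (b \<rho>') = \<zero>\<^bsub>R\<^esub>"
        using \<rho>' by (simp add: b_def A.add.int_pow_one)
    qed simp
    also have "\<dots> = [\<epsilon>] \<cdot>\<^bsub>R\<^esub> U \<rho> y'"
      using \<rho> Uc A.add.int_pow_closed[OF Uc] by (simp add: A.finsum_insert b_def \<epsilon>_def)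
    also have "\<dots> = U \<rho> y"
      using dual_mod_hom_simps(4)[OF F_low_module[OF R] U' y', of \<epsilon>] yy by simp
    finally show "rho R \<Sigma> p {0} \<rho> u y = U \<rho> y"
      using u_bd[OF b] unfolding rho_apply[OF y] bdb by simp
  qed
  ultimately show ?thesis by (rule that)
qed

text \<open>A functional is determined by its restrictions to the rays, because these generate by exactness at the vertex.
  A cycle gives a functional on every ray; on a cone of dimension two the restrictions from its two rays have
  the same cap products, hence agree, and exactness at the rays glues them.\<close>

theorem local_duality_vertex:
  assumes p: "p \<le> d" and d: "2 \<le> d"
    and vanish0: "carrier (BM_homology R \<Sigma> ori p 0) = {\<zero>\<^bsub>BM_homology R \<Sigma> ori p 0\<^esub>}"
    and vanish1: "carrier (BM_homology R \<Sigma> ori p 1) = {\<zero>\<^bsub>BM_homology R \<Sigma> ori p 1\<^esub>}"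
    and local: "\<And>\<gamma>. \<gamma> \<in> \<Sigma> \<Longrightarrow> dim \<gamma> > 0 \<Longrightarrow> local_duality p \<gamma>"
  shows "local_duality p {0}"
proof -
  let ?up = "\<lambda>\<gamma>. carrier (F_up R \<Sigma> p \<gamma>)" and ?cyc = "local_cycles (d - p)"
  have bij: "bij_betw (local_cap p \<gamma>) (?up \<gamma>) (?cyc \<gamma>)" if "\<gamma> \<in> \<Sigma>" "dim \<gamma> > 0" for \<gamma>
    using local[OF that] by (simp add: local_duality_def)
  have inj: "u = u'"
    if "\<gamma> \<in> \<Sigma>" "dim \<gamma> > 0" "u \<in> ?up \<gamma>" "u' \<in> ?up \<gamma>"
      and eq: "\<And>\<alpha>. \<alpha> \<in> max_cones \<Sigma> \<Longrightarrow> \<gamma> face_of \<alpha> \<Longrightarrow> cap p \<gamma> \<alpha> u = cap p \<gamma> \<alpha> u'" for \<gamma> u u'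
  proof -
    have "local_cap p \<gamma> u = local_cap p \<gamma> u'" unfolding local_cap_def by (rule restrict_ext) (simp add: eq)
    then show ?thesis using bij_betw_imp_inj_on[OF bij[OF that(1,2)]] that(3,4) by (simp add: inj_on_def)
  qed
  have ray: "\<rho> \<in> \<Sigma>" "dim \<rho> > 0" "{0} face_of \<rho>" if "\<rho> \<in> cones \<Sigma> 1" for \<rho>
    using that ray_face[OF that] by (simp_all add: cones_def)
  have ray_of: "\<exists>\<rho>\<in>cones \<Sigma> 1. \<rho> face_of \<sigma>" if \<sigma>: "\<sigma> \<in> \<Sigma>" "dim \<sigma> > 0" for \<sigma>
  proof -
    obtain \<rho> where \<rho>: "\<rho> face_of \<sigma>" "dim \<rho> = 1" using cone_has_ray[OF rational[OF \<sigma>(1)] \<sigma>(2)] .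
    have "\<rho> \<noteq> {}" using \<rho>(2) by auto
    then show ?thesis using face_mem[OF \<sigma>(1) \<rho>(1)] \<rho> by (intro bexI[of _ \<rho>]) (simp_all add: cones_def)
  qed
  have v: "{\<alpha> \<in> max_cones \<Sigma>. {0} face_of \<alpha>} = max_cones \<Sigma>"
    using vertex_face_of by (auto simp: max_cones_iff)
  show ?thesis
    unfolding local_duality_def bij_betw_def
  proof (intro conjI inj_onI equalityI subsetI)
    fix u u' assume u: "u \<in> ?up {0}" and u': "u' \<in> ?up {0}" and eq: "local_cap p {0} u = local_cap p {0} u'"
    have caps: "cap p {0} \<alpha> u = cap p {0} \<alpha> u'" if "\<alpha> \<in> max_cones \<Sigma>" for \<alpha>
      using fun_cong[OF eq, of \<alpha>] that by (simp add: local_cap_def v)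
    have rays: "rho R \<Sigma> p {0} \<rho> u = rho R \<Sigma> p {0} \<rho> u'" if \<rho>: "\<rho> \<in> cones \<Sigma> 1" for \<rho>
      by (rule inj[OF ray(1,2)[OF \<rho>] rho_closed[OF R ray(3)[OF \<rho>] u] rho_closed[OF R ray(3)[OF \<rho>] u']])
         (simp add: cap_at_face[OF R ray(3)[OF \<rho>]] caps)
    note U = u[unfolded F_up_def] and U' = u'[unfolded F_up_def]
    show "u = u'"
    proof (rule dual_mod_ext[OF U U'])
      let ?M = "F_low R \<Sigma> p {0}"
      interpret A: abelian_group R by (rule R_group)
      interpret M: module R ?M by (rule F_low_module[OF R])
      fix x assume "x \<in> carrier ?M"
      then obtain b where b: "b \<in> carrier (BM_chains R \<Sigma> p 1)" "BM_boundary R \<Sigma> ori p 1 b {0} = x"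
        using exact_at_vertex[OF vanish0] by metis
      have ib: "iota R \<Sigma> p {0} (b \<rho>) \<in> carrier ?M" if "\<rho> \<in> cones \<Sigma> 1" for \<rho>
        by (rule linear_mapD(1)[OF iota_linear[OF R ray_face[OF that]] chain_mem[OF b(1) that]])
      let ?t = "\<lambda>\<rho>. [rel_sign ori {0} \<rho>] \<cdot>\<^bsub>?M\<^esub> iota R \<Sigma> p {0} (b \<rho>)"
      have t: "?t \<in> cones \<Sigma> 1 \<rightarrow> carrier ?M" by (intro funcsetI M.M.add.int_pow_closed ib)
      have same: "u (iota R \<Sigma> p {0} (b \<rho>)) = u' (iota R \<Sigma> p {0} (b \<rho>))" if "\<rho> \<in> cones \<Sigma> 1" for \<rho>
        using fun_cong[OF rays[OF that], of "b \<rho>"] by (simp add: rho_apply[OF chain_mem[OF b(1) that]])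
      have "u x = (\<Oplus>\<^bsub>R\<^esub>\<rho>\<in>cones \<Sigma> 1. u (?t \<rho>))"
        unfolding b(2)[symmetric] boundary_at_vertex by (rule dual_finsum[OF F_low_module[OF R] U t finite_cones(1)])
      also have "\<dots> = (\<Oplus>\<^bsub>R\<^esub>\<rho>\<in>cones \<Sigma> 1. u' (?t \<rho>))"
      proof (rule A.finsum_cong'[OF refl])
        show "(\<lambda>\<rho>. u' (?t \<rho>)) \<in> cones \<Sigma> 1 \<rightarrow> carrier R"
          by (intro funcsetI dual_modD(1)[OF U'] M.M.add.int_pow_closed ib)
        fix \<rho> assume \<rho>: "\<rho> \<in> cones \<Sigma> 1"
        show "u (?t \<rho>) = u' (?t \<rho>)"
          unfolding dual_mod_hom_simps(4)[OF F_low_module[OF R] U ib[OF \<rho>]]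
            dual_mod_hom_simps(4)[OF F_low_module[OF R] U' ib[OF \<rho>]] same[OF \<rho>] ..
      qed
      also have "\<dots> = u' x"
        unfolding b(2)[symmetric] boundary_at_vertex by (rule dual_finsum[OF F_low_module[OF R] U' t finite_cones(1), symmetric])
      finally show "u x = u' x" .
    qed
  next
    fix z assume "z \<in> local_cap p {0} ` ?up {0}"
    then obtain u where u: "u \<in> ?up {0}" and z: "z = local_cap p {0} u" by auto
    have "facet_sum R \<Sigma> ori (d - p) \<kappa> z = \<zero>\<^bsub>F_low R \<Sigma> (d - p) \<kappa>\<^esub>"
      if \<kappa>: "\<kappa> \<in> \<Sigma>" "Suc (dim \<kappa>) = d" for \<kappa>
    proof -
      have "dim \<kappa> > 0" using \<kappa>(2) d by simp
      then obtain \<rho> where \<rho>: "\<rho> \<in> cones \<Sigma> 1" "\<rho> face_of \<kappa>" using ray_of[OF \<kappa>(1)] by metis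
      let ?u = "rho R \<Sigma> p {0} \<rho> u"
      have "local_cap p \<rho> ?u \<in> ?cyc \<rho>"
        using bij_betwE[OF bij[OF ray(1,2)[OF \<rho>(1)]]] rho_closed[OF R ray(3)[OF \<rho>(1)] u] by simp
      then have c: "facet_sum R \<Sigma> ori (d - p) \<kappa> (local_cap p \<rho> ?u) = \<zero>\<^bsub>F_low R \<Sigma> (d - p) \<kappa>\<^esub>"
        using \<kappa> \<rho>(2) by (simp add: local_cycles_def)
      have "facet_sum R \<Sigma> ori (d - p) \<kappa> z = facet_sum R \<Sigma> ori (d - p) \<kappa> (local_cap p \<rho> ?u)"
      proof (rule facet_sum_cong)
        fix \<sigma> assume \<sigma>: "\<sigma> \<in> max_cones \<Sigma>" "\<kappa> face_of \<sigma>"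
        have f: "\<rho> face_of \<sigma>" by (rule face_of_trans[OF \<rho>(2) \<sigma>(2)])
        have "z \<sigma> = cap p {0} \<sigma> u" using \<sigma>(1) by (simp add: z local_cap_def v)
        moreover have "local_cap p \<rho> ?u \<sigma> = cap p \<rho> \<sigma> ?u" using \<sigma>(1) f by (simp add: local_cap_def)
        moreover have "cap p \<rho> \<sigma> ?u \<in> carrier (F_low R \<Sigma> (d - p) \<sigma>)"
          by (rule cap_closed[OF \<sigma>(1) f rho_closed[OF R ray(3)[OF \<rho>(1)] u] p])
        ultimately show "z \<sigma> = local_cap p \<rho> ?u \<sigma> \<and> local_cap p \<rho> ?u \<sigma> \<in> carrier (F_low R \<Sigma> (d - p) \<sigma>)"
          using cap_at_face[OF R ray(3)[OF \<rho>(1)] f] by simp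
      qed
      then show ?thesis using c by simp
    qed
    then show "z \<in> ?cyc {0}"
      using local_cap_closed[OF p u] by (simp add: local_cycles_def v flip: z)
  next
    fix z assume z: "z \<in> ?cyc {0}"
    then have zP: "z \<in> (\<Pi>\<^sub>E \<alpha>\<in>max_cones \<Sigma>. carrier (F_low R \<Sigma> (d - p) \<alpha>))"
      and zb: "\<And>\<kappa>. \<kappa> \<in> \<Sigma> \<Longrightarrow> Suc (dim \<kappa>) = d \<Longrightarrow> facet_sum R \<Sigma> ori (d - p) \<kappa> z = \<zero>\<^bsub>F_low R \<Sigma> (d - p) \<kappa>\<^esub>"
      using vertex_face_of by (simp_all add: local_cycles_def v)
    have zc: "z \<alpha> \<in> carrier (F_low R \<Sigma> (d - p) \<alpha>)" if "\<alpha> \<in> max_cones \<Sigma>" for \<alpha> using zP that by (simp add: PiE_iff)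
    have "\<exists>u\<in>?up \<rho>. \<forall>\<alpha>\<in>max_cones \<Sigma>. \<rho> face_of \<alpha> \<longrightarrow> cap p \<rho> \<alpha> u = z \<alpha>" if \<rho>: "\<rho> \<in> cones \<Sigma> 1" for \<rho>
    proof -
      let ?z = "\<lambda>\<alpha>\<in>{\<alpha> \<in> max_cones \<Sigma>. \<rho> face_of \<alpha>}. z \<alpha>"
      have "facet_sum R \<Sigma> ori (d - p) \<kappa> ?z = \<zero>\<^bsub>F_low R \<Sigma> (d - p) \<kappa>\<^esub>"
        if \<kappa>: "\<kappa> \<in> \<Sigma>" "\<rho> face_of \<kappa>" "Suc (dim \<kappa>) = d" for \<kappa>
      proof -
        have "facet_sum R \<Sigma> ori (d - p) \<kappa> ?z = facet_sum R \<Sigma> ori (d - p) \<kappa> z"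
          by (rule facet_sum_cong) (use face_of_trans[OF \<kappa>(2)] zc in simp)
        then show ?thesis using zb[OF \<kappa>(1,3)] by simp
      qed
      then have "?z \<in> ?cyc \<rho>" using zc by (simp add: local_cycles_def)
      then have "?z \<in> local_cap p \<rho> ` ?up \<rho>" using bij_betw_imp_surj_on[OF bij[OF ray(1,2)[OF \<rho>]]] by simp
      then obtain u where u: "u \<in> ?up \<rho>" "?z = local_cap p \<rho> u" by auto
      have "cap p \<rho> \<alpha> u = z \<alpha>" if "\<alpha> \<in> max_cones \<Sigma>" "\<rho> face_of \<alpha>" for \<alpha>
        using fun_cong[OF u(2), of \<alpha>] that by (simp add: local_cap_def)
      then show ?thesis using u(1) by (intro bexI[of _ u]) simp_all
    qed
    then obtain U where U: "\<And>\<rho>. \<rho> \<in> cones \<Sigma> 1 \<Longrightarrow> U \<rho> \<in> ?up \<rho>"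
      "\<And>\<rho> \<alpha>. \<rho> \<in> cones \<Sigma> 1 \<Longrightarrow> \<alpha> \<in> max_cones \<Sigma> \<Longrightarrow> \<rho> face_of \<alpha> \<Longrightarrow> cap p \<rho> \<alpha> (U \<rho>) = z \<alpha>"
      by metis
    have compatible: "rho R \<Sigma> p \<rho> \<sigma> (U \<rho>) = rho R \<Sigma> p \<rho>' \<sigma> (U \<rho>')"
      if \<sigma>: "\<sigma> \<in> cones \<Sigma> 2" and \<rho>: "\<rho> \<in> cones \<Sigma> 1" "\<rho>' \<in> cones \<Sigma> 1" "\<rho> face_of \<sigma>" "\<rho>' face_of \<sigma>" for \<sigma> \<rho> \<rho>'
    proof (rule inj[OF _ _ rho_closed[OF R \<rho>(3) U(1)[OF \<rho>(1)]] rho_closed[OF R \<rho>(4) U(1)[OF \<rho>(2)]]])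
      show "\<sigma> \<in> \<Sigma>" "dim \<sigma> > 0" using \<sigma> by (simp_all add: cones_def)
      fix \<alpha> assume \<alpha>: "\<alpha> \<in> max_cones \<Sigma>" "\<sigma> face_of \<alpha>"
      show "cap p \<sigma> \<alpha> (rho R \<Sigma> p \<rho> \<sigma> (U \<rho>)) = cap p \<sigma> \<alpha> (rho R \<Sigma> p \<rho>' \<sigma> (U \<rho>'))"
        unfolding cap_at_face[OF R \<rho>(3) \<alpha>(2)] cap_at_face[OF R \<rho>(4) \<alpha>(2)]
          U(2)[OF \<rho>(1) \<alpha>(1) face_of_trans[OF \<rho>(3) \<alpha>(2)]] U(2)[OF \<rho>(2) \<alpha>(1) face_of_trans[OF \<rho>(4) \<alpha>(2)]] ..
    qed
    have "\<exists>u\<in>?up {0}. \<forall>\<rho>\<in>cones \<Sigma> 1. rho R \<Sigma> p {0} \<rho> u = U \<rho>"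
    proof (rule glue_ray_functionals[OF vanish0 vanish1, where U = U])
      show "U \<rho> \<in> ?up \<rho>" if "\<rho> \<in> cones \<Sigma> 1" for \<rho> by (rule U(1)[OF that])
      show "rho R \<Sigma> p \<rho> \<sigma> (U \<rho>) = rho R \<Sigma> p \<rho>' \<sigma> (U \<rho>')"
        if "\<sigma> \<in> cones \<Sigma> 2" "\<rho> \<in> cones \<Sigma> 1" "\<rho>' \<in> cones \<Sigma> 1" "\<rho> face_of \<sigma>" "\<rho>' face_of \<sigma>" for \<sigma> \<rho> \<rho>'
        by (rule compatible[OF that])
      show ?thesis if "u \<in> ?up {0}" "\<And>\<rho>. \<rho> \<in> cones \<Sigma> 1 \<Longrightarrow> rho R \<Sigma> p {0} \<rho> u = U \<rho>" for u
        using that by (intro bexI[of _ u] ballI)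
    qed
    then obtain u where u: "u \<in> ?up {0}" "\<forall>\<rho>\<in>cones \<Sigma> 1. rho R \<Sigma> p {0} \<rho> u = U \<rho>" by (rule bexE)
    have "cap p {0} \<alpha> u = z \<alpha>" if \<alpha>: "\<alpha> \<in> max_cones \<Sigma>" for \<alpha>
    proof -
      have "\<alpha> \<in> \<Sigma>" "dim \<alpha> > 0" using \<alpha> d by (simp_all add: max_cones_iff)
      then obtain \<rho> where \<rho>: "\<rho> \<in> cones \<Sigma> 1" "\<rho> face_of \<alpha>" using ray_of by metis
      show ?thesis
        using U(2)[OF \<rho>(1) \<alpha> \<rho>(2)] cap_at_face[OF R ray(3)[OF \<rho>(1)] \<rho>(2), of ori w p u] bspec[OF u(2) \<rho>(1)] by simp
    qed
    then have "local_cap p {0} u = z"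
      unfolding local_cap_def v
      by (intro extensionalityI[of _ "max_cones \<Sigma>"]) (use zP in \<open>simp_all add: PiE_iff\<close>)
    then show "z \<in> local_cap p {0} ` ?up {0}" using u(1) by (metis image_eqI)
  qed
qed

text \<open>Cochains in positive degree are functions on an empty set of cones, so both sides are trivial modules. The zero of the
  homology is the coset of the boundaries, whose stability under the operations has to be checked.\<close>

lemma duality_in_positive_degree:
  assumes p: "p \<le> d" and q: "0 < q"
    and vanish: "carrier (BM_homology R \<Sigma> ori (d - p) (int d - q)) = {\<zero>\<^bsub>BM_homology R \<Sigma> ori (d - p) (int d - q)\<^esub>}"
  shows "mod_iso R (cohomology R \<Sigma> ori p q) (BM_homology R \<Sigma> ori (d - p) (int d - q)) (cap_product R \<Sigma> ori w p q)"
proof -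
  let ?N = "BM_chains R \<Sigma> (d - p) (int d - q)" and ?K = "BM_boundaries R \<Sigma> ori (d - p) (int d - q)"
  let ?H = "BM_homology R \<Sigma> ori (d - p) (int d - q)" and ?cap = "cap_product R \<Sigma> ori w p q"
  define x :: "(real ^ 'n) set \<Rightarrow> ('r, 'n) mvec \<Rightarrow> 'r" where "x = (\<lambda>_. undefined)"
  have cq: "compact_cones \<Sigma> q = {}" "compact_cones \<Sigma> (q + 1) = {}" using q by (simp_all add: compact_cones_eq)
  have C: "carrier (cochains R \<Sigma> p q) = {x}" and C1: "\<zero>\<^bsub>cochains R \<Sigma> p (q + 1)\<^esub> = x" and xx: "x \<oplus>\<^bsub>cochains R \<Sigma> p q\<^esub> x = x"
    and rx: "r \<odot>\<^bsub>cochains R \<Sigma> p q\<^esub> x = x" for r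
    by (simp_all add: cochains_def dsum_simps cq x_def restrict_def)
  have "coboundary R \<Sigma> ori p q x = x" by (simp add: coboundary_def cq x_def restrict_def)
  then have Z: "cocycles R \<Sigma> ori p q = {x}" by (auto simp: cocycles_def a_kernel_def' C C1)
  have ne: "carrier (cochains R \<Sigma> p (q - 1)) \<noteq> {}"
  proof -
    have "\<zero>\<^bsub>cochains R \<Sigma> p (q - 1)\<^esub> \<in> carrier (cochains R \<Sigma> p (q - 1))"
      unfolding cochains_def dsum_simps using dual_mod_closed(1)[OF F_low_module[OF R]] by (simp add: F_up_def)
    then show ?thesis by auto
  qed
  have "coboundary R \<Sigma> ori p (q - 1) u = x" for u by (simp add: coboundary_def cq x_def restrict_def)
  then have B: "coboundaries R \<Sigma> ori p q = {x}" using ne by (simp add: coboundaries_def image_constant_conv)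
  have HC: "carrier (cohomology R \<Sigma> ori p q) = {{x}}"
    unfolding cohomology_def quot_mod_simps Z B by (simp add: A_RCOSETS_def' a_r_coset_def' xx)
  have Hadd: "{x} \<oplus>\<^bsub>cohomology R \<Sigma> ori p q\<^esub> {x} = {x}"
    unfolding cohomology_def quot_mod_simps B by (simp add: set_add_def' xx)
  have Hsm: "r \<odot>\<^bsub>cohomology R \<Sigma> ori p q\<^esub> {x} = {x}" for r
    unfolding cohomology_def quot_mod_simps B by (simp add: quot_map_def a_r_coset_def' xx rx)
  have Kzero: "\<zero>\<^bsub>?H\<^esub> = ?K" by (simp add: BM_homology_def quot_mod_simps)
  have "cap_chain R \<Sigma> ori w p q x = \<zero>\<^bsub>?N\<^esub>"
    unfolding cap_chain_def BM_chains_def dsum_simps cq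
    by (intro restrict_ext) (simp add: Let_def finsum_empty_general[OF abelian_monoid.zero_closed[
          OF abelian_group.axioms(1)[OF module.axioms(2)[OF F_low_module[OF R]]]]])
  then have cap1: "?cap {x} = ?K +>\<^bsub>?N\<^esub> \<zero>\<^bsub>?N\<^esub>"
    by (simp add: cap_product_def quot_map_def)
  have "BM_boundary R \<Sigma> ori (d - p) (int d - q) \<zero>\<^bsub>?N\<^esub> = \<zero>\<^bsub>BM_chains R \<Sigma> (d - p) (int d - q - 1)\<^esub>"
    by (rule boundary_of_zero)
  then have zZ: "\<zero>\<^bsub>?N\<^esub> \<in> BM_cycles R \<Sigma> ori (d - p) (int d - q)"
    using chains_zero_closed by (simp add: BM_cycles_def a_kernel_def')
  have "?K +>\<^bsub>?N\<^esub> \<zero>\<^bsub>?N\<^esub> \<in> carrier ?H"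
    unfolding BM_homology_def quot_mod_simps using zZ by (auto simp: A_RCOSETS_def' a_r_coset_def')
  then have cap: "?cap {x} = ?K" unfolding cap1 vanish Kzero by simp
  have zK: "\<zero>\<^bsub>?N\<^esub> \<in> ?K" by (rule cycle_is_boundary[OF vanish zZ])
  note S = boundaries_submodule[where p = "d - p" and q = "int d - q"]
  have one: "\<one>\<^bsub>R\<^esub> \<in> carrier R" by (rule monoid.one_closed[OF ring.is_monoid[OF cring.axioms(1)[OF R]]])
  have KK: "?K \<oplus>\<^bsub>?H\<^esub> ?K = ?K"
  proof -
    have "?K <+>\<^bsub>?N\<^esub> ?K = ?K"
    proof (intro equalityI subsetI)
      fix k assume "k \<in> ?K <+>\<^bsub>?N\<^esub> ?K"
      then obtain k1 k2 where "k1 \<in> ?K" "k2 \<in> ?K" "k = k1 \<oplus>\<^bsub>?N\<^esub> k2" by (auto simp: set_add_def')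
      then show "k \<in> ?K" using S(2)[OF _ _ one] by simp
    next
      fix k assume k: "k \<in> ?K"
      have "k = k \<oplus>\<^bsub>?N\<^esub> \<zero>\<^bsub>?N\<^esub>" using chains_zero(1)[OF S(1)[OF k k one]] by simp
      then show "k \<in> ?K <+>\<^bsub>?N\<^esub> ?K" using k zK unfolding set_add_def' by auto
    qed
    then show ?thesis by (simp add: BM_homology_def quot_mod_simps set_add_def')
  qed
  have rK: "r \<odot>\<^bsub>?H\<^esub> ?K = ?K" if r: "r \<in> carrier R" for r
  proof -
    have "(\<Union>x\<in>?K. ?K +>\<^bsub>?N\<^esub> (r \<odot>\<^bsub>?N\<^esub> x)) = ?K"
    proof (intro equalityI subsetI)
      fix k assume "k \<in> (\<Union>x\<in>?K. ?K +>\<^bsub>?N\<^esub> (r \<odot>\<^bsub>?N\<^esub> x))"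
      then obtain x k' where x: "x \<in> ?K" "k' \<in> ?K" and k: "k = k' \<oplus>\<^bsub>?N\<^esub> (r \<odot>\<^bsub>?N\<^esub> x)"
        by (auto simp: a_r_coset_def')
      show "k \<in> ?K" unfolding k by (rule S(2)[OF x(2) S(3)[OF x(1) x(1) r] one])
    next
      fix k assume k: "k \<in> ?K"
      have eq: "k = k \<oplus>\<^bsub>?N\<^esub> (r \<odot>\<^bsub>?N\<^esub> \<zero>\<^bsub>?N\<^esub>)"
        unfolding chains_zero(2)[OF r] using chains_zero(1)[OF S(1)[OF k k one]] by simp
      show "k \<in> (\<Union>x\<in>?K. ?K +>\<^bsub>?N\<^esub> (r \<odot>\<^bsub>?N\<^esub> x))"
        unfolding a_r_coset_def' by (rule UN_I[OF zK], rule UN_I[OF k], unfold singleton_iff, rule eq)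
    qed
    then show ?thesis by (simp add: BM_homology_def quot_mod_simps quot_map_def a_r_coset_def')
  qed
  show ?thesis
    unfolding mod_iso_def HC vanish Kzero by (simp add: bij_betw_def cap Hadd Hsm KK rK)
qed

end

section \<open>Duality of a fan from duality of its stars\<close>

text \<open>For \<open>\<gamma> \<noteq> {0}\<close> the star complex contains \<open>star_cone \<gamma> \<gamma>\<close>, which has \<open>\<gamma>\<close> and \<open>- \<gamma>\<close> as
  subsets and is therefore not strictly convex.\<close>

lemma (in fan) star_complex_neq:
  assumes "\<gamma> \<in> \<Sigma>" "dim \<gamma> > 0"
  shows "star_complex \<Sigma> \<gamma> \<noteq> \<Sigma>"
proof
  assume eq: "star_complex \<Sigma> \<gamma> = \<Sigma>"
  have "star_cone \<gamma> \<gamma> \<in> star_complex \<Sigma> \<gamma>"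
    unfolding star_complex_def by (rule imageI) (simp add: assms(1) face_self[OF assms(1)])
  then have A: "rational_cone (star_cone \<gamma> \<gamma>)" using rational by (simp add: eq)
  have "\<gamma> \<noteq> {0}" using assms(2) by (auto simp: dim_insert span_zero)
  then obtain x where x: "x \<in> \<gamma>" "x \<noteq> 0" using convex_coneD(1)[OF cone[OF assms(1)]] by auto
  have "y - z \<in> star_cone \<gamma> \<gamma>" if "y \<in> \<gamma>" "z \<in> \<gamma>" for y z
    unfolding star_cone_def using that by (intro CollectI exI[of _ 1] exI[of _ y] exI[of _ z]) simp
  then have "x - 0 \<in> star_cone \<gamma> \<gamma>" "0 - x \<in> star_cone \<gamma> \<gamma>"
    using x(1) convex_coneD(1)[OF cone[OF assms(1)]] by metis+
  then show False using rational_coneD(4)[OF A, of x] x(2) by simp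
qed

theorem theorem5p4:
  fixes R :: "('r, 'm) ring_scheme"
    and \<Sigma> :: "(real ^ 'n) set set"
    and ori :: "(real ^ 'n) set \<Rightarrow> (int ^ 'n) list"
    and w :: "(real ^ 'n) set \<Rightarrow> 'r"
    and Star :: "(real ^ 'n) set \<Rightarrow> (real ^ 'n) set set"
    and star_ori :: "(real ^ 'n) set \<Rightarrow> (real ^ 'n) set \<Rightarrow> (int ^ 'n) list"
  assumes PID: "principal_domain R"
    and fan: "rational_fan \<Sigma>" "orientation \<Sigma> ori"
    and weights: "weight_function R \<Sigma> w" "balanced R \<Sigma> ori w"
    and dimension: "fan_dim \<Sigma> \<ge> 2"
    and BM_vanishing:
      "\<And>p q. q \<noteq> int (fan_dim \<Sigma>) \<Longrightarrow>
        carrier (BM_homology R \<Sigma> ori p q) = {\<zero>\<^bsub>BM_homology R \<Sigma> ori p q\<^esub>}"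
    and stars: "\<And>\<gamma>. \<gamma> \<in> \<Sigma> \<Longrightarrow> star_fan \<Sigma> \<gamma> (Star \<gamma>) \<and> orientation (Star \<gamma>) (star_ori \<gamma>)"
    and star_duality:
      "\<And>\<gamma>. \<gamma> \<in> \<Sigma> \<Longrightarrow> star_complex \<Sigma> \<gamma> \<noteq> \<Sigma> \<Longrightarrow>
        tropical_PD R (Star \<gamma>) (star_ori \<gamma>) (star_weight \<Sigma> w \<gamma>)"
  shows "tropical_PD R \<Sigma> ori w"
proof -
  have R: "cring R" by (rule domain.axioms(1)[OF principal_domain.axioms(1)[OF PID]])
  have w: "w \<alpha> \<in> carrier R" if "\<alpha> \<in> max_cones \<Sigma>" for \<alpha>
    using weights(1) that by (simp add: weight_function_def)
  interpret F: weighted_fan \<Sigma> R ori w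
    by (intro weighted_fan.intro fan.intro weighted_fan_axioms.intro fan R w)
  have local: "F.local_duality p \<gamma>" if p: "p \<le> fan_dim \<Sigma>" and \<gamma>: "\<gamma> \<in> \<Sigma>" "dim \<gamma> > 0" for p \<gamma>
  proof -
    interpret S: weighted_star \<Sigma> R ori w \<gamma> "Star \<gamma>" "star_ori \<gamma>"
      by (intro weighted_star.intro F.weighted_fan_axioms oriented_star.intro star.intro F.fan_axioms
          star_axioms.intro oriented_star_axioms.intro \<gamma> fan(2) conjunct1[OF stars[OF \<gamma>(1)]]
          conjunct2[OF stars[OF \<gamma>(1)]])
    have pS: "p \<le> fan_dim (Star \<gamma>)" using p by (simp add: S.fan_dim_star)
    have "mod_iso R (cohomology R (Star \<gamma>) (star_ori \<gamma>) p 0)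
        (BM_homology R (Star \<gamma>) (star_ori \<gamma>) (fan_dim (Star \<gamma>) - p) (int (fan_dim (Star \<gamma>)) - 0))
        (cap_product R (Star \<gamma>) (star_ori \<gamma>) (star_weight \<Sigma> w \<gamma>) p 0)"
      using star_duality[OF \<gamma>(1) F.star_complex_neq[OF \<gamma>]] pS by (force simp: tropical_PD_def)
    then show ?thesis
      using S.star_duality_local[OF p] S.SW.duality_in_degree_0[OF pS] by simp
  qed
  have vertex: "F.local_duality p {0}" if p: "p \<le> fan_dim \<Sigma>" for p
    by (rule F.local_duality_vertex[OF p dimension BM_vanishing BM_vanishing local[OF p]]) (use dimension in simp_all)
  show ?thesis
    unfolding tropical_PD_def
  proof (intro ballI)
    fix p q assume "p \<in> {0..fan_dim \<Sigma>}" and q: "q \<in> {0..int (fan_dim \<Sigma>)}"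
    then have p: "p \<le> fan_dim \<Sigma>" by simp
    show "mod_iso R (cohomology R \<Sigma> ori p q) (BM_homology R \<Sigma> ori (fan_dim \<Sigma> - p) (int (fan_dim \<Sigma>) - q))
        (cap_product R \<Sigma> ori w p q)"
    proof (cases "q = 0")
      case True
      then show ?thesis using F.duality_in_degree_0[OF p] vertex[OF p] by simp
    next
      case False
      show ?thesis
        by (rule F.duality_in_positive_degree[OF p _ BM_vanishing]) (use False q in simp_all)
    qed
  qed
qed

end
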